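(* Let $G$ be a discrete group. If $G\in\mathcal{A}_2^{hom}$, $G$ is residually finite and $H_2(G,\mathbb{Z})$ is finitely generated, then the map $H_2(G,\mathbb{Z})\to H_2(\widehat{G},\widehat{\mathbb{Z}})$ induced by the canonical map $G\to\widehat{G}$ is injective and $G\wedge G$ is residually finite.
   Context: $\widehat{G}$ is the profinite completion of $G$; $H_n(\widehat{G},-)$ denotes profinite homology, and $H_2(\widehat{G},\widehat{\mathbb{Z}})\cong\varprojlim_{U,m}H_2(G/U,\mathbb{Z}/m\mathbb{Z})$ over normal finite-index subgroups $U$ of $G$ and $m\geq 1$ (trivial coefficients). A discrete group $G$ belongs to $\mathcal{A}_n^{hom}$ if the canonical map $G\to\widehat{G}$ induces an isomorphism $H_i(G,A)\to H_i(\widehat{G},A)$ for every finite discrete $\widehat{G}$-module $A$ and every $0\le i\le n$. Conventions: $g^h=h^{-1}gh$, $[a,b]=a^{-1}b^{-1}ab$. Let $G^{\varphi}$ be an isomorphic copy of $G$ via $g\mapsto g^{\varphi}$ and $$\nu(G)=\langle G,G^{\varphi}\mid [g_1,g_2^{\varphi}]^{g_3}=[g_1,g_2^{\varphi}]^{g_3^{\varphi}}=[g_1^{g_3},(g_2^{g_3})^{\varphi}]\ \text{for } g_1,g_2,g_3\in G\rangle.$$ The non-abelian tensor square $G\otimes G$ is identified with the subgroup $[G,G^{\varphi}]$ of $\nu(G)$, with $g\otimes h=[g,h^{\varphi}]$; $\Delta(G)=\langle g\otimes g\mid g\in G\rangle$ and the non-abelian exterior square is $G\wedge G=(G\otimes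 G)/\Delta(G)$. *)

theory Defs
  imports "HOL-Algebra.Algebra" "HOL-Analysis.Analysis"
begin

section \<open>Residual finiteness, finite generation, profinite completion\<close>

definition finite_index_normals :: "('a, 'x) monoid_scheme \<Rightarrow> 'a set set" where
  "finite_index_normals G = {N. N \<lhd> G \<and> finite (rcosets\<^bsub>G\<^esub> N)}"

definition residually_finite :: "('a, 'x) monoid_scheme \<Rightarrow> bool" where
  "residually_finite G \<longleftrightarrow>
     (\<forall>g\<in>carrier G. g \<noteq> \<one>\<^bsub>G\<^esub> \<longrightarrow> (\<exists>N\<in>finite_index_normals G. g \<notin> N))"

definition finitely_generated_group :: "('a, 'x) monoid_scheme \<Rightarrow> bool" where
  "finitely_generated_group G \<longleftrightarrow>
     (\<exists>S. finite S \<and> S \<subseteq> carrier G \<and> generate G S = carrier G)"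

record 'a top_group = "'a monoid" +
  topol :: "'a topology"

text \<open>
  The profinite completion is the inverse limit of the finite quotients \<open>G Mod N\<close>, realised inside
  their product. An element of \<open>G Mod N\<close> is a coset of \<open>N\<close>, and for \<open>N \<subseteq> M\<close> the projection
  \<open>G Mod N \<rightarrow> G Mod M\<close> sends a coset of \<open>N\<close> to the coset of \<open>M\<close> containing it.
\<close>

definition completion_carrier :: "('a, 'x) monoid_scheme \<Rightarrow> ('a set \<Rightarrow> 'a set) set" where
  "completion_carrier G =
     {x \<in> (\<Pi>\<^sub>E N\<in>finite_index_normals G. rcosets\<^bsub>G\<^esub> N).
        \<forall>N\<in>finite_index_normals G. \<forall>M\<in>finite_index_normals G. N \<subseteq> M \<longrightarrow> x N \<subseteq> x M}"

definition profinite_completion :: "('a, 'x) monoid_scheme \<Rightarrow> ('a set \<Rightarrow> 'a set) top_group" where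
  "profinite_completion G =
     \<lparr>carrier = completion_carrier G,
      monoid.mult = (\<lambda>x y. \<lambda>N\<in>finite_index_normals G. x N \<otimes>\<^bsub>G Mod N\<^esub> y N),
      one = (\<lambda>N\<in>finite_index_normals G. \<one>\<^bsub>G Mod N\<^esub>),
      topol = subtopology
        (product_topology (\<lambda>N. discrete_topology (rcosets\<^bsub>G\<^esub> N)) (finite_index_normals G))
        (completion_carrier G)\<rparr>"

definition completion_map :: "('a, 'x) monoid_scheme \<Rightarrow> 'a \<Rightarrow> ('a set \<Rightarrow> 'a set)" where
  "completion_map G g = (\<lambda>N\<in>finite_index_normals G. N #>\<^bsub>G\<^esub> g)"

section \<open>Homology of a chain complex of abelian groups\<close>

text \<open>
  Abelian groups are written multiplicatively. The map \<open>d n\<close> goes from \<open>C n\<close> to \<open>C (n - 1)\<close>;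
  \<open>d 0\<close> is ignored, since the complex is zero in negative degrees.
\<close>

definition cycles :: "(nat \<Rightarrow> 'c monoid) \<Rightarrow> (nat \<Rightarrow> 'c \<Rightarrow> 'c) \<Rightarrow> nat \<Rightarrow> 'c set" where
  "cycles C d n = {c \<in> carrier (C n). n = 0 \<or> d n c = \<one>\<^bsub>C (n - 1)\<^esub>}"

definition boundaries :: "(nat \<Rightarrow> 'c monoid) \<Rightarrow> (nat \<Rightarrow> 'c \<Rightarrow> 'c) \<Rightarrow> nat \<Rightarrow> 'c set" where
  "boundaries C d n = d (Suc n) ` carrier (C (Suc n))"

definition complex_homology ::
    "(nat \<Rightarrow> 'c monoid) \<Rightarrow> (nat \<Rightarrow> 'c \<Rightarrow> 'c) \<Rightarrow> nat \<Rightarrow> 'c set monoid" where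
  "complex_homology C d n = (C n\<lparr>carrier := cycles C d n\<rparr>) Mod boundaries C d n"

text \<open>
  The map on homology induced by a chain map \<open>f\<close> into \<open>(C, d)\<close> in degree \<open>n\<close>: the class of \<open>z\<close>,
  a coset of boundaries, goes to the coset of boundaries of \<open>(C, d)\<close> containing \<open>f z\<close>.
\<close>

definition homology_map ::
    "(nat \<Rightarrow> 'd monoid) \<Rightarrow> (nat \<Rightarrow> 'd \<Rightarrow> 'd) \<Rightarrow> nat \<Rightarrow> ('c \<Rightarrow> 'd) \<Rightarrow> 'c set \<Rightarrow> 'd set" where
  "homology_map C d n f S = boundaries C d n <#>\<^bsub>C n\<^esub> (f ` S)"

section \<open>Homology of discrete groups\<close>

definition chain_support :: "('m, 'y) monoid_scheme \<Rightarrow> ('q \<Rightarrow> 'm) \<Rightarrow> 'q set" where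
  "chain_support M c = {x. c x \<noteq> \<one>\<^bsub>M\<^esub>}"

text \<open>
  The bar complex \<open>M \<otimes> \<int>[G\<^sup>n]\<close>: the chain \<open>\<Sum> m [g\<^sub>1 | \<dots> | g\<^sub>n]\<close> is the finitely supported function
  sending the list \<open>[g\<^sub>1, \<dots>, g\<^sub>n]\<close> to its coefficient.
\<close>

definition bar_chains ::
    "('g, 'x) monoid_scheme \<Rightarrow> ('m, 'y) monoid_scheme \<Rightarrow> nat \<Rightarrow> ('g list \<Rightarrow> 'm) monoid" where
  "bar_chains G M n =
     \<lparr>carrier = {c. range c \<subseteq> carrier M \<and> finite (chain_support M c) \<and>
                    chain_support M c \<subseteq> {xs. length xs = n \<and> set xs \<subseteq> carrier G}},
      monoid.mult = (\<lambda>c c' xs. c xs \<otimes>\<^bsub>M\<^esub> c' xs),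
      one = (\<lambda>xs. \<one>\<^bsub>M\<^esub>)\<rparr>"

text \<open>The additive extension of \<open>m [x] \<mapsto> (h x m) [f x]\<close>.\<close>

definition chain_push ::
    "('m, 'y) monoid_scheme \<Rightarrow> ('n, 'z) monoid_scheme \<Rightarrow> ('q \<Rightarrow> 'r) \<Rightarrow> ('q \<Rightarrow> 'm \<Rightarrow> 'n) \<Rightarrow>
     ('q \<Rightarrow> 'm) \<Rightarrow> ('r \<Rightarrow> 'n)" where
  "chain_push M M' f h c =
     (\<lambda>y. finprod M' (\<lambda>x. h x (c x)) {x \<in> chain_support M c. f x = y})"

definition bar_face :: "('g, 'x) monoid_scheme \<Rightarrow> nat \<Rightarrow> 'g list \<Rightarrow> 'g list" where
  "bar_face G i xs =
     (if i = 0 then tl xs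
      else if i = length xs then butlast xs
      else take (i - 1) xs @ [xs ! (i - 1) \<otimes>\<^bsub>G\<^esub> xs ! i] @ drop (i + 1) xs)"

text \<open>
  Coefficients are left modules, made into right modules by \<open>m g = g\<^sup>-\<^sup>1 m\<close>. So, for \<open>n \<ge> 1\<close>,
  \<open>d (m [g\<^sub>1 | \<dots> | g\<^sub>n]) = (g\<^sub>1\<^sup>-\<^sup>1 m) [g\<^sub>2 | \<dots> | g\<^sub>n] +
     \<Sum>\<^sub>0\<^sub><\<^sub>i\<^sub><\<^sub>n (-1)\<^sup>i m [\<dots> | g\<^sub>i g\<^sub>i\<^sub>+\<^sub>1 | \<dots>] + (-1)\<^sup>n m [g\<^sub>1 | \<dots> | g\<^sub>n\<^sub>-\<^sub>1]\<close>.
\<close>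

definition bar_boundary ::
    "('g, 'x) monoid_scheme \<Rightarrow> ('m, 'y) monoid_scheme \<Rightarrow> ('g \<Rightarrow> 'm \<Rightarrow> 'm) \<Rightarrow> nat \<Rightarrow>
     ('g list \<Rightarrow> 'm) \<Rightarrow> ('g list \<Rightarrow> 'm)" where
  "bar_boundary G M act n c =
     (\<lambda>y. finprod M
        (\<lambda>i. chain_push M M (bar_face G i)
               (\<lambda>xs. if i = 0 then act (inv\<^bsub>G\<^esub> (hd xs)) else (\<lambda>m. m)) c y
             [^]\<^bsub>M\<^esub> ((-1) ^ i :: int))
        {..n})"

definition group_homology ::
    "('g, 'x) monoid_scheme \<Rightarrow> ('m, 'y) monoid_scheme \<Rightarrow> ('g \<Rightarrow> 'm \<Rightarrow> 'm) \<Rightarrow> nat \<Rightarrow>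
     ('g list \<Rightarrow> 'm) set monoid" where
  "group_homology G M act n = complex_homology (bar_chains G M) (bar_boundary G M act) n"

definition trivial_action ::
    "('g, 'x) monoid_scheme \<Rightarrow> ('m, 'y) monoid_scheme \<Rightarrow> 'g \<Rightarrow> 'm \<Rightarrow> 'm" where
  "trivial_action G M = (\<lambda>g\<in>carrier G. \<lambda>m\<in>carrier M. m)"

section \<open>Homology of profinite groups\<close>

text \<open>
  For a profinite group \<open>\<Gamma>\<close> and a profinite \<open>\<Gamma>\<close>-module \<open>M\<close>, the homology is that of the
  complex obtained from the profinite bar resolution, whose term in degree \<open>n\<close> is the complete
  tensor product of \<open>M\<close> with the free profinite abelian group on \<open>\<Gamma>\<^sup>n\<close>. That term is the inverse
  limit of the groups \<open>(M/N) \<otimes> \<int>[(\<Gamma>/U)\<^sup>n]\<close>, over open normal subgroups \<open>U\<close> of \<open>\<Gamma>\<close> and open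
  submodules \<open>N\<close> of \<open>M\<close> such that \<open>U\<close> acts trivially on \<open>M/N\<close>; such pairs are called levels. The
  limit is taken on chains, before passing to homology.
\<close>

definition levels ::
    "'g top_group \<Rightarrow> 'm top_group \<Rightarrow> ('g \<Rightarrow> 'm \<Rightarrow> 'm) \<Rightarrow> ('g set \<times> 'm set) set" where
  "levels \<Gamma> M act =
     {(U, N). U \<lhd> \<Gamma> \<and> openin (topol \<Gamma>) U \<and>
              subgroup N M \<and> openin (topol M) N \<and>
              (\<forall>g\<in>carrier \<Gamma>. act g ` N \<subseteq> N) \<and>
              (\<forall>u\<in>U. \<forall>m\<in>carrier M. act u m \<in> N #>\<^bsub>M\<^esub> m)}"

text \<open>The action of \<open>\<Gamma>/U\<close> on \<open>M/N\<close>; both arguments are cosets.\<close>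

definition quotient_action :: "('g \<Rightarrow> 'm \<Rightarrow> 'm) \<Rightarrow> 'g set \<Rightarrow> 'm set \<Rightarrow> 'm set" where
  "quotient_action act C S = (\<Union>g\<in>C. act g ` S)"

definition profinite_chains ::
    "'g top_group \<Rightarrow> 'm top_group \<Rightarrow> ('g \<Rightarrow> 'm \<Rightarrow> 'm) \<Rightarrow> nat \<Rightarrow>
     ('g set \<times> 'm set \<Rightarrow> 'g set list \<Rightarrow> 'm set) monoid" where
  "profinite_chains \<Gamma> M act n =
     \<lparr>carrier =
        {c \<in> (\<Pi>\<^sub>E (U, N)\<in>levels \<Gamma> M act. carrier (bar_chains (\<Gamma> Mod U) (M Mod N) n)).
           \<forall>(U, N)\<in>levels \<Gamma> M act. \<forall>(U', N')\<in>levels \<Gamma> M act. U \<subseteq> U' \<and> N \<subseteq> N' \<longrightarrow>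
             chain_push (M Mod N) (M Mod N')
               (map (\<lambda>C. U' <#>\<^bsub>\<Gamma>\<^esub> C)) (\<lambda>_ S. N' <#>\<^bsub>M\<^esub> S) (c (U, N)) = c (U', N')},
      monoid.mult = (\<lambda>c c'. \<lambda>(U, N)\<in>levels \<Gamma> M act.
                c (U, N) \<otimes>\<^bsub>bar_chains (\<Gamma> Mod U) (M Mod N) n\<^esub> c' (U, N)),
      one = (\<lambda>(U, N)\<in>levels \<Gamma> M act. \<one>\<^bsub>bar_chains (\<Gamma> Mod U) (M Mod N) n\<^esub>)\<rparr>"

definition profinite_boundary ::
    "'g top_group \<Rightarrow> 'm top_group \<Rightarrow> ('g \<Rightarrow> 'm \<Rightarrow> 'm) \<Rightarrow> nat \<Rightarrow>
     ('g set \<times> 'm set \<Rightarrow> 'g set list \<Rightarrow> 'm set) \<Rightarrow>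
     ('g set \<times> 'm set \<Rightarrow> 'g set list \<Rightarrow> 'm set)" where
  "profinite_boundary \<Gamma> M act n c =
     (\<lambda>(U, N)\<in>levels \<Gamma> M act.
        bar_boundary (\<Gamma> Mod U) (M Mod N) (quotient_action act) n (c (U, N)))"

definition profinite_homology ::
    "'g top_group \<Rightarrow> 'm top_group \<Rightarrow> ('g \<Rightarrow> 'm \<Rightarrow> 'm) \<Rightarrow> nat \<Rightarrow>
     ('g set \<times> 'm set \<Rightarrow> 'g set list \<Rightarrow> 'm set) set monoid" where
  "profinite_homology \<Gamma> M act n =
     complex_homology (profinite_chains \<Gamma> M act) (profinite_boundary \<Gamma> M act) n"

text \<open>
  The map from the homology of a discrete group with coefficients in \<open>L\<close> to the homology of
  \<open>\<Gamma>\<close> with coefficients in \<open>M\<close> induced by a homomorphism \<open>\<eta>\<close> into \<open>\<Gamma>\<close> and a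
  homomorphism \<open>\<theta> : L \<rightarrow> M\<close> compatible with the actions.
\<close>

definition comparison_chain_map ::
    "('m, 'y) monoid_scheme \<Rightarrow> 'h top_group \<Rightarrow> 'n top_group \<Rightarrow> ('h \<Rightarrow> 'n \<Rightarrow> 'n) \<Rightarrow>
     ('g \<Rightarrow> 'h) \<Rightarrow> ('m \<Rightarrow> 'n) \<Rightarrow>
     ('g list \<Rightarrow> 'm) \<Rightarrow> ('h set \<times> 'n set \<Rightarrow> 'h set list \<Rightarrow> 'n set)" where
  "comparison_chain_map L \<Gamma> M act \<eta> \<theta> c =
     (\<lambda>(U, N)\<in>levels \<Gamma> M act.
        chain_push L (M Mod N) (map (\<lambda>g. U #>\<^bsub>\<Gamma>\<^esub> \<eta> g)) (\<lambda>_ a. N #>\<^bsub>M\<^esub> \<theta> a) c)"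

definition comparison_map ::
    "('m, 'y) monoid_scheme \<Rightarrow> 'h top_group \<Rightarrow> 'n top_group \<Rightarrow> ('h \<Rightarrow> 'n \<Rightarrow> 'n) \<Rightarrow>
     ('g \<Rightarrow> 'h) \<Rightarrow> ('m \<Rightarrow> 'n) \<Rightarrow> nat \<Rightarrow>
     ('g list \<Rightarrow> 'm) set \<Rightarrow> ('h set \<times> 'n set \<Rightarrow> 'h set list \<Rightarrow> 'n set) set" where
  "comparison_map L \<Gamma> M act \<eta> \<theta> n =
     homology_map (profinite_chains \<Gamma> M act) (profinite_boundary \<Gamma> M act) n
       (comparison_chain_map L \<Gamma> M act \<eta> \<theta>)"

section \<open>The class \<open>\<A>\<^sub>n\<close> (homological version)\<close>

definition finite_discrete_module ::
    "'g top_group \<Rightarrow> 'm top_group \<Rightarrow> ('g \<Rightarrow> 'm \<Rightarrow> 'm) \<Rightarrow> bool" where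
  "finite_discrete_module \<Gamma> A act \<longleftrightarrow>
     comm_group A \<and> finite (carrier A) \<and> topol A = discrete_topology (carrier A) \<and>
     group_action \<Gamma> (carrier A) act \<and> (\<forall>g\<in>carrier \<Gamma>. act g \<in> hom A A) \<and>
     continuous_map (prod_topology (topol \<Gamma>) (topol A)) (topol A) (\<lambda>(g, a). act g a)"

text \<open>
  Restricting to modules with carrier in \<open>nat\<close> loses nothing, since every finite module is
  isomorphic to one of these.
\<close>

definition in_A_hom :: "nat \<Rightarrow> ('a, 'x) monoid_scheme \<Rightarrow> bool" where
  "in_A_hom n G \<longleftrightarrow>
     (\<forall>(A :: nat top_group) act. finite_discrete_module (profinite_completion G) A act \<longrightarrow>
       (\<forall>i\<le>n. comparison_map A (profinite_completion G) A act (completion_map G) (\<lambda>a. a) i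
          \<in> iso (group_homology G A (\<lambda>g. act (completion_map G g)) i)
                (profinite_homology (profinite_completion G) A act i)))"

section \<open>Integral coefficients\<close>

definition Zhat :: "(int set \<Rightarrow> int set) top_group" where
  "Zhat = profinite_completion integer_group"

definition integral_homology :: "('a, 'x) monoid_scheme \<Rightarrow> nat \<Rightarrow> ('a list \<Rightarrow> int) set monoid" where
  "integral_homology G n = group_homology G integer_group (trivial_action G integer_group) n"

definition integral_comparison_map ::
    "('a, 'x) monoid_scheme \<Rightarrow> nat \<Rightarrow> ('a list \<Rightarrow> int) set \<Rightarrow>
     (('a set \<Rightarrow> 'a set) set \<times> (int set \<Rightarrow> int set) set \<Rightarrow>
      ('a set \<Rightarrow> 'a set) set list \<Rightarrow> (int set \<Rightarrow> int set) set) set" where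
  "integral_comparison_map G n =
     comparison_map integer_group (profinite_completion G) Zhat
       (trivial_action (profinite_completion G) Zhat)
       (completion_map G) (completion_map integer_group) n"

section \<open>Groups given by presentations\<close>

text \<open>The letters \<open>(x, True)\<close> and \<open>(x, False)\<close> stand for \<open>x\<close> and its inverse.\<close>

type_synonym 'x word = "('x \<times> bool) list"

definition words :: "'x set \<Rightarrow> 'x word set" where
  "words S = lists (S \<times> UNIV)"

inductive_set presentation_rel ::
    "'x set \<Rightarrow> ('x word \<times> 'x word) set \<Rightarrow> ('x word \<times> 'x word) set"
  for S :: "'x set" and R :: "('x word \<times> 'x word) set" where
  relator: "(u, v) \<in> R \<Longrightarrow> a \<in> words S \<Longrightarrow> b \<in> words S \<Longrightarrow>
    (a @ u @ b, a @ v @ b) \<in> presentation_rel S R"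
| cancel: "x \<in> S \<Longrightarrow> a \<in> words S \<Longrightarrow> b \<in> words S \<Longrightarrow>
    (a @ [(x, s), (x, \<not> s)] @ b, a @ b) \<in> presentation_rel S R"
| refl: "u \<in> words S \<Longrightarrow> (u, u) \<in> presentation_rel S R"
| sym: "(u, v) \<in> presentation_rel S R \<Longrightarrow> (v, u) \<in> presentation_rel S R"
| trans: "(u, v) \<in> presentation_rel S R \<Longrightarrow> (v, w) \<in> presentation_rel S R \<Longrightarrow>
    (u, w) \<in> presentation_rel S R"

definition presented_group :: "'x set \<Rightarrow> ('x word \<times> 'x word) set \<Rightarrow> 'x word set monoid" where
  "presented_group S R =
     \<lparr>carrier = words S // presentation_rel S R,
      monoid.mult = (\<lambda>A B. presentation_rel S R `` {u @ v | u v. u \<in> A \<and> v \<in> B}),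
      one = presentation_rel S R `` {[]}\<rparr>"

definition word_inv :: "'x word \<Rightarrow> 'x word" where
  "word_inv w = rev (map (\<lambda>(x, s). (x, \<not> s)) w)"

definition word_conj :: "'x word \<Rightarrow> 'x word \<Rightarrow> 'x word" where
  "word_conj u w = word_inv w @ u @ w"

definition word_comm :: "'x word \<Rightarrow> 'x word \<Rightarrow> 'x word" where
  "word_comm u v = word_inv u @ word_inv v @ u @ v"

section \<open>The group \<open>\<nu>(G)\<close> and the non-abelian exterior square\<close>

text \<open>\<open>Inl g\<close> is the generator \<open>g\<close> and \<open>Inr g\<close> is its copy \<open>g\<^sup>\<phi>\<close>.\<close>

abbreviation lw :: "'a \<Rightarrow> ('a + 'a) word" where
  "lw g \<equiv> [(Inl g, True)]"

abbreviation rw :: "'a \<Rightarrow> ('a + 'a) word" where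
  "rw g \<equiv> [(Inr g, True)]"

definition conj_elt :: "('a, 'x) monoid_scheme \<Rightarrow> 'a \<Rightarrow> 'a \<Rightarrow> 'a" where
  "conj_elt G g h = inv\<^bsub>G\<^esub> h \<otimes>\<^bsub>G\<^esub> g \<otimes>\<^bsub>G\<^esub> h"

text \<open>The first two families of relations are the multiplication tables of \<open>G\<close> and \<open>G\<^sup>\<phi>\<close>.\<close>

definition nu_relations :: "('a, 'x) monoid_scheme \<Rightarrow> (('a + 'a) word \<times> ('a + 'a) word) set" where
  "nu_relations G =
     {(lw g @ lw h, lw (g \<otimes>\<^bsub>G\<^esub> h)) | g h. g \<in> carrier G \<and> h \<in> carrier G} \<union>
     {(rw g @ rw h, rw (g \<otimes>\<^bsub>G\<^esub> h)) | g h. g \<in> carrier G \<and> h \<in> carrier G} \<union>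
     {(word_conj (word_comm (lw g1) (rw g2)) (lw g3),
       word_conj (word_comm (lw g1) (rw g2)) (rw g3)) | g1 g2 g3.
        g1 \<in> carrier G \<and> g2 \<in> carrier G \<and> g3 \<in> carrier G} \<union>
     {(word_conj (word_comm (lw g1) (rw g2)) (rw g3),
       word_comm (lw (conj_elt G g1 g3)) (rw (conj_elt G g2 g3))) | g1 g2 g3.
        g1 \<in> carrier G \<and> g2 \<in> carrier G \<and> g3 \<in> carrier G}"

definition nu_generators :: "('a, 'x) monoid_scheme \<Rightarrow> ('a + 'a) set" where
  "nu_generators G = Inl ` carrier G \<union> Inr ` carrier G"

definition nu :: "('a, 'x) monoid_scheme \<Rightarrow> ('a + 'a) word set monoid" where
  "nu G = presented_group (nu_generators G) (nu_relations G)"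

definition tensor_elt :: "('a, 'x) monoid_scheme \<Rightarrow> 'a \<Rightarrow> 'a \<Rightarrow> ('a + 'a) word set" where
  "tensor_elt G g h =
     presentation_rel (nu_generators G) (nu_relations G) `` {word_comm (lw g) (rw h)}"

definition tensor_square :: "('a, 'x) monoid_scheme \<Rightarrow> ('a + 'a) word set monoid" where
  "tensor_square G =
     (nu G)\<lparr>carrier := generate (nu G) {tensor_elt G g h | g h. g \<in> carrier G \<and> h \<in> carrier G}\<rparr>"

definition Delta :: "('a, 'x) monoid_scheme \<Rightarrow> ('a + 'a) word set set" where
  "Delta G = generate (nu G) {tensor_elt G g g | g. g \<in> carrier G}"

definition exterior_square :: "('a, 'x) monoid_scheme \<Rightarrow> ('a + 'a) word set set monoid" where
  "exterior_square G = tensor_square G Mod Delta G"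

end

theory Submission
  imports Defs
begin

text \<open>
  A class of \<open>H\<^sub>2(G, \<int>)\<close> that vanishes at every finite level \<open>H\<^sub>2(\<Gamma>/U, (\<int>/m)/N)\<close>, where \<open>\<Gamma>\<close> is the
  profinite completion, vanishes in \<open>H\<^sub>2(\<Gamma>, \<int>/m)\<close> by compactness, hence in \<open>H\<^sub>2(G, \<int>/m)\<close> by
  hypothesis; so it is divisible by every \<open>m\<close>, and finite generation makes it zero. This gives the
  injectivity, since the finite levels factor through \<open>H\<^sub>2(\<Gamma>, Zhat)\<close>.

  For \<open>G \<and> G\<close>, residual finiteness of \<open>G\<close> separates the elements with nontrivial image in \<open>G\<close>. An
  element \<open>x\<close> of the kernel of \<open>G \<and> G \<rightarrow> G\<close> is a product of symbols \<open>g \<and> h\<close> and determines a cycle \<open>z\<close>,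
  the one that computes the corresponding product of commutators in every central extension. If \<open>z\<close>
  is not a boundary, it survives at a finite level, in the commutators of a finite central extension,
  and that extension yields a finite quotient of \<open>G \<and> G\<close> in which \<open>x\<close> is nontrivial. If \<open>z\<close> is a
  boundary then \<open>x = 1\<close> (Miller): adjoining to \<open>G \<and> G\<close> one free generator over \<open>g\<close> at a time, with
  commutators prescribed by the pairing, embeds it into a central extension of a subgroup of \<open>G\<close>
  in which the product of commutators given by \<open>x\<close> is \<open>x\<close> itself.
\<close>

section \<open>Finitely supported chains\<close>

text \<open>Homology of \<Gamma> is defined by chains that are compatible across all levels, so
  fillings found level by level have to be replaced by a compatible family. At each level the
  fillings form a finite set, because \<Gamma>/U and the coefficients are finite; that is what
  compactness acts on. In the other direction, a 3-chain that bounds z involves only finitely many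
  elements of G. Finitely many adjoined generators therefore suffice, and an induction over a finite
  set takes the place of a free presentation and Hopf's formula. Since each adjunction would change
  the type, the extended groups are carried back to a fixed one. A section of a central extension is
  not a homomorphism, so it does not act on \<nu>(G) directly. Its commutators, however, do not see
  the central error, and two suitable copies of it become homomorphisms modulo a central subgroup of
  a triple product.\<close>

lemma group_homI: "group G \<Longrightarrow> group H \<Longrightarrow> h \<in> hom G H \<Longrightarrow> group_hom G H h"
  by (simp add: group_hom_def group_hom_axioms_def)

text \<open>The direct sum of copies of M over V. Keeping V arbitrary separates the additive part of
  the theory from the tuples of a group.\<close>

definition fin_chains :: "('m, 'y) monoid_scheme \<Rightarrow> 'q set \<Rightarrow> ('q \<Rightarrow> 'm) monoid" where
  "fin_chains M V =
     \<lparr>carrier = {c. range c \<subseteq> carrier M \<and> finite (chain_support M c) \<and> chain_support M c \<subseteq> V},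
      monoid.mult = (\<lambda>c c' x. c x \<otimes>\<^bsub>M\<^esub> c' x),
      one = (\<lambda>x. \<one>\<^bsub>M\<^esub>)\<rparr>"

definition tuples :: "('g, 'x) monoid_scheme \<Rightarrow> nat \<Rightarrow> 'g list set" where
  "tuples G n = {xs. length xs = n \<and> set xs \<subseteq> carrier G}"

lemma bar_chains_eq: "bar_chains G M n = fin_chains M (tuples G n)"
  by (simp add: bar_chains_def fin_chains_def tuples_def)

definition single :: "('m, 'y) monoid_scheme \<Rightarrow> 'q \<Rightarrow> 'm \<Rightarrow> 'q \<Rightarrow> 'm" where
  "single M x m = (\<lambda>y. if y = x then m else \<one>\<^bsub>M\<^esub>)"

text \<open>The universal property of the direct sum: the homomorphism that a family of
  homomorphisms \<phi> x from M to D induces.\<close>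

definition chain_ext ::
    "('m, 'y) monoid_scheme \<Rightarrow> ('d, 'z) monoid_scheme \<Rightarrow> ('q \<Rightarrow> 'm \<Rightarrow> 'd) \<Rightarrow> ('q \<Rightarrow> 'm) \<Rightarrow> 'd" where
  "chain_ext M D \<phi> c = finprod D (\<lambda>x. \<phi> x (c x)) (chain_support M c)"

lemma fin_chains_mult [simp]: "c \<otimes>\<^bsub>fin_chains M V\<^esub> c' = (\<lambda>x. c x \<otimes>\<^bsub>M\<^esub> c' x)"
  and fin_chains_one [simp]: "\<one>\<^bsub>fin_chains M V\<^esub> = (\<lambda>x. \<one>\<^bsub>M\<^esub>)"
  by (simp_all add: fin_chains_def)

lemma fin_chains_coeff: "c \<in> carrier (fin_chains M V) \<Longrightarrow> c x \<in> carrier M"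
  by (auto simp: fin_chains_def)

text \<open>Any finite subset of V that contains the support will do, so sums and images of chains
  need no exact computation of supports.\<close>

lemma fin_chains_iff:
  "c \<in> carrier (fin_chains M V) \<longleftrightarrow>
     (\<forall>x. c x \<in> carrier M) \<and> (\<exists>F. finite F \<and> F \<subseteq> V \<and> (\<forall>x. x \<notin> F \<longrightarrow> c x = \<one>\<^bsub>M\<^esub>))"
  (is "?l \<longleftrightarrow> ?r")
proof
  assume ?l then show ?r
    by (auto simp: fin_chains_def chain_support_def intro!: exI[of _ "chain_support M c"])
next
  assume ?r
  then obtain F where "finite F" "F \<subseteq> V" "\<forall>x. x \<notin> F \<longrightarrow> c x = \<one>\<^bsub>M\<^esub>" and "\<forall>x. c x \<in> carrier M"
    by blast
  moreover from this have "chain_support M c \<subseteq> F" by (auto simp: chain_support_def)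
  ultimately show ?l
    using finite_subset by (auto simp: fin_chains_def)
qed

lemma fin_chains_support:
  "c \<in> carrier (fin_chains M V) \<Longrightarrow> finite (chain_support M c)"
  "c \<in> carrier (fin_chains M V) \<Longrightarrow> chain_support M c \<subseteq> V"
  by (auto simp: fin_chains_def)

lemma comm_group_fin_chains:
  assumes "comm_group M"
  shows "comm_group (fin_chains M V)"
proof -
  interpret M: comm_group M by fact
  show ?thesis
  proof (rule comm_groupI)
    fix c c' assume c: "c \<in> carrier (fin_chains M V)" and c': "c' \<in> carrier (fin_chains M V)"
    then obtain F F' where "finite F" "F \<subseteq> V" "\<forall>x. x \<notin> F \<longrightarrow> c x = \<one>\<^bsub>M\<^esub>"
      "finite F'" "F' \<subseteq> V" "\<forall>x. x \<notin> F' \<longrightarrow> c' x = \<one>\<^bsub>M\<^esub>"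
      by (auto simp: fin_chains_iff)
    then show "c \<otimes>\<^bsub>fin_chains M V\<^esub> c' \<in> carrier (fin_chains M V)"
      using fin_chains_coeff[OF c] fin_chains_coeff[OF c']
      by (auto simp: fin_chains_iff intro!: exI[of _ "F \<union> F'"])
    show "c \<otimes>\<^bsub>fin_chains M V\<^esub> c' = c' \<otimes>\<^bsub>fin_chains M V\<^esub> c"
      using fin_chains_coeff[OF c] fin_chains_coeff[OF c'] by (simp add: M.m_comm)
  next
    fix c assume c: "c \<in> carrier (fin_chains M V)"
    then obtain F where "finite F" "F \<subseteq> V" "\<forall>x. x \<notin> F \<longrightarrow> c x = \<one>\<^bsub>M\<^esub>"
      by (auto simp: fin_chains_iff)
    then have "(\<lambda>x. inv\<^bsub>M\<^esub> c x) \<in> carrier (fin_chains M V)"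
      using fin_chains_coeff[OF c] by (auto simp: fin_chains_iff)
    then show "\<exists>c'\<in>carrier (fin_chains M V). c' \<otimes>\<^bsub>fin_chains M V\<^esub> c = \<one>\<^bsub>fin_chains M V\<^esub>"
      using fin_chains_coeff[OF c] by (auto intro!: bexI[of _ "\<lambda>x. inv\<^bsub>M\<^esub> c x"])
  qed (auto simp: fin_chains_coeff M.m_assoc fin_chains_iff)
qed

lemma group_fin_chains: "comm_group M \<Longrightarrow> group (fin_chains M V)"
  using comm_group_fin_chains comm_group.axioms(2) by blast

lemma fin_chains_inv:
  assumes "comm_group M" and c: "c \<in> carrier (fin_chains M V)"
  shows "inv\<^bsub>fin_chains M V\<^esub> c = (\<lambda>x. inv\<^bsub>M\<^esub> c x)"
proof -
  interpret M: comm_group M by fact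
  interpret C: group "fin_chains M V" by (rule group_fin_chains) fact
  obtain F where "finite F" "F \<subseteq> V" "\<forall>x. x \<notin> F \<longrightarrow> c x = \<one>\<^bsub>M\<^esub>"
    using c by (auto simp: fin_chains_iff)
  then have "(\<lambda>x. inv\<^bsub>M\<^esub> c x) \<in> carrier (fin_chains M V)"
    using fin_chains_coeff[OF c] by (auto simp: fin_chains_iff)
  then show ?thesis
    using fin_chains_coeff[OF c] c by (intro C.inv_equality) auto
qed

lemma single_closed:
  assumes "comm_group M" "x \<in> V" "m \<in> carrier M"
  shows "single M x m \<in> carrier (fin_chains M V)"
proof -
  interpret M: comm_group M by fact
  show ?thesis
    unfolding fin_chains_iff using assms(2,3) by (auto simp: single_def intro!: exI[of _ "{x}"])
qed

lemma single_mult: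
  assumes "comm_group M" "m \<in> carrier M" "m' \<in> carrier M"
  shows "single M x (m \<otimes>\<^bsub>M\<^esub> m') = (\<lambda>y. single M x m y \<otimes>\<^bsub>M\<^esub> single M x m' y)"
proof -
  interpret M: comm_group M by fact
  show ?thesis using assms(2,3) by (auto simp: single_def)
qed

text \<open>The induction runs over a finite set containing the support and clears the coefficient
  at one of its points at a time.\<close>

lemma fin_chains_induct [consumes 2, case_names one single]:
  fixes c :: "'q \<Rightarrow> 'm"
  assumes "comm_group M" and c: "c \<in> carrier (fin_chains M V)"
    and one: "P (\<lambda>x. \<one>\<^bsub>M\<^esub>)"
    and step: "\<And>x m c. x \<in> V \<Longrightarrow> m \<in> carrier M \<Longrightarrow> c \<in> carrier (fin_chains M V) \<Longrightarrow> P c \<Longrightarrow>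
      P (\<lambda>y. single M x m y \<otimes>\<^bsub>M\<^esub> c y)"
  shows "P c"
proof -
  interpret M: comm_group M by fact
  have "\<forall>c\<in>carrier (fin_chains M V). chain_support M c \<subseteq> F \<longrightarrow> P c" if "finite F" for F
    using that
  proof (induction F rule: finite_induct)
    case empty
    show ?case
    proof (intro ballI impI)
      fix c :: "'q \<Rightarrow> 'm" assume "chain_support M c \<subseteq> {}"
      then have "c = (\<lambda>x. \<one>\<^bsub>M\<^esub>)" by (auto simp: chain_support_def)
      with one show "P c" by simp
    qed
  next
    case (insert a F)
    show ?case
    proof (intro ballI impI)
      fix c assume c: "c \<in> carrier (fin_chains M V)" and sub: "chain_support M c \<subseteq> insert a F"
      show "P c"
      proof (cases "a \<in> chain_support M c")
        case False
        with sub have "chain_support M c \<subseteq> F" by blast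
        with insert.IH c show ?thesis by blast
      next
        case True
        with c have aX: "a \<in> V" by (auto simp: fin_chains_def)
        define c' where "c' = c(a := \<one>\<^bsub>M\<^esub>)"
        have sub': "chain_support M c' \<subseteq> chain_support M c - {a}"
          by (auto simp: chain_support_def c'_def)
        then have c': "c' \<in> carrier (fin_chains M V)"
          using c finite_subset[of "chain_support M c'" "chain_support M c"]
          by (auto simp: fin_chains_def c'_def)
        have "P c'"
          using insert.IH c' sub sub' by blast
        from step[OF aX fin_chains_coeff[OF c, of a] c' this]
        have "P (\<lambda>y. single M a (c a) y \<otimes>\<^bsub>M\<^esub> c' y)" .
        moreover have "(\<lambda>y. single M a (c a) y \<otimes>\<^bsub>M\<^esub> c' y) = c"
          using fin_chains_coeff[OF c] by (auto simp: single_def c'_def)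
        ultimately show ?thesis by simp
      qed
    qed
  qed
  from this[OF fin_chains_support(1)[OF c]] c show ?thesis by blast
qed

text \<open>Chains with one nonzero coefficient generate the direct sum. Identities between chain
  maps are reduced to generators through this lemma.\<close>

lemma fin_chains_hom_eqI:
  assumes M: "comm_group M" and D: "group D"
    and F: "F \<in> hom (fin_chains M V) D" and F': "F' \<in> hom (fin_chains M V) D"
    and eq: "\<And>x m. x \<in> V \<Longrightarrow> m \<in> carrier M \<Longrightarrow> F (single M x m) = F' (single M x m)"
    and c: "c \<in> carrier (fin_chains M V)"
  shows "F c = F' c"
  using M c
proof (induction c rule: fin_chains_induct)
  case one
  have "F \<one>\<^bsub>fin_chains M V\<^esub> = F' \<one>\<^bsub>fin_chains M V\<^esub>"
    using hom_one[OF F group_fin_chains[OF M] D] hom_one[OF F' group_fin_chains[OF M] D] by simp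
  then show ?case by simp
next
  case (single x m c)
  have "F (single M x m \<otimes>\<^bsub>fin_chains M V\<^esub> c) = F' (single M x m \<otimes>\<^bsub>fin_chains M V\<^esub> c)"
    using single single_closed[OF M] eq hom_mult[OF F] hom_mult[OF F'] by metis
  then show ?case by simp
qed

text \<open>Each \<phi> x kills the unit, so extra indices contribute nothing. Two chains can then
  be summed over a common index set, which gives additivity.\<close>

lemma chain_ext_superset:
  assumes M: "comm_group M" and D: "comm_group D"
    and \<phi>: "\<phi> \<in> V \<rightarrow> hom M D"
    and c: "c \<in> carrier (fin_chains M V)" and F: "finite F" "chain_support M c \<subseteq> F" "F \<subseteq> V"
  shows "chain_ext M D \<phi> c = finprod D (\<lambda>x. \<phi> x (c x)) F"
proof -
  interpret M: comm_group M by fact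
  interpret D: comm_group D by fact
  have hc: "\<phi> x (c x) \<in> carrier D" "\<phi> x \<one>\<^bsub>M\<^esub> = \<one>\<^bsub>D\<^esub>" if "x \<in> F" for x
    using that F(3) hom_in_carrier[OF _ fin_chains_coeff[OF c]] hom_one[OF _ M.is_group D.is_group] \<phi>
    by blast+
  show ?thesis
    unfolding chain_ext_def
    using F hc by (intro D.finprod_mono_neutral_cong_left) (auto simp: chain_support_def)
qed

lemma chain_ext_hom:
  assumes M: "comm_group M" and D: "comm_group D"
    and \<phi>: "\<phi> \<in> V \<rightarrow> hom M D"
  shows "chain_ext M D \<phi> \<in> hom (fin_chains M V) D"
proof -
  interpret M: comm_group M by fact
  interpret D: comm_group D by fact
  interpret C: comm_group "fin_chains M V" by (rule comm_group_fin_chains) fact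
  have cl: "(\<lambda>x. \<phi> x (c x)) \<in> F \<rightarrow> carrier D" if "F \<subseteq> V" "c \<in> carrier (fin_chains M V)" for F c
    using that \<phi> hom_in_carrier[OF _ fin_chains_coeff[OF that(2)]] by blast
  show ?thesis
  proof (rule homI)
    fix c assume c: "c \<in> carrier (fin_chains M V)"
    show "chain_ext M D \<phi> c \<in> carrier D"
      unfolding chain_ext_def using cl[OF fin_chains_support(2)[OF c] c] by (rule D.finprod_closed)
  next
    fix c c' assume c: "c \<in> carrier (fin_chains M V)" and c': "c' \<in> carrier (fin_chains M V)"
    let ?F = "chain_support M c \<union> chain_support M c'"
    have cc': "(\<lambda>x. c x \<otimes>\<^bsub>M\<^esub> c' x) \<in> carrier (fin_chains M V)"
      using C.m_closed[OF c c'] by simp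
    have F: "finite ?F" "?F \<subseteq> V"
      using fin_chains_support[OF c] fin_chains_support[OF c'] by auto
    have e: "chain_ext M D \<phi> c = finprod D (\<lambda>x. \<phi> x (c x)) ?F"
      "chain_ext M D \<phi> c' = finprod D (\<lambda>x. \<phi> x (c' x)) ?F"
      using chain_ext_superset[OF M D \<phi> c F(1) _ F(2)] chain_ext_superset[OF M D \<phi> c' F(1) _ F(2)] by auto
    have "chain_support M (\<lambda>x. c x \<otimes>\<^bsub>M\<^esub> c' x) \<subseteq> ?F"
      by (auto simp: chain_support_def)
    then have "chain_ext M D \<phi> (\<lambda>x. c x \<otimes>\<^bsub>M\<^esub> c' x) = finprod D (\<lambda>x. \<phi> x (c x \<otimes>\<^bsub>M\<^esub> c' x)) ?F"
      using F cc' by (intro chain_ext_superset[OF M D \<phi>]) auto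
    also have "\<dots> = finprod D (\<lambda>x. \<phi> x (c x) \<otimes>\<^bsub>D\<^esub> \<phi> x (c' x)) ?F"
      using D.m_closed cl[OF F(2) c] cl[OF F(2) c'] hom_mult[OF _ fin_chains_coeff[OF c] fin_chains_coeff[OF c']] \<phi> F(2)
      by (intro D.finprod_cong') blast+
    also have "\<dots> = finprod D (\<lambda>x. \<phi> x (c x)) ?F \<otimes>\<^bsub>D\<^esub> finprod D (\<lambda>x. \<phi> x (c' x)) ?F"
      using cl[OF F(2) c] cl[OF F(2) c'] by (rule D.finprod_multf)
    also have "\<dots> = chain_ext M D \<phi> c \<otimes>\<^bsub>D\<^esub> chain_ext M D \<phi> c'"
      by (simp only: e)
    finally show "chain_ext M D \<phi> (c \<otimes>\<^bsub>fin_chains M V\<^esub> c') = chain_ext M D \<phi> c \<otimes>\<^bsub>D\<^esub> chain_ext M D \<phi> c'"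
      by simp
  qed
qed

lemma chain_ext_single:
  assumes M: "comm_group M" and D: "comm_group D"
    and \<phi>: "\<phi> x \<in> hom M D" and m: "m \<in> carrier M"
  shows "chain_ext M D \<phi> (single M x m) = \<phi> x m"
proof -
  interpret M: comm_group M by fact
  interpret D: comm_group D by fact
  have "chain_ext M D \<phi> (single M x m) = finprod D (\<lambda>y. \<phi> y (single M x m y)) {x}"
    using \<phi> m by (intro chain_ext_superset[OF M D, where V = "{x}"] single_closed[OF M])
      (auto simp: chain_support_def single_def)
  also have "\<dots> = \<phi> x m"
    using hom_in_carrier[OF \<phi> m] by (simp add: single_def)
  finally show ?thesis .
qed

text \<open>Moving the condition f x = y from the index set into the summand turns each coefficient
  of the pushed chain into a \<open>chain_ext\<close>, hence into a homomorphism in the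
  chain.\<close>

lemma chain_push_eq_ext:
  assumes M: "comm_group M" and M': "comm_group M'"
    and h: "h \<in> V \<rightarrow> hom M M'"
    and c: "c \<in> carrier (fin_chains M V)"
  shows "chain_push M M' f h c y = chain_ext M M' (\<lambda>x m. if f x = y then h x m else \<one>\<^bsub>M'\<^esub>) c"
proof -
  interpret M: comm_group M by fact
  interpret M': comm_group M' by fact
  have "h x (c x) \<in> carrier M'" if "x \<in> chain_support M c" for x
    using that h fin_chains_support(2)[OF c] hom_in_carrier[OF _ fin_chains_coeff[OF c]] by blast
  then show ?thesis
    unfolding chain_push_def chain_ext_def
    using fin_chains_support(1)[OF c] by (intro M'.finprod_mono_neutral_cong_left) auto
qed

lemma push_coeff_hom:
  assumes "comm_group M'" "h \<in> hom M M'"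
  shows "(\<lambda>m. if b then h m else \<one>\<^bsub>M'\<^esub>) \<in> hom M M'"
proof -
  interpret M': comm_group M' by fact
  show ?thesis using assms(2) by (auto simp: hom_def)
qed

lemma chain_push_hom:
  assumes M: "comm_group M" and M': "comm_group M'"
    and h: "h \<in> V \<rightarrow> hom M M'" and f: "f \<in> V \<rightarrow> V'"
  shows "chain_push M M' f h \<in> hom (fin_chains M V) (fin_chains M' V')"
proof -
  interpret M: comm_group M by fact
  interpret M': comm_group M' by fact
  have e: "chain_ext M M' (\<lambda>x m. if f x = y then h x m else \<one>\<^bsub>M'\<^esub>) \<in> hom (fin_chains M V) M'" for y
    using h by (intro chain_ext_hom[OF M M']) (auto intro!: push_coeff_hom[OF M'])
  show ?thesis
  proof (rule homI)
    fix c assume c: "c \<in> carrier (fin_chains M V)"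
    have "chain_push M M' f h c y \<in> carrier M'" for y
      by (subst chain_push_eq_ext[OF M M' h c]) (rule hom_in_carrier[OF e c])
    moreover have "chain_push M M' f h c y = \<one>\<^bsub>M'\<^esub>" if "y \<notin> f ` chain_support M c" for y
    proof -
      have "{x \<in> chain_support M c. f x = y} = {}" using that by auto
      then show ?thesis by (simp only: chain_push_def M'.finprod_empty)
    qed
    ultimately show "chain_push M M' f h c \<in> carrier (fin_chains M' V')"
      using fin_chains_support[OF c] f
      by (auto simp: fin_chains_iff Pi_iff subset_iff intro!: exI[of _ "f ` chain_support M c"])
  next
    fix c c' assume c: "c \<in> carrier (fin_chains M V)" and c': "c' \<in> carrier (fin_chains M V)"
    interpret C: comm_group "fin_chains M V" by (rule comm_group_fin_chains) fact
    show "chain_push M M' f h (c \<otimes>\<^bsub>fin_chains M V\<^esub> c') =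
        chain_push M M' f h c \<otimes>\<^bsub>fin_chains M' V'\<^esub> chain_push M M' f h c'"
    proof
      fix y
      show "chain_push M M' f h (c \<otimes>\<^bsub>fin_chains M V\<^esub> c') y =
        (chain_push M M' f h c \<otimes>\<^bsub>fin_chains M' V'\<^esub> chain_push M M' f h c') y"
        using hom_mult[OF e c c'] C.m_closed[OF c c']
        by (simp only: chain_push_eq_ext[OF M M' h] c c' fin_chains_mult)
    qed
  qed
qed

lemma chain_push_single:
  assumes M: "comm_group M" and M': "comm_group M'"
    and h: "h x \<in> hom M M'" and m: "m \<in> carrier M"
  shows "chain_push M M' f h (single M x m) = single M' (f x) (h x m)"
proof
  fix y
  have "chain_push M M' f h (single M x m) y =
      chain_ext M M' (\<lambda>x m. if f x = y then h x m else \<one>\<^bsub>M'\<^esub>) (single M x m)"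
    using h m by (intro chain_push_eq_ext[OF M M', where V = "{x}"] single_closed[OF M]) auto
  also have "\<dots> = (if f x = y then h x m else \<one>\<^bsub>M'\<^esub>)"
    using push_coeff_hom[OF M' h, of "f x = y"] m by (subst chain_ext_single[OF M M']) auto
  finally show "chain_push M M' f h (single M x m) y = single M' (f x) (h x m) y"
    by (auto simp: single_def)
qed

lemma chain_push_cong:
  assumes "comm_group M'" 
    and c: "c \<in> carrier (fin_chains M V)"
    and h: "\<And>x m. x \<in> V \<Longrightarrow> m \<in> carrier M \<Longrightarrow> h x m = h' x m"
    and f: "\<And>x. x \<in> V \<Longrightarrow> f x = f' x"
    and cl: "\<And>x m. x \<in> V \<Longrightarrow> m \<in> carrier M \<Longrightarrow> h' x m \<in> carrier M'"
  shows "chain_push M M' f h c = chain_push M M' f' h' c"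
proof -
  interpret M': comm_group M' by fact
  show ?thesis
    unfolding chain_push_def
    using fin_chains_support(2)[OF c] fin_chains_coeff[OF c] h f cl
    by (intro ext M'.finprod_cong') auto
qed

lemma hom_id: "(\<lambda>m. m) \<in> hom M M"
  by (auto simp: hom_def)

lemma hom_comp: "f \<in> hom A B \<Longrightarrow> g \<in> hom B C \<Longrightarrow> (\<lambda>x. g (f x)) \<in> hom A C"
  by (auto simp: hom_def Pi_def)

lemma chain_push_comp:
  assumes M: "comm_group M" and M': "comm_group M'" and M'': "comm_group M''"
    and h: "h \<in> hom M M'" and h': "h' \<in> hom M' M''"
    and c: "c \<in> carrier (fin_chains M V)"
  shows "chain_push M' M'' f' (\<lambda>_. h') (chain_push M M' f (\<lambda>_. h) c) =
         chain_push M M'' (f' \<circ> f) (\<lambda>_ m. h' (h m)) c"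
proof (rule fin_chains_hom_eqI[OF M _ _ _ _ c])
  \<comment> \<open>With \<open>UNIV\<close> as target index set, the maps f and f' are free of any
    condition on their values.\<close>
  show "group (fin_chains M'' UNIV)" by (rule group_fin_chains) fact
  show "(\<lambda>c. chain_push M' M'' f' (\<lambda>_. h') (chain_push M M' f (\<lambda>_. h) c)) \<in> hom (fin_chains M V) (fin_chains M'' UNIV)"
    by (rule hom_comp[of _ _ "fin_chains M' UNIV"]; rule chain_push_hom) (use assms in auto)
  show "chain_push M M'' (f' \<circ> f) (\<lambda>_ m. h' (h m)) \<in> hom (fin_chains M V) (fin_chains M'' UNIV)"
    by (rule chain_push_hom) (use assms hom_comp[OF h h'] in auto)
  fix x m assume "x \<in> V" and m: "m \<in> carrier M"
  then show "chain_push M' M'' f' (\<lambda>_. h') (chain_push M M' f (\<lambda>_. h) (single M x m)) =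
       chain_push M M'' (f' \<circ> f) (\<lambda>_ m. h' (h m)) (single M x m)"
    using h h' hom_comp[OF h h'] hom_in_carrier[OF h m]
    by (simp add: chain_push_single[OF M M'] chain_push_single[OF M' M''] chain_push_single[OF M M''])
qed

section \<open>The bar boundary with trivial coefficients\<close>

text \<open>The action is replaced by the identity everywhere. The trivial actions at hand differ
  outside the carriers or act on cosets, but on chains of positive degree they all give this
  boundary.\<close>

definition bdry ::
    "('g, 'x) monoid_scheme \<Rightarrow> ('m, 'y) monoid_scheme \<Rightarrow> nat \<Rightarrow> ('g list \<Rightarrow> 'm) \<Rightarrow> ('g list \<Rightarrow> 'm)" where
  "bdry G M n = bar_boundary G M (\<lambda>_ m. m) n"

text \<open>The action enters only through the zeroth face, at the inverse of the first entry; in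
  positive degree that entry exists and lies in G.\<close>

lemma bar_boundary_trivial:
  assumes G: "group G" and M: "comm_group M"
    and act: "\<And>g m. g \<in> carrier G \<Longrightarrow> m \<in> carrier M \<Longrightarrow> act g m = m"
    and n: "n > 0" and c: "c \<in> carrier (fin_chains M (tuples G n))"
  shows "bar_boundary G M act n c = bdry G M n c"
proof -
  interpret G: group G by fact
  have "chain_push M M (bar_face G i) (\<lambda>xs. if i = 0 then act (inv\<^bsub>G\<^esub> (hd xs)) else (\<lambda>m. m)) c =
    chain_push M M (bar_face G i) (\<lambda>xs. if i = 0 then (\<lambda>m. m) else (\<lambda>m. m)) c" for i
  proof (rule chain_push_cong[OF M c])
    fix xs m assume "xs \<in> tuples G n" "m \<in> carrier M"
    moreover from this n have "hd xs \<in> carrier G"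
      by (cases xs) (auto simp: tuples_def)
    ultimately show "(if i = 0 then act (inv\<^bsub>G\<^esub> (hd xs)) else (\<lambda>m. m)) m = (if i = 0 then (\<lambda>m. m) else (\<lambda>m. m)) m"
      using act by auto
  qed auto
  then show ?thesis unfolding bdry_def bar_boundary_def by simp
qed

abbreviation face_push where
  "face_push G M i \<equiv> chain_push M M (bar_face G i) (\<lambda>_ m. m)"

lemma bar_face_tuples:
  assumes "group G" "i \<le> Suc n"
  shows "bar_face G i \<in> tuples G (Suc n) \<rightarrow> tuples G n"
proof
  interpret G: group G by fact
  fix xs assume "xs \<in> tuples G (Suc n)"
  then have xs: "length xs = Suc n" "set xs \<subseteq> carrier G"
    by (auto simp: tuples_def)
  consider "i = 0" | "i = Suc n" "i \<noteq> 0" | "0 < i" "i \<le> n" using assms(2) by linarith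
  then show "bar_face G i xs \<in> tuples G n"
  proof cases
    case 1
    with xs show ?thesis by (cases xs) (auto simp: bar_face_def tuples_def)
  next
    case 2
    with xs show ?thesis by (auto simp: bar_face_def tuples_def dest: in_set_butlastD)
  next
    case 3
    then have "xs ! (i - 1) \<in> set xs" "xs ! i \<in> set xs"
      using xs by (auto intro!: nth_mem)
    then have "xs ! (i - 1) \<otimes>\<^bsub>G\<^esub> xs ! i \<in> carrier G"
      using xs by (meson G.m_closed subsetD)
    moreover have "set (take (i - 1) xs) \<subseteq> carrier G" "set (drop (i + 1) xs) \<subseteq> carrier G"
      using xs(2) set_take_subset set_drop_subset by (meson subset_trans)+
    ultimately show ?thesis
      using 3 xs(1) by (simp add: bar_face_def tuples_def)
  qed
qed

lemma face_push_hom: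
  assumes "group G" "comm_group M" "i \<le> Suc n"
  shows "face_push G M i \<in> hom (fin_chains M (tuples G (Suc n))) (fin_chains M (tuples G n))"
  by (intro chain_push_hom assms bar_face_tuples) (simp add: hom_id)

lemma bdry_apply:
  "bdry G M n c y = finprod M (\<lambda>i. face_push G M i c y [^]\<^bsub>M\<^esub> ((-1) ^ i :: int)) {..n}"
  by (simp add: bdry_def bar_boundary_def)

lemma face_push_coeff:
  assumes "group G" "comm_group M" "i \<le> Suc n" "c \<in> carrier (fin_chains M (tuples G (Suc n)))"
  shows "face_push G M i c y \<in> carrier M"
  using hom_in_carrier[OF face_push_hom[OF assms(1-3)] assms(4)] by (rule fin_chains_coeff)

text \<open>Second homology involves only the boundaries out of degrees 2 and 3, so the alternating
  sum is written out there; the exponent (-1)^i becomes an inverse for odd i.\<close>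

lemma bdry_eq2:
  assumes G: "group G" and M: "comm_group M" and c: "c \<in> carrier (fin_chains M (tuples G 2))"
  shows "bdry G M 2 c y =
    face_push G M 0 c y \<otimes>\<^bsub>M\<^esub> inv\<^bsub>M\<^esub> (face_push G M 1 c y) \<otimes>\<^bsub>M\<^esub> face_push G M 2 c y"
proof -
  interpret M: comm_group M by fact
  have cl: "face_push G M i c y \<in> carrier M" if "i \<le> 2" for i
    using face_push_coeff[OF G M, of i 1 c] that c by (simp add: numeral_2_eq_2)
  have two: "{..2::nat} = {0, 1, 2}" by auto
  show ?thesis
    unfolding bdry_apply two using cl[of 0] cl[of 1] cl[of 2]
    by (simp add: M.m_assoc M.int_pow_neg[of _ 1, simplified])
qed

lemma bdry_eq3:
  assumes G: "group G" and M: "comm_group M" and c: "c \<in> carrier (fin_chains M (tuples G 3))"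
  shows "bdry G M 3 c y = face_push G M 0 c y \<otimes>\<^bsub>M\<^esub> inv\<^bsub>M\<^esub> (face_push G M 1 c y) \<otimes>\<^bsub>M\<^esub>
    face_push G M 2 c y \<otimes>\<^bsub>M\<^esub> inv\<^bsub>M\<^esub> (face_push G M 3 c y)"
proof -
  interpret M: comm_group M by fact
  have cl: "face_push G M i c y \<in> carrier M" if "i \<le> 3" for i
    using face_push_coeff[OF G M, of i 2 c] that c by (simp add: numeral_3_eq_3 numeral_2_eq_2)
  have three: "{..3::nat} = {0, 1, 2, 3}" by auto
  show ?thesis
    unfolding bdry_apply three using cl[of 0] cl[of 1] cl[of 2] cl[of 3]
    by (simp add: M.m_assoc M.int_pow_neg[of _ 1, simplified])
qed

lemma bdry_hom:
  assumes G: "group G" and M: "comm_group M"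
  shows "bdry G M (Suc n) \<in> hom (fin_chains M (tuples G (Suc n))) (fin_chains M (tuples G n))"
proof -
  interpret M: comm_group M by fact
  let ?C = "fin_chains M (tuples G (Suc n))"
  have cl: "face_push G M i c y [^]\<^bsub>M\<^esub> ((-1) ^ i :: int) \<in> carrier M"
    if "c \<in> carrier ?C" "i \<le> Suc n" for c i y
    using face_push_coeff[OF G M that(2,1)] by simp
  show ?thesis
  proof (rule homI)
    fix c assume c: "c \<in> carrier ?C"
    have f: "face_push G M i c \<in> carrier (fin_chains M (tuples G n))" if "i \<le> Suc n" for i
      by (rule hom_in_carrier[OF face_push_hom[OF G M that] c])
    define F where "F = (\<Union>i\<le>Suc n. chain_support M (face_push G M i c))"
    have F: "finite F" "F \<subseteq> tuples G n"
      unfolding F_def using fin_chains_support[OF f] by auto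
    have "bdry G M (Suc n) c y = \<one>\<^bsub>M\<^esub>" if "y \<notin> F" for y
      unfolding bdry_apply
      using that by (intro M.finprod_one_eqI) (auto simp: F_def chain_support_def)
    moreover have "bdry G M (Suc n) c y \<in> carrier M" for y
      unfolding bdry_apply using cl[OF c] by (intro M.finprod_closed) auto
    ultimately show "bdry G M (Suc n) c \<in> carrier (fin_chains M (tuples G n))"
      using F unfolding fin_chains_iff by blast
  next
    fix c c' assume c: "c \<in> carrier ?C" and c': "c' \<in> carrier ?C"
    show "bdry G M (Suc n) (c \<otimes>\<^bsub>?C\<^esub> c') = bdry G M (Suc n) c \<otimes>\<^bsub>fin_chains M (tuples G n)\<^esub> bdry G M (Suc n) c'"
    proof
      fix y
      have "bdry G M (Suc n) (c \<otimes>\<^bsub>?C\<^esub> c') y = finprod M (\<lambda>i. face_push G M i c y [^]\<^bsub>M\<^esub> ((-1) ^ i :: int) \<otimes>\<^bsub>M\<^esub>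
          face_push G M i c' y [^]\<^bsub>M\<^esub> ((-1) ^ i :: int)) {..Suc n}"
        unfolding bdry_apply
      proof (rule M.finprod_cong')
        fix i assume "i \<in> {..Suc n}"
        then have i: "i \<le> Suc n" by simp
        show "face_push G M i (c \<otimes>\<^bsub>?C\<^esub> c') y [^]\<^bsub>M\<^esub> ((-1) ^ i :: int) = face_push G M i c y [^]\<^bsub>M\<^esub> ((-1) ^ i :: int) \<otimes>\<^bsub>M\<^esub>
            face_push G M i c' y [^]\<^bsub>M\<^esub> ((-1) ^ i :: int)"
          using face_push_coeff[OF G M i] c c'
          by (subst hom_mult[OF face_push_hom[OF G M i] c c']) (simp add: M.int_pow_distrib)
      qed (use cl[OF c] cl[OF c'] in auto)
      also have "\<dots> = bdry G M (Suc n) c y \<otimes>\<^bsub>M\<^esub> bdry G M (Suc n) c' y"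
        unfolding bdry_apply using cl[OF c] cl[OF c'] by (intro M.finprod_multf) auto
      finally show "bdry G M (Suc n) (c \<otimes>\<^bsub>?C\<^esub> c') y =
          (bdry G M (Suc n) c \<otimes>\<^bsub>fin_chains M (tuples G n)\<^esub> bdry G M (Suc n) c') y"
        by simp
    qed
  qed
qed

lemma bdry_hom2:
  "group G \<Longrightarrow> comm_group M \<Longrightarrow> bdry G M 2 \<in> hom (fin_chains M (tuples G 2)) (fin_chains M (tuples G 1))"
  using bdry_hom[of G M 1] by (simp add: numeral_2_eq_2)

lemma bdry_hom3:
  "group G \<Longrightarrow> comm_group M \<Longrightarrow> bdry G M 3 \<in> hom (fin_chains M (tuples G 3)) (fin_chains M (tuples G 2))"
  using bdry_hom[of G M 2] by (simp add: numeral_2_eq_2 numeral_3_eq_3)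

lemma bdry_single2:
  assumes G: "group G" and M: "comm_group M" and g: "g \<in> carrier G" "h \<in> carrier G" and m: "m \<in> carrier M"
  shows "bdry G M 2 (single M [g, h] m) y = single M [h] m y \<otimes>\<^bsub>M\<^esub> inv\<^bsub>M\<^esub> (single M [g \<otimes>\<^bsub>G\<^esub> h] m y) \<otimes>\<^bsub>M\<^esub> single M [g] m y"
proof -
  have "single M [g, h] m \<in> carrier (fin_chains M (tuples G 2))"
    by (rule single_closed[OF M _ m]) (use g in \<open>simp add: tuples_def\<close>)
  then show ?thesis
    using m by (simp add: bdry_eq2[OF G M] chain_push_single[OF M M] hom_id bar_face_def)
qed

lemma bdry_single3:
  assumes G: "group G" and M: "comm_group M"
    and g: "g \<in> carrier G" "h \<in> carrier G" "k \<in> carrier G" and m: "m \<in> carrier M"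
  shows "bdry G M 3 (single M [g, h, k] m) y =
    single M [h, k] m y \<otimes>\<^bsub>M\<^esub> inv\<^bsub>M\<^esub> (single M [g \<otimes>\<^bsub>G\<^esub> h, k] m y) \<otimes>\<^bsub>M\<^esub>
    single M [g, h \<otimes>\<^bsub>G\<^esub> k] m y \<otimes>\<^bsub>M\<^esub> inv\<^bsub>M\<^esub> (single M [g, h] m y)"
proof -
  have "single M [g, h, k] m \<in> carrier (fin_chains M (tuples G 3))"
    by (rule single_closed[OF M _ m]) (use g in \<open>simp add: tuples_def\<close>)
  then show ?thesis
    using m by (simp add: bdry_eq3[OF G M] chain_push_single[OF M M] hom_id bar_face_def numeral_2_eq_2)
qed

lemma tuples2E:
  assumes "xs \<in> tuples G 2"
  obtains g h where "xs = [g, h]" "g \<in> carrier G" "h \<in> carrier G"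
  using assms by (auto simp: tuples_def length_Suc_conv numeral_2_eq_2)

lemma tuples3E:
  assumes "xs \<in> tuples G 3"
  obtains g h k where "xs = [g, h, k]" "g \<in> carrier G" "h \<in> carrier G" "k \<in> carrier G"
  using assms by (auto simp: tuples_def length_Suc_conv numeral_3_eq_3)

lemma (in group_hom) hom_alternating:
  assumes "a \<in> carrier G" "b \<in> carrier G" "c \<in> carrier G" "d \<in> carrier G"
  shows "h (a \<otimes> inv b \<otimes> c \<otimes> inv d) = h a \<otimes>\<^bsub>H\<^esub> inv\<^bsub>H\<^esub> h b \<otimes>\<^bsub>H\<^esub> h c \<otimes>\<^bsub>H\<^esub> inv\<^bsub>H\<^esub> h d"
  using assms by simp

text \<open>Separates the positive faces from the negative ones: a trivial image of a 3-boundary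
  then reads as the cocycle identity.\<close>

lemma (in comm_group) alternating_eq:
  assumes "a \<in> carrier G" "b \<in> carrier G" "c \<in> carrier G" "d \<in> carrier G"
  shows "a \<otimes> inv b \<otimes> c \<otimes> inv d = (a \<otimes> c) \<otimes> inv (d \<otimes> b)"
  using assms by (simp add: inv_mult m_ac)

text \<open>The double boundary of [g | h | k]: the letters a, b, c, d, e, f stand for the 1-chains
  at k, hk, h, ghk, gh, g.\<close>

lemma (in comm_group) cancel_faces:
  assumes "a \<in> carrier G" "b \<in> carrier G" "c \<in> carrier G" "d \<in> carrier G" "e \<in> carrier G" "f \<in> carrier G"
  shows "a \<otimes> inv b \<otimes> c \<otimes> inv (a \<otimes> inv d \<otimes> e) \<otimes> (b \<otimes> inv d \<otimes> f) \<otimes> inv (c \<otimes> inv e \<otimes> f) = \<one>"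
proof -
  have "a \<otimes> inv b \<otimes> c \<otimes> (b \<otimes> inv d \<otimes> f) = a \<otimes> c \<otimes> inv d \<otimes> f \<otimes> (inv b \<otimes> b)"
    using assms by (simp add: m_ac del: l_inv r_inv Units_l_inv Units_r_inv)
  moreover have "(c \<otimes> inv e \<otimes> f) \<otimes> (a \<otimes> inv d \<otimes> e) = a \<otimes> c \<otimes> inv d \<otimes> f \<otimes> (e \<otimes> inv e)"
    using assms by (simp add: m_ac del: l_inv r_inv Units_l_inv Units_r_inv)
  ultimately have eq: "a \<otimes> inv b \<otimes> c \<otimes> (b \<otimes> inv d \<otimes> f) = (c \<otimes> inv e \<otimes> f) \<otimes> (a \<otimes> inv d \<otimes> e)"
    using assms by simp
  show ?thesis
    by (subst alternating_eq) (use assms eq in simp_all)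
qed

lemma bdry_bdry:
  fixes G :: "('g, 'x) monoid_scheme" and M :: "('m, 'y) monoid_scheme"
  assumes G: "group G" and M: "comm_group M" and c: "c \<in> carrier (fin_chains M (tuples G 3))"
  shows "bdry G M 2 (bdry G M 3 c) = \<one>\<^bsub>fin_chains M (tuples G 1)\<^esub>"
proof (rule fin_chains_hom_eqI[OF M _ _ _ _ c])
  interpret G: group G by fact
  interpret M: comm_group M by fact
  show D: "group (fin_chains M (tuples G 1))" by (rule group_fin_chains) fact
  interpret D: comm_group "fin_chains M (tuples G 1)" by (rule comm_group_fin_chains) fact
  note h2 = bdry_hom2[OF G M] and h3 = bdry_hom3[OF G M]
  show "(\<lambda>c. bdry G M 2 (bdry G M 3 c)) \<in> hom (fin_chains M (tuples G 3)) (fin_chains M (tuples G 1))"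
    by (rule hom_comp[OF h3 h2])
  show "(\<lambda>c. \<one>\<^bsub>fin_chains M (tuples G 1)\<^esub>) \<in> hom (fin_chains M (tuples G 3)) (fin_chains M (tuples G 1))"
    by (rule homI) (simp_all only: D.one_closed D.l_one)
  interpret C: comm_group "fin_chains M (tuples G 2)" by (rule comm_group_fin_chains) fact
  interpret B: group_hom "fin_chains M (tuples G 2)" "fin_chains M (tuples G 1)" "bdry G M 2"
    using h2 by unfold_locales
  fix xs m assume mem: "xs \<in> tuples G 3" and m: "m \<in> carrier M"
  from mem obtain g h k where xs: "xs = [g, h, k]" and ghk: "g \<in> carrier G" "h \<in> carrier G" "k \<in> carrier G"
    by (rule tuples3E)
  let ?s = "\<lambda>g h. single M [g, h] m" and ?C = "fin_chains M (tuples G 2)"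
  have s: "?s a b \<in> carrier ?C" if "a \<in> carrier G" "b \<in> carrier G" for a b
    by (rule single_closed[OF M _ m]) (use that in \<open>simp add: tuples_def\<close>)
  have b3: "bdry G M 3 (single M xs m) = ?s h k \<otimes>\<^bsub>?C\<^esub> inv\<^bsub>?C\<^esub> (?s (g \<otimes>\<^bsub>G\<^esub> h) k) \<otimes>\<^bsub>?C\<^esub>
    ?s g (h \<otimes>\<^bsub>G\<^esub> k) \<otimes>\<^bsub>?C\<^esub> inv\<^bsub>?C\<^esub> (?s g h)"
    using s ghk by (simp add: fun_eq_iff xs bdry_single3[OF G M _ _ _ m] fin_chains_inv[OF M])
  have "bdry G M 2 (bdry G M 3 (single M xs m)) = bdry G M 2 (?s h k) \<otimes>\<^bsub>fin_chains M (tuples G 1)\<^esub>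
     inv\<^bsub>fin_chains M (tuples G 1)\<^esub> (bdry G M 2 (?s (g \<otimes>\<^bsub>G\<^esub> h) k)) \<otimes>\<^bsub>fin_chains M (tuples G 1)\<^esub>
     bdry G M 2 (?s g (h \<otimes>\<^bsub>G\<^esub> k)) \<otimes>\<^bsub>fin_chains M (tuples G 1)\<^esub> inv\<^bsub>fin_chains M (tuples G 1)\<^esub> (bdry G M 2 (?s g h))"
    unfolding b3 by (rule B.hom_alternating) (intro s ghk G.m_closed)+
  also have "\<dots> = \<one>\<^bsub>fin_chains M (tuples G 1)\<^esub>"
  proof -
    have "bdry G M 2 (?s a b) \<in> carrier (fin_chains M (tuples G 1))" if "a \<in> carrier G" "b \<in> carrier G" for a b
      by (rule B.hom_closed[OF s[OF that]])
    note i = fin_chains_inv[OF M this]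
    have sm: "single M y m x \<in> carrier M" for y x using m by (simp add: single_def)
    show ?thesis
    proof
      fix x :: "'g list"
      let ?t = "\<lambda>a. single M [a] m x"
      have e: "bdry G M 2 (?s a b) x = ?t b \<otimes>\<^bsub>M\<^esub> inv\<^bsub>M\<^esub> ?t (a \<otimes>\<^bsub>G\<^esub> b) \<otimes>\<^bsub>M\<^esub> ?t a"
        if "a \<in> carrier G" "b \<in> carrier G" for a b
        by (rule bdry_single2[OF G M that m])
      have "?t k \<otimes>\<^bsub>M\<^esub> inv\<^bsub>M\<^esub> ?t (h \<otimes>\<^bsub>G\<^esub> k) \<otimes>\<^bsub>M\<^esub> ?t h \<otimes>\<^bsub>M\<^esub>
        inv\<^bsub>M\<^esub> (?t k \<otimes>\<^bsub>M\<^esub> inv\<^bsub>M\<^esub> ?t (g \<otimes>\<^bsub>G\<^esub> h \<otimes>\<^bsub>G\<^esub> k) \<otimes>\<^bsub>M\<^esub> ?t (g \<otimes>\<^bsub>G\<^esub> h)) \<otimes>\<^bsub>M\<^esub>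
        (?t (h \<otimes>\<^bsub>G\<^esub> k) \<otimes>\<^bsub>M\<^esub> inv\<^bsub>M\<^esub> ?t (g \<otimes>\<^bsub>G\<^esub> h \<otimes>\<^bsub>G\<^esub> k) \<otimes>\<^bsub>M\<^esub> ?t g) \<otimes>\<^bsub>M\<^esub>
        inv\<^bsub>M\<^esub> (?t h \<otimes>\<^bsub>M\<^esub> inv\<^bsub>M\<^esub> ?t (g \<otimes>\<^bsub>G\<^esub> h) \<otimes>\<^bsub>M\<^esub> ?t g) = \<one>\<^bsub>M\<^esub>"
        by (rule M.cancel_faces) (rule sm)+
      then show "(bdry G M 2 (?s h k) \<otimes>\<^bsub>fin_chains M (tuples G 1)\<^esub>
     inv\<^bsub>fin_chains M (tuples G 1)\<^esub> (bdry G M 2 (?s (g \<otimes>\<^bsub>G\<^esub> h) k)) \<otimes>\<^bsub>fin_chains M (tuples G 1)\<^esub>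
     bdry G M 2 (?s g (h \<otimes>\<^bsub>G\<^esub> k)) \<otimes>\<^bsub>fin_chains M (tuples G 1)\<^esub> inv\<^bsub>fin_chains M (tuples G 1)\<^esub> (bdry G M 2 (?s g h))) x =
        \<one>\<^bsub>fin_chains M (tuples G 1)\<^esub> x"
        by (simp only: fin_chains_mult fin_chains_one i e ghk G.m_closed G.m_assoc)
    qed
  qed
  finally show "bdry G M 2 (bdry G M 3 (single M xs m)) = \<one>\<^bsub>fin_chains M (tuples G 1)\<^esub>" .
qed

lemma map_tuples: "q \<in> carrier G \<rightarrow> carrier Q \<Longrightarrow> map q \<in> tuples G n \<rightarrow> tuples Q n"
  by (auto simp: tuples_def Pi_iff)

lemma tuple_push_hom:
  assumes "comm_group M" "comm_group M'" "\<theta> \<in> hom M M'" "q \<in> carrier G \<rightarrow> carrier Q"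
  shows "chain_push M M' (map q) (\<lambda>_. \<theta>) \<in> hom (fin_chains M (tuples G n)) (fin_chains M' (tuples Q n))"
  using assms by (intro chain_push_hom map_tuples) auto

lemma bdry_push2:
  assumes G: "group G" and M: "comm_group M" and Q: "group Q" and M': "comm_group M'"
    and q: "q \<in> hom G Q" and \<theta>: "\<theta> \<in> hom M M'" and c: "c \<in> carrier (fin_chains M (tuples G 2))"
  shows "bdry Q M' 2 (chain_push M M' (map q) (\<lambda>_. \<theta>) c) = chain_push M M' (map q) (\<lambda>_. \<theta>) (bdry G M 2 c)"
proof (rule fin_chains_hom_eqI[OF M _ _ _ _ c])
  interpret G: group G by fact
  interpret M: comm_group M by fact
  interpret M': comm_group M' by fact
  have q': "q \<in> carrier G \<rightarrow> carrier Q" using q by (auto simp: hom_def)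
  let ?p = "chain_push M M' (map q) (\<lambda>_. \<theta>)"
  let ?C = "fin_chains M (tuples G 1)" and ?C' = "fin_chains M' (tuples Q 1)"
  have p: "?p \<in> hom (fin_chains M (tuples G n)) (fin_chains M' (tuples Q n))" for n
    by (rule tuple_push_hom[OF M M' \<theta> q'])
  show "group ?C'" by (rule group_fin_chains) fact
  show "(\<lambda>c. bdry Q M' 2 (?p c)) \<in> hom (fin_chains M (tuples G 2)) ?C'"
    by (rule hom_comp[OF p bdry_hom2[OF Q M']])
  show "(\<lambda>c. ?p (bdry G M 2 c)) \<in> hom (fin_chains M (tuples G 2)) ?C'"
    by (rule hom_comp[OF bdry_hom2[OF G M] p])
  interpret C: comm_group ?C by (rule comm_group_fin_chains) fact
  interpret C': comm_group ?C' by (rule comm_group_fin_chains) fact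
  interpret p: group_hom ?C ?C' ?p using p by unfold_locales
  fix xs m assume mem: "xs \<in> tuples G 2" and m: "m \<in> carrier M"
  from mem obtain g h where xs: "xs = [g, h]" and gh: "g \<in> carrier G" "h \<in> carrier G"
    by (rule tuples2E)
  have tm: "\<theta> m \<in> carrier M'" using hom_in_carrier[OF \<theta> m] .
  have s: "single M [a] m \<in> carrier ?C" if "a \<in> carrier G" for a
    by (rule single_closed[OF M _ m]) (use that in \<open>simp add: tuples_def\<close>)
  have s': "single M' [a] (\<theta> m) \<in> carrier ?C'" if "a \<in> carrier Q" for a
    by (rule single_closed[OF M' _ tm]) (use that in \<open>simp add: tuples_def\<close>)
  have ps: "?p (single M zs m) = single M' (map q zs) (\<theta> m)" for zs
    using \<theta> m by (simp add: chain_push_single[OF M M'])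
  have "bdry G M 2 (single M xs m) = single M [h] m \<otimes>\<^bsub>?C\<^esub> inv\<^bsub>?C\<^esub> (single M [g \<otimes>\<^bsub>G\<^esub> h] m) \<otimes>\<^bsub>?C\<^esub> single M [g] m"
    using s gh by (simp add: fun_eq_iff xs bdry_single2[OF G M _ _ m] fin_chains_inv[OF M])
  then have "?p (bdry G M 2 (single M xs m)) = single M' [q h] (\<theta> m) \<otimes>\<^bsub>?C'\<^esub>
      inv\<^bsub>?C'\<^esub> (single M' [q g \<otimes>\<^bsub>Q\<^esub> q h] (\<theta> m)) \<otimes>\<^bsub>?C'\<^esub> single M' [q g] (\<theta> m)"
    using s gh hom_mult[OF q] by (simp only: p.hom_mult p.hom_inv C.m_closed C.inv_closed G.m_closed ps list.map)
  also have "\<dots> = bdry Q M' 2 (?p (single M xs m))"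
    using s' gh q' Q
    by (simp add: fun_eq_iff xs ps bdry_single2[OF Q M' _ _ tm] fin_chains_inv[OF M'] Pi_iff group.is_monoid monoid.m_closed)
  finally show "bdry Q M' 2 (?p (single M xs m)) = ?p (bdry G M 2 (single M xs m))" by simp
qed

lemma bdry_push3:
  assumes G: "group G" and M: "comm_group M" and Q: "group Q" and M': "comm_group M'"
    and q: "q \<in> hom G Q" and \<theta>: "\<theta> \<in> hom M M'" and c: "c \<in> carrier (fin_chains M (tuples G 3))"
  shows "bdry Q M' 3 (chain_push M M' (map q) (\<lambda>_. \<theta>) c) = chain_push M M' (map q) (\<lambda>_. \<theta>) (bdry G M 3 c)"
proof (rule fin_chains_hom_eqI[OF M _ _ _ _ c])
  interpret G: group G by fact
  interpret M: comm_group M by fact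
  interpret M': comm_group M' by fact
  have q': "q \<in> carrier G \<rightarrow> carrier Q" using q by (auto simp: hom_def)
  let ?p = "chain_push M M' (map q) (\<lambda>_. \<theta>)"
  let ?C = "fin_chains M (tuples G 2)" and ?C' = "fin_chains M' (tuples Q 2)"
  have p: "?p \<in> hom (fin_chains M (tuples G n)) (fin_chains M' (tuples Q n))" for n
    by (rule tuple_push_hom[OF M M' \<theta> q'])
  show "group ?C'" by (rule group_fin_chains) fact
  show "(\<lambda>c. bdry Q M' 3 (?p c)) \<in> hom (fin_chains M (tuples G 3)) ?C'"
    by (rule hom_comp[OF p bdry_hom3[OF Q M']])
  show "(\<lambda>c. ?p (bdry G M 3 c)) \<in> hom (fin_chains M (tuples G 3)) ?C'"
    by (rule hom_comp[OF bdry_hom3[OF G M] p])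
  interpret C: comm_group ?C by (rule comm_group_fin_chains) fact
  interpret C': comm_group ?C' by (rule comm_group_fin_chains) fact
  interpret p: group_hom ?C ?C' ?p using p by unfold_locales
  fix xs m assume mem: "xs \<in> tuples G 3" and m: "m \<in> carrier M"
  from mem obtain g h k where xs: "xs = [g, h, k]" and gh: "g \<in> carrier G" "h \<in> carrier G" "k \<in> carrier G"
    by (rule tuples3E)
  have tm: "\<theta> m \<in> carrier M'" using hom_in_carrier[OF \<theta> m] .
  have s: "single M [a, b] m \<in> carrier ?C" if "a \<in> carrier G" "b \<in> carrier G" for a b
    by (rule single_closed[OF M _ m]) (use that in \<open>simp add: tuples_def\<close>)
  have s': "single M' [a, b] (\<theta> m) \<in> carrier ?C'" if "a \<in> carrier Q" "b \<in> carrier Q" for a b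
    by (rule single_closed[OF M' _ tm]) (use that in \<open>simp add: tuples_def\<close>)
  have ps: "?p (single M zs m) = single M' (map q zs) (\<theta> m)" for zs
    using \<theta> m by (simp add: chain_push_single[OF M M'])
  have "bdry G M 3 (single M xs m) = single M [h, k] m \<otimes>\<^bsub>?C\<^esub> inv\<^bsub>?C\<^esub> (single M [g \<otimes>\<^bsub>G\<^esub> h, k] m) \<otimes>\<^bsub>?C\<^esub>
      single M [g, h \<otimes>\<^bsub>G\<^esub> k] m \<otimes>\<^bsub>?C\<^esub> inv\<^bsub>?C\<^esub> (single M [g, h] m)"
    using s gh by (simp add: fun_eq_iff xs bdry_single3[OF G M _ _ _ m] fin_chains_inv[OF M])
  then have "?p (bdry G M 3 (single M xs m)) = single M' [q h, q k] (\<theta> m) \<otimes>\<^bsub>?C'\<^esub>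
      inv\<^bsub>?C'\<^esub> (single M' [q g \<otimes>\<^bsub>Q\<^esub> q h, q k] (\<theta> m)) \<otimes>\<^bsub>?C'\<^esub>
      single M' [q g, q h \<otimes>\<^bsub>Q\<^esub> q k] (\<theta> m) \<otimes>\<^bsub>?C'\<^esub> inv\<^bsub>?C'\<^esub> (single M' [q g, q h] (\<theta> m))"
    using s gh hom_mult[OF q] by (simp only: p.hom_mult p.hom_inv C.m_closed C.inv_closed G.m_closed ps list.map)
  also have "\<dots> = bdry Q M' 3 (?p (single M xs m))"
    using s' gh q' Q
    by (simp add: fun_eq_iff xs ps bdry_single3[OF Q M' _ _ _ tm] fin_chains_inv[OF M'] Pi_iff group.is_monoid monoid.m_closed)
  finally show "bdry Q M' 3 (?p (single M xs m)) = ?p (bdry G M 3 (single M xs m))" by simp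
qed

section \<open>The profinite completion\<close>

text \<open>On A the map g factors through h, by choosing one preimage for each value of h. It
  bounds numbers of cosets by numbers of values of an invariant.\<close>

lemma finite_image_factor:
  assumes "finite (h ` A)" and "\<And>x y. x \<in> A \<Longrightarrow> y \<in> A \<Longrightarrow> h x = h y \<Longrightarrow> g x = g y"
  shows "finite (g ` A)"
proof (rule finite_surj[OF assms(1)])
  show "g ` A \<subseteq> (\<lambda>c. g (SOME x. x \<in> A \<and> h x = c)) ` h ` A"
  proof
    fix y assume "y \<in> g ` A"
    then obtain x where x: "x \<in> A" "y = g x" by blast
    let ?z = "SOME z. z \<in> A \<and> h z = h x"
    have "?z \<in> A \<and> h ?z = h x" using x(1) by (intro someI[of "\<lambda>z. z \<in> A \<and> h z = h x" x]) auto
    then have "g ?z = y" using assms(2)[of ?z x] x by simp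
    then show "y \<in> (\<lambda>c. g (SOME x. x \<in> A \<and> h x = c)) ` h ` A" using x(1) by blast
  qed
qed

lemma kernel_finite_index:
  assumes "group G" "group F" "f \<in> hom G F" "finite (carrier F)"
  shows "kernel G F f \<in> finite_index_normals G"
proof -
  interpret group_hom G F f by (intro group_homI assms)
  have "finite ((\<lambda>x. kernel G F f #>\<^bsub>G\<^esub> x) ` carrier G)"
  proof (rule finite_image_factor)
    show "finite (f ` carrier G)" using assms(4) by (rule finite_subset[rotated]) auto
    fix x y assume xy: "x \<in> carrier G" "y \<in> carrier G" "f x = f y"
    then have "y \<otimes>\<^bsub>G\<^esub> inv\<^bsub>G\<^esub> x \<in> kernel G F f" by (simp add: kernel_def)
    then show "kernel G F f #>\<^bsub>G\<^esub> x = kernel G F f #>\<^bsub>G\<^esub> y"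
      using xy G.repr_independence[OF _ _ subgroup_kernel, of y x] subgroup.rcos_module_rev[OF subgroup_kernel G.is_group, of x y]
      by auto
  qed
  then show ?thesis
    unfolding finite_index_normals_def using normal_kernel by (simp add: RCOSETS_def UNION_singleton_eq_range)
qed

lemma kernel_finite_index_Mod:
  assumes "group G" "group F" "f \<in> hom G F" "N \<in> finite_index_normals F"
  shows "{x \<in> carrier G. f x \<in> N} \<in> finite_index_normals G"
proof -
  have N: "N \<lhd> F" and fin: "finite (rcosets\<^bsub>F\<^esub> N)"
    using assms(4) by (auto simp: finite_index_normals_def)
  interpret F: group F by fact
  interpret N: normal N F by fact
  have h: "(\<lambda>x. N #>\<^bsub>F\<^esub> f x) \<in> hom G (F Mod N)"
    using hom_compose[OF assms(3) N.r_coset_hom_Mod] by (simp add: comp_def)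
  have "kernel G (F Mod N) (\<lambda>x. N #>\<^bsub>F\<^esub> f x) \<in> finite_index_normals G"
    using fin by (intro kernel_finite_index[OF assms(1) N.factorgroup_is_group h]) (simp add: FactGroup_def)
  moreover have "kernel G (F Mod N) (\<lambda>x. N #>\<^bsub>F\<^esub> f x) = {x \<in> carrier G. f x \<in> N}"
    using hom_in_carrier[OF assms(3)] F.coset_join1[OF _ _ N.subgroup_axioms] F.coset_join2[OF _ N.subgroup_axioms] N.subset
    by (auto simp: kernel_def)
  ultimately show ?thesis by simp
qed

context group begin

lemma finite_index_normals_carrier: "carrier G \<in> finite_index_normals G"
proof -
  have "rcosets carrier G \<subseteq> {carrier G}"
    using coset_join2[OF _ subgroup_self] by (auto simp: RCOSETS_def)
  then show ?thesis
    using finite_subset normal_self by (auto simp: finite_index_normals_def)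
qed

lemma finite_index_normals_Int:
  assumes "N \<in> finite_index_normals G" "M \<in> finite_index_normals G"
  shows "N \<inter> M \<in> finite_index_normals G"
proof -
  have N: "N \<lhd> G" "finite (rcosets N)" and M: "M \<lhd> G" "finite (rcosets M)"
    using assms by (auto simp: finite_index_normals_def)
  have "N \<inter> M #> g = (N #> g) \<inter> (M #> g)" if "g \<in> carrier G" for g
    using that normal_imp_subgroup[OF N(1)] normal_imp_subgroup[OF M(1)]
    by (auto simp: r_coset_def dest: subgroup.mem_carrier) (metis IntI right_cancel subgroup.mem_carrier)
  then have "rcosets (N \<inter> M) \<subseteq> (\<lambda>(A, B). A \<inter> B) ` ((rcosets N) \<times> (rcosets M))"
    by (fastforce simp: RCOSETS_def)
  then have "finite (rcosets (N \<inter> M))"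
    by (rule finite_subset) (use N M in auto)
  moreover have "N \<inter> M \<lhd> G"
    using N M normal_subgroup_intersect by blast
  ultimately show ?thesis by (simp add: finite_index_normals_def)
qed

lemma finite_index_normals_INT:
  assumes "finite F" "F \<subseteq> finite_index_normals G"
  shows "carrier G \<inter> \<Inter>F \<in> finite_index_normals G"
  using assms
proof (induction F rule: finite_induct)
  case empty
  then show ?case using finite_index_normals_carrier by simp
next
  case (insert N F)
  then have "N \<inter> (carrier G \<inter> \<Inter>F) \<in> finite_index_normals G"
    using finite_index_normals_Int[of N "carrier G \<inter> \<Inter>F"] by blast
  then show ?case by (simp add: Int_left_commute)
qed

end

section \<open>Group structure and topology of the completion\<close>

locale profinite = group G for G :: "('a, 'b) monoid_scheme" (structure)
begin

abbreviation "\<Gamma> \<equiv> profinite_completion G"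
abbreviation "\<NN> \<equiv> finite_index_normals G"

lemma normal_NN: "N \<in> \<NN> \<Longrightarrow> N \<lhd> G"
  by (simp add: finite_index_normals_def)

lemma carrier_\<Gamma>: "carrier \<Gamma> = completion_carrier G"
  by (simp add: profinite_completion_def)

lemma \<Gamma>_mult: "N \<in> \<NN> \<Longrightarrow> (x \<otimes>\<^bsub>\<Gamma>\<^esub> y) N = x N <#> y N"
  by (simp add: profinite_completion_def)

lemma \<Gamma>_one: "N \<in> \<NN> \<Longrightarrow> \<one>\<^bsub>\<Gamma>\<^esub> N = N"
  by (simp add: profinite_completion_def)

lemma \<Gamma>_coset: "x \<in> carrier \<Gamma> \<Longrightarrow> N \<in> \<NN> \<Longrightarrow> x N \<in> rcosets N"
  by (auto simp: carrier_\<Gamma> completion_carrier_def)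

lemma \<Gamma>_mono: "x \<in> carrier \<Gamma> \<Longrightarrow> N \<in> \<NN> \<Longrightarrow> M \<in> \<NN> \<Longrightarrow> N \<subseteq> M \<Longrightarrow> x N \<subseteq> x M"
  by (auto simp: carrier_\<Gamma> completion_carrier_def)

lemma \<Gamma>_eqI:
  assumes "x \<in> extensional \<NN>" "y \<in> extensional \<NN>" "\<And>N. N \<in> \<NN> \<Longrightarrow> x N = y N"
  shows "x = y"
  using assms by (rule extensionalityI)

lemma \<Gamma>_ext: "x \<in> carrier \<Gamma> \<Longrightarrow> x \<in> extensional \<NN>"
  by (auto simp: carrier_\<Gamma> completion_carrier_def PiE_def)

lemma \<Gamma>_closedI:
  assumes "x \<in> extensional \<NN>" "\<And>N. N \<in> \<NN> \<Longrightarrow> x N \<in> rcosets N"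
    "\<And>N M. N \<in> \<NN> \<Longrightarrow> M \<in> \<NN> \<Longrightarrow> N \<subseteq> M \<Longrightarrow> x N \<subseteq> x M"
  shows "x \<in> carrier \<Gamma>"
  using assms by (auto simp: carrier_\<Gamma> completion_carrier_def PiE_def)

lemma group_\<Gamma>: "group \<Gamma>"
proof (rule groupI)
  have mult_ext: "x \<otimes>\<^bsub>\<Gamma>\<^esub> y \<in> extensional \<NN>" for x y
    by (simp add: profinite_completion_def)
  have one_ext: "\<one>\<^bsub>\<Gamma>\<^esub> \<in> extensional \<NN>"
    by (simp add: profinite_completion_def)
  have Q: "group (G Mod N)" if "N \<in> \<NN>" for N
    using normal.factorgroup_is_group[OF normal_NN[OF that]] .
  have C: "carrier (G Mod N) = rcosets N" for N by (simp add: FactGroup_def)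
  show cl: "x \<otimes>\<^bsub>\<Gamma>\<^esub> y \<in> carrier \<Gamma>" if x: "x \<in> carrier \<Gamma>" and y: "y \<in> carrier \<Gamma>" for x y
  proof (rule \<Gamma>_closedI[OF mult_ext])
    fix N assume N: "N \<in> \<NN>"
    show "(x \<otimes>\<^bsub>\<Gamma>\<^esub> y) N \<in> rcosets N"
      using normal.setmult_closed[OF normal_NN[OF N] \<Gamma>_coset[OF x N] \<Gamma>_coset[OF y N]] N
      by (simp add: \<Gamma>_mult)
    fix M assume M: "M \<in> \<NN>" and NM: "N \<subseteq> M"
    show "(x \<otimes>\<^bsub>\<Gamma>\<^esub> y) N \<subseteq> (x \<otimes>\<^bsub>\<Gamma>\<^esub> y) M"
      using \<Gamma>_mono[OF x N M NM] \<Gamma>_mono[OF y N M NM] N M by (auto simp: \<Gamma>_mult set_mult_def)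
  qed
  show "\<one>\<^bsub>\<Gamma>\<^esub> \<in> carrier \<Gamma>"
    using one_ext normal_NN normal_imp_subgroup subgroup.subgroup_in_rcosets[OF _ is_group]
    by (intro \<Gamma>_closedI) (auto simp: \<Gamma>_one)
  fix x assume x: "x \<in> carrier \<Gamma>"
  show "\<one>\<^bsub>\<Gamma>\<^esub> \<otimes>\<^bsub>\<Gamma>\<^esub> x = x"
    by (rule \<Gamma>_eqI[OF mult_ext \<Gamma>_ext[OF x]])
       (simp add: \<Gamma>_mult \<Gamma>_one normal.rcosets_mult_eq[OF normal_NN \<Gamma>_coset[OF x]])
  show "\<exists>y\<in>carrier \<Gamma>. y \<otimes>\<^bsub>\<Gamma>\<^esub> x = \<one>\<^bsub>\<Gamma>\<^esub>"
  proof (intro bexI)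
    let ?y = "\<lambda>N\<in>\<NN>. set_inv (x N)"
    show "?y \<in> carrier \<Gamma>"
    proof (rule \<Gamma>_closedI)
      fix N assume N: "N \<in> \<NN>"
      show "?y N \<in> rcosets N"
        using normal.setinv_closed[OF normal_NN[OF N] \<Gamma>_coset[OF x N]] N by simp
      fix M assume "M \<in> \<NN>" "N \<subseteq> M"
      with \<Gamma>_mono[OF x N this] N show "?y N \<subseteq> ?y M" by (auto simp: SET_INV_def)
    qed auto
    show "?y \<otimes>\<^bsub>\<Gamma>\<^esub> x = \<one>\<^bsub>\<Gamma>\<^esub>"
      by (rule \<Gamma>_eqI[OF mult_ext one_ext])
         (simp add: \<Gamma>_mult \<Gamma>_one normal.rcosets_inv_mult_group_eq[OF normal_NN \<Gamma>_coset[OF x]])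
  qed
  fix y z assume y: "y \<in> carrier \<Gamma>" and z: "z \<in> carrier \<Gamma>"
  show "x \<otimes>\<^bsub>\<Gamma>\<^esub> y \<otimes>\<^bsub>\<Gamma>\<^esub> z = x \<otimes>\<^bsub>\<Gamma>\<^esub> (y \<otimes>\<^bsub>\<Gamma>\<^esub> z)"
    by (rule \<Gamma>_eqI[OF mult_ext mult_ext])
       (simp add: \<Gamma>_mult normal.rcosets_assoc[OF normal_NN \<Gamma>_coset[OF x] \<Gamma>_coset[OF y] \<Gamma>_coset[OF z]])
qed

lemma completion_map_hom: "completion_map G \<in> hom G \<Gamma>"
proof (rule homI)
  have ext: "completion_map G g \<in> extensional \<NN>" for g by (simp add: completion_map_def)
  show "completion_map G g \<in> carrier \<Gamma>" if "g \<in> carrier G" for g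
    using that ext by (intro \<Gamma>_closedI) (auto simp: completion_map_def RCOSETS_def r_coset_def)
  show "completion_map G (g \<otimes> h) = completion_map G g \<otimes>\<^bsub>\<Gamma>\<^esub> completion_map G h"
    if "g \<in> carrier G" "h \<in> carrier G" for g h
  proof (rule \<Gamma>_eqI[OF ext])
    show "completion_map G g \<otimes>\<^bsub>\<Gamma>\<^esub> completion_map G h \<in> extensional \<NN>"
      by (simp add: profinite_completion_def)
  qed (use that in \<open>simp add: \<Gamma>_mult completion_map_def normal.rcos_sum[OF normal_NN]\<close>)
qed

lemma topspace_\<Gamma>: "topspace (topol \<Gamma>) = carrier \<Gamma>"
  by (auto simp: profinite_completion_def completion_carrier_def)

text \<open>The coordinates are continuous maps to discrete spaces. This makes the preimage in Zhat
  of a subgroup of Z/m open.\<close>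

lemma openin_coordinate:
  assumes N: "N \<in> \<NN>"
  shows "openin (topol \<Gamma>) {x \<in> carrier \<Gamma>. x N \<in> S}"
proof -
  let ?P = "product_topology (\<lambda>N. discrete_topology (rcosets N)) \<NN>"
  have "continuous_map ?P (discrete_topology (rcosets N)) (\<lambda>x. x N)"
    using continuous_map_product_projection[OF N] by metis
  then have "continuous_map (topol \<Gamma>) (discrete_topology (rcosets N)) (\<lambda>x. x N)"
    by (simp add: profinite_completion_def continuous_map_from_subtopology)
  from openin_continuous_map_preimage[OF this, of "S \<inter> rcosets N"]
  have "openin (topol \<Gamma>) {x \<in> carrier \<Gamma>. x N \<in> S \<inter> rcosets N}"
    by (simp add: topspace_\<Gamma>)
  moreover have "{x \<in> carrier \<Gamma>. x N \<in> S \<inter> rcosets N} = {x \<in> carrier \<Gamma>. x N \<in> S}"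
    using \<Gamma>_coset N by auto
  ultimately show ?thesis by simp
qed

text \<open>A basic neighbourhood of the unit inside U restricts only finitely many coordinates. If
  N0 is the intersection of the subgroups concerned, the coordinate at N0 determines the coset of
  U.\<close>

lemma open_subgroup_finite_index:
  assumes U: "subgroup U \<Gamma>" and op: "openin (topol \<Gamma>) U"
  shows "finite (rcosets\<^bsub>\<Gamma>\<^esub> U)"
proof -
  interpret \<Gamma>: group \<Gamma> by (rule group_\<Gamma>)
  obtain W where W: "openin (product_topology (\<lambda>N. discrete_topology (rcosets N)) \<NN>) W"
    and UW: "U = W \<inter> completion_carrier G"
    using op by (auto simp: profinite_completion_def openin_subtopology)
  have "\<one>\<^bsub>\<Gamma>\<^esub> \<in> W" using UW subgroup.one_closed[OF U] by auto
  with W obtain B where finB: "finite {i \<in> \<NN>. B i \<noteq> rcosets i}"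
    and oneB: "\<one>\<^bsub>\<Gamma>\<^esub> \<in> Pi\<^sub>E \<NN> B" and BW: "Pi\<^sub>E \<NN> B \<subseteq> W"
    unfolding openin_product_topology_alt by (auto 0 3)
  let ?F = "{i \<in> \<NN>. B i \<noteq> rcosets i}"
  define N0 where "N0 = carrier G \<inter> \<Inter>?F"
  have N0: "N0 \<in> \<NN>" unfolding N0_def by (rule finite_index_normals_INT[OF finB]) auto
  have "finite ((\<lambda>x. U #>\<^bsub>\<Gamma>\<^esub> x) ` carrier \<Gamma>)"
  proof (rule finite_image_factor[where h = "\<lambda>x. x N0"])
    have "finite (rcosets N0)" using N0 by (simp add: finite_index_normals_def)
    then show "finite ((\<lambda>x. x N0) ` carrier \<Gamma>)"
      by (rule finite_subset[rotated]) (use \<Gamma>_coset N0 in auto)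
    fix x y assume x: "x \<in> carrier \<Gamma>" and y: "y \<in> carrier \<Gamma>" and eq: "x N0 = y N0"
    let ?d = "y \<otimes>\<^bsub>\<Gamma>\<^esub> inv\<^bsub>\<Gamma>\<^esub> x"
    have d: "?d \<in> carrier \<Gamma>" using x y by simp
    have "?d N0 = (x \<otimes>\<^bsub>\<Gamma>\<^esub> inv\<^bsub>\<Gamma>\<^esub> x) N0" using N0 eq by (simp add: \<Gamma>_mult)
    then have dN0: "?d N0 = N0" using x N0 by (simp add: \<Gamma>_one)
    have "?d \<in> Pi\<^sub>E \<NN> B"
    proof (rule PiE_I)
      fix i assume i: "i \<in> \<NN>"
      show "?d i \<in> B i"
      proof (cases "B i = rcosets i")
        case True
        then show ?thesis using \<Gamma>_coset[OF d i] by simp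
      next
        case False
        with i have "N0 \<subseteq> i" by (auto simp: N0_def)
        \<comment> \<open>The coordinate of \<open>?d\<close> at i contains that at N0, hence the
          unit; a coset of i that contains the unit is i itself.\<close>
        from \<Gamma>_mono[OF d N0 i this] have "\<one> \<in> ?d i"
          using dN0 normal_imp_subgroup[OF normal_NN[OF N0]] subgroup.one_closed by blast
        moreover have "\<one> \<in> i" using normal_imp_subgroup[OF normal_NN[OF i]] subgroup.one_closed by blast
        moreover have "i \<in> rcosets i"
          using subgroup.subgroup_in_rcosets[OF normal_imp_subgroup[OF normal_NN[OF i]] is_group] .
        ultimately have "?d i = i"
          using rcos_disjoint[OF normal_imp_subgroup[OF normal_NN[OF i]]] \<Gamma>_coset[OF d i]
          by (fastforce simp: pairwise_def disjnt_def)
        moreover have "\<one>\<^bsub>\<Gamma>\<^esub> i \<in> B i" using oneB i by blast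
        ultimately show ?thesis using i by (simp add: \<Gamma>_one)
      qed
    qed (use \<Gamma>_ext[OF d] in \<open>auto simp: extensional_def\<close>)
    with BW d have "?d \<in> U" by (auto simp: UW carrier_\<Gamma>)
    then show "U #>\<^bsub>\<Gamma>\<^esub> x = U #>\<^bsub>\<Gamma>\<^esub> y"
      using x y \<Gamma>.repr_independence[OF _ _ U, of y x] subgroup.rcos_module_rev[OF U \<Gamma>.is_group, of x y]
      by auto
  qed
  then show ?thesis by (simp add: RCOSETS_def UNION_singleton_eq_range)
qed

end

section \<open>Inverse limits of finite sets\<close>

lemma directed_lower_bound:
  assumes "finite J" "J \<subseteq> I" "I \<noteq> {}"
    and dir: "\<And>i j. i \<in> I \<Longrightarrow> j \<in> I \<Longrightarrow> \<exists>k\<in>I. r k i \<and> r k j"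
    and trans: "\<And>i j k. i \<in> I \<Longrightarrow> j \<in> I \<Longrightarrow> k \<in> I \<Longrightarrow> r i j \<Longrightarrow> r j k \<Longrightarrow> r i k"
  shows "\<exists>k\<in>I. \<forall>j\<in>J. r k j"
  using assms(1,2)
proof (induction J rule: finite_induct)
  case empty
  then show ?case using assms(3) by blast
next
  case (insert i J)
  then obtain k where k: "k \<in> I" "\<forall>j\<in>J. r k j" by blast
  moreover from insert have "i \<in> I" by simp
  ultimately obtain l where "l \<in> I" "r l k" "r l i" using dir by blast
  with k insert.prems \<open>i \<in> I\<close> show ?case
    by (intro bexI[of _ l]) (auto intro: trans)
qed

text \<open>Tychonoff for finite discrete spaces: each compatibility condition is closed, and
  finitely many of them hold simultaneously because of a common lower bound. Here
  \<open>r i j\<close> means that i is finer than j, and \<open>t i j\<close> maps from the finer to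
  the coarser index.\<close>

lemma inverse_limit_nonempty:
  assumes ne: "I \<noteq> {}" and S: "\<And>i. i \<in> I \<Longrightarrow> finite (S i)" "\<And>i. i \<in> I \<Longrightarrow> S i \<noteq> {}"
    and dir: "\<And>i j. i \<in> I \<Longrightarrow> j \<in> I \<Longrightarrow> \<exists>k\<in>I. r k i \<and> r k j"
    and trans: "\<And>i j k. i \<in> I \<Longrightarrow> j \<in> I \<Longrightarrow> k \<in> I \<Longrightarrow> r i j \<Longrightarrow> r j k \<Longrightarrow> r i k"
    and t: "\<And>i j s. i \<in> I \<Longrightarrow> j \<in> I \<Longrightarrow> r i j \<Longrightarrow> s \<in> S i \<Longrightarrow> t i j s \<in> S j"
    and t_comp: "\<And>i j k s. i \<in> I \<Longrightarrow> j \<in> I \<Longrightarrow> k \<in> I \<Longrightarrow> r i j \<Longrightarrow> r j k \<Longrightarrow> s \<in> S i \<Longrightarrow>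
      t j k (t i j s) = t i k s"
  shows "\<exists>x\<in>Pi\<^sub>E I S. \<forall>i\<in>I. \<forall>j\<in>I. r i j \<longrightarrow> t i j (x i) = x j"
proof -
  let ?P = "product_topology (\<lambda>i. discrete_topology (S i)) I"
  have top: "topspace ?P = Pi\<^sub>E I S" by simp
  have comp: "compact_space ?P"
    using S(1) by (simp add: compact_space_product_topology compact_space_discrete_topology)
  have proj: "closedin ?P {x \<in> Pi\<^sub>E I S. x i = s}" if "i \<in> I" for i s
  proof -
    have "continuous_map ?P (discrete_topology (S i)) (\<lambda>x. x i)"
      using continuous_map_product_projection[OF that] by metis
    from closedin_continuous_map_preimage[OF this, of "{s} \<inter> S i"]
    have "closedin ?P {x \<in> Pi\<^sub>E I S. x i \<in> {s} \<inter> S i}" by simp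
    moreover have "{x \<in> Pi\<^sub>E I S. x i \<in> {s} \<inter> S i} = {x \<in> Pi\<^sub>E I S. x i = s}"
      using that by auto
    ultimately show ?thesis by simp
  qed
  define C where "C = (\<lambda>(i, j). {x \<in> Pi\<^sub>E I S. t i j (x i) = x j})"
  define K where "K = {(i, j). i \<in> I \<and> j \<in> I \<and> r i j}"
  have closed: "closedin ?P (C p)" if "p \<in> K" for p
  proof -
    obtain i j where p: "p = (i, j)" "i \<in> I" "j \<in> I" using \<open>p \<in> K\<close> by (auto simp: K_def)
    \<comment> \<open>As S i is finite, the condition is a finite union of conditions on single
      coordinates.\<close>
    have "C p = (\<Union>s\<in>S i. {x \<in> Pi\<^sub>E I S. x i = s} \<inter> {x \<in> Pi\<^sub>E I S. x j = t i j s})"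
      using p by (auto simp: C_def)
    moreover have "closedin ?P (\<Union>s\<in>S i. {x \<in> Pi\<^sub>E I S. x i = s} \<inter> {x \<in> Pi\<^sub>E I S. x j = t i j s})"
      using S(1) p by (intro closedin_Union) (auto intro!: closedin_Int proj)
    ultimately show ?thesis by simp
  qed
  let ?\<U> = "insert (Pi\<^sub>E I S) (C ` K)"
  have "\<Inter>?\<U> \<noteq> {}"
  proof (rule compact_space_fip[THEN iffD1, OF comp, rule_format], intro conjI ballI allI impI)
    show "closedin ?P D" if "D \<in> ?\<U>" for D
      using that closed closedin_topspace[of ?P] by (auto simp: top)
    fix \<F> assume \<F>: "finite \<F> \<and> \<F> \<subseteq> ?\<U>"
    then have "finite (\<F> - {Pi\<^sub>E I S})" "\<F> - {Pi\<^sub>E I S} \<subseteq> C ` K" by auto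
    then obtain K' where K': "K' \<subseteq> K" "finite K'" "\<F> - {Pi\<^sub>E I S} = C ` K'"
      by (meson finite_subset_image)
    have "\<exists>k\<in>I. \<forall>j\<in>fst ` K' \<union> snd ` K'. r k j"
    proof (rule directed_lower_bound[OF _ _ ne dir trans])
      show "finite (fst ` K' \<union> snd ` K')" "fst ` K' \<union> snd ` K' \<subseteq> I"
        using K' by (auto simp: K_def)
    qed
    then obtain k where k: "k \<in> I" "\<forall>j\<in>fst ` K' \<union> snd ` K'. r k j"
      by (elim bexE)
    from S(2)[OF k(1)] obtain s where s: "s \<in> S k" by blast
    \<comment> \<open>One element s at the lower bound k determines all coordinates that matter; the
      others are arbitrary.\<close>
    define x where "x = (\<lambda>i\<in>I. if r k i then t k i s else SOME y. y \<in> S i)"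
    have x: "x \<in> Pi\<^sub>E I S"
      using t[OF k(1)] s S(2) by (auto simp: x_def some_in_eq)
    have "x \<in> C p" if p: "p \<in> K'" for p
    proof -
      obtain i j where ij: "p = (i, j)" by (cases p)
      then have "i \<in> I" "j \<in> I" "r i j" using p K' by (auto simp: K_def)
      moreover have "r k i" "r k j" using k(2) p ij by force+
      ultimately show ?thesis
        using x t_comp[OF k(1) _ _ _ _ s] by (simp add: C_def ij x_def)
    qed
    then have "x \<in> \<Inter>\<F>" using x K'(3) by blast
    then show "\<Inter>\<F> \<noteq> {}" by blast
  qed
  then obtain x where "x \<in> \<Inter>?\<U>" by (auto simp only: ex_in_conv[symmetric])
  then have x: "x \<in> Pi\<^sub>E I S" and xC: "\<forall>p\<in>K. x \<in> C p" by simp_all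
  have "t i j (x i) = x j" if "i \<in> I" "j \<in> I" "r i j" for i j
    using xC that by (auto simp: K_def C_def)
  with x show ?thesis by (intro bexI[of _ x]) simp_all
qed

section \<open>Profinite chains with trivial coefficients\<close>

lemma coset_proj:
  assumes "N \<lhd> G" "N' \<lhd> G" "N \<subseteq> N'" "x \<in> carrier G"
  shows "N' <#>\<^bsub>G\<^esub> (N #>\<^bsub>G\<^esub> x) = N' #>\<^bsub>G\<^esub> x"
proof -
  interpret N: normal N G by fact
  interpret N': normal N' G by fact
  have "N' <#>\<^bsub>G\<^esub> N = N'"
  proof
    show "N' <#>\<^bsub>G\<^esub> N \<subseteq> N'"
      using mono_set_mult[OF subset_refl assms(3), of G N'] N.subgroup_mult_id[OF N'.subgroup_axioms] by simp
    show "N' \<subseteq> N' <#>\<^bsub>G\<^esub> N"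
    proof
      fix n assume n: "n \<in> N'"
      have "n \<otimes>\<^bsub>G\<^esub> \<one>\<^bsub>G\<^esub> \<in> N' <#>\<^bsub>G\<^esub> N"
        unfolding set_mult_def using n N.one_closed by (intro UN_I[where a = n] UN_I[where a = "\<one>\<^bsub>G\<^esub>"]) simp_all
      then show "n \<in> N' <#>\<^bsub>G\<^esub> N" using subsetD[OF N'.subset n] by simp
    qed
  qed
  then show ?thesis
    using N.setmult_rcos_assoc[OF N'.subset N.subset assms(4)] by simp
qed

lemma coset_proj_hom:
  assumes "N \<lhd> G" "N' \<lhd> G" "N \<subseteq> N'"
  shows "(\<lambda>C. N' <#>\<^bsub>G\<^esub> C) \<in> hom (G Mod N) (G Mod N')"
proof (rule homI)
  interpret N: normal N G by fact
  interpret N': normal N' G by fact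
  fix C assume "C \<in> carrier (G Mod N)"
  then obtain x where x: "x \<in> carrier G" "C = N #>\<^bsub>G\<^esub> x" by (auto simp: carrier_FactGroup)
  show "N' <#>\<^bsub>G\<^esub> C \<in> carrier (G Mod N')"
    using x by (auto simp: coset_proj[OF assms] carrier_FactGroup)
  fix D assume "D \<in> carrier (G Mod N)"
  then obtain y where y: "y \<in> carrier G" "D = N #>\<^bsub>G\<^esub> y" by (auto simp: carrier_FactGroup)
  show "N' <#>\<^bsub>G\<^esub> (C \<otimes>\<^bsub>G Mod N\<^esub> D) = (N' <#>\<^bsub>G\<^esub> C) \<otimes>\<^bsub>G Mod N'\<^esub> (N' <#>\<^bsub>G\<^esub> D)"
    using x y by (simp add: N.rcos_sum N'.rcos_sum coset_proj[OF assms])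
qed

lemma finite_fin_chains:
  assumes "finite (carrier M)" "finite V"
  shows "finite (carrier (fin_chains M V))"
proof -
  have "finite {c. c ` V \<subseteq> carrier M \<and> (\<forall>x. x \<notin> V \<longrightarrow> c x = \<one>\<^bsub>M\<^esub>)}"
    using finite_set_of_finite_funs[OF assms(2,1), of "\<one>\<^bsub>M\<^esub>"]
    by (rule finite_subset[rotated]) auto
  then show ?thesis
    by (rule finite_subset[rotated]) (auto simp: fin_chains_def chain_support_def)
qed

lemma finite_tuples: "finite (carrier G) \<Longrightarrow> finite (tuples G n)"
  using finite_lists_length_eq[of "carrier G" n] by (simp add: tuples_def conj_commute)

text \<open>Triviality is demanded on the carriers only, since \<open>trivial_action\<close> is a
  restricted function.\<close>

locale trivial_coeffs = profinite G + M: comm_group M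
  for G :: "('a, 'b) monoid_scheme" (structure) and M :: "'m top_group" +
  fixes act :: "('a set \<Rightarrow> 'a set) \<Rightarrow> 'm \<Rightarrow> 'm"
  assumes act: "\<And>g m. g \<in> carrier (profinite_completion G) \<Longrightarrow> m \<in> carrier M \<Longrightarrow> act g m = m"
begin

abbreviation "L \<equiv> levels \<Gamma> M act"
abbreviation "C U N n \<equiv> fin_chains (M Mod N) (tuples (\<Gamma> Mod U) n)"

lemma levelD:
  assumes "(U, N) \<in> L"
  shows "U \<lhd> \<Gamma>" "openin (topol \<Gamma>) U" "subgroup N M" "N \<lhd> M" "openin (topol M) N"
    "group (\<Gamma> Mod U)" "comm_group (M Mod N)" "finite (carrier (\<Gamma> Mod U))"
proof -
  show U: "U \<lhd> \<Gamma>" "openin (topol \<Gamma>) U" and N: "subgroup N M" "openin (topol M) N"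
    using assms by (auto simp: levels_def)
  then show "N \<lhd> M" by (simp add: M.normal_iff_subgroup)
  show "group (\<Gamma> Mod U)" using U(1) by (rule normal.factorgroup_is_group)
  show "comm_group (M Mod N)" using N(1) by (rule M.abelian_FactGroup)
  show "finite (carrier (\<Gamma> Mod U))"
    using open_subgroup_finite_index[OF normal_imp_subgroup[OF U(1)] U(2)] by (simp add: FactGroup_def)
qed

text \<open>For a trivial action the two conditions on the action are automatic: N is stable, and
  each m lies in its own coset. So every pair of an open normal subgroup and an open subgroup is a
  level.\<close>

lemma levelI:
  assumes "U \<lhd> \<Gamma>" "openin (topol \<Gamma>) U" "subgroup N M" "openin (topol M) N"
  shows "(U, N) \<in> L"
  using assms act subgroup.subset[OF assms(3)] normal_imp_subgroup[OF assms(1)]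
    M.rcos_self[OF _ assms(3)]
  by (auto simp: levels_def dest: subgroup.mem_carrier subsetD)

text \<open>The quotient action unites the sets g S over g in a coset D; each of them is S, and D is
  nonempty.\<close>

lemma level_boundary:
  assumes l: "(U, N) \<in> L" and n: "n > 0" and c: "c \<in> carrier (C U N n)"
  shows "bar_boundary (\<Gamma> Mod U) (M Mod N) (quotient_action act) n c = bdry (\<Gamma> Mod U) (M Mod N) n c"
proof (rule bar_boundary_trivial[OF levelD(6,7)[OF l] _ n c])
  fix D S assume D: "D \<in> carrier (\<Gamma> Mod U)" and S: "S \<in> carrier (M Mod N)"
  obtain x where x: "x \<in> carrier \<Gamma>" "D = U #>\<^bsub>\<Gamma>\<^esub> x" using D by (auto simp: carrier_FactGroup)
  have U: "subgroup U \<Gamma>" using normal_imp_subgroup levelD(1)[OF l] by blast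
  have "D \<subseteq> carrier \<Gamma>" "x \<in> D"
    using x group.rcos_self[OF group_\<Gamma> x(1) U] monoid.r_coset_subset_G[OF group.is_monoid[OF group_\<Gamma>] subgroup.subset[OF U]] by auto
  moreover have "S \<subseteq> carrier M"
    using S subgroup.rcosets_carrier[OF levelD(3)[OF l] M.is_group] by (auto simp: FactGroup_def)
  ultimately have "act g ` S = S" if "g \<in> D" for g
    using that act by (auto simp: image_def subset_iff) 
  with \<open>x \<in> D\<close> show "quotient_action act D S = S"
    by (auto simp: quotient_action_def)
qed

abbreviation "pr U' N' N \<equiv> chain_push (M Mod N) (M Mod N') (map (\<lambda>D. U' <#>\<^bsub>\<Gamma>\<^esub> D)) (\<lambda>_ S. N' <#>\<^bsub>M\<^esub> S)"

lemma pr_hom: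
  assumes "(U, N) \<in> L" "(U', N') \<in> L" "U \<subseteq> U'" "N \<subseteq> N'"
  shows "pr U' N' N \<in> hom (C U N n) (C U' N' n)"
proof -
  note d = levelD[OF assms(1)] levelD[OF assms(2)]
  have "(\<lambda>D. U' <#>\<^bsub>\<Gamma>\<^esub> D) \<in> carrier (\<Gamma> Mod U) \<rightarrow> carrier (\<Gamma> Mod U')"
    using coset_proj_hom[OF d(1,9) assms(3)] by (auto simp: hom_def)
  then show ?thesis
    using d coset_proj_hom[OF d(4,12) assms(4)] by (intro tuple_push_hom)
qed

lemma pr_comp:
  assumes "(U, N) \<in> L" "(U', N') \<in> L" "(U'', N'') \<in> L" "U \<subseteq> U'" "N \<subseteq> N'" "U' \<subseteq> U''" "N' \<subseteq> N''"
    and c: "c \<in> carrier (C U N n)"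
  shows "pr U'' N'' N' (pr U' N' N c) = pr U'' N'' N c"
proof -
  note d = levelD[OF assms(1)] and d' = levelD[OF assms(2)] and d'' = levelD[OF assms(3)]
  have e: "N'' <#>\<^bsub>M\<^esub> (N' <#>\<^bsub>M\<^esub> S) = N'' <#>\<^bsub>M\<^esub> S" if "S \<in> carrier (M Mod N)" for S
    using that assms(5,7) d(4) d'(4) d''(4) by (auto simp: carrier_FactGroup coset_proj)
  have e': "U'' <#>\<^bsub>\<Gamma>\<^esub> (U' <#>\<^bsub>\<Gamma>\<^esub> S) = U'' <#>\<^bsub>\<Gamma>\<^esub> S" if "S \<in> carrier (\<Gamma> Mod U)" for S
    using that assms(4,6) d(1) d'(1) d''(1) by (auto simp: carrier_FactGroup coset_proj)
  have cl: "N'' <#>\<^bsub>M\<^esub> S \<in> carrier (M Mod N'')" if "S \<in> carrier (M Mod N)" for S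
    using hom_in_carrier[OF coset_proj_hom[OF d(4) d''(4)] that] assms(5,7) by blast
  have "pr U'' N'' N' (pr U' N' N c) = chain_push (M Mod N) (M Mod N'')
      (map (\<lambda>D. U'' <#>\<^bsub>\<Gamma>\<^esub> D) \<circ> map (\<lambda>D. U' <#>\<^bsub>\<Gamma>\<^esub> D)) (\<lambda>_ S. N'' <#>\<^bsub>M\<^esub> (N' <#>\<^bsub>M\<^esub> S)) c"
    by (rule chain_push_comp[OF d(7) d'(7) d''(7) coset_proj_hom[OF d(4) d'(4) assms(5)]
          coset_proj_hom[OF d'(4) d''(4) assms(7)] c])
  also have "\<dots> = pr U'' N'' N c"
  proof (rule chain_push_cong[OF d''(7) c])
    fix xs assume "xs \<in> tuples (\<Gamma> Mod U) n"
    then show "(map (\<lambda>D. U'' <#>\<^bsub>\<Gamma>\<^esub> D) \<circ> map (\<lambda>D. U' <#>\<^bsub>\<Gamma>\<^esub> D)) xs = map (\<lambda>D. U'' <#>\<^bsub>\<Gamma>\<^esub> D) xs"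
      using e' by (auto simp: tuples_def simp del: map_eq_conv intro!: map_cong)
  qed (use e cl in auto)
  finally show ?thesis .
qed

text \<open>Levels are directed, as the inverse limit argument requires.\<close>

lemma level_Int:
  assumes "(U, N) \<in> L" "(U', N') \<in> L"
  shows "(U \<inter> U', N \<inter> N') \<in> L"
  using levelD[OF assms(1)] levelD[OF assms(2)] group.normal_subgroup_intersect[OF group_\<Gamma>]
  by (intro levelI openin_Int subgroups_Inter_pair M.subgroups_Inter_pair)

lemma profinite_chains_carrier:
  "c \<in> carrier (profinite_chains \<Gamma> M act n) \<longleftrightarrow>
     c \<in> extensional L \<and> (\<forall>U N. (U, N) \<in> L \<longrightarrow> c (U, N) \<in> carrier (C U N n)) \<and>
     (\<forall>U N U' N'. (U, N) \<in> L \<and> (U', N') \<in> L \<and> U \<subseteq> U' \<and> N \<subseteq> N' \<longrightarrow> pr U' N' N (c (U, N)) = c (U', N'))"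
  unfolding profinite_chains_def bar_chains_eq PiE_def Pi_def by (auto simp: split_beta Ball_def)

lemma profinite_chains_level:
  "c \<in> carrier (profinite_chains \<Gamma> M act n) \<Longrightarrow> (U, N) \<in> L \<Longrightarrow> c (U, N) \<in> carrier (C U N n)"
  unfolding profinite_chains_carrier by blast

lemma profinite_chains_compat:
  "c \<in> carrier (profinite_chains \<Gamma> M act n) \<Longrightarrow> (U, N) \<in> L \<Longrightarrow> (U', N') \<in> L \<Longrightarrow> U \<subseteq> U' \<Longrightarrow> N \<subseteq> N' \<Longrightarrow>
   pr U' N' N (c (U, N)) = c (U', N')"
  unfolding profinite_chains_carrier by blast

lemma profinite_boundary_level:
  assumes "c \<in> carrier (profinite_chains \<Gamma> M act n)" "n > 0" "(U, N) \<in> L"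
  shows "profinite_boundary \<Gamma> M act n c (U, N) = bdry (\<Gamma> Mod U) (M Mod N) n (c (U, N))"
  using assms(3) level_boundary[OF assms(3,2) profinite_chains_level[OF assms(1,3)]]
  by (simp only: profinite_boundary_def restrict_apply' prod.case)

text \<open>At each level the 3-chains that bound b form a finite nonempty set, and the transition
  maps respect these sets. A point of their inverse limit is a profinite 3-chain with boundary
  b.\<close>

lemma levelwise_boundary:
  assumes fin: "finite (carrier M)" and L: "L \<noteq> {}"
    and b: "b \<in> carrier (profinite_chains \<Gamma> M act 2)"
    and lw: "\<And>U N. (U, N) \<in> L \<Longrightarrow> b (U, N) \<in> bdry (\<Gamma> Mod U) (M Mod N) 3 ` carrier (C U N 3)"
  shows "b \<in> boundaries (profinite_chains \<Gamma> M act) (profinite_boundary \<Gamma> M act) 2"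
proof -
  define S where "S = (\<lambda>(U, N). {c \<in> carrier (C U N 3). bdry (\<Gamma> Mod U) (M Mod N) 3 c = b (U, N)})"
  define r :: "('a set \<Rightarrow> 'a set) set \<times> 'm set \<Rightarrow> _ \<Rightarrow> bool" where
    "r = (\<lambda>(U, N) (U', N'). U \<subseteq> U' \<and> N \<subseteq> N')"
  define t where "t = (\<lambda>(U :: ('a set \<Rightarrow> 'a set) set, N) (U', N'). pr U' N' N)"
  have "\<exists>x\<in>Pi\<^sub>E L S. \<forall>i\<in>L. \<forall>j\<in>L. r i j \<longrightarrow> t i j (x i) = x j"
  proof (rule inverse_limit_nonempty[where S = S and r = r and t = t, OF L])
    fix i assume i: "i \<in> L"
    obtain U N where UN: "i = (U, N)" by (cases i)
    note d = levelD[OF i[unfolded UN]]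
    have "finite (carrier (M Mod N))" using fin by (simp add: carrier_FactGroup)
    then show "finite (S i)"
      unfolding S_def UN using finite_fin_chains[OF _ finite_tuples[OF d(8)], of "M Mod N" 3]
      by (simp add: finite_subset[OF Collect_restrict])
    show "S i \<noteq> {}" using lw[of U N] i by (auto simp: S_def UN)
    fix j assume j: "j \<in> L"
    obtain U' N' where UN': "j = (U', N')" by (cases j)
    show "\<exists>k\<in>L. r k i \<and> r k j"
      using level_Int i j by (intro bexI[of _ "(U \<inter> U', N \<inter> N')"]) (auto simp: UN UN' r_def)
    { fix s assume ij: "r i j" and s: "s \<in> S i"
      note d' = levelD[OF j[unfolded UN']]
      have sub: "U \<subseteq> U'" "N \<subseteq> N'" using ij by (auto simp: r_def UN UN')
      have sc: "s \<in> carrier (C U N 3)" and sb: "bdry (\<Gamma> Mod U) (M Mod N) 3 s = b (U, N)"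
        using s by (auto simp: S_def UN)
      \<comment> \<open>A filling at the finer level projects to a filling at the coarser one,
        because b itself is compatible.\<close>
      have "bdry (\<Gamma> Mod U') (M Mod N') 3 (pr U' N' N s) = pr U' N' N (b (U, N))"
        using bdry_push3[OF d(6,7) d'(6,7) coset_proj_hom[OF d(1) d'(1) sub(1)] coset_proj_hom[OF d(4) d'(4) sub(2)] sc]
        by (simp add: sb)
      also have "\<dots> = b (U', N')"
        using profinite_chains_compat[OF b i[unfolded UN] j[unfolded UN'] sub] .
      finally show "t i j s \<in> S j"
        using hom_in_carrier[OF pr_hom sc] i j sub by (simp add: UN UN' S_def t_def)
      fix k assume k: "k \<in> L" and jk: "r j k"
      obtain U'' N'' where UN'': "k = (U'', N'')" by (cases k)
      show "t j k (t i j s) = t i k s"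
        unfolding UN UN' UN'' t_def prod.case
        by (rule pr_comp[OF _ _ _ _ _ _ _ sc]) (use i j k ij jk in \<open>auto simp: UN UN' UN'' r_def\<close>) }
    show "r i k" if "k \<in> L" "r i j" "r j k" for k
      using that by (auto simp: r_def split: prod.splits)
  qed
  then obtain x where xS: "x \<in> Pi\<^sub>E L S" and xt: "\<And>i j. i \<in> L \<Longrightarrow> j \<in> L \<Longrightarrow> r i j \<Longrightarrow> t i j (x i) = x j"
    by blast
  have xc: "x (U, N) \<in> carrier (C U N 3)" "bdry (\<Gamma> Mod U) (M Mod N) 3 (x (U, N)) = b (U, N)"
    if "(U, N) \<in> L" for U N
    using PiE_mem[OF xS that] by (auto simp: S_def)
  have x: "x \<in> carrier (profinite_chains \<Gamma> M act 3)"
    unfolding profinite_chains_carrier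
    using xc xS xt[of "(_, _)" "(_, _)"] by (auto simp: PiE_def r_def t_def)
  have "profinite_boundary \<Gamma> M act 3 x = b"
  proof (rule extensionalityI[of _ L])
    show "b \<in> extensional L" using b by (simp add: profinite_chains_carrier)
    show "profinite_boundary \<Gamma> M act 3 x \<in> extensional L" by (simp add: profinite_boundary_def)
    show "profinite_boundary \<Gamma> M act 3 x l = b l" if "l \<in> L" for l
      using that xc profinite_boundary_level[OF x] by (cases l) simp
  qed
  with x show ?thesis
    unfolding boundaries_def by (auto simp: numeral_3_eq_3 numeral_2_eq_2)
qed

end

section \<open>Divisible elements of finitely generated abelian groups\<close>

lemma (in group) subgroup_Union_chain:
  assumes "\<C> \<noteq> {}" "\<And>B. B \<in> \<C> \<Longrightarrow> subgroup B G" "\<And>A B. A \<in> \<C> \<Longrightarrow> B \<in> \<C> \<Longrightarrow> A \<subseteq> B \<or> B \<subseteq> A"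
  shows "subgroup (\<Union>\<C>) G"
proof -
  show ?thesis
  proof (rule subgroupI)
    show "\<Union>\<C> \<subseteq> carrier G" using subgroup.subset[OF assms(2)] by blast
    obtain B where "B \<in> \<C>" using assms(1) by blast
    then have "\<one> \<in> \<Union>\<C>" using subgroup.one_closed[OF assms(2)] by blast
    then show "\<Union>\<C> \<noteq> {}" by blast
    fix a assume "a \<in> \<Union>\<C>"
    then obtain A where A: "A \<in> \<C>" "a \<in> A" by blast
    show "inv a \<in> \<Union>\<C>" using A(1) subgroup.m_inv_closed[OF assms(2)[OF A(1)] A(2)] by blast
    fix b assume "b \<in> \<Union>\<C>"
    then obtain B where B: "B \<in> \<C>" "b \<in> B" by blast
    then obtain D where D: "D \<in> \<C>" "a \<in> D" "b \<in> D" using A assms(3) by blast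
    show "a \<otimes> b \<in> \<Union>\<C>" using D(1) subgroup.m_closed[OF assms(2)[OF D(1)] D(2,3)] by blast
  qed
qed

text \<open>
  In the quotient by a subgroup maximal among those missing \<open>x\<close>, every nontrivial subgroup
  contains the image of \<open>x\<close>; hence that image has finite order and the quotient is torsion, so finite
  generation bounds its exponent.
\<close>

lemma (in comm_group) divisible_imp_one:
  assumes fg: "finitely_generated_group G" and x: "x \<in> carrier G"
    and div: "\<And>m::nat. m \<ge> 1 \<Longrightarrow> \<exists>y\<in>carrier G. x = y [^] m"
  shows "x = \<one>"
proof (rule ccontr)
  assume "x \<noteq> \<one>"
  let ?\<A> = "{B. subgroup B G \<and> x \<notin> B}"
  have "{\<one>} \<in> ?\<A>" using \<open>x \<noteq> \<one>\<close> triv_subgroup by simp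
  moreover have "\<Union>\<C> \<in> ?\<A>" if "\<C> \<noteq> {}" "subset.chain ?\<A> \<C>" for \<C>
    using that subgroup_Union_chain[OF that(1)]
    by (auto simp: subset.chain_def subset_chain_def)
  ultimately obtain B where B: "subgroup B G" "x \<notin> B"
    and max: "\<And>K. subgroup K G \<Longrightarrow> x \<notin> K \<Longrightarrow> B \<subseteq> K \<Longrightarrow> K = B"
    using subset_Zorn_nonempty[of ?\<A>] by (metis (mono_tags, lifting) empty_iff mem_Collect_eq)
  interpret B: subgroup B G by fact
  \<comment> \<open>By maximality, the subgroup generated by B and an element g outside B contains
    x.\<close>
  have ex: "\<exists>b\<in>B. \<exists>k::int. x = b \<otimes> g [^] k" if g: "g \<in> carrier G" "g \<notin> B" for g
  proof -
    let ?K = "{b \<otimes> g [^] (k::int) | b k. b \<in> B}"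
    have "subgroup ?K G"
    proof (rule subgroupI)
      show "?K \<subseteq> carrier G" using g by auto
      show "?K \<noteq> {}" using B.one_closed by blast
      fix a assume "a \<in> ?K"
      then obtain b k where a: "a = b \<otimes> g [^] (k::int)" "b \<in> B" by blast
      have "inv a = inv b \<otimes> g [^] (- k)" using a g by (simp add: inv_mult int_pow_neg)
      then show "inv a \<in> ?K" using a by blast
      fix a' assume "a' \<in> ?K"
      then obtain b' k' where a': "a' = b' \<otimes> g [^] (k'::int)" "b' \<in> B" by blast
      have "a \<otimes> a' = (b \<otimes> b') \<otimes> g [^] (k + k')" using a a' g by (simp add: int_pow_mult m_ac)
      then show "a \<otimes> a' \<in> ?K" using a a' by blast
    qed
    moreover have "B \<subseteq> ?K"
    proof
      fix b assume "b \<in> B"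
      moreover from this have "b = b \<otimes> g [^] (0::int)" by simp
      ultimately show "b \<in> ?K" by blast
    qed
    moreover have "g \<in> ?K"
    proof -
      have "g = \<one> \<otimes> g [^] (1::int)" using g by simp
      then show ?thesis using B.one_closed by blast
    qed
    ultimately have "x \<in> ?K" using max g(2) by blast
    then show ?thesis by blast
  qed
  have pow_B: "b [^] (k::int) \<in> B" if "b \<in> B" for b k
    using that B by (simp add: subgroup_int_pow_closed)
  \<comment> \<open>If the square of x is outside B, then x = b x^(2k) for some b in B, so x^(1 -
    2k) lies in B; the exponent is odd, hence nonzero.\<close>
  obtain e :: int where e: "e \<noteq> 0" "x [^] e \<in> B"
  proof (cases "x [^] (2::int) \<in> B")
    case False
    then obtain b k where b: "b \<in> B" "x = b \<otimes> (x [^] (2::int)) [^] (k::int)"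
      using ex[of "x [^] (2::int)"] x by auto
    then have "x = b \<otimes> x [^] (2 * k)" using x by (simp add: int_pow_pow)
    then have "x \<otimes> x [^] (- (2 * k)) = b \<otimes> x [^] (2 * k) \<otimes> x [^] (- (2 * k))" by simp
    also have "\<dots> = b" using b(1) x by (simp add: m_assoc flip: int_pow_mult)
    also have "x \<otimes> x [^] (- (2 * k)) = x [^] (1 - 2 * k)"
      using x int_pow_mult[OF x, of 1 "- (2 * k)"] by simp
    finally have "x [^] (1 - 2 * k) \<in> B" using b(1) by simp
    moreover have "1 - 2 * k \<noteq> 0" by presburger
    ultimately show ?thesis using that by blast
  next
    case True
    then show ?thesis using that[of 2] by simp
  qed
  \<comment> \<open>For s outside B one has x = b s^k, where k is nonzero because x is not in B. The
    e-th power of this equation puts s^(ke) into B.\<close>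
  have tors: "\<exists>n::nat. n \<ge> 1 \<and> s [^] n \<in> B" if s: "s \<in> carrier G" for s
  proof (cases "s \<in> B")
    case True
    then show ?thesis using s by (intro exI[of _ 1]) simp
  next
    case False
    then obtain b k where b: "b \<in> B" "x = b \<otimes> s [^] (k::int)" using ex s by blast
    have "k \<noteq> 0" using b B(2) by auto
    have "x [^] e = b [^] e \<otimes> s [^] (k * e)"
      using b s by (simp add: int_pow_distrib int_pow_pow)
    then have "s [^] (k * e) = inv (b [^] e) \<otimes> x [^] e"
      using b(1) s by (simp flip: m_assoc)
    then have *: "s [^] (k * e) \<in> B" using pow_B[OF b(1)] e(2) by simp
    have "s [^] (nat \<bar>k * e\<bar>) \<in> B"
    proof (cases "k * e \<ge> 0")
      case True
      then show ?thesis using * by (simp flip: int_pow_int)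
    next
      case False
      then have "s [^] (nat \<bar>k * e\<bar>) = inv (s [^] (k * e))"
        using s by (simp flip: int_pow_int int_pow_neg)
      then show ?thesis using * by simp
    qed
    moreover have "nat \<bar>k * e\<bar> \<ge> 1" using \<open>k \<noteq> 0\<close> e(1) by (simp add: Suc_le_eq)
    ultimately show ?thesis by blast
  qed
  obtain S where S: "finite S" "S \<subseteq> carrier G" "generate G S = carrier G"
    using fg by (auto simp: finitely_generated_group_def)
  have "\<forall>s\<in>S. \<exists>n::nat. n \<ge> 1 \<and> s [^] n \<in> B" using tors S(2) by blast
  then obtain n :: "'a \<Rightarrow> nat" where n: "\<forall>s\<in>S. n s \<ge> 1 \<and> s [^] n s \<in> B" by metis
  \<comment> \<open>A common exponent of the generators modulo B, hence of the whole group: all m-th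
    powers lie in B, while x, which is one of them, does not.\<close>
  define m where "m = prod n S"
  have "m \<ge> 1" using n by (auto simp: m_def Suc_le_eq prod_pos)
  have "subgroup {y \<in> carrier G. y [^] m \<in> B} G"
    by (rule subgroupI) (auto simp: nat_pow_distrib nat_pow_inv)
  moreover have "S \<subseteq> {y \<in> carrier G. y [^] m \<in> B}"
  proof
    fix s assume s: "s \<in> S"
    then have "n s dvd m" using S(1) by (simp add: m_def dvd_prodI)
    then obtain k where "m = n s * k" by blast
    then have "s [^] m = (s [^] n s) [^] (int k)" using s S(2) by (simp add: nat_pow_pow int_pow_int subset_iff)
    then show "s \<in> {y \<in> carrier G. y [^] m \<in> B}" using n s S(2) pow_B by auto
  qed
  ultimately have "carrier G \<subseteq> {y \<in> carrier G. y [^] m \<in> B}"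
    using generate_subgroup_incl[of S "{y \<in> carrier G. y [^] m \<in> B}"] S(3) by simp
  then show False using div[OF \<open>m \<ge> 1\<close>] B(2) by blast
qed

section \<open>Second homology\<close>

text \<open>Degree 2 for the boundary without an action; \<open>homology2_eq\<close> identifies the
  quotient with the homology for every action that is trivial on the carriers.\<close>

definition cycles2 :: "('g, 'x) monoid_scheme \<Rightarrow> ('m, 'y) monoid_scheme \<Rightarrow> ('g list \<Rightarrow> 'm) set" where
  "cycles2 G A = {z \<in> carrier (fin_chains A (tuples G 2)). bdry G A 2 z = (\<lambda>_. \<one>\<^bsub>A\<^esub>)}"

definition boundaries2 :: "('g, 'x) monoid_scheme \<Rightarrow> ('m, 'y) monoid_scheme \<Rightarrow> ('g list \<Rightarrow> 'm) set" where
  "boundaries2 G A = bdry G A 3 ` carrier (fin_chains A (tuples G 3))"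

lemma homology2_eq:
  assumes G: "group G" and A: "comm_group A"
    and act: "\<And>g m. g \<in> carrier G \<Longrightarrow> m \<in> carrier A \<Longrightarrow> act g m = m"
  shows "group_homology G A act 2 = (fin_chains A (tuples G 2))\<lparr>carrier := cycles2 G A\<rparr> Mod boundaries2 G A"
proof -
  have "cycles (bar_chains G A) (bar_boundary G A act) 2 = cycles2 G A"
    using bar_boundary_trivial[OF G A act, where n = 2]
    by (auto simp: cycles_def cycles2_def bar_chains_eq)
  moreover have "boundaries (bar_chains G A) (bar_boundary G A act) 2 = boundaries2 G A"
    using bar_boundary_trivial[OF G A act, where n = 3]
    by (auto simp: boundaries_def boundaries2_def bar_chains_eq numeral_3_eq_3 numeral_2_eq_2 image_def)
  ultimately show ?thesis
    by (simp add: group_homology_def complex_homology_def bar_chains_eq)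
qed

lemma homology2_carrier:
  assumes "group G" "comm_group A"
    and "\<And>g m. g \<in> carrier G \<Longrightarrow> m \<in> carrier A \<Longrightarrow> act g m = m"
  shows "carrier (group_homology G A act 2) =
    (\<lambda>z. boundaries2 G A #>\<^bsub>fin_chains A (tuples G 2)\<^esub> z) ` cycles2 G A"
  by (simp add: homology2_eq[OF assms] carrier_FactGroup r_coset_def)

lemma boundaries2_subgroup:
  assumes G: "group G" and A: "comm_group A"
  shows "subgroup (boundaries2 G A) (fin_chains A (tuples G 2))"
proof -
  interpret group_hom "fin_chains A (tuples G 3)" "fin_chains A (tuples G 2)" "bdry G A 3"
    by (intro group_homI bdry_hom3 group_fin_chains assms)
  show ?thesis unfolding boundaries2_def by (rule img_is_subgroup)
qed

lemma cycles2_subgroup: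
  assumes G: "group G" and A: "comm_group A"
  shows "subgroup (cycles2 G A) (fin_chains A (tuples G 2))"
proof -
  interpret group_hom "fin_chains A (tuples G 2)" "fin_chains A (tuples G 1)" "bdry G A 2"
    by (intro group_homI bdry_hom2 group_fin_chains assms)
  have "cycles2 G A = kernel (fin_chains A (tuples G 2)) (fin_chains A (tuples G 1)) (bdry G A 2)"
    by (simp add: cycles2_def kernel_def)
  then show ?thesis using subgroup_kernel by simp
qed

lemma boundaries2_subset: "group G \<Longrightarrow> comm_group A \<Longrightarrow> boundaries2 G A \<subseteq> cycles2 G A"
  using bdry_bdry[of G A] hom_in_carrier[OF bdry_hom3[of G A]]
  by (auto simp: boundaries2_def cycles2_def)

lemma homology2_comm_group:
  assumes "group G" "comm_group A"
    and "\<And>g m. g \<in> carrier G \<Longrightarrow> m \<in> carrier A \<Longrightarrow> act g m = m"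
  shows "comm_group (group_homology G A act 2)"
proof -
  interpret C: comm_group "fin_chains A (tuples G 2)" by (rule comm_group_fin_chains) fact
  let ?Z = "(fin_chains A (tuples G 2))\<lparr>carrier := cycles2 G A\<rparr>"
  have "group ?Z" by (rule C.subgroup_imp_group[OF cycles2_subgroup[OF assms(1,2)]])
  then have Z: "comm_group ?Z"
    using subgroup.subset[OF cycles2_subgroup[OF assms(1,2)]] C.m_comm
    by (intro group.group_comm_groupI) (auto simp del: fin_chains_mult)
  have "subgroup (boundaries2 G A) ?Z"
    by (rule C.subgroup_incl[OF boundaries2_subgroup cycles2_subgroup boundaries2_subset]; fact)
  then show ?thesis
    by (simp only: homology2_eq[OF assms] comm_group.abelian_FactGroup[OF Z])
qed

text \<open>The values of f on B are absorbed by B'. This computes \<open>homology_map\<close>,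
  which is defined by a product of sets, on the class of z.\<close>

lemma hom_image_coset:
  assumes H: "group H" and K: "group K" and f: "f \<in> hom H K"
    and B: "subgroup B H" and B': "subgroup B' K" and sub: "f ` B \<subseteq> B'" and z: "z \<in> carrier H"
  shows "B' <#>\<^bsub>K\<^esub> (f ` (B #>\<^bsub>H\<^esub> z)) = B' #>\<^bsub>K\<^esub> f z"
proof -
  interpret H: group H by fact
  interpret K: group K by fact
  have fz: "f z \<in> carrier K" using f z by (rule hom_in_carrier)
  have eq: "b' \<otimes>\<^bsub>K\<^esub> f (b \<otimes>\<^bsub>H\<^esub> z) = (b' \<otimes>\<^bsub>K\<^esub> f b) \<otimes>\<^bsub>K\<^esub> f z" if "b' \<in> B'" "b \<in> B" for b b'
  proof -
    have "b \<in> carrier H" "b' \<in> carrier K" "f b \<in> carrier K"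
      using that subgroup.subset[OF B] subgroup.subset[OF B'] sub by blast+
    then show ?thesis using fz z by (simp add: hom_mult[OF f] K.m_assoc)
  qed
  show ?thesis
  proof
    show "B' <#>\<^bsub>K\<^esub> (f ` (B #>\<^bsub>H\<^esub> z)) \<subseteq> B' #>\<^bsub>K\<^esub> f z"
    proof
      fix x assume "x \<in> B' <#>\<^bsub>K\<^esub> (f ` (B #>\<^bsub>H\<^esub> z))"
      then obtain b b' where b: "b' \<in> B'" "b \<in> B" "x = b' \<otimes>\<^bsub>K\<^esub> f (b \<otimes>\<^bsub>H\<^esub> z)"
        by (auto simp: set_mult_def r_coset_def)
      then have "x = (b' \<otimes>\<^bsub>K\<^esub> f b) \<otimes>\<^bsub>K\<^esub> f z" by (simp add: eq)
      moreover have "b' \<otimes>\<^bsub>K\<^esub> f b \<in> B'" 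
        using subgroup.m_closed[OF B' b(1), of "f b"] sub b(2) by auto
      ultimately show "x \<in> B' #>\<^bsub>K\<^esub> f z" by (auto simp: r_coset_def)
    qed
    show "B' #>\<^bsub>K\<^esub> f z \<subseteq> B' <#>\<^bsub>K\<^esub> (f ` (B #>\<^bsub>H\<^esub> z))"
    proof
      fix x assume "x \<in> B' #>\<^bsub>K\<^esub> f z"
      then obtain b' where b: "b' \<in> B'" "x = b' \<otimes>\<^bsub>K\<^esub> f z" by (auto simp: r_coset_def)
      moreover have "z \<in> B #>\<^bsub>H\<^esub> z" by (rule H.rcos_self[OF z B])
      ultimately show "x \<in> B' <#>\<^bsub>K\<^esub> (f ` (B #>\<^bsub>H\<^esub> z))" by (auto simp: set_mult_def)
    qed
  qed
qed

section \<open>The abelian groups of profinite chains and their boundary in degree 3\<close>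

context trivial_coeffs begin

abbreviation "PC n \<equiv> profinite_chains \<Gamma> M act n"
abbreviation "PB \<equiv> boundaries (profinite_chains \<Gamma> M act) (profinite_boundary \<Gamma> M act) 2"

lemma PC_closedI:
  assumes "c \<in> extensional L" "\<And>U N. (U, N) \<in> L \<Longrightarrow> c (U, N) \<in> carrier (C U N n)"
    "\<And>U N U' N'. (U, N) \<in> L \<Longrightarrow> (U', N') \<in> L \<Longrightarrow> U \<subseteq> U' \<Longrightarrow> N \<subseteq> N' \<Longrightarrow>
      pr U' N' N (c (U, N)) = c (U', N')"
  shows "c \<in> carrier (PC n)"
  unfolding profinite_chains_carrier using assms by (intro conjI allI impI) (elim conjE | assumption)+

lemma PC_mult: "(U, N) \<in> L \<Longrightarrow> (c \<otimes>\<^bsub>PC n\<^esub> c') (U, N) = c (U, N) \<otimes>\<^bsub>C U N n\<^esub> c' (U, N)"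
  by (simp add: profinite_chains_def bar_chains_eq)

lemma PC_one: "(U, N) \<in> L \<Longrightarrow> \<one>\<^bsub>PC n\<^esub> (U, N) = \<one>\<^bsub>C U N n\<^esub>"
  by (simp add: profinite_chains_def bar_chains_eq)

lemma PC_mult_ext: "c \<otimes>\<^bsub>PC n\<^esub> c' \<in> extensional L"
  by (simp add: profinite_chains_def)

lemma PC_one_ext: "\<one>\<^bsub>PC n\<^esub> \<in> extensional L"
  by (simp add: profinite_chains_def)

lemma PC_ext: "c \<in> carrier (PC n) \<Longrightarrow> c \<in> extensional L"
  by (simp add: profinite_chains_carrier)

lemma PC_eqI:
  assumes "c \<in> extensional L" "c' \<in> extensional L" "\<And>U N. (U, N) \<in> L \<Longrightarrow> c (U, N) = c' (U, N)"
  shows "c = c'"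
proof (rule extensionalityI[OF assms(1,2)])
  fix l assume "l \<in> L"
  then show "c l = c' l" using assms(3)[of "fst l" "snd l"] by simp
qed

lemma level_comm_group: "(U, N) \<in> L \<Longrightarrow> comm_group (C U N n)"
  by (rule comm_group_fin_chains[OF levelD(7)])

lemma pr_group_hom:
  assumes "(U, N) \<in> L" "(U', N') \<in> L" "U \<subseteq> U'" "N \<subseteq> N'"
  shows "group_hom (C U N n) (C U' N' n) (pr U' N' N)"
  by (intro group_homI pr_hom assms group_fin_chains levelD(7)[OF assms(1)] levelD(7)[OF assms(2)])

lemma comm_group_PC: "comm_group (PC n)"
proof (rule comm_groupI)
  note grp = comm_group.axioms(2)[OF level_comm_group]
  show "c \<otimes>\<^bsub>PC n\<^esub> c' \<in> carrier (PC n)" if c: "c \<in> carrier (PC n)" and c': "c' \<in> carrier (PC n)" for c c'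
  proof (rule PC_closedI[OF PC_mult_ext])
    fix U N assume l: "(U, N) \<in> L"
    interpret C: comm_group "C U N n" by (rule level_comm_group[OF l])
    note cl = profinite_chains_level[OF c l] profinite_chains_level[OF c' l]
    show "(c \<otimes>\<^bsub>PC n\<^esub> c') (U, N) \<in> carrier (C U N n)"
      unfolding PC_mult[OF l] by (rule C.m_closed[OF cl])
    fix U' N' assume l': "(U', N') \<in> L" and sub: "U \<subseteq> U'" "N \<subseteq> N'"
    show "pr U' N' N ((c \<otimes>\<^bsub>PC n\<^esub> c') (U, N)) = (c \<otimes>\<^bsub>PC n\<^esub> c') (U', N')"
      unfolding PC_mult[OF l] PC_mult[OF l'] hom_mult[OF pr_hom[OF l l' sub] cl]
        profinite_chains_compat[OF c l l' sub] profinite_chains_compat[OF c' l l' sub] ..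
  qed
  show "\<one>\<^bsub>PC n\<^esub> \<in> carrier (PC n)"
  proof (rule PC_closedI[OF PC_one_ext])
    fix U N assume l: "(U, N) \<in> L"
    interpret C: comm_group "C U N n" by (rule level_comm_group[OF l])
    show "\<one>\<^bsub>PC n\<^esub> (U, N) \<in> carrier (C U N n)"
      unfolding PC_one[OF l] by (rule C.one_closed)
    fix U' N' assume l': "(U', N') \<in> L" and sub: "U \<subseteq> U'" "N \<subseteq> N'"
    show "pr U' N' N (\<one>\<^bsub>PC n\<^esub> (U, N)) = \<one>\<^bsub>PC n\<^esub> (U', N')"
      unfolding PC_one[OF l] PC_one[OF l'] by (rule group_hom.hom_one[OF pr_group_hom[OF l l' sub]])
  qed
  fix c assume c: "c \<in> carrier (PC n)"
  show "\<one>\<^bsub>PC n\<^esub> \<otimes>\<^bsub>PC n\<^esub> c = c"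
  proof (rule PC_eqI[OF PC_mult_ext PC_ext[OF c]])
    fix U N assume l: "(U, N) \<in> L"
    interpret C: comm_group "C U N n" by (rule level_comm_group[OF l])
    show "(\<one>\<^bsub>PC n\<^esub> \<otimes>\<^bsub>PC n\<^esub> c) (U, N) = c (U, N)"
      unfolding PC_mult[OF l] PC_one[OF l] by (rule C.l_one[OF profinite_chains_level[OF c l]])
  qed
  show "\<exists>c'\<in>carrier (PC n). c' \<otimes>\<^bsub>PC n\<^esub> c = \<one>\<^bsub>PC n\<^esub>"
  proof (intro bexI)
    let ?i = "\<lambda>(U, N)\<in>L. inv\<^bsub>C U N n\<^esub> (c (U, N))"
    have i: "?i (U, N) = inv\<^bsub>C U N n\<^esub> (c (U, N))" if "(U, N) \<in> L" for U N using that by simp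
    show "?i \<in> carrier (PC n)"
    proof (rule PC_closedI)
      fix U N assume l: "(U, N) \<in> L"
      interpret C: comm_group "C U N n" by (rule level_comm_group[OF l])
      show "?i (U, N) \<in> carrier (C U N n)"
        unfolding i[OF l] by (rule C.inv_closed[OF profinite_chains_level[OF c l]])
      fix U' N' assume l': "(U', N') \<in> L" and sub: "U \<subseteq> U'" "N \<subseteq> N'"
      show "pr U' N' N (?i (U, N)) = ?i (U', N')"
        unfolding i[OF l] i[OF l'] group_hom.hom_inv[OF pr_group_hom[OF l l' sub] profinite_chains_level[OF c l]]
          profinite_chains_compat[OF c l l' sub] ..
    qed auto
    show "?i \<otimes>\<^bsub>PC n\<^esub> c = \<one>\<^bsub>PC n\<^esub>"
    proof (rule PC_eqI[OF PC_mult_ext PC_one_ext])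
      fix U N assume l: "(U, N) \<in> L"
      interpret C: comm_group "C U N n" by (rule level_comm_group[OF l])
      show "(?i \<otimes>\<^bsub>PC n\<^esub> c) (U, N) = \<one>\<^bsub>PC n\<^esub> (U, N)"
        unfolding PC_mult[OF l] PC_one[OF l] i[OF l] by (rule C.l_inv[OF profinite_chains_level[OF c l]])
    qed
  qed
  fix c' assume c': "c' \<in> carrier (PC n)"
  show "c \<otimes>\<^bsub>PC n\<^esub> c' = c' \<otimes>\<^bsub>PC n\<^esub> c"
  proof (rule PC_eqI[OF PC_mult_ext PC_mult_ext])
    fix U N assume l: "(U, N) \<in> L"
    interpret C: comm_group "C U N n" by (rule level_comm_group[OF l])
    show "(c \<otimes>\<^bsub>PC n\<^esub> c') (U, N) = (c' \<otimes>\<^bsub>PC n\<^esub> c) (U, N)"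
      unfolding PC_mult[OF l] by (rule C.m_comm[OF profinite_chains_level[OF c l] profinite_chains_level[OF c' l]])
  qed
  fix c'' assume c'': "c'' \<in> carrier (PC n)"
  show "c \<otimes>\<^bsub>PC n\<^esub> c' \<otimes>\<^bsub>PC n\<^esub> c'' = c \<otimes>\<^bsub>PC n\<^esub> (c' \<otimes>\<^bsub>PC n\<^esub> c'')"
  proof (rule PC_eqI[OF PC_mult_ext PC_mult_ext])
    fix U N assume l: "(U, N) \<in> L"
    interpret C: comm_group "C U N n" by (rule level_comm_group[OF l])
    show "(c \<otimes>\<^bsub>PC n\<^esub> c' \<otimes>\<^bsub>PC n\<^esub> c'') (U, N) = (c \<otimes>\<^bsub>PC n\<^esub> (c' \<otimes>\<^bsub>PC n\<^esub> c'')) (U, N)"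
      unfolding PC_mult[OF l]
      by (rule C.m_assoc[OF profinite_chains_level[OF c l] profinite_chains_level[OF c' l] profinite_chains_level[OF c'' l]])
  qed
qed

lemma profinite_boundary_hom: "profinite_boundary \<Gamma> M act 3 \<in> hom (PC 3) (PC 2)"
proof (rule homI)
  have ext: "profinite_boundary \<Gamma> M act 3 c \<in> extensional L" for c
    by (simp add: profinite_boundary_def)
  note lev = profinite_boundary_level[of _ 3, OF _ zero_less_numeral]
  fix c assume c: "c \<in> carrier (PC 3)"
  show "profinite_boundary \<Gamma> M act 3 c \<in> carrier (PC 2)"
  proof (rule PC_closedI[OF ext])
    fix U N assume l: "(U, N) \<in> L"
    show "profinite_boundary \<Gamma> M act 3 c (U, N) \<in> carrier (C U N 2)"
      unfolding lev[OF c l] by (rule hom_in_carrier[OF bdry_hom3[OF levelD(6,7)[OF l]] profinite_chains_level[OF c l]])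
    fix U' N' assume l': "(U', N') \<in> L" and sub: "U \<subseteq> U'" "N \<subseteq> N'"
    show "pr U' N' N (profinite_boundary \<Gamma> M act 3 c (U, N)) = profinite_boundary \<Gamma> M act 3 c (U', N')"
      unfolding lev[OF c l] lev[OF c l'] profinite_chains_compat[OF c l l' sub, symmetric]
      by (rule bdry_push3[symmetric, OF levelD(6,7)[OF l] levelD(6,7)[OF l'] coset_proj_hom[OF levelD(1)[OF l] levelD(1)[OF l'] sub(1)]
          coset_proj_hom[OF levelD(4)[OF l] levelD(4)[OF l'] sub(2)] profinite_chains_level[OF c l]])
  qed
  fix c' assume c': "c' \<in> carrier (PC 3)"
  have cc': "c \<otimes>\<^bsub>PC 3\<^esub> c' \<in> carrier (PC 3)"
    using comm_group_PC[of 3] c c' by (simp add: comm_group_def comm_monoid_def monoid.m_closed)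
  show "profinite_boundary \<Gamma> M act 3 (c \<otimes>\<^bsub>PC 3\<^esub> c') =
      profinite_boundary \<Gamma> M act 3 c \<otimes>\<^bsub>PC 2\<^esub> profinite_boundary \<Gamma> M act 3 c'"
  proof (rule PC_eqI[OF ext PC_mult_ext])
    fix U N assume l: "(U, N) \<in> L"
    show "profinite_boundary \<Gamma> M act 3 (c \<otimes>\<^bsub>PC 3\<^esub> c') (U, N) =
      (profinite_boundary \<Gamma> M act 3 c \<otimes>\<^bsub>PC 2\<^esub> profinite_boundary \<Gamma> M act 3 c') (U, N)"
      unfolding PC_mult[OF l] lev[OF cc' l] lev[OF c l] lev[OF c' l]
      by (rule hom_mult[OF bdry_hom3[OF levelD(6,7)[OF l]] profinite_chains_level[OF c l] profinite_chains_level[OF c' l]])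
  qed
qed

lemma PB_eq: "PB = profinite_boundary \<Gamma> M act 3 ` carrier (PC 3)"
  by (simp add: boundaries_def numeral_3_eq_3 numeral_2_eq_2)

lemma PB_subgroup: "subgroup PB (PC 2)"
  unfolding PB_eq
  by (intro group_hom.img_is_subgroup group_homI profinite_boundary_hom comm_group.axioms(2)[OF comm_group_PC])

end

text \<open>Two kinds of instances occur: the identity of Z/m, which is the map of the hypothesis on
  G, and the canonical map from the integers to Zhat, which is the map of the conclusion.\<close>

locale comparison = trivial_coeffs +
  fixes A :: "('l, 'z) monoid_scheme" and \<theta> :: "'l \<Rightarrow> 'c" and actA
  assumes A: "comm_group A" and \<theta>: "\<theta> \<in> hom A M"
    and actA: "\<And>g m. g \<in> carrier G \<Longrightarrow> m \<in> carrier A \<Longrightarrow> actA g m = m"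
begin

abbreviation "\<eta> \<equiv> completion_map G"
abbreviation "cmp \<equiv> comparison_chain_map A \<Gamma> M act \<eta> \<theta>"
abbreviation "pu U N \<equiv> chain_push A (M Mod N) (map (\<lambda>g. U #>\<^bsub>\<Gamma>\<^esub> \<eta> g)) (\<lambda>_ a. N #>\<^bsub>M\<^esub> \<theta> a)"

lemma cmp_level: "(U, N) \<in> L \<Longrightarrow> cmp c (U, N) = pu U N c"
  by (simp add: comparison_chain_map_def)

lemma cmp_ext: "cmp c \<in> extensional L"
  by (simp add: comparison_chain_map_def)

lemma proj_hom: "(U, N) \<in> L \<Longrightarrow> (\<lambda>g. U #>\<^bsub>\<Gamma>\<^esub> \<eta> g) \<in> hom G (\<Gamma> Mod U)"
  by (rule hom_comp[OF completion_map_hom normal.r_coset_hom_Mod[OF levelD(1)]])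

lemma coeff_hom: "(U, N) \<in> L \<Longrightarrow> (\<lambda>a. N #>\<^bsub>M\<^esub> \<theta> a) \<in> hom A (M Mod N)"
  by (rule hom_comp[OF \<theta> normal.r_coset_hom_Mod[OF levelD(4)]])

lemma proj_funcset: "(U, N) \<in> L \<Longrightarrow> (\<lambda>g. U #>\<^bsub>\<Gamma>\<^esub> \<eta> g) \<in> carrier G \<rightarrow> carrier (\<Gamma> Mod U)"
  using proj_hom by (auto simp: hom_def)

lemma pu_hom: "(U, N) \<in> L \<Longrightarrow> pu U N \<in> hom (fin_chains A (tuples G n)) (C U N n)"
  by (rule tuple_push_hom[OF A levelD(7) coeff_hom proj_funcset])

lemma pu_pr:
  assumes l: "(U, N) \<in> L" and l': "(U', N') \<in> L" and sub: "U \<subseteq> U'" "N \<subseteq> N'"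
    and c: "c \<in> carrier (fin_chains A (tuples G n))"
  shows "pr U' N' N (pu U N c) = pu U' N' c"
proof -
  note d = levelD[OF l] and d' = levelD[OF l']
  have e: "N' <#>\<^bsub>M\<^esub> (N #>\<^bsub>M\<^esub> \<theta> a) = N' #>\<^bsub>M\<^esub> \<theta> a" if "a \<in> carrier A" for a
    by (rule coset_proj[OF d(4) d'(4) sub(2) hom_in_carrier[OF \<theta> that]])
  have e': "U' <#>\<^bsub>\<Gamma>\<^esub> (U #>\<^bsub>\<Gamma>\<^esub> \<eta> g) = U' #>\<^bsub>\<Gamma>\<^esub> \<eta> g" if "g \<in> carrier G" for g
    by (rule coset_proj[OF d(1) d'(1) sub(1) hom_in_carrier[OF completion_map_hom that]])
  have "pr U' N' N (pu U N c) = chain_push A (M Mod N')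
      (map (\<lambda>D. U' <#>\<^bsub>\<Gamma>\<^esub> D) \<circ> map (\<lambda>g. U #>\<^bsub>\<Gamma>\<^esub> \<eta> g)) (\<lambda>_ a. N' <#>\<^bsub>M\<^esub> (N #>\<^bsub>M\<^esub> \<theta> a)) c"
    by (rule chain_push_comp[OF A d(7) d'(7) coeff_hom[OF l] coset_proj_hom[OF d(4) d'(4) sub(2)] c])
  also have "\<dots> = pu U' N' c"
  proof (rule chain_push_cong[OF d'(7) c])
    fix xs assume "xs \<in> tuples G n"
    then show "(map (\<lambda>D. U' <#>\<^bsub>\<Gamma>\<^esub> D) \<circ> map (\<lambda>g. U #>\<^bsub>\<Gamma>\<^esub> \<eta> g)) xs = map (\<lambda>g. U' #>\<^bsub>\<Gamma>\<^esub> \<eta> g) xs"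
      using e' by (auto simp: tuples_def simp del: map_eq_conv intro!: map_cong)
  next
    fix m assume "m \<in> carrier A"
    then show "N' #>\<^bsub>M\<^esub> \<theta> m \<in> carrier (M Mod N')" by (rule hom_in_carrier[OF coeff_hom[OF l']])
  qed (rule e)
  finally show ?thesis .
qed

lemma cmp_hom: "cmp \<in> hom (fin_chains A (tuples G n)) (PC n)"
proof (rule homI)
  fix c assume c: "c \<in> carrier (fin_chains A (tuples G n))"
  show "cmp c \<in> carrier (PC n)"
  proof (rule PC_closedI[OF cmp_ext])
    fix U N assume l: "(U, N) \<in> L"
    show "cmp c (U, N) \<in> carrier (C U N n)"
      unfolding cmp_level[OF l] by (rule hom_in_carrier[OF pu_hom[OF l] c])
    fix U' N' assume l': "(U', N') \<in> L" and sub: "U \<subseteq> U'" "N \<subseteq> N'"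
    show "pr U' N' N (cmp c (U, N)) = cmp c (U', N')"
      unfolding cmp_level[OF l] cmp_level[OF l'] by (rule pu_pr[OF l l' sub c])
  qed
  fix c' assume c': "c' \<in> carrier (fin_chains A (tuples G n))"
  show "cmp (c \<otimes>\<^bsub>fin_chains A (tuples G n)\<^esub> c') = cmp c \<otimes>\<^bsub>PC n\<^esub> cmp c'"
  proof (rule PC_eqI[OF cmp_ext PC_mult_ext])
    fix U N assume l: "(U, N) \<in> L"
    show "cmp (c \<otimes>\<^bsub>fin_chains A (tuples G n)\<^esub> c') (U, N) = (cmp c \<otimes>\<^bsub>PC n\<^esub> cmp c') (U, N)"
      unfolding PC_mult[OF l] cmp_level[OF l] by (rule hom_mult[OF pu_hom[OF l] c c'])
  qed
qed

lemma cmp_boundaries: "cmp ` boundaries2 G A \<subseteq> PB"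
proof (rule image_subsetI)
  fix b assume "b \<in> boundaries2 G A"
  then obtain c where c: "c \<in> carrier (fin_chains A (tuples G 3))" "b = bdry G A 3 c"
    by (auto simp: boundaries2_def)
  have pc: "cmp c \<in> carrier (PC 3)" by (rule hom_in_carrier[OF cmp_hom c(1)])
  have "profinite_boundary \<Gamma> M act 3 (cmp c) = cmp b"
  proof (rule PC_eqI[OF _ cmp_ext])
    show "profinite_boundary \<Gamma> M act 3 (cmp c) \<in> extensional L"
      by (simp add: profinite_boundary_def)
    fix U N assume l: "(U, N) \<in> L"
    show "profinite_boundary \<Gamma> M act 3 (cmp c) (U, N) = cmp b (U, N)"
      unfolding profinite_boundary_level[OF pc zero_less_numeral l] cmp_level[OF l] c(2)
      by (rule bdry_push3[OF is_group A levelD(6,7)[OF l] proj_hom[OF l] coeff_hom[OF l] c(1)])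
  qed
  then show "cmp b \<in> PB" unfolding PB_eq using pc by (metis imageI)
qed

lemma comparison_map_coset:
  assumes z: "z \<in> carrier (fin_chains A (tuples G 2))"
  shows "comparison_map A \<Gamma> M act \<eta> \<theta> 2 (boundaries2 G A #>\<^bsub>fin_chains A (tuples G 2)\<^esub> z) = PB #>\<^bsub>PC 2\<^esub> cmp z"
  unfolding comparison_map_def homology_map_def
  by (rule hom_image_coset[OF group_fin_chains[OF A] comm_group.axioms(2)[OF comm_group_PC] cmp_hom
      boundaries2_subgroup[OF is_group A] PB_subgroup cmp_boundaries z])

text \<open>Equal cosets of \<open>PB\<close> differ by an element of \<open>PB\<close>, and
  \<open>cmp\<close> is a homomorphism; so injectivity becomes a question about one cycle.\<close>

lemma comparison_map_eq_imp:
  assumes z: "z \<in> carrier (fin_chains A (tuples G 2))" "z' \<in> carrier (fin_chains A (tuples G 2))"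
    and eq: "comparison_map A \<Gamma> M act \<eta> \<theta> 2 (boundaries2 G A #>\<^bsub>fin_chains A (tuples G 2)\<^esub> z) =
      comparison_map A \<Gamma> M act \<eta> \<theta> 2 (boundaries2 G A #>\<^bsub>fin_chains A (tuples G 2)\<^esub> z')"
  shows "cmp (z \<otimes>\<^bsub>fin_chains A (tuples G 2)\<^esub> inv\<^bsub>fin_chains A (tuples G 2)\<^esub> z') \<in> PB"
proof -
  interpret P: comm_group "PC 2" by (rule comm_group_PC)
  interpret h: group_hom "fin_chains A (tuples G 2)" "PC 2" cmp
    by (intro group_homI cmp_hom group_fin_chains A P.is_group)
  have "PB #>\<^bsub>PC 2\<^esub> cmp z = PB #>\<^bsub>PC 2\<^esub> cmp z'"
    using eq unfolding comparison_map_coset[OF z(1)] comparison_map_coset[OF z(2)] .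
  then have "cmp z \<in> PB #>\<^bsub>PC 2\<^esub> cmp z'"
    using P.rcos_self[OF h.hom_closed[OF z(1)] PB_subgroup] by simp
  then have "cmp z \<otimes>\<^bsub>PC 2\<^esub> inv\<^bsub>PC 2\<^esub> cmp z' \<in> PB"
    by (rule subgroup.rcos_module_imp[OF PB_subgroup P.is_group h.hom_closed[OF z(2)]])
  then show ?thesis
    using z by (simp only: h.hom_mult h.hom_inv h.G.inv_closed)
qed

text \<open>Comparing the class of z with the zero class turns injectivity on homology into a
  statement about chains.\<close>

lemma injective_comparison_boundary:
  assumes inj: "inj_on (comparison_map A \<Gamma> M act \<eta> \<theta> 2) (carrier (group_homology G A actA 2))"
    and z: "z \<in> cycles2 G A" and cz: "cmp z \<in> PB"
  shows "z \<in> boundaries2 G A"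
proof -
  let ?C = "fin_chains A (tuples G 2)" and ?B = "boundaries2 G A"
  interpret C: comm_group ?C by (rule comm_group_fin_chains[OF A])
  interpret P: comm_group "PC 2" by (rule comm_group_PC)
  interpret h: group_hom ?C "PC 2" cmp
    by (intro group_homI cmp_hom C.is_group P.is_group)
  note B = boundaries2_subgroup[OF is_group A]
  have z': "z \<in> carrier ?C" using z by (simp add: cycles2_def)
  have one: "\<one>\<^bsub>?C\<^esub> \<in> cycles2 G A" using cycles2_subgroup[OF is_group A] by (rule subgroup.one_closed)
  have hc: "carrier (group_homology G A actA 2) = (\<lambda>z. ?B #>\<^bsub>?C\<^esub> z) ` cycles2 G A"
    by (rule homology2_carrier[OF is_group A]) (rule actA)
  have mem: "?B #>\<^bsub>?C\<^esub> z \<in> carrier (group_homology G A actA 2)"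
    "?B #>\<^bsub>?C\<^esub> \<one>\<^bsub>?C\<^esub> \<in> carrier (group_homology G A actA 2)"
    unfolding hc by (intro imageI z one)+
  have "PB #>\<^bsub>PC 2\<^esub> cmp z = PB"
    by (rule P.coset_join2[OF h.hom_closed[OF z'] PB_subgroup cz])
  moreover have "PB #>\<^bsub>PC 2\<^esub> cmp \<one>\<^bsub>?C\<^esub> = PB"
    unfolding h.hom_one by (rule P.coset_join2[OF P.one_closed PB_subgroup subgroup.one_closed[OF PB_subgroup]])
  ultimately have "comparison_map A \<Gamma> M act \<eta> \<theta> 2 (?B #>\<^bsub>?C\<^esub> z) = comparison_map A \<Gamma> M act \<eta> \<theta> 2 (?B #>\<^bsub>?C\<^esub> \<one>\<^bsub>?C\<^esub>)"
    unfolding comparison_map_coset[OF z'] comparison_map_coset[OF C.one_closed] by simp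
  then have "?B #>\<^bsub>?C\<^esub> z = ?B #>\<^bsub>?C\<^esub> \<one>\<^bsub>?C\<^esub>"
    by (rule inj_onD[OF inj _ mem])
  also have "\<dots> = ?B" by (rule C.coset_join2[OF C.one_closed B subgroup.one_closed[OF B]])
  finally show ?thesis by (rule C.coset_join1[OF _ z' B])
qed

end

section \<open>Detecting integral classes at finite levels\<close>

text \<open>Natural numbers serve as elements because \<open>in_A_hom\<close> quantifies over
  modules on \<open>nat\<close>. For m = 0 the carrier is empty, whence the bounds m \<ge> 1
  below.\<close>

definition zmod :: "nat \<Rightarrow> nat top_group" where
  "zmod m = \<lparr>carrier = {..<m}, monoid.mult = (\<lambda>a b. (a + b) mod m), one = 0, topol = discrete_topology {..<m}\<rparr>"

definition red :: "nat \<Rightarrow> int \<Rightarrow> nat" where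
  "red m k = nat (k mod int m)"

lemma zmod_simps [simp]:
  "carrier (zmod m) = {..<m}" "a \<otimes>\<^bsub>zmod m\<^esub> b = (a + b) mod m" "\<one>\<^bsub>zmod m\<^esub> = 0"
  "topol (zmod m) = discrete_topology {..<m}"
  by (simp_all add: zmod_def)

lemma comm_group_zmod:
  assumes "m \<ge> 1"
  shows "comm_group (zmod m)"
proof (rule comm_groupI)
  show "\<exists>y\<in>carrier (zmod m). y \<otimes>\<^bsub>zmod m\<^esub> x = \<one>\<^bsub>zmod m\<^esub>" if "x \<in> carrier (zmod m)" for x
    using that assms by (intro bexI[of _ "(m - x) mod m"]) (auto simp: mod_add_left_eq)
qed (use assms in \<open>auto simp: mod_simps ac_simps\<close>)

lemma red_hom: "m \<ge> 1 \<Longrightarrow> red m \<in> hom integer_group (zmod m)"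
proof (rule homI)
  assume m: "m \<ge> 1"
  show "red m x \<in> carrier (zmod m)" for x using m by (simp add: red_def nat_less_iff)
  show "red m (x \<otimes>\<^bsub>integer_group\<^esub> y) = red m x \<otimes>\<^bsub>zmod m\<^esub> red m y" for x y
  proof -
    have "int (red m (x + y)) = int ((red m x + red m y) mod m)"
      using m by (simp add: red_def zmod_int mod_add_eq)
    then show ?thesis by (simp only: of_nat_eq_iff mult_integer_group zmod_simps)
  qed
qed

lemma red_eq_iff: "m \<ge> 1 \<Longrightarrow> red m x = red m y \<longleftrightarrow> int m dvd x - y"
  by (simp add: red_def eq_nat_nat_iff mod_eq_dvd_iff)

lemma red_int: "a < m \<Longrightarrow> red m (int a) = a"
  by (simp add: red_def flip: zmod_int)

text \<open>The identity on entries moves no tuple, so no coefficients are added together. It makes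
  reduction modulo m an instance of the general push.\<close>

lemma chain_push_coeffs:
  assumes M: "comm_group M" and M': "comm_group M'" and \<theta>: "\<theta> \<in> hom M M'"
    and c: "c \<in> carrier (fin_chains M (tuples G n))"
  shows "chain_push M M' (map (\<lambda>g. g)) (\<lambda>_. \<theta>) c = (\<lambda>y. \<theta> (c y))"
proof
  fix y
  interpret M: comm_group M by fact
  interpret M': comm_group M' by fact
  have one: "\<theta> \<one>\<^bsub>M\<^esub> = \<one>\<^bsub>M'\<^esub>" by (rule hom_one[OF \<theta> M.is_group M'.is_group])
  have cl: "\<theta> (c y) \<in> carrier M'" by (rule hom_in_carrier[OF \<theta> fin_chains_coeff[OF c]])
  show "chain_push M M' (map (\<lambda>g. g)) (\<lambda>_. \<theta>) c y = \<theta> (c y)"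
  proof (cases "y \<in> chain_support M c")
    case True
    then have "{x \<in> chain_support M c. map (\<lambda>g. g) x = y} = {y}" by auto
    then show ?thesis using cl by (simp add: chain_push_def)
  next
    case False
    then have "{x \<in> chain_support M c. map (\<lambda>g. g) x = y} = {}" "c y = \<one>\<^bsub>M\<^esub>"
      by (auto simp: chain_support_def)
    then show ?thesis by (simp only: chain_push_def M'.finprod_empty one)
  qed
qed

lemma fin_chains_int_pow:
  assumes "c \<in> carrier (fin_chains integer_group V)"
  shows "(c [^]\<^bsub>fin_chains integer_group V\<^esub> m) x = int m * c x"
  by (induction m) (simp_all add: algebra_simps)

lemma fin_chains_intI:
  assumes "finite F" "F \<subseteq> V" "\<And>x. x \<notin> F \<Longrightarrow> c x = 0"
  shows "c \<in> carrier (fin_chains integer_group V)"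
  using assms by (auto simp: fin_chains_iff)

text \<open>Exactness at the middle term of H_2(G, Z) --m--> H_2(G, Z) --> H_2(G, Z/m), on chains. A
  filling modulo m lifts to an integral chain; the difference of z and its boundary is divisible by
  m, and the quotient is a cycle because the integers are torsion free.\<close>

lemma boundary_mod_imp:
  assumes G: "group G" and m: "m \<ge> 1" and z: "z \<in> cycles2 G integer_group"
    and zm: "chain_push integer_group (zmod m) (map (\<lambda>g. g)) (\<lambda>_. red m) z \<in> boundaries2 G (zmod m)"
  obtains w v where "w \<in> boundaries2 G integer_group" "v \<in> cycles2 G integer_group"
    "z = w \<otimes>\<^bsub>fin_chains integer_group (tuples G 2)\<^esub> (v [^]\<^bsub>fin_chains integer_group (tuples G 2)\<^esub> m)"
proof -
  let ?Z = integer_group and ?C = "\<lambda>n. fin_chains integer_group (tuples G n)"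
  note Z = abelian_integer_group and A = comm_group_zmod[OF m] and red = red_hom[OF m]
  have gid: "(\<lambda>g. g) \<in> hom G G" by (rule hom_id)
  have zc: "z \<in> carrier (?C 2)" and z0: "bdry G ?Z 2 z = (\<lambda>_. 0)" using z by (simp_all add: cycles2_def)
  obtain wm where wm: "wm \<in> carrier (fin_chains (zmod m) (tuples G 3))"
    and wmz: "(\<lambda>y. red m (z y)) = bdry G (zmod m) 3 wm"
    using zm unfolding boundaries2_def chain_push_coeffs[OF Z A red zc] by blast
  \<comment> \<open>The lift of the filling with coefficients in {0, ..., m - 1}, which
    \<open>red m\<close> takes back to \<open>wm\<close>.\<close>
  define u where "u = (\<lambda>x. int (wm x))"
  have u: "u \<in> carrier (?C 3)"
    using fin_chains_support[OF wm]
    by (intro fin_chains_intI[of "chain_support (zmod m) wm"]) (auto simp: u_def chain_support_def)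
  have "wm x < m" for x using fin_chains_coeff[OF wm, of x] by simp
  then have "chain_push ?Z (zmod m) (map (\<lambda>g. g)) (\<lambda>_. red m) u = wm"
    unfolding chain_push_coeffs[OF Z A red u] by (simp add: u_def red_int)
  then have "bdry G (zmod m) 3 wm = chain_push ?Z (zmod m) (map (\<lambda>g. g)) (\<lambda>_. red m) (bdry G ?Z 3 u)"
    using bdry_push3[OF G Z G A gid red u] by simp
  also have "\<dots> = (\<lambda>y. red m (bdry G ?Z 3 u y))"
    by (rule chain_push_coeffs[OF Z A red hom_in_carrier[OF bdry_hom3[OF G Z] u]])
  finally have "red m (z y) = red m (bdry G ?Z 3 u y)" for y using wmz by metis
  then have dvd: "int m dvd z y - bdry G ?Z 3 u y" for y using red_eq_iff[OF m] by blast
  let ?w = "bdry G ?Z 3 u"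
  have w: "?w \<in> boundaries2 G ?Z" unfolding boundaries2_def using u by (rule imageI)
  have wc: "?w \<in> carrier (?C 2)" by (rule hom_in_carrier[OF bdry_hom3[OF G Z] u])
  define v where "v = (\<lambda>y. (z y - ?w y) div int m)"
  have v: "v \<in> carrier (?C 2)"
    using fin_chains_support[OF zc] fin_chains_support[OF wc]
    by (intro fin_chains_intI[of "chain_support ?Z z \<union> chain_support ?Z ?w"]) (auto simp: v_def chain_support_def)
  interpret C: comm_group "?C 2" by (rule comm_group_fin_chains[OF Z])
  have eq: "z = ?w \<otimes>\<^bsub>?C 2\<^esub> (v [^]\<^bsub>?C 2\<^esub> m)"
  proof
    fix y
    have "int m * v y = z y - ?w y" using dvd[of y] by (simp add: v_def)
    then show "z y = (?w \<otimes>\<^bsub>?C 2\<^esub> (v [^]\<^bsub>?C 2\<^esub> m)) y" by (simp add: fin_chains_int_pow[OF v])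
  qed
  interpret d: group_hom "?C 2" "?C 1" "bdry G ?Z 2"
    by (intro group_homI bdry_hom2 group_fin_chains G Z)
  have dv: "bdry G ?Z 2 v \<in> carrier (?C 1)" by (rule d.hom_closed[OF v])
  have w0: "bdry G ?Z 2 ?w = \<one>\<^bsub>?C 1\<^esub>" by (rule bdry_bdry[OF G Z u])
  have "bdry G ?Z 2 z = bdry G ?Z 2 ?w \<otimes>\<^bsub>?C 1\<^esub> (bdry G ?Z 2 v [^]\<^bsub>?C 1\<^esub> m)"
    by (subst eq) (simp only: d.hom_mult wc v C.nat_pow_closed d.hom_nat_pow)
  \<comment> \<open>The boundary of z = w + m v vanishes, and so does that of w.\<close>
  then have "int m * bdry G ?Z 2 v y = 0" for y
    unfolding w0 z0 by (metis d.H.l_one d.H.nat_pow_closed dv fin_chains_int_pow[OF dv])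
  then have "v \<in> cycles2 G ?Z" using v m by (simp add: cycles2_def fun_eq_iff)
  with w eq show thesis using that by blast
qed

section \<open>The modules Z/m and the detection criterion\<close>

context profinite begin

lemma trivial_coeffs_trivial_action:
  "comm_group M \<Longrightarrow> trivial_coeffs G M (trivial_action \<Gamma> M)"
  by (intro trivial_coeffs.intro profinite_axioms trivial_coeffs_axioms.intro)
     (simp_all add: trivial_action_def)

lemma finite_discrete_module_zmod:
  assumes m: "m \<ge> 1"
  shows "finite_discrete_module \<Gamma> (zmod m) (trivial_action \<Gamma> (zmod m))"
proof -
  let ?act = "trivial_action \<Gamma> (zmod m)"
  have act: "?act g = (\<lambda>a\<in>carrier (zmod m). a)" if "g \<in> carrier \<Gamma>" for g
    using that by (simp add: trivial_action_def)
  interpret A: comm_group "zmod m" by (rule comm_group_zmod[OF m])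
  have B: "group (BijGroup (carrier (zmod m)))" by (rule group_BijGroup)
  have "?act \<in> hom \<Gamma> (BijGroup (carrier (zmod m)))"
  proof (rule homI)
    \<comment> \<open>Elements of \<open>BijGroup\<close> are undefined outside the set they
      permute, so its unit is the restricted identity; this is the form that
      \<open>trivial_action\<close> has.\<close>
    have one: "(\<lambda>a\<in>carrier (zmod m). a) = \<one>\<^bsub>BijGroup (carrier (zmod m))\<^esub>" by (simp add: BijGroup_def)
    fix g assume g: "g \<in> carrier \<Gamma>"
    show "?act g \<in> carrier (BijGroup (carrier (zmod m)))"
      unfolding act[OF g] one by (rule monoid.one_closed[OF group.is_monoid[OF B]])
    fix h assume h: "h \<in> carrier \<Gamma>"
    have gh: "g \<otimes>\<^bsub>\<Gamma>\<^esub> h \<in> carrier \<Gamma>"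
      by (rule monoid.m_closed[OF group.is_monoid[OF group_\<Gamma>] g h])
    show "?act (g \<otimes>\<^bsub>\<Gamma>\<^esub> h) = ?act g \<otimes>\<^bsub>BijGroup (carrier (zmod m))\<^esub> ?act h"
      unfolding act[OF g] act[OF h] act[OF gh] one
      by (rule monoid.l_one[symmetric, OF group.is_monoid[OF B] monoid.one_closed[OF group.is_monoid[OF B]]])
  qed
  then have "group_action \<Gamma> (carrier (zmod m)) ?act"
    unfolding group_action_def using group_\<Gamma> B by (intro group_homI)
  moreover have "?act g \<in> hom (zmod m) (zmod m)" if "g \<in> carrier \<Gamma>" for g
    unfolding act[OF that] by (rule homI) (use m in auto)
  moreover have "continuous_map (prod_topology (topol \<Gamma>) (topol (zmod m))) (topol (zmod m)) (\<lambda>(g, a). ?act g a)"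
  proof (rule continuous_map_eq[OF continuous_map_snd])
    fix p assume "p \<in> topspace (prod_topology (topol \<Gamma>) (topol (zmod m)))"
    then show "snd p = (case p of (g, a) \<Rightarrow> ?act g a)"
      by (auto simp: topspace_\<Gamma> trivial_action_def)
  qed
  ultimately show ?thesis
    by (simp add: finite_discrete_module_def A.comm_group_axioms)
qed

abbreviation "\<eta>0 \<equiv> completion_map G"

text \<open>Reduction modulo m followed by projection to the level (U, N), in one step; detection at
  finite levels can thus be stated for integral cycles.\<close>

definition level_push :: "nat \<Rightarrow> ('a set \<Rightarrow> 'a set) set \<Rightarrow> nat set \<Rightarrow> ('a list \<Rightarrow> int) \<Rightarrow> ('a set \<Rightarrow> 'a set) set list \<Rightarrow> nat set" where
  "level_push m U N = chain_push integer_group (zmod m Mod N)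
     (map (\<lambda>g. U #>\<^bsub>\<Gamma>\<^esub> \<eta>0 g)) (\<lambda>_ k. N #>\<^bsub>zmod m\<^esub> red m k)"

lemma levelwise_boundary_imp_boundary_mod:
  assumes A2: "in_A_hom 2 G" and m: "m \<ge> 1" and z: "z \<in> cycles2 G integer_group"
    and lw: "\<And>U N. (U, N) \<in> levels \<Gamma> (zmod m) (trivial_action \<Gamma> (zmod m)) \<Longrightarrow>
      level_push m U N z \<in> boundaries2 (\<Gamma> Mod U) (zmod m Mod N)"
  shows "chain_push integer_group (zmod m) (map (\<lambda>g. g)) (\<lambda>_. red m) z \<in> boundaries2 G (zmod m)"
proof -
  let ?act = "trivial_action \<Gamma> (zmod m)" and ?Z = integer_group
  note Z = abelian_integer_group and A = comm_group_zmod[OF m] and red = red_hom[OF m]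
  interpret trivial_coeffs G "zmod m" ?act by (rule trivial_coeffs_trivial_action[OF A])
  \<comment> \<open>Source and target coefficients agree here and \<theta> is the identity, exactly
    as in \<open>in_A_hom\<close>.\<close>
  interpret comparison G "zmod m" ?act "zmod m" "\<lambda>a. a" "\<lambda>g. ?act (\<eta>0 g)"
  proof (intro comparison.intro comparison_axioms.intro trivial_coeffs_axioms A hom_id)
    show "?act (\<eta>0 g) a = a" if "g \<in> carrier G" "a \<in> carrier (zmod m)" for g a
      by (rule act[OF hom_in_carrier[OF completion_map_hom that(1)] that(2)])
  qed
  let ?p = "chain_push ?Z (zmod m) (map (\<lambda>g :: 'a. g)) (\<lambda>_. red m)"
  have zc: "z \<in> carrier (fin_chains ?Z (tuples G 2))" and z0: "bdry G ?Z 2 z = (\<lambda>_. 0)"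
    using z by (simp_all add: cycles2_def)
  have p: "?p \<in> hom (fin_chains ?Z (tuples G n)) (fin_chains (zmod m) (tuples G n))" for n
    by (rule tuple_push_hom[OF Z A red]) simp
  have pz: "?p z \<in> carrier (fin_chains (zmod m) (tuples G 2))" by (rule hom_in_carrier[OF p zc])
  have "?p (\<lambda>_. 0) = (\<lambda>_. 0)"
    using hom_one[OF p[of 1] group_fin_chains[OF Z] group_fin_chains[OF A]] by simp
  then have cyc: "?p z \<in> cycles2 G (zmod m)"
    using pz bdry_push2[OF is_group Z is_group A hom_id red zc] by (simp add: cycles2_def z0)
  have "cmp (?p z) \<in> PB"
  proof (rule levelwise_boundary)
    show "finite (carrier (zmod m))" by simp
    have "carrier \<Gamma> \<lhd> \<Gamma>" by (rule group.normal_self[OF group_\<Gamma>])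
    moreover have "openin (topol \<Gamma>) (carrier \<Gamma>)" using openin_topspace[of "topol \<Gamma>"] by (simp add: topspace_\<Gamma>)
    \<comment> \<open>The coarsest level, where both quotients are trivial, shows that levels
      exist.\<close>
    ultimately have "(carrier \<Gamma>, carrier (zmod m)) \<in> L"
      by (intro levelI) (simp_all only: M.subgroup_self, simp)
    then show "L \<noteq> {}" by blast
    show "cmp (?p z) \<in> carrier (PC 2)" by (rule hom_in_carrier[OF cmp_hom pz])
    fix U N assume l: "(U, N) \<in> L"
    have "cmp (?p z) (U, N) = chain_push ?Z (zmod m Mod N)
        (map (\<lambda>g. U #>\<^bsub>\<Gamma>\<^esub> \<eta> g) \<circ> map (\<lambda>g. g)) (\<lambda>_ k. N #>\<^bsub>zmod m\<^esub> red m k) z"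
      unfolding cmp_level[OF l] by (rule chain_push_comp[OF Z A levelD(7)[OF l] red coeff_hom[OF l] zc])
    also have "\<dots> = level_push m U N z" by (simp add: level_push_def comp_def)
    finally show "cmp (?p z) (U, N) \<in> bdry (\<Gamma> Mod U) (zmod m Mod N) 3 ` carrier (C U N 3)"
      using lw[OF l] by (simp add: boundaries2_def)
  qed
  moreover have "inj_on (comparison_map (zmod m) \<Gamma> (zmod m) ?act \<eta> (\<lambda>a. a) 2)
      (carrier (group_homology G (zmod m) (\<lambda>g. ?act (\<eta> g)) 2))"
    using A2 finite_discrete_module_zmod[OF m] unfolding in_A_hom_def iso_def bij_betw_def by blast
  ultimately show ?thesis using injective_comparison_boundary cyc by blast
qed

text \<open>Both conclusions rest on this criterion: injectivity uses it directly, the exterior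
  square its contrapositive, which supplies a finite level where the cycle survives.\<close>

lemma integral_cycle_boundary:
  assumes A2: "in_A_hom 2 G" and fg: "finitely_generated_group (integral_homology G 2)"
    and z: "z \<in> cycles2 G integer_group"
    and lw: "\<And>m U N. m \<ge> 1 \<Longrightarrow> (U, N) \<in> levels \<Gamma> (zmod m) (trivial_action \<Gamma> (zmod m)) \<Longrightarrow>
      level_push m U N z \<in> boundaries2 (\<Gamma> Mod U) (zmod m Mod N)"
  shows "z \<in> boundaries2 G integer_group"
proof -
  let ?Z = integer_group and ?C = "fin_chains integer_group (tuples G 2)"
  let ?H = "integral_homology G 2" and ?B = "boundaries2 G integer_group"
  note Z = abelian_integer_group
  let ?C' = "?C\<lparr>carrier := cycles2 G ?Z\<rparr>"
  have act: "trivial_action G ?Z g k = k" if "g \<in> carrier G" "k \<in> carrier ?Z" for g k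
    using that by (simp add: trivial_action_def)
  have H: "?H = ?C' Mod ?B"
    unfolding integral_homology_def by (rule homology2_eq[OF is_group Z act])
  interpret H: comm_group ?H
    unfolding integral_homology_def by (rule homology2_comm_group[OF is_group Z act])
  interpret C: comm_group ?C by (rule comm_group_fin_chains[OF Z])
  note B = boundaries2_subgroup[OF is_group Z] and cyc = cycles2_subgroup[OF is_group Z]
  have gC': "group ?C'" by (rule C.subgroup_imp_group[OF cyc])
  have cC': "comm_group ?C'"
    using subgroup.subset[OF cyc] C.m_comm by (intro group.group_comm_groupI[OF gC']) (auto simp del: fin_chains_mult)
  have BC': "subgroup ?B ?C'" by (rule C.subgroup_incl[OF B cyc boundaries2_subset[OF is_group Z]])
  have nor: "?B \<lhd> ?C'" by (rule comm_group.subgroup_imp_normal[OF cC' BC'])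
  have pow: "v [^]\<^bsub>?C'\<^esub> m = v [^]\<^bsub>?C\<^esub> m" for v and m :: nat
    by (simp add: nat_pow_def)
  have car: "carrier ?H = (\<lambda>v. ?B #>\<^bsub>?C'\<^esub> v) ` cycles2 G ?Z"
    unfolding H by (simp add: carrier_FactGroup)
  have "?B #>\<^bsub>?C'\<^esub> z = \<one>\<^bsub>?H\<^esub>"
  proof (rule H.divisible_imp_one[OF fg])
    show "?B #>\<^bsub>?C'\<^esub> z \<in> carrier ?H" unfolding car using z by (rule imageI)
    fix m :: nat assume m: "m \<ge> 1"
    obtain w v where w: "w \<in> ?B" and v: "v \<in> cycles2 G ?Z" and zeq: "z = w \<otimes>\<^bsub>?C\<^esub> (v [^]\<^bsub>?C\<^esub> m)"
      using boundary_mod_imp[OF is_group m z levelwise_boundary_imp_boundary_mod[OF A2 m z lw[OF m]]] by metis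
    have vm: "v [^]\<^bsub>?C'\<^esub> m \<in> carrier ?C'"
      using monoid.nat_pow_closed[OF group.is_monoid[OF gC'], of v m] v by simp
    \<comment> \<open>Since z = w + m v with w a boundary, the class of z is m times that of
      v.\<close>
    have "z \<in> ?B #>\<^bsub>?C'\<^esub> (v [^]\<^bsub>?C'\<^esub> m)"
      using w zeq unfolding r_coset_def pow by auto
    then have "?B #>\<^bsub>?C'\<^esub> (v [^]\<^bsub>?C'\<^esub> m) = ?B #>\<^bsub>?C'\<^esub> z"
      by (rule group.repr_independence[OF gC' _ vm BC'])
    moreover have "(?B #>\<^bsub>?C'\<^esub> v) [^]\<^bsub>?H\<^esub> m = ?B #>\<^bsub>?C'\<^esub> (v [^]\<^bsub>?C'\<^esub> m)"
      unfolding H by (rule normal.FactGroup_pow[OF nor]) (use v in simp)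
    moreover have "?B #>\<^bsub>?C'\<^esub> v \<in> carrier ?H" unfolding car using v by (rule imageI)
    ultimately show "\<exists>y\<in>carrier ?H. ?B #>\<^bsub>?C'\<^esub> z = y [^]\<^bsub>?H\<^esub> m" by metis
  qed
  then have "?B #>\<^bsub>?C'\<^esub> z = ?B" unfolding H by simp
  then show ?thesis by (rule group.coset_join1[OF gC' _ _ BC']) (use z in simp)
qed

end

section \<open>Groups given by presentations\<close>

lemma words_append [simp]: "u @ v \<in> words S \<longleftrightarrow> u \<in> words S \<and> v \<in> words S"
  by (simp add: words_def)

lemma words_Nil [simp]: "[] \<in> words S"
  by (simp add: words_def)

lemma words_Cons [simp]: "a # w \<in> words S \<longleftrightarrow> fst a \<in> S \<and> w \<in> words S"
  by (cases a) (simp add: words_def)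

locale presentation =
  fixes S :: "'x set" and R :: "('x word \<times> 'x word) set"
  assumes R: "R \<subseteq> words S \<times> words S"
begin

abbreviation "rel \<equiv> presentation_rel S R"
abbreviation "cls w \<equiv> rel `` {w}"
abbreviation "P \<equiv> presented_group S R"

lemma rel_words: "(u, v) \<in> rel \<Longrightarrow> u \<in> words S \<and> v \<in> words S"
  by (induction rule: presentation_rel.induct) (use R in auto)

lemma equiv_rel: "equiv (words S) rel"
proof (rule equivI)
  show "rel \<subseteq> words S \<times> words S" using rel_words by auto
  show "refl_on (words S) rel" by (rule refl_onI) (rule presentation_rel.refl)
  show "sym rel" by (rule symI) (rule presentation_rel.sym)
  show "trans rel" by (rule transI) (rule presentation_rel.trans)
qed

lemma rel_append_left: "(u, v) \<in> rel \<Longrightarrow> w \<in> words S \<Longrightarrow> (w @ u, w @ v) \<in> rel"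
proof (induction rule: presentation_rel.induct)
  case (relator u v a b)
  then show ?case using presentation_rel.relator[of u v R "w @ a" S b] by simp
next
  case (cancel x a b s)
  then show ?case using presentation_rel.cancel[of x S "w @ a" b s] by simp
qed (auto intro: presentation_rel.intros)

lemma rel_append_right: "(u, v) \<in> rel \<Longrightarrow> w \<in> words S \<Longrightarrow> (u @ w, v @ w) \<in> rel"
proof (induction rule: presentation_rel.induct)
  case (relator u v a b)
  then show ?case using presentation_rel.relator[of u v R a S "b @ w"] by simp
next
  case (cancel x a b s)
  then show ?case using presentation_rel.cancel[of x S a "b @ w" s] by simp
qed (auto intro: presentation_rel.intros)

lemma rel_append: "(u, u') \<in> rel \<Longrightarrow> (v, v') \<in> rel \<Longrightarrow> (u @ v, u' @ v') \<in> rel"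
  by (rule presentation_rel.trans[of _ "u' @ v"]) (use rel_append_left rel_append_right rel_words in blast)+

lemma cls_eq_iff: "u \<in> words S \<Longrightarrow> v \<in> words S \<Longrightarrow> cls u = cls v \<longleftrightarrow> (u, v) \<in> rel"
  by (rule eq_equiv_class_iff[OF equiv_rel])

lemma carrier_P: "carrier P = cls ` words S"
  by (auto simp: presented_group_def quotient_def)

text \<open>The relation is a congruence, so saturating the set of products of representatives
  yields a single class.\<close>

lemma cls_mult: "u \<in> words S \<Longrightarrow> v \<in> words S \<Longrightarrow> cls u \<otimes>\<^bsub>P\<^esub> cls v = cls (u @ v)"
proof -
  assume u: "u \<in> words S" and v: "v \<in> words S"
  have "rel `` {u' @ v' | u' v'. u' \<in> cls u \<and> v' \<in> cls v} = cls (u @ v)"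
  proof (intro subset_antisym subsetI)
    fix w assume "w \<in> rel `` {u' @ v' | u' v'. u' \<in> cls u \<and> v' \<in> cls v}"
    then obtain u' v' where "(u, u') \<in> rel" "(v, v') \<in> rel" "(u' @ v', w) \<in> rel" by auto
    then have "(u @ v, w) \<in> rel" using presentation_rel.trans[OF rel_append] by blast
    then show "w \<in> cls (u @ v)" by simp
  next
    fix w assume "w \<in> cls (u @ v)"
    moreover have "u \<in> cls u" "v \<in> cls v" using u v presentation_rel.refl by auto
    ultimately show "w \<in> rel `` {u' @ v' | u' v'. u' \<in> cls u \<and> v' \<in> cls v}" by blast
  qed
  then show ?thesis by (simp add: presented_group_def)
qed

lemma cls_one: "\<one>\<^bsub>P\<^esub> = cls []"
  by (simp add: presented_group_def)

lemma word_inv_words: "w \<in> words S \<Longrightarrow> word_inv w \<in> words S"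
  by (induction w) (auto simp: word_inv_def)

lemma word_inv_rel: "w \<in> words S \<Longrightarrow> (word_inv w @ w, []) \<in> rel"
proof (induction w)
  case Nil
  then show ?case by (simp add: word_inv_def presentation_rel.refl)
next
  case (Cons a w)
  obtain x s where a: "a = (x, s)" by (cases a)
  have "(word_inv w @ [(x, \<not> s), (x, \<not> \<not> s)] @ w, word_inv w @ w) \<in> rel"
    by (rule presentation_rel.cancel) (use Cons a word_inv_words in auto)
  then have "(word_inv (a # w) @ a # w, word_inv w @ w) \<in> rel"
    by (simp add: word_inv_def a)
  then show ?case using Cons presentation_rel.trans by fastforce
qed

lemma group_P: "group P"
proof (rule groupI)
  show "\<exists>y\<in>carrier P. y \<otimes>\<^bsub>P\<^esub> x = \<one>\<^bsub>P\<^esub>" if x: "x \<in> carrier P" for x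
  proof -
    obtain w where w: "w \<in> words S" "x = cls w" using x unfolding carrier_P by blast
    then have "cls (word_inv w) \<otimes>\<^bsub>P\<^esub> x = \<one>\<^bsub>P\<^esub>"
      using word_inv_rel word_inv_words by (simp add: cls_mult cls_one cls_eq_iff)
    moreover have "cls (word_inv w) \<in> carrier P" using w word_inv_words by (simp add: carrier_P)
    ultimately show ?thesis by blast
  qed
qed (auto simp: carrier_P cls_mult cls_one)

lemma cls_inv: "w \<in> words S \<Longrightarrow> inv\<^bsub>P\<^esub> (cls w) = cls (word_inv w)"
  using word_inv_rel word_inv_words
  by (intro group.inv_equality[OF group_P]) (auto simp: cls_mult cls_one cls_eq_iff carrier_P)

end

primrec eval_word :: "('h, 'y) monoid_scheme \<Rightarrow> ('x \<Rightarrow> 'h) \<Rightarrow> 'x word \<Rightarrow> 'h" where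
  "eval_word H f [] = \<one>\<^bsub>H\<^esub>"
| "eval_word H f (a # w) = (if snd a then f (fst a) else inv\<^bsub>H\<^esub> f (fst a)) \<otimes>\<^bsub>H\<^esub> eval_word H f w"

lemma eval_word_closed:
  assumes "group H" "f \<in> S \<rightarrow> carrier H" "w \<in> words S"
  shows "eval_word H f w \<in> carrier H"
proof -
  interpret H: group H by fact
  show ?thesis using assms(2,3) by (induction w) auto
qed

lemma eval_word_append:
  assumes "group H" "f \<in> S \<rightarrow> carrier H" "u \<in> words S" "v \<in> words S"
  shows "eval_word H f (u @ v) = eval_word H f u \<otimes>\<^bsub>H\<^esub> eval_word H f v"
proof -
  interpret H: group H by fact
  have v: "eval_word H f v \<in> carrier H" by (rule eval_word_closed[OF assms(1,2,4)])
  show ?thesis using assms(3)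
  proof (induction u)
    case Nil
    then show ?case using v by simp
  next
    case (Cons a u)
    have "f (fst a) \<in> carrier H" using assms(2) Cons.prems by auto
    moreover have "eval_word H f u \<in> carrier H" using eval_word_closed[OF assms(1,2)] Cons.prems by simp
    ultimately show ?case using Cons v by (simp add: H.m_assoc)
  qed
qed

lemma (in presentation) eval_word_rel:
  assumes H: "group H" and f: "f \<in> S \<rightarrow> carrier H"
    and rels: "\<And>u v. (u, v) \<in> R \<Longrightarrow> eval_word H f u = eval_word H f v"
    and "(u, v) \<in> rel"
  shows "eval_word H f u = eval_word H f v"
  using assms(4)
proof (induction rule: presentation_rel.induct)
  case (relator u v a b)
  then have "u \<in> words S" "v \<in> words S" using R by auto
  then show ?case using relator rels by (simp add: eval_word_append[OF H f])
next
  case (cancel x a b s)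
  interpret H: group H by fact
  have "f x \<in> carrier H" using f cancel by blast
  then have "eval_word H f [(x, s), (x, \<not> s)] = \<one>\<^bsub>H\<^esub>" by simp
  moreover have "[(x, s), (x, \<not> s)] \<in> words S" using cancel by simp
  ultimately show ?case
    using cancel eval_word_closed[OF H f] by (simp only: eval_word_append[OF H f] words_append H.l_one)
qed auto

text \<open>Von Dyck's theorem. Evaluation is constant on classes because each step of the relation
  preserves it, so an arbitrary representative defines the map.\<close>

lemma (in presentation) presentation_hom:
  assumes H: "group H" and f: "f \<in> S \<rightarrow> carrier H"
    and rels: "\<And>u v. (u, v) \<in> R \<Longrightarrow> eval_word H f u = eval_word H f v"
  obtains \<Phi> where "\<Phi> \<in> hom P H" "\<And>w. w \<in> words S \<Longrightarrow> \<Phi> (cls w) = eval_word H f w"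
proof
  let ?\<Phi> = "\<lambda>A. eval_word H f (SOME w. w \<in> A)"
  show eq: "?\<Phi> (cls w) = eval_word H f w" if "w \<in> words S" for w
  proof -
    have "w \<in> cls w" using presentation_rel.refl[OF that] by simp
    then have "(SOME v. v \<in> cls w) \<in> cls w" by (rule someI)
    then show ?thesis using eval_word_rel[OF H f rels] by (metis Image_singleton_iff)
  qed
  show "?\<Phi> \<in> hom P H"
  proof (rule homI)
    fix x assume "x \<in> carrier P"
    then obtain u where u: "u \<in> words S" "x = cls u" by (auto simp: carrier_P)
    show "?\<Phi> x \<in> carrier H" unfolding u(2) eq[OF u(1)] by (rule eval_word_closed[OF H f u(1)])
    fix y assume "y \<in> carrier P"
    then obtain v where v: "v \<in> words S" "y = cls v" by (auto simp: carrier_P)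
    have uv: "u @ v \<in> words S" using u(1) v(1) by simp
    show "?\<Phi> (x \<otimes>\<^bsub>P\<^esub> y) = ?\<Phi> x \<otimes>\<^bsub>H\<^esub> ?\<Phi> y"
      unfolding u(2) v(2) cls_mult[OF u(1) v(1)] eq[OF uv] eq[OF u(1)] eq[OF v(1)]
      by (rule eval_word_append[OF H f u(1) v(1)])
  qed
qed

section \<open>The group \<open>\<nu>(G)\<close>\<close>

text \<open>Bracketed to the right like the word \<open>word_comm\<close>, so that evaluating a
  commutator word gives this expression.\<close>

definition comm_elt :: "('a, 'x) monoid_scheme \<Rightarrow> 'a \<Rightarrow> 'a \<Rightarrow> 'a" where
  "comm_elt G a b = inv\<^bsub>G\<^esub> a \<otimes>\<^bsub>G\<^esub> (inv\<^bsub>G\<^esub> b \<otimes>\<^bsub>G\<^esub> (a \<otimes>\<^bsub>G\<^esub> b))"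

context group begin

lemma cancel_left [simp]:
  "x \<in> carrier G \<Longrightarrow> y \<in> carrier G \<Longrightarrow> x \<otimes> (inv x \<otimes> y) = y"
  "x \<in> carrier G \<Longrightarrow> y \<in> carrier G \<Longrightarrow> inv x \<otimes> (x \<otimes> y) = y"
  by (simp_all flip: m_assoc)

lemma comm_elt_closed [simp]: "a \<in> carrier G \<Longrightarrow> b \<in> carrier G \<Longrightarrow> comm_elt G a b \<in> carrier G"
  by (simp add: comm_elt_def)

lemma conj_elt_closed [simp]: "a \<in> carrier G \<Longrightarrow> b \<in> carrier G \<Longrightarrow> conj_elt G a b \<in> carrier G"
  by (simp add: conj_elt_def)

lemma conj_comm_elt:
  "a \<in> carrier G \<Longrightarrow> b \<in> carrier G \<Longrightarrow> c \<in> carrier G \<Longrightarrow>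
    conj_elt G (comm_elt G a b) c = comm_elt G (conj_elt G a c) (conj_elt G b c)"
  by (simp add: comm_elt_def conj_elt_def inv_mult_group m_assoc)

end

locale nu_group = group G for G :: "('a, 'b) monoid_scheme" (structure)
begin

lemma nu_relations_words: "nu_relations G \<subseteq> words (nu_generators G) \<times> words (nu_generators G)"
  by (auto simp: nu_relations_def nu_generators_def word_conj_def word_comm_def word_inv_def)

sublocale nu: presentation "nu_generators G" "nu_relations G"
  by unfold_locales (rule nu_relations_words)

lemma group_nu: "group (nu G)"
  unfolding nu_def by (rule nu.group_P)

abbreviation "lft g \<equiv> nu.cls (lw g)"
abbreviation "rgt g \<equiv> nu.cls (rw g)"

lemma gen_mem [simp]: "Inl g \<in> nu_generators G \<longleftrightarrow> g \<in> carrier G" "Inr g \<in> nu_generators G \<longleftrightarrow> g \<in> carrier G"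
  by (auto simp: nu_generators_def)

lemma gen_words [simp]: "g \<in> carrier G \<Longrightarrow> [(Inl g, s)] \<in> words (nu_generators G)"
  "g \<in> carrier G \<Longrightarrow> [(Inr g, s)] \<in> words (nu_generators G)"
  by (auto simp: nu_generators_def)

lemma rel_of_relation: "(u, v) \<in> nu_relations G \<Longrightarrow> (u, v) \<in> nu.rel"
  using presentation_rel.relator[of u v "nu_relations G" "[]" "nu_generators G" "[]"] by simp

lemma cls_of_relation: "(u, v) \<in> nu_relations G \<Longrightarrow> nu.cls u = nu.cls v"
  using equiv_class_eq[OF nu.equiv_rel rel_of_relation] .

lemma lft_hom: "lft \<in> hom G (nu G)"
proof (rule homI)
  fix g h assume g: "g \<in> carrier G"
  show "lft g \<in> carrier (nu G)" using g unfolding nu_def nu.carrier_P by (intro imageI) simp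
  assume h: "h \<in> carrier G"
  have "(lw g @ lw h, lw (g \<otimes> h)) \<in> nu_relations G"
    using g h by (auto simp: nu_relations_def)
  from cls_of_relation[OF this] show "lft (g \<otimes> h) = lft g \<otimes>\<^bsub>nu G\<^esub> lft h"
    using g h by (simp add: nu_def nu.cls_mult)
qed

lemma rgt_hom: "rgt \<in> hom G (nu G)"
proof (rule homI)
  fix g h assume g: "g \<in> carrier G"
  show "rgt g \<in> carrier (nu G)" using g unfolding nu_def nu.carrier_P by (intro imageI) simp
  assume h: "h \<in> carrier G"
  have "(rw g @ rw h, rw (g \<otimes> h)) \<in> nu_relations G"
    using g h by (auto simp: nu_relations_def)
  from cls_of_relation[OF this] show "rgt (g \<otimes> h) = rgt g \<otimes>\<^bsub>nu G\<^esub> rgt h"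
    using g h by (simp add: nu_def nu.cls_mult)
qed

lemma cls_word_comm:
  assumes "u \<in> words (nu_generators G)" "v \<in> words (nu_generators G)"
  shows "nu.cls (word_comm u v) = comm_elt (nu G) (nu.cls u) (nu.cls v)"
  using assms by (simp add: word_comm_def comm_elt_def nu_def nu.cls_mult nu.cls_inv nu.word_inv_words)

lemma cls_word_conj:
  assumes "u \<in> words (nu_generators G)" "v \<in> words (nu_generators G)"
  shows "nu.cls (word_conj u v) = conj_elt (nu G) (nu.cls u) (nu.cls v)"
  using assms by (simp add: word_conj_def conj_elt_def nu_def nu.cls_mult nu.cls_inv nu.word_inv_words)

lemma word_comm_words:
  "u \<in> words (nu_generators G) \<Longrightarrow> v \<in> words (nu_generators G) \<Longrightarrow> word_comm u v \<in> words (nu_generators G)"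
  by (simp add: word_comm_def nu.word_inv_words)

lemma tensor_elt_eq:
  "g \<in> carrier G \<Longrightarrow> h \<in> carrier G \<Longrightarrow> tensor_elt G g h = comm_elt (nu G) (lft g) (rgt h)"
  unfolding tensor_elt_def by (rule cls_word_comm) simp_all

lemma nu_relation_lft_rgt:
  assumes g: "a \<in> carrier G" "b \<in> carrier G" "c \<in> carrier G"
  shows "conj_elt (nu G) (comm_elt (nu G) (lft a) (rgt b)) (lft c) =
         conj_elt (nu G) (comm_elt (nu G) (lft a) (rgt b)) (rgt c)"
proof -
  have "(word_conj (word_comm (lw a) (rw b)) (lw c), word_conj (word_comm (lw a) (rw b)) (rw c)) \<in> nu_relations G"
    using g by (auto simp: nu_relations_def)
  from cls_of_relation[OF this] show ?thesis
    using g by (simp only: cls_word_conj cls_word_comm gen_words word_comm_words)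
qed

lemma nu_relation_conj:
  assumes g: "a \<in> carrier G" "b \<in> carrier G" "c \<in> carrier G"
  shows "conj_elt (nu G) (comm_elt (nu G) (lft a) (rgt b)) (rgt c) =
         comm_elt (nu G) (lft (conj_elt G a c)) (rgt (conj_elt G b c))"
proof -
  have "(word_conj (word_comm (lw a) (rw b)) (rw c), word_comm (lw (conj_elt G a c)) (rw (conj_elt G b c))) \<in> nu_relations G"
    using g by (auto simp: nu_relations_def)
  from cls_of_relation[OF this] show ?thesis
    using g by (simp only: cls_word_conj cls_word_comm gen_words word_comm_words conj_elt_closed)
qed

text \<open>Von Dyck's theorem for \<nu>(G): the multiplication tables hold because l and r are
  homomorphisms, and \<open>r1\<close> and \<open>r2\<close> are the two equalities of the remaining
  relations.\<close>

lemma nu_universal: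
  assumes H: "group H" and l: "l \<in> hom G H" and r: "r \<in> hom G H"
    and r1: "\<And>a b c. a \<in> carrier G \<Longrightarrow> b \<in> carrier G \<Longrightarrow> c \<in> carrier G \<Longrightarrow>
      conj_elt H (comm_elt H (l a) (r b)) (l c) = conj_elt H (comm_elt H (l a) (r b)) (r c)"
    and r2: "\<And>a b c. a \<in> carrier G \<Longrightarrow> b \<in> carrier G \<Longrightarrow> c \<in> carrier G \<Longrightarrow>
      conj_elt H (comm_elt H (l a) (r b)) (r c) = comm_elt H (l (conj_elt G a c)) (r (conj_elt G b c))"
  obtains \<Phi> where "\<Phi> \<in> hom (nu G) H" "\<And>g. g \<in> carrier G \<Longrightarrow> \<Phi> (lft g) = l g" "\<And>g. g \<in> carrier G \<Longrightarrow> \<Phi> (rgt g) = r g"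
proof -
  interpret H: group H by fact
  have lc: "l g \<in> carrier H" and rc: "r g \<in> carrier H" if "g \<in> carrier G" for g
    using that hom_in_carrier[OF l] hom_in_carrier[OF r] by auto
  define f where "f = case_sum l r"
  have f: "f \<in> nu_generators G \<rightarrow> carrier H"
    using lc rc by (auto simp: f_def nu_generators_def)
  note app = eval_word_append[OF H f] and cl = eval_word_closed[OF H f]
  have ew_inv: "eval_word H f (word_inv w) = inv\<^bsub>H\<^esub> (eval_word H f w)" if "w \<in> words (nu_generators G)" for w
    using that
  proof (induction w)
    case Nil
    then show ?case by (simp add: word_inv_def)
  next
    case (Cons a w)
    obtain x s where a: "a = (x, s)" by (cases a)
    have x: "x \<in> nu_generators G" and w: "w \<in> words (nu_generators G)" using Cons.prems a by auto
    have fx: "f x \<in> carrier H" using f x by blast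
    have "eval_word H f (word_inv (a # w)) = eval_word H f (word_inv w @ [(x, \<not> s)])"
      by (simp add: word_inv_def a)
    also have "\<dots> = eval_word H f (word_inv w) \<otimes>\<^bsub>H\<^esub> eval_word H f [(x, \<not> s)]"
      by (rule app) (use x w nu.word_inv_words in auto)
    finally show ?case using Cons.IH w fx cl[OF w] by (simp add: a H.inv_mult_group)
  qed
  have comm: "eval_word H f (word_comm u v) = comm_elt H (eval_word H f u) (eval_word H f v)"
    if "u \<in> words (nu_generators G)" "v \<in> words (nu_generators G)" for u v
    using that by (simp add: word_comm_def comm_elt_def app ew_inv nu.word_inv_words)
  have conj: "eval_word H f (word_conj u v) = conj_elt H (eval_word H f u) (eval_word H f v)"
    if "u \<in> words (nu_generators G)" "v \<in> words (nu_generators G)" for u v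
    using that cl by (simp add: word_conj_def conj_elt_def app ew_inv nu.word_inv_words H.m_assoc)
  have lw: "eval_word H f (lw g) = l g" and rw: "eval_word H f (rw g) = r g" if "g \<in> carrier G" for g
    using that lc rc by (auto simp: f_def)
  have "eval_word H f u = eval_word H f v" if "(u, v) \<in> nu_relations G" for u v
    using that[unfolded nu_relations_def]
  proof (elim UnE CollectE exE conjE Pair_inject)
    fix g h assume "u = lw g @ lw h" "v = lw (g \<otimes> h)" "g \<in> carrier G" "h \<in> carrier G"
    then show ?thesis using lw hom_mult[OF l] by (simp only: app gen_words m_closed)
  next
    fix g h assume "u = rw g @ rw h" "v = rw (g \<otimes> h)" "g \<in> carrier G" "h \<in> carrier G"
    then show ?thesis using rw hom_mult[OF r] by (simp only: app gen_words m_closed)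
  next
    fix a b c assume "u = word_conj (word_comm (lw a) (rw b)) (lw c)"
      "v = word_conj (word_comm (lw a) (rw b)) (rw c)" "a \<in> carrier G" "b \<in> carrier G" "c \<in> carrier G"
    then show ?thesis using lw rw r1 by (simp only: conj comm gen_words word_comm_words)
  next
    fix a b c assume "u = word_conj (word_comm (lw a) (rw b)) (rw c)"
      "v = word_comm (lw (conj_elt G a c)) (rw (conj_elt G b c))" "a \<in> carrier G" "b \<in> carrier G" "c \<in> carrier G"
    then show ?thesis using lw rw r2 by (simp only: conj comm gen_words word_comm_words conj_elt_closed)
  qed
  from nu.presentation_hom[OF H f this] obtain \<Phi> where
    \<Phi>: "\<Phi> \<in> hom (nu G) H" "\<And>w. w \<in> words (nu_generators G) \<Longrightarrow> \<Phi> (nu.cls w) = eval_word H f w"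
    unfolding nu_def by blast
  show thesis
    by (rule that[OF \<Phi>(1)]) (simp_all only: \<Phi>(2) gen_words lw rw)
qed

text \<open>What is known about conjugation by the two copies of G spreads from here to conjugation
  by all of \<nu>(G).\<close>

lemma nu_generate: "carrier (nu G) = generate (nu G) (lft ` carrier G \<union> rgt ` carrier G)"
proof
  interpret N: group "nu G" by (rule group_nu)
  let ?X = "lft ` carrier G \<union> rgt ` carrier G"
  have sub: "?X \<subseteq> carrier (nu G)" using lft_hom rgt_hom by (auto simp: hom_def)
  show "generate (nu G) ?X \<subseteq> carrier (nu G)" using N.generate_incl[OF sub] .
  have gen: "nu.cls [a] \<in> generate (nu G) ?X" if "fst a \<in> nu_generators G" for a
  proof -
    obtain x s where a: "a = (x, s)" by (cases a)
    have x: "nu.cls [(x, True)] \<in> ?X" using that a by (auto simp: nu_generators_def)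
    show ?thesis
    proof (cases s)
      case True
      then show ?thesis using generate.incl[OF x] a by simp
    next
      case False
      have "inv\<^bsub>nu G\<^esub> (nu.cls [(x, True)]) = nu.cls [(x, False)]"
        using that a by (simp add: nu_def nu.cls_inv word_inv_def)
      then show ?thesis using generate.inv[OF x, of "nu G"] a False by simp
    qed
  qed
  have "nu.cls w \<in> generate (nu G) ?X" if "w \<in> words (nu_generators G)" for w
    using that
  proof (induction w)
    case Nil
    then show ?case using generate.one[of "nu G" ?X] by (simp add: nu_def nu.cls_one)
  next
    case (Cons a w)
    then have "nu.cls [a] \<otimes>\<^bsub>nu G\<^esub> nu.cls w \<in> generate (nu G) ?X"
      by (intro generate.eng gen) auto
    moreover have "nu.cls [a] \<otimes>\<^bsub>nu G\<^esub> nu.cls w = nu.cls (a # w)"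
      using Cons.prems nu.cls_mult[of "[a]" w] by (simp add: nu_def)
    ultimately show ?case by simp
  qed
  then show "carrier (nu G) \<subseteq> generate (nu G) ?X"
    by (auto simp: nu_def nu.carrier_P)
qed

end

section \<open>The exterior pairing\<close>

text \<open>Identifies a commutator by an equation without inverses; commutators in extensions are
  computed in this form.\<close>

lemma (in group) comm_elt_eq_iff:
  assumes "a \<in> carrier G" "b \<in> carrier G" "c \<in> carrier G"
  shows "comm_elt G a b = c \<longleftrightarrow> a \<otimes> b = b \<otimes> a \<otimes> c"
proof -
  have "b \<otimes> a \<otimes> comm_elt G a b = a \<otimes> b"
    using assms by (simp add: comm_elt_def m_assoc)
  then show ?thesis
    using assms by (metis comm_elt_closed l_cancel m_closed)
qed

lemma (in group) conj_elt_mult: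
  "\<lbrakk>s \<in> carrier G; x \<in> carrier G; y \<in> carrier G\<rbrakk> \<Longrightarrow> conj_elt G s (x \<otimes> y) = conj_elt G (conj_elt G s x) y"
  by (simp add: conj_elt_def inv_mult_group m_assoc)

lemma (in group) conj_elt_one [simp]: "s \<in> carrier G \<Longrightarrow> conj_elt G s \<one> = s"
  by (simp add: conj_elt_def)

lemma (in group) conj_elt_hom:
  "c \<in> carrier G \<Longrightarrow> x \<in> carrier G \<Longrightarrow> y \<in> carrier G \<Longrightarrow> conj_elt G (x \<otimes> y) c = conj_elt G x c \<otimes> conj_elt G y c"
  "c \<in> carrier G \<Longrightarrow> x \<in> carrier G \<Longrightarrow> conj_elt G (inv x) c = inv (conj_elt G x c)"
  "c \<in> carrier G \<Longrightarrow> conj_elt G \<one> c = \<one>"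
  by (simp_all add: conj_elt_def inv_mult_group m_assoc)

lemma (in group_hom) hom_comm_elt:
  "u \<in> carrier G \<Longrightarrow> v \<in> carrier G \<Longrightarrow> h (comm_elt G u v) = comm_elt H (h u) (h v)"
  by (simp add: comm_elt_def)

lemma (in group_hom) hom_conj_elt:
  "u \<in> carrier G \<Longrightarrow> v \<in> carrier G \<Longrightarrow> h (conj_elt G u v) = conj_elt H (h u) (h v)"
  by (simp add: conj_elt_def)

text \<open>Captures \<nu>(G)/\<Delta>(G) by what the calculations use: two copies of G that
  generate, the defining relations, trivial diagonal symbols and the map \<kappa> that identifies
  the copies. Words and cosets are thereby kept out of the calculus of symbols.\<close>

locale nu_quotient = group G + N: group N
  for G :: "('a, 'b) monoid_scheme" (structure) and N :: "('n, 'd) monoid_scheme" +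
  fixes l r :: "'a \<Rightarrow> 'n" and \<kappa> :: "'n \<Rightarrow> 'a"
  assumes l_hom: "l \<in> hom G N" and r_hom: "r \<in> hom G N" and \<kappa>_hom: "\<kappa> \<in> hom N G"
    and \<kappa>_l [simp]: "\<And>g. g \<in> carrier G \<Longrightarrow> \<kappa> (l g) = g"
    and \<kappa>_r [simp]: "\<And>g. g \<in> carrier G \<Longrightarrow> \<kappa> (r g) = g"
    and rel1: "\<And>a b c. a \<in> carrier G \<Longrightarrow> b \<in> carrier G \<Longrightarrow> c \<in> carrier G \<Longrightarrow>
      conj_elt N (comm_elt N (l a) (r b)) (l c) = conj_elt N (comm_elt N (l a) (r b)) (r c)"
    and rel2: "\<And>a b c. a \<in> carrier G \<Longrightarrow> b \<in> carrier G \<Longrightarrow> c \<in> carrier G \<Longrightarrow>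
      conj_elt N (comm_elt N (l a) (r b)) (r c) = comm_elt N (l (conj_elt G a c)) (r (conj_elt G b c))"
    and diag: "\<And>g. g \<in> carrier G \<Longrightarrow> comm_elt N (l g) (r g) = \<one>\<^bsub>N\<^esub>"
    and gen: "carrier N = generate N (l ` carrier G \<union> r ` carrier G)"
begin

sublocale L: group_hom G N l by unfold_locales (rule l_hom)
sublocale R: group_hom G N r by unfold_locales (rule r_hom)
sublocale K: group_hom N G \<kappa> by unfold_locales (rule \<kappa>_hom)

text \<open>\<open>w a b\<close> plays the role of the symbol of a and b in the exterior square, and
  \<open>T\<close> that of the exterior square itself.\<close>

definition "w a b = comm_elt N (l a) (r b)"
definition "T = generate N {w a b | a b. a \<in> carrier G \<and> b \<in> carrier G}"

lemma w_closed [simp]: "a \<in> carrier G \<Longrightarrow> b \<in> carrier G \<Longrightarrow> w a b \<in> carrier N"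
  by (simp add: w_def)

lemma T_subgroup: "subgroup T N"
  unfolding T_def by (rule N.generate_is_subgroup) auto

lemma T_carrier: "t \<in> T \<Longrightarrow> t \<in> carrier N"
  using subgroup.subset[OF T_subgroup] by blast

lemma w_T: "a \<in> carrier G \<Longrightarrow> b \<in> carrier G \<Longrightarrow> w a b \<in> T"
  unfolding T_def by (rule generate.incl) blast

lemma w_conj: "\<lbrakk>a \<in> carrier G; b \<in> carrier G; c \<in> carrier G\<rbrakk> \<Longrightarrow>
    conj_elt N (w a b) (l c) = w (conj_elt G a c) (conj_elt G b c)"
  "\<lbrakk>a \<in> carrier G; b \<in> carrier G; c \<in> carrier G\<rbrakk> \<Longrightarrow>
    conj_elt N (w a b) (r c) = w (conj_elt G a c) (conj_elt G b c)"
  by (simp_all add: w_def rel1 rel2)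

text \<open>By the relations, either copy of c acts on a symbol by conjugating both entries;
  products and inverses inherit this.\<close>

lemma T_conj_gen:
  assumes "s \<in> T" and c: "c \<in> carrier G"
  shows "conj_elt N s (l c) = conj_elt N s (r c) \<and> conj_elt N s (l c) \<in> T"
  using assms(1) unfolding T_def
proof (induction rule: generate.induct)
  case one
  show ?case using c by (simp add: N.conj_elt_hom generate.one)
next
  case (incl h)
  then obtain a b where "a \<in> carrier G" "b \<in> carrier G" "h = w a b" by blast
  then show ?case using c w_T by (simp add: w_conj flip: T_def)
next
  case (inv h)
  then obtain a b where h: "a \<in> carrier G" "b \<in> carrier G" "h = w a b" by blast
  have "w (conj_elt G a c) (conj_elt G b c) \<in> T" using h c w_T by simp
  then show ?case using h c subgroup.m_inv_closed[OF T_subgroup]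
    by (simp add: N.conj_elt_hom w_conj flip: T_def)
next
  case (eng x y)
  then have "x \<in> carrier N" "y \<in> carrier N" using T_carrier by (auto simp: T_def)
  moreover have "conj_elt N x (r c) \<in> T" "conj_elt N y (r c) \<in> T"
    using eng.IH unfolding T_def by metis+
  ultimately show ?case using eng.IH c subgroup.m_closed[OF T_subgroup, of "conj_elt N x (r c)" "conj_elt N y (r c)"]
    by (simp add: N.conj_elt_hom flip: T_def)
qed

text \<open>The two copies of G act alike on \<open>T\<close>, so the action of a product of
  generators depends only on its image under \<kappa>. The element s varies in the induction because
  conjugation by a product is iterated.\<close>

lemma T_conj:
  assumes "n \<in> carrier N" "s \<in> T"
  shows "conj_elt N s n = conj_elt N s (l (\<kappa> n)) \<and> conj_elt N s n \<in> T"
  using assms(1)[unfolded gen] assms(2)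
proof (induction arbitrary: s rule: generate.induct)
  case one
  then show ?case using T_carrier by simp
next
  case (incl h)
  then obtain g where "g \<in> carrier G" "h = l g \<or> h = r g" by blast
  then show ?case using T_conj_gen[OF incl.prems, of g] by auto
next
  case (inv h)
  then obtain g where g: "g \<in> carrier G" "h = l g \<or> h = r g" by blast
  then have "inv\<^bsub>N\<^esub> h = l (inv g) \<or> inv\<^bsub>N\<^esub> h = r (inv g)" by auto
  then show ?case using T_conj_gen[OF inv.prems, of "inv g"] g by auto
next
  case (eng x y)
  have xy: "x \<in> carrier N" "y \<in> carrier N" using eng.hyps gen by auto
  have s: "s \<in> carrier N" using eng.prems T_carrier by blast
  have x: "conj_elt N s x = conj_elt N s (l (\<kappa> x))" "conj_elt N s x \<in> T" using eng.IH(1)[OF eng.prems] by auto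
  have y: "conj_elt N (conj_elt N s x) y = conj_elt N (conj_elt N s x) (l (\<kappa> y))"
    "conj_elt N (conj_elt N s x) y \<in> T" using eng.IH(2)[OF x(2)] by auto
  have "conj_elt N s (x \<otimes>\<^bsub>N\<^esub> y) = conj_elt N (conj_elt N s x) y"
    using s xy by (simp add: N.conj_elt_mult)
  moreover have "conj_elt N s (l (\<kappa> (x \<otimes>\<^bsub>N\<^esub> y))) = conj_elt N (conj_elt N s (l (\<kappa> x))) (l (\<kappa> y))"
    using s xy by (simp add: N.conj_elt_mult)
  ultimately show ?case using x y by simp
qed

lemma T_conj_closed: "s \<in> T \<Longrightarrow> g \<in> carrier G \<Longrightarrow> conj_elt N s (l g) \<in> T"
  using T_conj_gen by blast

lemma \<kappa>_w [simp]: "a \<in> carrier G \<Longrightarrow> b \<in> carrier G \<Longrightarrow> \<kappa> (w a b) = comm_elt G a b"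
  by (simp add: w_def comm_elt_def)

lemma w_mult_left:
  assumes "a \<in> carrier G" "b \<in> carrier G" "c \<in> carrier G"
  shows "w (a \<otimes> b) c = conj_elt N (w a c) (l b) \<otimes>\<^bsub>N\<^esub> w b c"
  using assms by (simp add: w_def comm_elt_def conj_elt_def N.m_assoc N.inv_mult_group)

text \<open>The identity [a, bc] = [a, c] [a, b]^c produces conjugation by the second copy of c; the
  relations trade it for the first.\<close>

lemma w_mult_right:
  assumes "a \<in> carrier G" "b \<in> carrier G" "c \<in> carrier G"
  shows "w a (b \<otimes> c) = w a c \<otimes>\<^bsub>N\<^esub> conj_elt N (w a b) (l c)"
proof -
  have "w a (b \<otimes> c) = w a c \<otimes>\<^bsub>N\<^esub> conj_elt N (w a b) (r c)"
    using assms by (simp add: w_def comm_elt_def conj_elt_def N.m_assoc N.inv_mult_group)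
  then show ?thesis using assms by (simp add: w_conj)
qed

lemma w_one [simp]: "a \<in> carrier G \<Longrightarrow> w a \<one> = \<one>\<^bsub>N\<^esub>" "a \<in> carrier G \<Longrightarrow> w \<one> a = \<one>\<^bsub>N\<^esub>"
  by (simp_all add: w_def comm_elt_def)

lemma w_self [simp]: "a \<in> carrier G \<Longrightarrow> w a a = \<one>\<^bsub>N\<^esub>"
  by (simp add: w_def diag)

text \<open>Expanding the symbol of ab with itself, which is trivial, leaves the conjugate by b of
  the product of the two symbols.\<close>

lemma w_swap:
  assumes a: "a \<in> carrier G" and b: "b \<in> carrier G"
  shows "w b a = inv\<^bsub>N\<^esub> (w a b)"
proof -
  have "\<one>\<^bsub>N\<^esub> = w (a \<otimes> b) (a \<otimes> b)" using a b by simp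
  also have "\<dots> = conj_elt N (w a b) (l b) \<otimes>\<^bsub>N\<^esub> conj_elt N (w b a) (l b)"
    using a b by (subst w_mult_left) (simp_all add: w_mult_right N.conj_elt_hom)
  also have "\<dots> = conj_elt N (w a b \<otimes>\<^bsub>N\<^esub> w b a) (l b)"
    using a b by (simp add: N.conj_elt_hom)
  finally have e: "conj_elt N (w a b \<otimes>\<^bsub>N\<^esub> w b a) (l b) = \<one>\<^bsub>N\<^esub>" by simp
  have "w a b \<otimes>\<^bsub>N\<^esub> w b a = conj_elt N (conj_elt N (w a b \<otimes>\<^bsub>N\<^esub> w b a) (l b)) (l (inv b))"
    using a b by (simp flip: N.conj_elt_mult L.hom_mult)
  then have "w a b \<otimes>\<^bsub>N\<^esub> w b a = \<one>\<^bsub>N\<^esub>"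
    using e b by (simp add: N.conj_elt_hom)
  then have "w a b = inv\<^bsub>N\<^esub> (w b a)" using a b by (intro N.inv_equality[symmetric]) simp_all
  then show ?thesis using a b by simp
qed

text \<open>A second expansion, obtained from bc = (b c b^-1) b. It is compared with the first one
  below, and it makes the adjoined generators act compatibly with multiplication in G.\<close>

lemma w_mult_right':
  assumes a: "a \<in> carrier G" and b: "b \<in> carrier G" and c: "c \<in> carrier G"
  shows "w a (b \<otimes> c) = w a b \<otimes>\<^bsub>N\<^esub> w (conj_elt G a b) c"
proof -
  let ?c = "b \<otimes> c \<otimes> inv b"
  have "b \<otimes> c = ?c \<otimes> b" and c': "conj_elt G ?c b = c"
    using b c by (simp_all add: m_assoc conj_elt_def)
  then have "w a (b \<otimes> c) = w a b \<otimes>\<^bsub>N\<^esub> conj_elt N (w a ?c) (l b)"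
    using w_mult_right[of a ?c b] a b c by simp
  also have "conj_elt N (w a ?c) (l b) = w (conj_elt G a b) c"
    using w_conj(1)[of a ?c b] c' a b c by simp
  finally show ?thesis .
qed

text \<open>The left law applies to [a, b] = a^-1 a^b, and the two expansions of the symbol of a and
  bc identify what remains.\<close>

lemma w_comm_elt:
  assumes a: "a \<in> carrier G" and b: "b \<in> carrier G" and c: "c \<in> carrier G"
  shows "w (comm_elt G a b) c = inv\<^bsub>N\<^esub> (w a b) \<otimes>\<^bsub>N\<^esub> conj_elt N (w a b) (l c)"
proof -
  let ?t = "w a b" and ?ab = "conj_elt G a b"
  have ab: "comm_elt G a b = inv a \<otimes> ?ab"
    using a b by (simp add: comm_elt_def conj_elt_def m_assoc)
  have "\<one>\<^bsub>N\<^esub> = conj_elt N (w a c) (l (inv a)) \<otimes>\<^bsub>N\<^esub> w (inv a) c"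
    using w_mult_left[of a "inv a" c] a c by simp
  then have "conj_elt N (w a c) (l (inv a)) = inv\<^bsub>N\<^esub> w (inv a) c"
    using a c by (intro N.inv_equality[symmetric]) (simp_all del: L.hom_inv)
  then have "w (inv a) c = inv\<^bsub>N\<^esub> (conj_elt N (w a c) (l (inv a)))"
    using a c by simp
  also have "\<dots> = conj_elt N (inv\<^bsub>N\<^esub> w a c) (l (inv a))"
    using N.conj_elt_hom(2)[of "l (inv a)" "w a c"] a c by simp
  finally have "conj_elt N (w (inv a) c) (l ?ab) = conj_elt N (inv\<^bsub>N\<^esub> w a c) (l (comm_elt G a b))"
    unfolding ab using a b c N.conj_elt_mult[of "inv\<^bsub>N\<^esub> w a c" "l (inv a)" "l ?ab"] by simp
  \<comment> \<open>As \<kappa> maps \<open>?t\<close> to [a, b], acting by [a, b] is conjugation by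
    \<open>?t\<close>.\<close>
  also have "\<dots> = conj_elt N (inv\<^bsub>N\<^esub> w a c) ?t"
    using T_conj[of ?t "inv\<^bsub>N\<^esub> w a c"] subgroup.m_inv_closed[OF T_subgroup w_T[OF a c]] a b by simp
  finally have "w (comm_elt G a b) c = conj_elt N (inv\<^bsub>N\<^esub> w a c) ?t \<otimes>\<^bsub>N\<^esub> w ?ab c"
    unfolding ab using w_mult_left[of "inv a" ?ab c] a b c by (simp flip: ab)
  also have "\<dots> = inv\<^bsub>N\<^esub> ?t \<otimes>\<^bsub>N\<^esub> (inv\<^bsub>N\<^esub> w a c \<otimes>\<^bsub>N\<^esub> (?t \<otimes>\<^bsub>N\<^esub> w ?ab c))"
    using a b c by (simp add: conj_elt_def[of N] N.m_assoc)
  \<comment> \<open>Both sides are the symbol of a and bc.\<close>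
  also have "?t \<otimes>\<^bsub>N\<^esub> w ?ab c = w a c \<otimes>\<^bsub>N\<^esub> conj_elt N ?t (l c)"
    using w_mult_right[OF a b c] w_mult_right'[OF a b c] by simp
  finally show ?thesis using a b c by simp
qed

text \<open>Extends the formula for commutators to all of \<open>T\<close>. Both sides obey the same
  product rule, since the conjugation by \<kappa> y that the left law produces is conjugation by
  y.\<close>

lemma w_\<kappa>:
  assumes "t \<in> T" and g: "g \<in> carrier G"
  shows "w (\<kappa> t) g = inv\<^bsub>N\<^esub> t \<otimes>\<^bsub>N\<^esub> conj_elt N t (l g)"
  using assms(1) unfolding T_def
proof (induction rule: generate.induct)
  case one
  show ?case using g by (simp add: N.conj_elt_hom)
next
  case (incl h)
  then obtain a b where h: "a \<in> carrier G" "b \<in> carrier G" "h = w a b" by blast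
  show ?case unfolding h(3) \<kappa>_w[OF h(1,2)] by (rule w_comm_elt[OF h(1,2) g])
next
  case (inv h)
  then obtain a b where h: "a \<in> carrier G" "b \<in> carrier G" "h = w a b" by blast
  \<comment> \<open>The inverse of a symbol is the symbol with its entries exchanged, so the case of
    a generator applies again.\<close>
  show ?case unfolding h(3) w_swap[OF h(1,2), symmetric] \<kappa>_w[OF h(2,1)] by (rule w_comm_elt[OF h(2,1) g])
next
  case (eng x y)
  have T: "x \<in> T" "y \<in> T" using eng.hyps by (auto simp: T_def)
  then have xy: "x \<in> carrier N" "y \<in> carrier N" using T_carrier by auto
  have "w (\<kappa> (x \<otimes>\<^bsub>N\<^esub> y)) g = conj_elt N (w (\<kappa> x) g) (l (\<kappa> y)) \<otimes>\<^bsub>N\<^esub> w (\<kappa> y) g"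
    using xy g w_mult_left by simp
  also have "conj_elt N (w (\<kappa> x) g) (l (\<kappa> y)) = conj_elt N (w (\<kappa> x) g) y"
    using T_conj[OF xy(2) w_T] xy g by simp
  finally show ?case
    using eng.IH xy g by (simp add: conj_elt_def N.m_assoc N.inv_mult_group)
qed

text \<open>The element \<kappa> s acts on t as s does, so the formula becomes t^-1 t^s. It makes
  \<open>T\<close> itself the start of the tower of lifts.\<close>

lemma w_\<kappa>_\<kappa>: "t \<in> T \<Longrightarrow> s \<in> T \<Longrightarrow> w (\<kappa> t) (\<kappa> s) = comm_elt N t s"
  using w_\<kappa>[of t "\<kappa> s"] T_conj[of s t] T_carrier[of s] T_carrier[of t]
  by (simp add: comm_elt_def conj_elt_def N.m_assoc)

text \<open>For fixed b, the elements whose symbol with b is trivial form a subgroup; swapping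
  handles the second power. It is needed because an adjoined generator commutes with its own
  powers.\<close>

lemma w_powers:
  assumes g: "g \<in> carrier G"
  shows "w (g [^] (i::int)) (g [^] (j::int)) = \<one>\<^bsub>N\<^esub>"
proof -
  have sub: "subgroup {a \<in> carrier G. w a b = \<one>\<^bsub>N\<^esub>} G" if b: "b \<in> carrier G" for b
  proof (rule subgroupI)
    fix a assume a: "a \<in> {a \<in> carrier G. w a b = \<one>\<^bsub>N\<^esub>}"
    then show "inv a \<in> {a \<in> carrier G. w a b = \<one>\<^bsub>N\<^esub>}"
      using w_mult_left[of a "inv a" b] b by (simp add: N.conj_elt_hom)
    fix a' assume "a' \<in> {a \<in> carrier G. w a b = \<one>\<^bsub>N\<^esub>}"
    then show "a \<otimes> a' \<in> {a \<in> carrier G. w a b = \<one>\<^bsub>N\<^esub>}"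
      using a w_mult_left[of a a' b] b by (simp add: N.conj_elt_hom)
  qed (use b in auto)
  have pw: "w (b [^] k) b' = \<one>\<^bsub>N\<^esub>" if "b \<in> carrier G" "b' \<in> carrier G" "w b b' = \<one>\<^bsub>N\<^esub>" for b b' and k :: int
    using subgroup_int_pow_closed[OF sub[OF that(2)], of b k] that by simp
  have "w (g [^] j) g = \<one>\<^bsub>N\<^esub>" using g by (intro pw) auto
  then have "w g (g [^] j) = \<one>\<^bsub>N\<^esub>" using w_swap[of "g [^] j" g] g by simp
  then show ?thesis using g by (intro pw) auto
qed

text \<open>No inverses occur, since exchanging the entries inverts a symbol.\<close>

lemma T_products:
  assumes "t \<in> T"
  obtains ps where "set ps \<subseteq> carrier G \<times> carrier G" "t = foldr (\<lambda>(a, b) x. w a b \<otimes>\<^bsub>N\<^esub> x) ps \<one>\<^bsub>N\<^esub>"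
proof -
  let ?f = "\<lambda>ps. foldr (\<lambda>(a, b) x. w a b \<otimes>\<^bsub>N\<^esub> x) ps"
  have cl: "?f ps x \<in> carrier N" if "set ps \<subseteq> carrier G \<times> carrier G" "x \<in> carrier N" for ps x
    using that by (induction ps) auto
  have app: "?f ps \<one>\<^bsub>N\<^esub> \<otimes>\<^bsub>N\<^esub> x = ?f ps x" if "set ps \<subseteq> carrier G \<times> carrier G" "x \<in> carrier N" for ps x
    using that cl by (induction ps) (auto simp: N.m_assoc)
  have "\<exists>ps. set ps \<subseteq> carrier G \<times> carrier G \<and> t = ?f ps \<one>\<^bsub>N\<^esub>"
    using assms unfolding T_def
  proof (induction rule: generate.induct)
    case one
    show ?case by (rule exI[of _ "[]"]) simp
  next
    case (incl h)
    then obtain a b where "a \<in> carrier G" "b \<in> carrier G" "h = w a b" by blast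
    then show ?case by (intro exI[of _ "[(a, b)]"]) simp
  next
    case (inv h)
    then obtain a b where h: "a \<in> carrier G" "b \<in> carrier G" "h = w a b" by blast
    then have "inv\<^bsub>N\<^esub> h = w b a" using w_swap[OF h(1,2)] by simp
    with h show ?case by (intro exI[of _ "[(b, a)]"]) simp
  next
    case (eng x y)
    then obtain ps qs where "set ps \<subseteq> carrier G \<times> carrier G" "x = ?f ps \<one>\<^bsub>N\<^esub>"
      "set qs \<subseteq> carrier G \<times> carrier G" "y = ?f qs \<one>\<^bsub>N\<^esub>" by blast
    then show ?case using app[of ps "?f qs \<one>\<^bsub>N\<^esub>"] cl[of qs "\<one>\<^bsub>N\<^esub>"]
      by (intro exI[of _ "ps @ qs"]) simp
  qed
  with that show thesis by blast
qed

end

section \<open>Groups over G whose commutators are the symbols\<close>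

context nu_quotient begin

text \<open>The map \<pi> need not be onto G. Since a symbol with an entry 1 is trivial, elements
  over 1 are central; so E is a central extension of the image of \<pi>, with \<open>T\<close> as
  the place where its commutators live.\<close>

definition exterior_lift :: "('y, 'z) monoid_scheme \<Rightarrow> ('y \<Rightarrow> 'a) \<Rightarrow> ('n \<Rightarrow> 'y) \<Rightarrow> bool" where
  "exterior_lift E \<pi> \<iota> \<longleftrightarrow> group E \<and> \<pi> \<in> hom E G \<and> \<iota> \<in> hom (N\<lparr>carrier := T\<rparr>) E \<and> inj_on \<iota> T \<and>
     (\<forall>t\<in>T. \<pi> (\<iota> t) = \<kappa> t) \<and>
     (\<forall>u\<in>carrier E. \<forall>v\<in>carrier E. comm_elt E u v = \<iota> (w (\<pi> u) (\<pi> v)))"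

lemma T_group: "group (N\<lparr>carrier := T\<rparr>)"
  by (rule N.subgroup_imp_group[OF T_subgroup])

lemma exterior_lift_T: "exterior_lift (N\<lparr>carrier := T\<rparr>) \<kappa> (\<lambda>t. t)"
proof -
  have "comm_elt (N\<lparr>carrier := T\<rparr>) s t = comm_elt N s t" if "s \<in> T" "t \<in> T" for s t
    using that by (simp add: comm_elt_def N.m_inv_consistent[OF T_subgroup])
  then show ?thesis
    using T_group w_\<kappa>_\<kappa> T_carrier by (auto simp: exterior_lift_def hom_def)
qed

text \<open>Adjoining a generator changes the type of the group. Transport along an injection brings
  it back to the type fixed by the induction.\<close>

lemma exterior_lift_image:
  assumes lift: "exterior_lift E \<pi> \<iota>" and inj: "inj_on e (carrier E)"
  shows "exterior_lift (image_group e E) (\<lambda>x. \<pi> (inv_into (carrier E) e x)) (\<lambda>t. e (\<iota> t))"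
proof -
  interpret E: group E using lift by (simp add: exterior_lift_def)
  let ?E = "image_group e E" and ?i = "inv_into (carrier E) e"
  have gE: "group ?E" by (rule E.inj_imp_image_group_is_group[OF inj])
  have e: "e \<in> hom E ?E" using inj_imp_image_group_iso[OF inj] by (simp add: iso_def)
  have car: "carrier ?E = e ` carrier E" by (simp add: image_group_carrier)
  have i: "?i (e u) = u" if "u \<in> carrier E" for u by (rule inv_into_f_f[OF inj that])
  have \<pi>: "\<pi> \<in> hom E G" and \<iota>: "\<iota> \<in> hom (N\<lparr>carrier := T\<rparr>) E" using lift by (simp_all add: exterior_lift_def)
  have \<iota>c: "\<iota> t \<in> carrier E" if "t \<in> T" for t using hom_in_carrier[OF \<iota>] that by simp
  show ?thesis
    unfolding exterior_lift_def
  proof (intro conjI ballI)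
    show "group ?E" by fact
    show "(\<lambda>x. \<pi> (?i x)) \<in> hom ?E G"
    proof (rule homI)
      fix x assume "x \<in> carrier ?E"
      then obtain u where u: "u \<in> carrier E" "x = e u" by (auto simp: car)
      show "\<pi> (?i x) \<in> carrier G" using u i hom_in_carrier[OF \<pi>] by simp
      fix y assume "y \<in> carrier ?E"
      then obtain v where v: "v \<in> carrier E" "y = e v" by (auto simp: car)
      have "x \<otimes>\<^bsub>?E\<^esub> y = e (u \<otimes>\<^bsub>E\<^esub> v)" using hom_mult[OF e u(1) v(1)] u v by simp
      then show "\<pi> (?i (x \<otimes>\<^bsub>?E\<^esub> y)) = \<pi> (?i x) \<otimes> \<pi> (?i y)"
        using u v i hom_mult[OF \<pi>] by simp
    qed
    show "(\<lambda>t. e (\<iota> t)) \<in> hom (N\<lparr>carrier := T\<rparr>) ?E" by (rule hom_comp[OF \<iota> e])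
    show "inj_on (\<lambda>t. e (\<iota> t)) T"
      using lift inj \<iota>c by (auto simp: exterior_lift_def inj_on_def)
    show "\<pi> (?i (e (\<iota> t))) = \<kappa> t" if "t \<in> T" for t
      using lift that \<iota>c i by (simp add: exterior_lift_def)
    fix x y assume "x \<in> carrier ?E" "y \<in> carrier ?E"
    then obtain u v where u: "u \<in> carrier E" "x = e u" "v \<in> carrier E" "y = e v" by (auto simp: car)
    have "comm_elt ?E x y = e (comm_elt E u v)"
      unfolding u(2,4)
      by (rule group_hom.hom_comm_elt[OF group_homI[OF E.is_group gE e] u(1,3), symmetric])
    then show "comm_elt ?E x y = e (\<iota> (w (\<pi> (?i x)) (\<pi> (?i y))))"
      using u i lift by (simp add: exterior_lift_def)
  qed
qed

text \<open>
  Adjoins an element \<open>y\<close> over \<open>g\<close>: the lift is extended by the infinite cyclic group on \<open>y\<close>, which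
  acts by \<open>u\<^sup>y = u [u, y]\<close> with the commutator \<open>[u, y]\<close> prescribed by the pairing. The pair \<open>(k, u)\<close>
  stands for \<open>y\<^sup>k u\<close>. The prescribed commutators remain correct on all of the larger group because
  \<open>g \<and> g = 1\<close>.
\<close>

lemma exterior_lift_extend:
  fixes E :: "('y, 'z) monoid_scheme"
  assumes lift: "exterior_lift E \<pi> \<iota>" and g: "g \<in> carrier G"
  obtains E' :: "(int \<times> 'y) monoid" and \<pi>' \<iota>'
  where "exterior_lift E' \<pi>' \<iota>'" "g \<in> \<pi>' ` carrier E'" "\<pi> ` carrier E \<subseteq> \<pi>' ` carrier E'"
proof -
  interpret E: group E using lift by (simp add: exterior_lift_def)
  have \<pi>: "\<pi> \<in> hom E G" and \<iota>: "\<iota> \<in> hom (N\<lparr>carrier := T\<rparr>) E" and \<iota>_inj: "inj_on \<iota> T"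
    and \<pi>\<iota>: "\<And>t. t \<in> T \<Longrightarrow> \<pi> (\<iota> t) = \<kappa> t"
    and comm: "\<And>u v. u \<in> carrier E \<Longrightarrow> v \<in> carrier E \<Longrightarrow> comm_elt E u v = \<iota> (w (\<pi> u) (\<pi> v))"
    using lift by (simp_all add: exterior_lift_def)
  interpret p: group_hom E G \<pi> by unfold_locales (rule \<pi>)
  have \<iota>c [simp]: "\<iota> t \<in> carrier E" if "t \<in> T" for t using hom_in_carrier[OF \<iota>] that by simp
  have \<iota>m: "\<iota> (s \<otimes>\<^bsub>N\<^esub> t) = \<iota> s \<otimes>\<^bsub>E\<^esub> \<iota> t" if "s \<in> T" "t \<in> T" for s t
    using hom_mult[OF \<iota>, of s t] that by simp
  have \<iota>1: "\<iota> \<one>\<^bsub>N\<^esub> = \<one>\<^bsub>E\<^esub>" using hom_one[OF \<iota> T_group E.is_group] by simp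
  have \<iota>i: "\<iota> (inv\<^bsub>N\<^esub> t) = inv\<^bsub>E\<^esub> \<iota> t" if "t \<in> T" for t
    using group_hom.hom_inv[OF group_homI[OF T_group E.is_group \<iota>], of t] that
    by (simp add: N.m_inv_consistent[OF T_subgroup])
  \<comment> \<open>The commutator of \<iota> t and v is known twice, from \<open>comm\<close> and
    from the formula for the symbol of \<kappa> t and \<pi> v.\<close>
  have conj_\<iota>: "\<iota> (conj_elt N t (l (\<pi> v))) = conj_elt E (\<iota> t) v" if t: "t \<in> T" and v: "v \<in> carrier E" for t v
  proof -
    have T: "conj_elt N t (l (\<pi> v)) \<in> T" "inv\<^bsub>N\<^esub> t \<in> T"
      using T_conj_closed[OF t p.hom_closed[OF v]] subgroup.m_inv_closed[OF T_subgroup t] by auto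
    have "comm_elt E (\<iota> t) v = \<iota> (inv\<^bsub>N\<^esub> t \<otimes>\<^bsub>N\<^esub> conj_elt N t (l (\<pi> v)))"
      using comm[OF \<iota>c[OF t] v] w_\<kappa>[OF t p.hom_closed[OF v]] \<pi>\<iota>[OF t] by simp
    also have "\<dots> = inv\<^bsub>E\<^esub> \<iota> t \<otimes>\<^bsub>E\<^esub> \<iota> (conj_elt N t (l (\<pi> v)))"
      using \<iota>m[OF T(2,1)] \<iota>i[OF t] by simp
    also have "comm_elt E (\<iota> t) v = inv\<^bsub>E\<^esub> \<iota> t \<otimes>\<^bsub>E\<^esub> conj_elt E (\<iota> t) v"
      using t v by (simp add: comm_elt_def conj_elt_def E.m_assoc)
    finally show ?thesis using t v T by simp
  qed
  \<comment> \<open>The conjugate of u by an element over h, with the commutator replaced by the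
    symbol it has to equal. The left law makes it multiplicative in u, the second right law makes it
    an action in h.\<close>
  define \<alpha> where "\<alpha> h u = u \<otimes>\<^bsub>E\<^esub> \<iota> (w (\<pi> u) h)" for h u
  have wT [simp]: "w (\<pi> u) h \<in> T" if "u \<in> carrier E" "h \<in> carrier G" for u h
    using that w_T by simp
  have \<alpha>c [simp]: "\<alpha> h u \<in> carrier E" if "u \<in> carrier E" "h \<in> carrier G" for u h
    using that by (simp add: \<alpha>_def)
  have \<alpha>m: "\<alpha> h (u \<otimes>\<^bsub>E\<^esub> v) = \<alpha> h u \<otimes>\<^bsub>E\<^esub> \<alpha> h v" if "u \<in> carrier E" "v \<in> carrier E" "h \<in> carrier G" for u v h
  proof -
    have "w (\<pi> (u \<otimes>\<^bsub>E\<^esub> v)) h = conj_elt N (w (\<pi> u) h) (l (\<pi> v)) \<otimes>\<^bsub>N\<^esub> w (\<pi> v) h"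
      using that w_mult_left by simp
    then have "\<iota> (w (\<pi> (u \<otimes>\<^bsub>E\<^esub> v)) h) = conj_elt E (\<iota> (w (\<pi> u) h)) v \<otimes>\<^bsub>E\<^esub> \<iota> (w (\<pi> v) h)"
      using that \<iota>m[OF T_conj_closed] conj_\<iota> by simp
    then show ?thesis using that by (simp add: \<alpha>_def conj_elt_def E.m_assoc del: p.hom_mult)
  qed
  have \<pi>\<alpha>: "\<pi> (\<alpha> h u) = conj_elt G (\<pi> u) h" if "u \<in> carrier E" "h \<in> carrier G" for u h
    using that \<pi>\<iota> by (simp add: \<alpha>_def comm_elt_def conj_elt_def m_assoc)
  have \<alpha>\<alpha>: "\<alpha> h (\<alpha> h' u) = \<alpha> (h' \<otimes> h) u" if "u \<in> carrier E" "h \<in> carrier G" "h' \<in> carrier G" for u h h'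
  proof -
    have "\<alpha> h (\<alpha> h' u) = u \<otimes>\<^bsub>E\<^esub> (\<iota> (w (\<pi> u) h') \<otimes>\<^bsub>E\<^esub> \<iota> (w (conj_elt G (\<pi> u) h') h))"
      unfolding \<alpha>_def[of h] \<pi>\<alpha>[OF that(1,3)] using that w_T by (simp add: \<alpha>_def E.m_assoc)
    also have "\<dots> = u \<otimes>\<^bsub>E\<^esub> \<iota> (w (\<pi> u) (h' \<otimes> h))"
      using that w_T \<iota>m w_mult_right' by simp
    finally show ?thesis by (simp add: \<alpha>_def)
  qed
  have \<alpha>1: "\<alpha> \<one> u = u" if "u \<in> carrier E" for u using that \<iota>1 by (simp add: \<alpha>_def)
  define y where "y k = g [^] (k::int)" for k
  have yc [simp]: "y k \<in> carrier G" for k using g by (simp add: y_def)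
  have y_add: "y (j + k) = y j \<otimes> y k" for j k using g by (simp add: y_def int_pow_mult)
  have y0 [simp]: "y 0 = \<one>" by (simp add: y_def)
  have y1: "y 1 = g" using g by (simp add: y_def)
  have wyy: "w (y j) (y k) = \<one>\<^bsub>N\<^esub>" for j k unfolding y_def by (rule w_powers[OF g])
  define E' :: "(int \<times> 'y) monoid" where
    "E' = \<lparr>carrier = UNIV \<times> carrier E, monoid.mult = (\<lambda>(k, u) (j, v). (k + j, \<alpha> (y j) u \<otimes>\<^bsub>E\<^esub> v)), one = (0, \<one>\<^bsub>E\<^esub>)\<rparr>"
  have E'm: "(k, u) \<otimes>\<^bsub>E'\<^esub> (j, v) = (k + j, \<alpha> (y j) u \<otimes>\<^bsub>E\<^esub> v)" for k u j v by (simp add: E'_def)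
  have E'c: "(k, u) \<in> carrier E' \<longleftrightarrow> u \<in> carrier E" for k u by (simp add: E'_def)
  have E'1: "\<one>\<^bsub>E'\<^esub> = (0, \<one>\<^bsub>E\<^esub>)" by (simp add: E'_def)
  have \<alpha>yy: "\<alpha> (y i) (\<alpha> (y j) u) = \<alpha> (y (j + i)) u" if "u \<in> carrier E" for i j u
    using \<alpha>\<alpha>[OF that] by (simp add: y_add)
  have \<alpha>_one: "\<alpha> h \<one>\<^bsub>E\<^esub> = \<one>\<^bsub>E\<^esub>" if "h \<in> carrier G" for h using that \<iota>1 by (simp add: \<alpha>_def)
  have grp: "group E'"
  proof (rule groupI)
    fix p q assume p: "p \<in> carrier E'" and q: "q \<in> carrier E'"
    obtain k u j v where pq: "p = (k, u)" "q = (j, v)" by (cases p, cases q)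
    show "p \<otimes>\<^bsub>E'\<^esub> q \<in> carrier E'" using p q by (simp add: pq E'm E'c)
    fix s assume s: "s \<in> carrier E'"
    obtain i z where s': "s = (i, z)" by (cases s)
    show "p \<otimes>\<^bsub>E'\<^esub> q \<otimes>\<^bsub>E'\<^esub> s = p \<otimes>\<^bsub>E'\<^esub> (q \<otimes>\<^bsub>E'\<^esub> s)"
      using p q s by (simp add: pq s' E'm E'c \<alpha>m \<alpha>yy E.m_assoc add.assoc)
  next
    fix p assume p: "p \<in> carrier E'"
    obtain k u where p': "p = (k, u)" by (cases p)
    show "\<one>\<^bsub>E'\<^esub> \<otimes>\<^bsub>E'\<^esub> p = p" using p by (simp add: p' E'm E'c E'1 \<alpha>_one)
    have "(- k, \<alpha> (y (- k)) (inv\<^bsub>E\<^esub> u)) \<otimes>\<^bsub>E'\<^esub> p = \<one>\<^bsub>E'\<^esub>"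
      using p by (simp add: p' E'm E'c E'1 \<alpha>yy \<alpha>1)
    then show "\<exists>q\<in>carrier E'. q \<otimes>\<^bsub>E'\<^esub> p = \<one>\<^bsub>E'\<^esub>"
      using p by (intro bexI[of _ "(- k, \<alpha> (y (- k)) (inv\<^bsub>E\<^esub> u))"]) (simp_all add: p' E'c)
  qed (simp add: E'1 E'c)
  interpret E': group E' by (rule grp)
  define \<pi>' where "\<pi>' = (\<lambda>(k, u). y k \<otimes> \<pi> u)"
  define \<iota>' where "\<iota>' t = (0::int, \<iota> t)" for t
  have "exterior_lift E' \<pi>' \<iota>'"
    unfolding exterior_lift_def
  proof (intro conjI ballI)
    show "\<pi>' \<in> hom E' G"
    proof (rule homI)
      fix p q assume p: "p \<in> carrier E'"
      obtain k u where p': "p = (k, u)" by (cases p)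
      show "\<pi>' p \<in> carrier G" using p by (simp add: \<pi>'_def p' E'c)
      assume q: "q \<in> carrier E'"
      obtain j v where q': "q = (j, v)" by (cases q)
      show "\<pi>' (p \<otimes>\<^bsub>E'\<^esub> q) = \<pi>' p \<otimes> \<pi>' q"
        using p q by (simp add: \<pi>'_def p' q' E'c E'm \<pi>\<alpha> y_add conj_elt_def m_assoc)
    qed
    show "\<iota>' \<in> hom (N\<lparr>carrier := T\<rparr>) E'"
      by (rule homI) (simp_all add: \<iota>'_def E'c E'm \<alpha>1 \<iota>m)
    show "inj_on \<iota>' T" using \<iota>_inj by (auto simp: inj_on_def \<iota>'_def)
    show "\<pi>' (\<iota>' t) = \<kappa> t" if "t \<in> T" for t using that T_carrier[OF that] \<pi>\<iota> by (simp add: \<pi>'_def \<iota>'_def)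
    fix p q assume p: "p \<in> carrier E'" and q: "q \<in> carrier E'"
    obtain k u j v where pq: "p = (k, u)" "q = (j, v)" by (cases p, cases q)
    have u: "u \<in> carrier E" and v: "v \<in> carrier E" using p q by (simp_all add: pq E'c)
    let ?a = "\<pi> u" and ?b = "\<pi> v" and ?x = "y k" and ?y = "y j"
    have ab [simp]: "?a \<in> carrier G" "?b \<in> carrier G" using u v by auto
    \<comment> \<open>The symbol of two powers of g drops out of this expansion.\<close>
    have "w (?x \<otimes> ?a) (?y \<otimes> ?b) = conj_elt N (w ?x ?b) (l ?a) \<otimes>\<^bsub>N\<^esub> (w ?a ?b \<otimes>\<^bsub>N\<^esub> conj_elt N (w ?a ?y) (l ?b))"
      by (simp add: w_mult_left w_mult_right[of _ ?y] wyy N.conj_elt_hom N.m_assoc)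
    also have "\<iota> \<dots> = conj_elt E (\<iota> (w ?x ?b)) u \<otimes>\<^bsub>E\<^esub> (comm_elt E u v \<otimes>\<^bsub>E\<^esub> conj_elt E (\<iota> (w ?a ?y)) v)"
      using u v w_T conj_\<iota> by (simp add: \<iota>m T_conj_closed subgroup.m_closed[OF T_subgroup] comm)
    finally have W: "\<iota> (w (?x \<otimes> ?a) (?y \<otimes> ?b)) =
        conj_elt E (\<iota> (w ?x ?b)) u \<otimes>\<^bsub>E\<^esub> (comm_elt E u v \<otimes>\<^bsub>E\<^esub> conj_elt E (\<iota> (w ?a ?y)) v)" .
    have wx: "\<iota> (w ?x ?b) = inv\<^bsub>E\<^esub> \<iota> (w ?b ?x)"
      using w_swap[of ?b ?x] \<iota>i[OF w_T[of ?b ?x]] by simp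
    have [simp]: "\<iota> (w ?b ?x) \<in> carrier E" "\<iota> (w ?a ?y) \<in> carrier E" using w_T by simp_all
    \<comment> \<open>The second coordinate of the equation p q = q p [p, q]; in this form no
      inverse in E' has to be computed.\<close>
    have "\<alpha> ?x v \<otimes>\<^bsub>E\<^esub> u \<otimes>\<^bsub>E\<^esub> \<iota> (w (?x \<otimes> ?a) (?y \<otimes> ?b)) = \<alpha> ?y u \<otimes>\<^bsub>E\<^esub> v"
      unfolding W wx \<alpha>_def using u v by (simp add: comm_elt_def conj_elt_def E.m_assoc)
    then have "p \<otimes>\<^bsub>E'\<^esub> q = q \<otimes>\<^bsub>E'\<^esub> p \<otimes>\<^bsub>E'\<^esub> \<iota>' (w (\<pi>' p) (\<pi>' q))"
      using u v by (simp add: pq E'm \<pi>'_def \<iota>'_def \<alpha>1 add.commute)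
    moreover have "\<iota>' (w (\<pi>' p) (\<pi>' q)) \<in> carrier E'"
      using u v w_T by (simp add: pq \<pi>'_def \<iota>'_def E'c)
    ultimately show "comm_elt E' p q = \<iota>' (w (\<pi>' p) (\<pi>' q))"
      using E'.comm_elt_eq_iff[OF p q] by blast
  qed (rule grp)
  moreover have "g \<in> \<pi>' ` carrier E'"
    by (rule image_eqI[of _ _ "(1, \<one>\<^bsub>E\<^esub>)"]) (use g in \<open>simp_all add: \<pi>'_def y1 E'c\<close>)
  moreover have "\<pi> ` carrier E \<subseteq> \<pi>' ` carrier E'"
  proof (rule image_subsetI)
    fix u assume u: "u \<in> carrier E"
    show "\<pi> u \<in> \<pi>' ` carrier E'"
      by (rule image_eqI[of _ _ "(0, u)"]) (use u in \<open>simp_all add: \<pi>'_def E'c\<close>)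
  qed
  ultimately show thesis by (rule that)
qed

text \<open>An element of the iterated extension is an element of \<open>T\<close> together with one
  exponent for each adjoined generator. A list of integers holds any number of exponents in a single
  type.\<close>

lemma exterior_lift_over:
  assumes "finite S" "S \<subseteq> carrier G"
  shows "\<exists>(E :: ('n \<times> int list) monoid) \<pi> \<iota>. exterior_lift E \<pi> \<iota> \<and> S \<subseteq> \<pi> ` carrier E"
  using assms
proof (induction S rule: finite_induct)
  case empty
  have "exterior_lift (image_group (\<lambda>t. (t, [] :: int list)) (N\<lparr>carrier := T\<rparr>))
     (\<lambda>x. \<kappa> (inv_into (carrier (N\<lparr>carrier := T\<rparr>)) (\<lambda>t. (t, [])) x)) (\<lambda>t. (t, []))"
    by (rule exterior_lift_image[OF exterior_lift_T]) (auto simp: inj_on_def)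
  then show ?case by blast
next
  case (insert g S)
  then obtain E :: "('n \<times> int list) monoid" and \<pi> \<iota> where E: "exterior_lift E \<pi> \<iota>" "S \<subseteq> \<pi> ` carrier E"
    by auto
  from insert.prems have "g \<in> carrier G" by simp
  from exterior_lift_extend[OF E(1) this] obtain E' :: "(int \<times> 'n \<times> int list) monoid" and \<pi>' \<iota>' where
    E': "exterior_lift E' \<pi>' \<iota>'" "g \<in> \<pi>' ` carrier E'" "\<pi> ` carrier E \<subseteq> \<pi>' ` carrier E'" by blast
  \<comment> \<open>The exponent of the new generator goes to the front of the list.\<close>
  let ?e = "\<lambda>(k, t, ks). (t :: 'n, k # ks :: int list)"
  have inj: "inj_on ?e (carrier E')" by (auto simp: inj_on_def)
  let ?\<pi> = "\<lambda>x. \<pi>' (inv_into (carrier E') ?e x)"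
  have "\<pi>' ` carrier E' \<subseteq> ?\<pi> ` carrier (image_group ?e E')"
  proof (rule image_subsetI)
    fix u assume u: "u \<in> carrier E'"
    show "\<pi>' u \<in> ?\<pi> ` carrier (image_group ?e E')"
      by (rule image_eqI[of _ _ "?e u"]) (use u in \<open>simp_all only: inv_into_f_f[OF inj] image_group_carrier imageI\<close>)
  qed
  then have "insert g S \<subseteq> ?\<pi> ` carrier (image_group ?e E')" using E(2) E'(2,3) by blast
  with exterior_lift_image[OF E'(1) inj] show ?case by blast
qed

end

section \<open>Maps into central extensions\<close>

primrec comm_prod :: "('a, 'x) monoid_scheme \<Rightarrow> ('a \<times> 'a) list \<Rightarrow> 'a" where
  "comm_prod G [] = \<one>\<^bsub>G\<^esub>"
| "comm_prod G (p # ps) = comm_elt G (fst p) (snd p) \<otimes>\<^bsub>G\<^esub> comm_prod G ps"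

text \<open>
  The 2-chain that computes a product of commutators in every central extension of \<open>G\<close>; it comes
  from \<open>[u, v] = (v u)\<^sup>-\<^sup>1 u v\<close> and \<open>g h = h g [g, h]\<close>.
\<close>

primrec comm_chain :: "('a, 'x) monoid_scheme \<Rightarrow> ('a \<times> 'a) list \<Rightarrow> 'a list \<Rightarrow> int" where
  "comm_chain G [] = single integer_group [\<one>\<^bsub>G\<^esub>, \<one>\<^bsub>G\<^esub>] (- 1)"
| "comm_chain G (p # ps) = (\<lambda>xs.
     single integer_group [fst p, snd p] 1 xs + (single integer_group [snd p, fst p] (- 1) xs +
     (single integer_group [snd p \<otimes>\<^bsub>G\<^esub> fst p, comm_elt G (fst p) (snd p)] (- 1) xs +
     (single integer_group [comm_elt G (fst p) (snd p), comm_prod G ps] 1 xs + comm_chain G ps xs))))"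

text \<open>The chain has boundary -[c], where c is the product of commutators. If c = 1, the term
  [1 | 1], whose boundary is [1], closes it up.\<close>

definition comm_cycle :: "('a, 'x) monoid_scheme \<Rightarrow> ('a \<times> 'a) list \<Rightarrow> 'a list \<Rightarrow> int" where
  "comm_cycle G ps = (\<lambda>xs. comm_chain G ps xs + single integer_group [\<one>\<^bsub>G\<^esub>, \<one>\<^bsub>G\<^esub>] 1 xs)"

lemma int_chain_add:
  "c \<in> carrier (fin_chains integer_group V) \<Longrightarrow> c' \<in> carrier (fin_chains integer_group V) \<Longrightarrow>
   (\<lambda>x. c x + c' x) \<in> carrier (fin_chains integer_group V)"
  using comm_group_fin_chains[OF abelian_integer_group, of V]
    monoid.m_closed[of "fin_chains integer_group V" c c']
  by (simp add: comm_group_def comm_monoid_def)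

lemma hom_int_chain_add:
  "F \<in> hom (fin_chains integer_group V) D \<Longrightarrow>
   c \<in> carrier (fin_chains integer_group V) \<Longrightarrow> c' \<in> carrier (fin_chains integer_group V) \<Longrightarrow>
   F (\<lambda>x. c x + c' x) = F c \<otimes>\<^bsub>D\<^esub> F c'"
  using hom_mult[of F "fin_chains integer_group V" D c c'] by simp

context group begin

lemma comm_prod_closed [simp]: "set ps \<subseteq> carrier G \<times> carrier G \<Longrightarrow> comm_prod G ps \<in> carrier G"
  by (induction ps) auto

lemma pair_single_closed:
  "a \<in> carrier G \<Longrightarrow> b \<in> carrier G \<Longrightarrow> single integer_group [a, b] k \<in> carrier (fin_chains integer_group (tuples G 2))"
  by (rule single_closed[OF abelian_integer_group]) (simp_all add: tuples_def)

lemma comm_chain_closed: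
  "set ps \<subseteq> carrier G \<times> carrier G \<Longrightarrow> comm_chain G ps \<in> carrier (fin_chains integer_group (tuples G 2))"
proof (induction ps)
  case Nil
  then show ?case by (simp add: pair_single_closed)
next
  case (Cons p ps)
  then have "fst p \<in> carrier G" "snd p \<in> carrier G" "set ps \<subseteq> carrier G \<times> carrier G" by auto
  then show ?case using Cons.IH
    unfolding comm_chain.simps by (intro int_chain_add pair_single_closed) simp_all
qed

text \<open>With c = [a, b] and k the remaining product, the boundaries of the four pairs cancel
  down to [k] - [ck], because b a c = a b; the rest of the chain contributes -[k].\<close>

lemma bdry_comm_chain:
  "set ps \<subseteq> carrier G \<times> carrier G \<Longrightarrow>
   bdry G integer_group 2 (comm_chain G ps) y = single integer_group [comm_prod G ps] (- 1) y"
proof (induction ps)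
  case Nil
  then show ?case
    by (simp add: bdry_single2[OF is_group abelian_integer_group])
next
  case (Cons p ps)
  let ?a = "fst p" and ?b = "snd p" and ?k = "comm_prod G ps" and ?s = "single integer_group"
  let ?c = "comm_elt G ?a ?b"
  have ps: "set ps \<subseteq> carrier G \<times> carrier G" and ab: "?a \<in> carrier G" "?b \<in> carrier G"
    using Cons.prems by auto
  have k: "?k \<in> carrier G" using ps by simp
  have c: "?c \<in> carrier G" using ab by simp
  have bac: "?b \<otimes> ?a \<otimes> ?c = ?a \<otimes> ?b" using comm_elt_eq_iff[OF ab c] by simp
  note add = hom_int_chain_add[OF bdry_hom2[OF is_group abelian_integer_group]]
  note cl = pair_single_closed comm_chain_closed[OF ps]
  have d: "bdry G integer_group 2 (?s [g, h] n) y = ?s [h] n y - ?s [g \<otimes> h] n y + ?s [g] n y"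
    if "g \<in> carrier G" "h \<in> carrier G" for g h n
    using bdry_single2[OF is_group abelian_integer_group that, of n y] by simp
  have neg: "?s x (- 1) y = - ?s x 1 y" for x
    by (simp add: single_def)
  have "bdry G integer_group 2 (comm_chain G (p # ps)) y =
    bdry G integer_group 2 (?s [?a, ?b] 1) y + (bdry G integer_group 2 (?s [?b, ?a] (- 1)) y +
    (bdry G integer_group 2 (?s [?b \<otimes> ?a, ?c] (- 1)) y + (bdry G integer_group 2 (?s [?c, ?k] 1) y +
     bdry G integer_group 2 (comm_chain G ps) y)))"
    unfolding comm_chain.simps using ab k c cl by (simp add: add int_chain_add)
  also have "\<dots> = ?s [?c \<otimes> ?k] (- 1) y"
    using ab k c by (simp add: d Cons.IH[OF ps] bac neg)
  finally show ?case by simp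
qed

lemma comm_cycle_closed:
  "set ps \<subseteq> carrier G \<times> carrier G \<Longrightarrow> comm_cycle G ps \<in> carrier (fin_chains integer_group (tuples G 2))"
  unfolding comm_cycle_def by (intro int_chain_add comm_chain_closed pair_single_closed) simp_all

lemma comm_cycle_cycle:
  assumes ps: "set ps \<subseteq> carrier G \<times> carrier G" and one: "comm_prod G ps = \<one>"
  shows "comm_cycle G ps \<in> cycles2 G integer_group"
proof -
  have "bdry G integer_group 2 (comm_cycle G ps) y = 0" for y
    unfolding comm_cycle_def
    using hom_int_chain_add[OF bdry_hom2[OF is_group abelian_integer_group] comm_chain_closed[OF ps] pair_single_closed[of \<one> \<one> 1]]
      bdry_comm_chain[OF ps, of y] bdry_single2[OF is_group abelian_integer_group, of \<one> \<one> 1 y]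
    by (simp add: one) (simp add: single_def)
  then show ?thesis using comm_cycle_closed[OF ps] by (simp add: cycles2_def fun_eq_iff)
qed

end

text \<open>A map that is multiplicative up to a central subgroup. No projection from E to G is
  assumed: the locale covers sections over G as well as maps that pass through a quotient of
  G.\<close>

locale central_map = group G + E: group E
  for G :: "('a, 'b) monoid_scheme" (structure) and E :: "('e, 'z) monoid_scheme" +
  fixes D :: "'e set" and \<sigma> :: "'a \<Rightarrow> 'e"
  assumes D: "subgroup D E"
    and central: "\<And>d x. d \<in> D \<Longrightarrow> x \<in> carrier E \<Longrightarrow> x \<otimes>\<^bsub>E\<^esub> d = d \<otimes>\<^bsub>E\<^esub> x"
    and \<sigma> [simp]: "\<And>g. g \<in> carrier G \<Longrightarrow> \<sigma> g \<in> carrier E"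
    and defect_D: "\<And>g h. g \<in> carrier G \<Longrightarrow> h \<in> carrier G \<Longrightarrow>
      \<sigma> g \<otimes>\<^bsub>E\<^esub> \<sigma> h \<otimes>\<^bsub>E\<^esub> inv\<^bsub>E\<^esub> \<sigma> (g \<otimes> h) \<in> D"
begin

text \<open>The factor set of \<sigma>, a 2-cocycle with values in D.\<close>

definition "defect g h = \<sigma> g \<otimes>\<^bsub>E\<^esub> \<sigma> h \<otimes>\<^bsub>E\<^esub> inv\<^bsub>E\<^esub> \<sigma> (g \<otimes> h)"

abbreviation "DG \<equiv> E\<lparr>carrier := D\<rparr>"

lemma D_carrier: "d \<in> D \<Longrightarrow> d \<in> carrier E"
  using subgroup.subset[OF D] by (rule subsetD)

lemma D_mult: "d \<in> D \<Longrightarrow> d' \<in> D \<Longrightarrow> d \<otimes>\<^bsub>E\<^esub> d' \<in> D"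
  by (rule subgroup.m_closed[OF D])

lemma D_inv: "d \<in> D \<Longrightarrow> inv\<^bsub>E\<^esub> d \<in> D"
  by (rule subgroup.m_inv_closed[OF D])

lemma comm_group_DG: "comm_group DG"
  by (rule group.group_comm_groupI[OF E.subgroup_imp_group[OF D]]) (simp add: central D_carrier)

lemma defect_closed [simp]: "g \<in> carrier G \<Longrightarrow> h \<in> carrier G \<Longrightarrow> defect g h \<in> D"
  by (simp add: defect_def defect_D)

lemma \<sigma>_mult:
  "g \<in> carrier G \<Longrightarrow> h \<in> carrier G \<Longrightarrow> \<sigma> g \<otimes>\<^bsub>E\<^esub> \<sigma> h = defect g h \<otimes>\<^bsub>E\<^esub> \<sigma> (g \<otimes> h)"
  by (simp add: defect_def E.m_assoc)

lemma central_left: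
  "d \<in> D \<Longrightarrow> x \<in> carrier E \<Longrightarrow> y \<in> carrier E \<Longrightarrow> x \<otimes>\<^bsub>E\<^esub> (d \<otimes>\<^bsub>E\<^esub> y) = d \<otimes>\<^bsub>E\<^esub> (x \<otimes>\<^bsub>E\<^esub> y)"
  using central[of d x] D_carrier[of d] by (simp flip: E.m_assoc)

lemma central_left3:
  assumes d: "d1 \<in> D" "d2 \<in> D" "d3 \<in> D" and x: "x \<in> carrier E" and y: "y \<in> carrier E"
  shows "x \<otimes>\<^bsub>E\<^esub> (d1 \<otimes>\<^bsub>E\<^esub> (d2 \<otimes>\<^bsub>E\<^esub> (d3 \<otimes>\<^bsub>E\<^esub> y))) = d1 \<otimes>\<^bsub>E\<^esub> (d2 \<otimes>\<^bsub>E\<^esub> (d3 \<otimes>\<^bsub>E\<^esub> (x \<otimes>\<^bsub>E\<^esub> y)))"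
proof -
  note dc = d[THEN D_carrier]
  have "x \<otimes>\<^bsub>E\<^esub> (d1 \<otimes>\<^bsub>E\<^esub> (d2 \<otimes>\<^bsub>E\<^esub> (d3 \<otimes>\<^bsub>E\<^esub> y))) = d1 \<otimes>\<^bsub>E\<^esub> (x \<otimes>\<^bsub>E\<^esub> (d2 \<otimes>\<^bsub>E\<^esub> (d3 \<otimes>\<^bsub>E\<^esub> y)))"
    by (rule central_left[OF d(1) x]) (intro E.m_closed dc y)
  also have "x \<otimes>\<^bsub>E\<^esub> (d2 \<otimes>\<^bsub>E\<^esub> (d3 \<otimes>\<^bsub>E\<^esub> y)) = d2 \<otimes>\<^bsub>E\<^esub> (x \<otimes>\<^bsub>E\<^esub> (d3 \<otimes>\<^bsub>E\<^esub> y))"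
    by (rule central_left[OF d(2) x]) (intro E.m_closed dc y)
  also have "x \<otimes>\<^bsub>E\<^esub> (d3 \<otimes>\<^bsub>E\<^esub> y) = d3 \<otimes>\<^bsub>E\<^esub> (x \<otimes>\<^bsub>E\<^esub> y)"
    by (rule central_left[OF d(3) x y])
  finally show ?thesis .
qed

text \<open>The product of the values of \<sigma> at g, h, k is evaluated with either bracketing,
  and the common factor is cancelled.\<close>

lemma defect_cocycle:
  assumes g: "g \<in> carrier G" "h \<in> carrier G" "k \<in> carrier G"
  shows "defect g h \<otimes>\<^bsub>E\<^esub> defect (g \<otimes> h) k = defect h k \<otimes>\<^bsub>E\<^esub> defect g (h \<otimes> k)"
proof -
  note dc = D_carrier[OF defect_closed]
  note c = dc \<sigma> m_closed
  have "defect g h \<otimes>\<^bsub>E\<^esub> defect (g \<otimes> h) k \<otimes>\<^bsub>E\<^esub> \<sigma> (g \<otimes> h \<otimes> k) = defect g h \<otimes>\<^bsub>E\<^esub> (\<sigma> (g \<otimes> h) \<otimes>\<^bsub>E\<^esub> \<sigma> k)"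
    using g by (simp only: \<sigma>_mult[of "g \<otimes> h" k] E.m_assoc c)
  also have "\<dots> = (\<sigma> g \<otimes>\<^bsub>E\<^esub> \<sigma> h) \<otimes>\<^bsub>E\<^esub> \<sigma> k"
    using g by (simp only: \<sigma>_mult[of g h] E.m_assoc c)
  also have "\<dots> = \<sigma> g \<otimes>\<^bsub>E\<^esub> (defect h k \<otimes>\<^bsub>E\<^esub> \<sigma> (h \<otimes> k))"
    using g by (simp only: \<sigma>_mult[of h k, symmetric] E.m_assoc c)
  also have "\<dots> = defect h k \<otimes>\<^bsub>E\<^esub> (\<sigma> g \<otimes>\<^bsub>E\<^esub> \<sigma> (h \<otimes> k))"
    using g by (intro central_left) simp_all
  also have "\<dots> = defect h k \<otimes>\<^bsub>E\<^esub> defect g (h \<otimes> k) \<otimes>\<^bsub>E\<^esub> \<sigma> (g \<otimes> h \<otimes> k)"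
    using g by (simp only: \<sigma>_mult[of g "h \<otimes> k"] E.m_assoc m_assoc c)
  finally show ?thesis using g dc by simp
qed

text \<open>The factor set, extended to a homomorphism on integral 2-chains. Powers are taken in the
  abelian group \<open>DG\<close>, where \<open>chain_ext\<close> applies.\<close>

definition ev :: "('a list \<Rightarrow> int) \<Rightarrow> 'e" where
  "ev = chain_ext integer_group DG (\<lambda>xs k. defect (xs ! 0) (xs ! 1) [^]\<^bsub>DG\<^esub> k)"

lemma ev_coeff_hom: "xs \<in> tuples G 2 \<Longrightarrow> (\<lambda>k :: int. defect (xs ! 0) (xs ! 1) [^]\<^bsub>DG\<^esub> k) \<in> hom integer_group DG"
  using comm_group.axioms(2)[OF comm_group_DG]
  by (intro group.hom_integer_group_pow) (auto elim!: tuples2E)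

lemma ev_hom: "ev \<in> hom (fin_chains integer_group (tuples G 2)) DG"
  unfolding ev_def by (intro chain_ext_hom abelian_integer_group comm_group_DG Pi_I ev_coeff_hom)

lemma ev_single: "g \<in> carrier G \<Longrightarrow> h \<in> carrier G \<Longrightarrow> ev (single integer_group [g, h] k) = defect g h [^]\<^bsub>DG\<^esub> k"
  unfolding ev_def
  by (subst chain_ext_single[OF abelian_integer_group comm_group_DG])
     (use ev_coeff_hom[of "[g, h]"] in \<open>simp_all add: tuples_def\<close>)

lemma ev_single_pos: "g \<in> carrier G \<Longrightarrow> h \<in> carrier G \<Longrightarrow> ev (single integer_group [g, h] 1) = defect g h"
  and ev_single_neg: "g \<in> carrier G \<Longrightarrow> h \<in> carrier G \<Longrightarrow> ev (single integer_group [g, h] (- 1)) = inv\<^bsub>E\<^esub> defect g h"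
proof -
  interpret DG: comm_group DG by (rule comm_group_DG)
  assume g: "g \<in> carrier G" "h \<in> carrier G"
  show "ev (single integer_group [g, h] 1) = defect g h"
    using g DG.int_pow_1[of "defect g h"] by (simp add: ev_single)
  show "ev (single integer_group [g, h] (- 1)) = inv\<^bsub>E\<^esub> defect g h"
    using g DG.int_pow_neg[of "defect g h" 1] DG.int_pow_1[of "defect g h"] E.m_inv_consistent[OF D, of "defect g h"]
    by (simp add: ev_single)
qed

text \<open>A cocycle vanishes on boundaries; on a single triple this is the cocycle identity,
  raised to the power k.\<close>

lemma ev_bdry:
  assumes c: "c \<in> carrier (fin_chains integer_group (tuples G 3))"
  shows "ev (bdry G integer_group 3 c) = \<one>\<^bsub>E\<^esub>"
proof -
  interpret DG: comm_group DG by (rule comm_group_DG)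
  note Z = abelian_integer_group
  interpret C: comm_group "fin_chains integer_group (tuples G 2)" by (rule comm_group_fin_chains[OF Z])
  interpret e: group_hom "fin_chains integer_group (tuples G 2)" DG ev
    by (intro group_homI ev_hom C.is_group DG.is_group)
  let ?C = "fin_chains integer_group (tuples G 2)"
  have "ev (bdry G integer_group 3 c) = \<one>\<^bsub>DG\<^esub>"
  proof (rule fin_chains_hom_eqI[OF Z DG.is_group _ _ _ c])
    show "(\<lambda>c. ev (bdry G integer_group 3 c)) \<in> hom (fin_chains integer_group (tuples G 3)) DG"
      by (rule hom_comp[OF bdry_hom3[OF is_group Z] ev_hom])
    show "(\<lambda>_. \<one>\<^bsub>DG\<^esub>) \<in> hom (fin_chains integer_group (tuples G 3)) DG"
      by (rule homI) (simp_all only: DG.one_closed DG.l_one)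
    fix xs k assume mem: "xs \<in> tuples G 3"
    from mem obtain g h i where xs: "xs = [g, h, i]" and g: "g \<in> carrier G" "h \<in> carrier G" "i \<in> carrier G"
      by (rule tuples3E)
    let ?s = "\<lambda>a b. single integer_group [a, b] k"
    have s: "?s a b \<in> carrier ?C" if "a \<in> carrier G" "b \<in> carrier G" for a b
      by (rule pair_single_closed[OF that])
    have b3: "bdry G integer_group 3 (single integer_group xs k) =
        ?s h i \<otimes>\<^bsub>?C\<^esub> inv\<^bsub>?C\<^esub> (?s (g \<otimes> h) i) \<otimes>\<^bsub>?C\<^esub> ?s g (h \<otimes> i) \<otimes>\<^bsub>?C\<^esub> inv\<^bsub>?C\<^esub> (?s g h)"
      using s g by (simp add: fun_eq_iff xs bdry_single3[OF is_group Z] fin_chains_inv[OF Z])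
    have "ev (bdry G integer_group 3 (single integer_group xs k)) = ev (?s h i) \<otimes>\<^bsub>DG\<^esub> inv\<^bsub>DG\<^esub> ev (?s (g \<otimes> h) i)
        \<otimes>\<^bsub>DG\<^esub> ev (?s g (h \<otimes> i)) \<otimes>\<^bsub>DG\<^esub> inv\<^bsub>DG\<^esub> ev (?s g h)"
      unfolding b3 by (rule e.hom_alternating) (intro s g m_closed)+
    also have "\<dots> = (ev (?s h i) \<otimes>\<^bsub>DG\<^esub> ev (?s g (h \<otimes> i))) \<otimes>\<^bsub>DG\<^esub> inv\<^bsub>DG\<^esub> (ev (?s g h) \<otimes>\<^bsub>DG\<^esub> ev (?s (g \<otimes> h) i))"
      by (rule DG.alternating_eq) (intro e.hom_closed s g m_closed)+
    also have "ev (?s h i) \<otimes>\<^bsub>DG\<^esub> ev (?s g (h \<otimes> i)) = ev (?s g h) \<otimes>\<^bsub>DG\<^esub> ev (?s (g \<otimes> h) i)"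
      using g defect_cocycle[OF g]
        DG.int_pow_distrib[of "defect h i" "defect g (h \<otimes> i)" k] DG.int_pow_distrib[of "defect g h" "defect (g \<otimes> h) i" k]
      by (simp add: ev_single)
    also have "\<dots> \<otimes>\<^bsub>DG\<^esub> inv\<^bsub>DG\<^esub> (ev (?s g h) \<otimes>\<^bsub>DG\<^esub> ev (?s (g \<otimes> h) i)) = \<one>\<^bsub>DG\<^esub>"
      by (rule DG.r_inv) (intro DG.m_closed e.hom_closed s g m_closed)
    finally show "ev (bdry G integer_group 3 (single integer_group xs k)) = \<one>\<^bsub>DG\<^esub>" .
  qed
  then show ?thesis by simp
qed

lemma ev_closed: "c \<in> carrier (fin_chains integer_group (tuples G 2)) \<Longrightarrow> ev c \<in> D"
  using hom_in_carrier[OF ev_hom] by simp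

lemma ev_add:
  "c \<in> carrier (fin_chains integer_group (tuples G 2)) \<Longrightarrow> c' \<in> carrier (fin_chains integer_group (tuples G 2)) \<Longrightarrow>
   ev (\<lambda>x. c x + c' x) = ev c \<otimes>\<^bsub>E\<^esub> ev c'"
  using hom_int_chain_add[OF ev_hom] by simp

text \<open>Verified as an equation without inverses, v u [u, v] = u v for the images of a and b.
  Each product of two values of \<sigma> costs one defect; these are the first three pairs of a step
  of \<open>comm_chain\<close>.\<close>

lemma comm_elt_\<sigma>:
  assumes a: "a \<in> carrier G" and b: "b \<in> carrier G"
  shows "comm_elt E (\<sigma> a) (\<sigma> b) =
    defect a b \<otimes>\<^bsub>E\<^esub> (inv\<^bsub>E\<^esub> defect b a \<otimes>\<^bsub>E\<^esub> (inv\<^bsub>E\<^esub> defect (b \<otimes> a) (comm_elt G a b) \<otimes>\<^bsub>E\<^esub> \<sigma> (comm_elt G a b)))"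
proof -
  let ?c = "comm_elt G a b" and ?p = "defect a b" and ?q = "defect b a" and ?r = "defect (b \<otimes> a) (comm_elt G a b)"
  have c: "?c \<in> carrier G" using a b by simp
  have bac: "b \<otimes> a \<otimes> ?c = a \<otimes> b" using comm_elt_eq_iff[OF a b c] by simp
  have D: "?p \<in> D" "?q \<in> D" "?r \<in> D" "inv\<^bsub>E\<^esub> ?q \<in> D" "inv\<^bsub>E\<^esub> ?r \<in> D" using a b c by (simp_all add: D_inv)
  note E = D[THEN D_carrier]
  have sc: "\<sigma> ?c \<in> carrier E" "\<sigma> (b \<otimes> a) \<in> carrier E" "\<sigma> (a \<otimes> b) \<in> carrier E" using a b c by simp_all
  have "\<sigma> b \<otimes>\<^bsub>E\<^esub> \<sigma> a \<otimes>\<^bsub>E\<^esub> (?p \<otimes>\<^bsub>E\<^esub> (inv\<^bsub>E\<^esub> ?q \<otimes>\<^bsub>E\<^esub> (inv\<^bsub>E\<^esub> ?r \<otimes>\<^bsub>E\<^esub> \<sigma> ?c))) =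
      ?q \<otimes>\<^bsub>E\<^esub> (\<sigma> (b \<otimes> a) \<otimes>\<^bsub>E\<^esub> (?p \<otimes>\<^bsub>E\<^esub> (inv\<^bsub>E\<^esub> ?q \<otimes>\<^bsub>E\<^esub> (inv\<^bsub>E\<^esub> ?r \<otimes>\<^bsub>E\<^esub> \<sigma> ?c))))"
    using E sc by (simp add: \<sigma>_mult[OF b a] E.m_assoc)
  also have "\<dots> = ?q \<otimes>\<^bsub>E\<^esub> (?p \<otimes>\<^bsub>E\<^esub> (inv\<^bsub>E\<^esub> ?q \<otimes>\<^bsub>E\<^esub> (inv\<^bsub>E\<^esub> ?r \<otimes>\<^bsub>E\<^esub> (\<sigma> (b \<otimes> a) \<otimes>\<^bsub>E\<^esub> \<sigma> ?c))))"
    using central_left3[OF D(1,4,5) sc(2,1)] by simp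
  also have "\<sigma> (b \<otimes> a) \<otimes>\<^bsub>E\<^esub> \<sigma> ?c = ?r \<otimes>\<^bsub>E\<^esub> \<sigma> (a \<otimes> b)"
    using \<sigma>_mult[of "b \<otimes> a" ?c] a b c bac by simp
  also have "?q \<otimes>\<^bsub>E\<^esub> (?p \<otimes>\<^bsub>E\<^esub> (inv\<^bsub>E\<^esub> ?q \<otimes>\<^bsub>E\<^esub> (inv\<^bsub>E\<^esub> ?r \<otimes>\<^bsub>E\<^esub> (?r \<otimes>\<^bsub>E\<^esub> \<sigma> (a \<otimes> b))))) = ?p \<otimes>\<^bsub>E\<^esub> \<sigma> (a \<otimes> b)"
    using E sc by (simp add: central_left[OF D(1)])
  also have "\<dots> = \<sigma> a \<otimes>\<^bsub>E\<^esub> \<sigma> b" by (rule \<sigma>_mult[OF a b, symmetric])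
  finally have "\<sigma> b \<otimes>\<^bsub>E\<^esub> \<sigma> a \<otimes>\<^bsub>E\<^esub> (?p \<otimes>\<^bsub>E\<^esub> (inv\<^bsub>E\<^esub> ?q \<otimes>\<^bsub>E\<^esub> (inv\<^bsub>E\<^esub> ?r \<otimes>\<^bsub>E\<^esub> \<sigma> ?c))) =
      \<sigma> a \<otimes>\<^bsub>E\<^esub> \<sigma> b" .
  note eq = this[symmetric]
  show ?thesis
    by (rule E.comm_elt_eq_iff[THEN iffD2, OF _ _ _ eq]) (use a b E sc in simp_all)
qed

lemma defect_one: "\<sigma> \<one> = defect \<one> \<one>"
  by (simp add: defect_def E.m_assoc)

text \<open>The fourth pair of each step of the chain accounts for multiplying the commutator by the
  rest of the product.\<close>

lemma comm_prod_\<sigma>_chain: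
  assumes "set ps \<subseteq> carrier G \<times> carrier G"
  shows "comm_prod E (map (map_prod \<sigma> \<sigma>) ps) = ev (comm_chain G ps) \<otimes>\<^bsub>E\<^esub> \<sigma> (comm_prod G ps)"
  using assms
proof (induction ps)
  case Nil
  have "inv\<^bsub>E\<^esub> defect \<one> \<one> \<otimes>\<^bsub>E\<^esub> \<sigma> \<one> = \<one>\<^bsub>E\<^esub>"
    unfolding defect_one by (rule E.l_inv) (simp add: D_carrier)
  then show ?case by (simp add: ev_single_neg)
next
  case (Cons p ps)
  obtain a b where p: "p = (a, b)" by (cases p)
  have ab: "a \<in> carrier G" "b \<in> carrier G" and ps: "set ps \<subseteq> carrier G \<times> carrier G"
    using Cons.prems p by auto
  let ?c = "comm_elt G a b" and ?k = "comm_prod G ps"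
  let ?p = "defect a b" and ?q = "defect b a" and ?r = "defect (b \<otimes> a) ?c" and ?t = "defect ?c ?k" and ?e = "ev (comm_chain G ps)"
  have c: "?c \<in> carrier G" "?k \<in> carrier G" using ab ps by simp_all
  have D: "?p \<in> D" "inv\<^bsub>E\<^esub> ?q \<in> D" "inv\<^bsub>E\<^esub> ?r \<in> D" "?t \<in> D" "?e \<in> D"
    using ab c ev_closed[OF comm_chain_closed[OF ps]] by (simp_all add: D_inv)
  note E = D[THEN D_carrier]
  have sc: "\<sigma> ?c \<in> carrier E" "\<sigma> ?k \<in> carrier E" "\<sigma> (?c \<otimes> ?k) \<in> carrier E" using c by simp_all
  note cl = pair_single_closed comm_chain_closed[OF ps]
  have "ev (comm_chain G (p # ps)) = ?p \<otimes>\<^bsub>E\<^esub> (inv\<^bsub>E\<^esub> ?q \<otimes>\<^bsub>E\<^esub> (inv\<^bsub>E\<^esub> ?r \<otimes>\<^bsub>E\<^esub> (?t \<otimes>\<^bsub>E\<^esub> ?e)))"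
    unfolding comm_chain.simps p fst_conv snd_conv
    using ab c cl by (simp add: ev_add int_chain_add ev_single_pos ev_single_neg)
  then have "ev (comm_chain G (p # ps)) \<otimes>\<^bsub>E\<^esub> \<sigma> (comm_prod G (p # ps)) =
      ?p \<otimes>\<^bsub>E\<^esub> (inv\<^bsub>E\<^esub> ?q \<otimes>\<^bsub>E\<^esub> (inv\<^bsub>E\<^esub> ?r \<otimes>\<^bsub>E\<^esub> (?t \<otimes>\<^bsub>E\<^esub> (?e \<otimes>\<^bsub>E\<^esub> \<sigma> (?c \<otimes> ?k)))))"
    using E sc by (simp add: p E.m_assoc)
  also have "?t \<otimes>\<^bsub>E\<^esub> (?e \<otimes>\<^bsub>E\<^esub> \<sigma> (?c \<otimes> ?k)) = ?e \<otimes>\<^bsub>E\<^esub> (\<sigma> ?c \<otimes>\<^bsub>E\<^esub> \<sigma> ?k)"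
    using E sc by (simp add: \<sigma>_mult[OF c] central_left[OF D(5)])
  also have "\<dots> = \<sigma> ?c \<otimes>\<^bsub>E\<^esub> (?e \<otimes>\<^bsub>E\<^esub> \<sigma> ?k)"
    using E sc by (simp add: central_left[OF D(5)])
  also have "?p \<otimes>\<^bsub>E\<^esub> (inv\<^bsub>E\<^esub> ?q \<otimes>\<^bsub>E\<^esub> (inv\<^bsub>E\<^esub> ?r \<otimes>\<^bsub>E\<^esub> (\<sigma> ?c \<otimes>\<^bsub>E\<^esub> (?e \<otimes>\<^bsub>E\<^esub> \<sigma> ?k)))) =
      comm_elt E (\<sigma> a) (\<sigma> b) \<otimes>\<^bsub>E\<^esub> (?e \<otimes>\<^bsub>E\<^esub> \<sigma> ?k)"
    using E sc by (simp add: comm_elt_\<sigma>[OF ab] E.m_assoc)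
  finally show ?case using Cons.IH[OF ps] by (simp add: p)
qed

text \<open>When the product in G is 1, the leftover factor \<sigma> 1 is the defect of the pair (1,
  1), which the last term of the cycle supplies.\<close>

lemma comm_prod_\<sigma>:
  assumes ps: "set ps \<subseteq> carrier G \<times> carrier G" and one: "comm_prod G ps = \<one>"
  shows "comm_prod E (map (map_prod \<sigma> \<sigma>) ps) = ev (comm_cycle G ps)"
  unfolding comm_prod_\<sigma>_chain[OF ps] one comm_cycle_def
  using comm_chain_closed[OF ps] pair_single_closed[of \<one> \<one> 1]
  by (simp add: ev_add ev_single_pos defect_one)

end

section \<open>Injectivity of the integral comparison map\<close>

lemma comm_group_Zhat: "comm_group Zhat"
proof -
  interpret Zp: profinite integer_group by (simp add: profinite_def)
  show ?thesis
    unfolding Zhat_def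
  proof (rule group.group_comm_groupI[OF Zp.group_\<Gamma>])
    fix x y assume x: "x \<in> carrier Zp.\<Gamma>" and y: "y \<in> carrier Zp.\<Gamma>"
    show "x \<otimes>\<^bsub>Zp.\<Gamma>\<^esub> y = y \<otimes>\<^bsub>Zp.\<Gamma>\<^esub> x"
    proof (rule Zp.\<Gamma>_eqI)
      show "x \<otimes>\<^bsub>Zp.\<Gamma>\<^esub> y \<in> extensional Zp.\<NN>" "y \<otimes>\<^bsub>Zp.\<Gamma>\<^esub> x \<in> extensional Zp.\<NN>"
        by (simp_all add: profinite_completion_def)
      show "(x \<otimes>\<^bsub>Zp.\<Gamma>\<^esub> y) N = (y \<otimes>\<^bsub>Zp.\<Gamma>\<^esub> x) N" if "N \<in> Zp.\<NN>" for N
        unfolding Zp.\<Gamma>_mult[OF that] by (auto simp: set_mult_def add.commute)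
    qed
  qed
qed

text \<open>The projection of Zhat to Z/m: the coordinate at mZ is a coset on which
  \<open>red m\<close> is constant, and the image of that coset is a singleton.\<close>

definition Zhat_red :: "nat \<Rightarrow> (int set \<Rightarrow> int set) \<Rightarrow> nat" where
  "Zhat_red m x = the_elem (red m ` (x (kernel integer_group (zmod m) (red m))))"

lemma profinite_integer_group: "profinite integer_group"
  by (simp add: profinite_def)

lemma red_kernel_normal:
  assumes "m \<ge> 1"
  shows "kernel integer_group (zmod m) (red m) \<in> finite_index_normals integer_group"
  using comm_group_zmod[OF assms] red_hom[OF assms]
  by (intro kernel_finite_index group_integer_group) (simp_all add: comm_group.axioms(2))

lemma Zhat_red_hom:
  assumes m: "m \<ge> 1"
  shows "Zhat_red m \<in> hom Zhat (zmod m)"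
proof -
  interpret Zp: profinite integer_group by (rule profinite_integer_group)
  interpret r: group_hom integer_group "zmod m" "red m"
    using comm_group_zmod[OF m] red_hom[OF m] by (intro group_homI group_integer_group) (simp_all add: comm_group.axioms(2))
  let ?K = "kernel integer_group (zmod m) (red m)"
  note K = red_kernel_normal[OF m]
  have "(\<lambda>x. x ?K) \<in> hom Zhat (integer_group Mod ?K)"
    unfolding Zhat_def
  proof (rule homI)
    fix x y assume x: "x \<in> carrier Zp.\<Gamma>"
    show "x ?K \<in> carrier (integer_group Mod ?K)" using Zp.\<Gamma>_coset[OF x K] by (simp add: FactGroup_def)
    show "(x \<otimes>\<^bsub>Zp.\<Gamma>\<^esub> y) ?K = x ?K \<otimes>\<^bsub>integer_group Mod ?K\<^esub> y ?K"
      by (simp add: Zp.\<Gamma>_mult[OF K])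
  qed
  from hom_comp[OF this r.FactGroup_hom] show ?thesis unfolding Zhat_red_def[abs_def] .
qed

lemma Zhat_red_completion:
  assumes m: "m \<ge> 1"
  shows "Zhat_red m (completion_map integer_group k) = red m k"
proof -
  interpret r: group_hom integer_group "zmod m" "red m"
    using comm_group_zmod[OF m] red_hom[OF m] by (intro group_homI group_integer_group) (simp_all add: comm_group.axioms(2))
  let ?K = "kernel integer_group (zmod m) (red m)"
  have "red m i = red m k" if i: "i \<in> ?K #>\<^bsub>integer_group\<^esub> k" for i
  proof -
    obtain j where j: "j \<in> ?K" "i = j \<otimes>\<^bsub>integer_group\<^esub> k" using i by (auto simp: r_coset_def)
    have "red m i = red m j \<otimes>\<^bsub>zmod m\<^esub> red m k" unfolding j(2) by (rule r.hom_mult) simp_all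
    also have "red m j = \<one>\<^bsub>zmod m\<^esub>" using j(1) by (simp add: kernel_def)
    also have "\<one>\<^bsub>zmod m\<^esub> \<otimes>\<^bsub>zmod m\<^esub> red m k = red m k" by (rule r.H.l_one) (rule r.hom_closed, simp)
    finally show ?thesis .
  qed
  moreover have "k \<in> ?K #>\<^bsub>integer_group\<^esub> k"
    by (rule group.rcos_self[OF group_integer_group _ r.subgroup_kernel]) simp
  ultimately have "red m ` (?K #>\<^bsub>integer_group\<^esub> k) = {red m k}" by blast
  then show ?thesis
    using red_kernel_normal[OF m] by (simp add: Zhat_red_def completion_map_def)
qed

context profinite begin

text \<open>The preimage N' of N in Zhat gives a level (U, N') for Zhat, and the projection to Z/m
  induces a map from Zhat/N' to (Z/m)/N. A filling over Zhat, read at that level and pushed along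
  this map, fills the image of z at (U, N).\<close>

lemma integral_boundary_levelwise:
  assumes z: "z \<in> carrier (fin_chains integer_group (tuples G 2))" and m: "m \<ge> 1"
    and b: "comparison_chain_map integer_group \<Gamma> Zhat (trivial_action \<Gamma> Zhat) \<eta>0 (completion_map integer_group) z
      \<in> boundaries (profinite_chains \<Gamma> Zhat (trivial_action \<Gamma> Zhat)) (profinite_boundary \<Gamma> Zhat (trivial_action \<Gamma> Zhat)) 2"
    and l: "(U, N) \<in> levels \<Gamma> (zmod m) (trivial_action \<Gamma> (zmod m))"
  shows "level_push m U N z \<in> boundaries2 (\<Gamma> Mod U) (zmod m Mod N)"
proof -
  let ?act = "trivial_action \<Gamma> Zhat" and ?\<tau> = "Zhat_red m" and ?A = "zmod m"
  interpret Zp: profinite integer_group by (rule profinite_integer_group)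
  interpret A: trivial_coeffs G ?A "trivial_action \<Gamma> ?A"
    by (rule trivial_coeffs_trivial_action[OF comm_group_zmod[OF m]])
  interpret M: trivial_coeffs G Zhat ?act by (rule trivial_coeffs_trivial_action[OF comm_group_Zhat])
  have \<eta>Z: "completion_map integer_group \<in> hom integer_group Zhat"
    unfolding Zhat_def by (rule Zp.completion_map_hom)
  interpret c: comparison G Zhat ?act integer_group "completion_map integer_group" "\<lambda>_ k. k"
    by (intro comparison.intro comparison_axioms.intro M.trivial_coeffs_axioms abelian_integer_group \<eta>Z) simp
  note d = A.levelD[OF l]
  interpret t: group_hom Zhat ?A ?\<tau>
    by (intro group_homI Zhat_red_hom m A.M.is_group M.M.is_group)
  define N' where "N' = {x \<in> carrier Zhat. ?\<tau> x \<in> N}"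
  have sub: "subgroup N' Zhat"
  proof (rule M.M.subgroupI)
    show "N' \<noteq> {}" using subgroup.one_closed[OF d(3)] M.M.one_closed t.hom_one by (auto simp: N'_def)
    fix x assume x: "x \<in> N'"
    show "inv\<^bsub>Zhat\<^esub> x \<in> N'"
      using x subgroup.m_inv_closed[OF d(3), of "?\<tau> x"] t.hom_inv[of x] by (simp add: N'_def)
    fix y assume y: "y \<in> N'"
    show "x \<otimes>\<^bsub>Zhat\<^esub> y \<in> N'"
      using x y subgroup.m_closed[OF d(3), of "?\<tau> x" "?\<tau> y"] t.hom_mult[of x y] by (simp add: N'_def del: zmod_simps)
  qed (auto simp: N'_def)
  \<comment> \<open>Membership in N' depends only on the coordinate at mZ.\<close>
  have "openin (topol Zp.\<Gamma>) {x \<in> carrier Zp.\<Gamma>. x (kernel integer_group ?A (red m)) \<in> {S. the_elem (red m ` S) \<in> N}}"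
    by (rule Zp.openin_coordinate[OF red_kernel_normal[OF m]])
  then have op: "openin (topol Zhat) N'" by (simp add: N'_def Zhat_def Zhat_red_def)
  have l': "(U, N') \<in> M.L" by (rule M.levelI[OF d(1,2) sub op])
  note d' = M.levelD[OF l']
  have h: "(\<lambda>x. N #>\<^bsub>?A\<^esub> ?\<tau> x) \<in> hom Zhat (?A Mod N)"
    by (rule hom_comp[OF Zhat_red_hom[OF m] normal.r_coset_hom_Mod[OF d(4)]])
  interpret h: group_hom Zhat "?A Mod N" "\<lambda>x. N #>\<^bsub>?A\<^esub> ?\<tau> x"
    by (intro group_homI h M.M.is_group comm_group.axioms(2)[OF d(7)])
  have "N' \<subseteq> kernel Zhat (?A Mod N) (\<lambda>x. N #>\<^bsub>?A\<^esub> ?\<tau> x)"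
    using A.M.coset_join2[OF _ d(3)] subgroup.subset[OF d(3)] by (auto simp: N'_def kernel_def)
  from h.FactGroup_universal_kernel[OF d'(4) this] obtain \<theta> where
    \<theta>: "\<theta> \<in> hom (Zhat Mod N') (?A Mod N)" "\<And>x. x \<in> carrier Zhat \<Longrightarrow> \<theta> (N' #>\<^bsub>Zhat\<^esub> x) = N #>\<^bsub>?A\<^esub> ?\<tau> x"
    by blast
  obtain c where cc: "c \<in> carrier (M.PC 3)" and bc: "c.cmp z = profinite_boundary \<Gamma> Zhat ?act 3 c"
    using b unfolding M.PB_eq by blast
  have cl: "c (U, N') \<in> carrier (M.C U N' 3)" by (rule M.profinite_chains_level[OF cc l'])
  have eq: "c.pu U N' z = bdry (\<Gamma> Mod U) (Zhat Mod N') 3 (c (U, N'))"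
    using fun_cong[OF bc, of "(U, N')"] unfolding c.cmp_level[OF l'] M.profinite_boundary_level[OF cc zero_less_numeral l'] .
  have \<eta>c: "completion_map integer_group k \<in> carrier Zhat" for k
    by (rule hom_in_carrier[OF \<eta>Z]) simp
  have \<theta>\<eta>: "\<theta> (N' #>\<^bsub>Zhat\<^esub> completion_map integer_group k) = N #>\<^bsub>?A\<^esub> red m k" for k
    using \<theta>(2)[OF \<eta>c] by (simp add: Zhat_red_completion[OF m])
  let ?p = "chain_push (Zhat Mod N') (?A Mod N) (map (\<lambda>D :: ('a set \<Rightarrow> 'a set) set. D)) (\<lambda>_. \<theta>)"
  have "?p (c.pu U N' z) = chain_push integer_group (?A Mod N)
      (map (\<lambda>D :: ('a set \<Rightarrow> 'a set) set. D) \<circ> map (\<lambda>g. U #>\<^bsub>\<Gamma>\<^esub> \<eta>0 g)) (\<lambda>_ k. \<theta> (N' #>\<^bsub>Zhat\<^esub> completion_map integer_group k)) z"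
    by (rule chain_push_comp[OF abelian_integer_group d'(7) d(7) c.coeff_hom[OF l'] \<theta>(1) z])
  also have "\<dots> = level_push m U N z"
    by (simp add: level_push_def \<theta>\<eta> comp_def)
  finally have "level_push m U N z = ?p (c.pu U N' z)" by simp
  also have "\<dots> = bdry (\<Gamma> Mod U) (?A Mod N) 3 (?p (c (U, N')))"
    unfolding eq by (rule bdry_push3[symmetric, OF d(6) d'(7) d(6,7) hom_id \<theta>(1) cl])
  also have "?p (c (U, N')) \<in> carrier (A.C U N 3)"
    by (rule hom_in_carrier[OF tuple_push_hom[OF d'(7) d(7) \<theta>(1)] cl]) simp
  ultimately show ?thesis by (simp add: boundaries2_def)
qed

lemma integral_comparison_inj:
  assumes A2: "in_A_hom 2 G" and fg: "finitely_generated_group (integral_homology G 2)"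
  shows "inj_on (integral_comparison_map G 2) (carrier (integral_homology G 2))"
proof (rule inj_onI)
  let ?act = "trivial_action \<Gamma> Zhat" and ?C = "fin_chains integer_group (tuples G 2)"
    and ?B = "boundaries2 G integer_group"
  interpret Zp: profinite integer_group by (rule profinite_integer_group)
  interpret M: trivial_coeffs G Zhat ?act by (rule trivial_coeffs_trivial_action[OF comm_group_Zhat])
  have \<eta>Z: "completion_map integer_group \<in> hom integer_group Zhat"
    unfolding Zhat_def by (rule Zp.completion_map_hom)
  interpret c: comparison G Zhat ?act integer_group "completion_map integer_group" "trivial_action G integer_group"
    by (intro comparison.intro comparison_axioms.intro M.trivial_coeffs_axioms abelian_integer_group \<eta>Z)
       (simp add: trivial_action_def)
  interpret C: comm_group ?C by (rule comm_group_fin_chains[OF abelian_integer_group])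
  note B = boundaries2_subgroup[OF is_group abelian_integer_group]
    and cyc = cycles2_subgroup[OF is_group abelian_integer_group]
  have car: "carrier (integral_homology G 2) = (\<lambda>z. ?B #>\<^bsub>?C\<^esub> z) ` cycles2 G integer_group"
    unfolding integral_homology_def by (rule homology2_carrier[OF is_group abelian_integer_group]) (rule c.actA)
  fix S S' assume "S \<in> carrier (integral_homology G 2)" "S' \<in> carrier (integral_homology G 2)"
    and eq: "integral_comparison_map G 2 S = integral_comparison_map G 2 S'"
  then obtain z z' where z: "z \<in> cycles2 G integer_group" "S = ?B #>\<^bsub>?C\<^esub> z"
    and z': "z' \<in> cycles2 G integer_group" "S' = ?B #>\<^bsub>?C\<^esub> z'" unfolding car by blast
  let ?d = "z \<otimes>\<^bsub>?C\<^esub> inv\<^bsub>?C\<^esub> z'"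
  have zc: "z \<in> carrier ?C" "z' \<in> carrier ?C" using z z' by (simp_all add: cycles2_def)
  have "c.cmp ?d \<in> M.PB"
    by (rule c.comparison_map_eq_imp[OF zc]) (use eq in \<open>simp only: z(2) z'(2) integral_comparison_map_def\<close>)
  have d: "?d \<in> cycles2 G integer_group"
    by (intro subgroup.m_closed[OF cyc] subgroup.m_inv_closed[OF cyc] z z')
  have dc: "?d \<in> carrier ?C" by (intro C.m_closed C.inv_closed zc)
  have "?d \<in> ?B"
    by (rule integral_cycle_boundary[OF A2 fg d integral_boundary_levelwise[OF dc _ \<open>c.cmp ?d \<in> M.PB\<close>]])
  then have "z \<in> ?B #>\<^bsub>?C\<^esub> z'" by (rule subgroup.rcos_module_rev[OF B C.is_group zc(2,1)])
  then show "S = S'" unfolding z(2) z'(2) by (rule C.repr_independence[symmetric, OF _ zc(2) B])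
qed

end

section \<open>Finite central extensions\<close>

text \<open>The extension with factor set f and trivial action of Q on D. The cocycle is not
  normalised, so the unit carries the inverse of f(1, 1).\<close>

definition cocycle_extension ::
    "('d, 'y) monoid_scheme \<Rightarrow> ('q, 'z) monoid_scheme \<Rightarrow> ('q \<Rightarrow> 'q \<Rightarrow> 'd) \<Rightarrow> ('d \<times> 'q) monoid" where
  "cocycle_extension D Q f =
     \<lparr>carrier = carrier D \<times> carrier Q,
      monoid.mult = (\<lambda>(d, q) (e, r). (d \<otimes>\<^bsub>D\<^esub> e \<otimes>\<^bsub>D\<^esub> f q r, q \<otimes>\<^bsub>Q\<^esub> r)),
      one = (inv\<^bsub>D\<^esub> f \<one>\<^bsub>Q\<^esub> \<one>\<^bsub>Q\<^esub>, \<one>\<^bsub>Q\<^esub>)\<rparr>"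

locale cocycle = D: comm_group D + Q: group Q
  for D :: "('d, 'y) monoid_scheme" and Q :: "('q, 'z) monoid_scheme" +
  fixes f :: "'q \<Rightarrow> 'q \<Rightarrow> 'd"
  assumes f [simp]: "\<And>q r. q \<in> carrier Q \<Longrightarrow> r \<in> carrier Q \<Longrightarrow> f q r \<in> carrier D"
    and cocycle: "\<And>q r s. q \<in> carrier Q \<Longrightarrow> r \<in> carrier Q \<Longrightarrow> s \<in> carrier Q \<Longrightarrow>
      f q r \<otimes>\<^bsub>D\<^esub> f (q \<otimes>\<^bsub>Q\<^esub> r) s = f r s \<otimes>\<^bsub>D\<^esub> f q (r \<otimes>\<^bsub>Q\<^esub> s)"
begin

abbreviation "CE \<equiv> cocycle_extension D Q f"
abbreviation "f1 \<equiv> f \<one>\<^bsub>Q\<^esub> \<one>\<^bsub>Q\<^esub>"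

text \<open>The cocycle identity at (1, 1, q).\<close>

lemma f_one_left: "q \<in> carrier Q \<Longrightarrow> f \<one>\<^bsub>Q\<^esub> q = f1"
  using cocycle[of "\<one>\<^bsub>Q\<^esub>" "\<one>\<^bsub>Q\<^esub>" q] D.r_cancel[of "f \<one>\<^bsub>Q\<^esub> q" f1 "f \<one>\<^bsub>Q\<^esub> q"] by simp

lemma f_one_right: "q \<in> carrier Q \<Longrightarrow> f q \<one>\<^bsub>Q\<^esub> = f1"
  using cocycle[of q "\<one>\<^bsub>Q\<^esub>" "\<one>\<^bsub>Q\<^esub>"] D.r_cancel[of "f q \<one>\<^bsub>Q\<^esub>" "f q \<one>\<^bsub>Q\<^esub>" f1] by simp

lemma CE_mult: "(d, q) \<otimes>\<^bsub>CE\<^esub> (e, r) = (d \<otimes>\<^bsub>D\<^esub> e \<otimes>\<^bsub>D\<^esub> f q r, q \<otimes>\<^bsub>Q\<^esub> r)"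
  by (simp add: cocycle_extension_def)

lemma CE_carrier: "(d, q) \<in> carrier CE \<longleftrightarrow> d \<in> carrier D \<and> q \<in> carrier Q"
  by (simp add: cocycle_extension_def)

lemma CE_one: "\<one>\<^bsub>CE\<^esub> = (inv\<^bsub>D\<^esub> f1, \<one>\<^bsub>Q\<^esub>)"
  by (simp add: cocycle_extension_def)

lemma group_CE: "group CE"
proof (rule groupI)
  fix x y assume x: "x \<in> carrier CE" and y: "y \<in> carrier CE"
  obtain d q e r where xy: "x = (d, q)" "y = (e, r)" by (cases x, cases y)
  have c: "d \<in> carrier D" "q \<in> carrier Q" "e \<in> carrier D" "r \<in> carrier Q"
    using x y by (simp_all add: xy CE_carrier)
  show "x \<otimes>\<^bsub>CE\<^esub> y \<in> carrier CE" using c by (simp add: xy CE_mult CE_carrier)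
  fix z assume z: "z \<in> carrier CE"
  obtain e' s where z': "z = (e', s)" by (cases z)
  have c': "e' \<in> carrier D" "s \<in> carrier Q" using z by (simp_all add: z' CE_carrier)
  have "d \<otimes>\<^bsub>D\<^esub> e \<otimes>\<^bsub>D\<^esub> f q r \<otimes>\<^bsub>D\<^esub> e' \<otimes>\<^bsub>D\<^esub> f (q \<otimes>\<^bsub>Q\<^esub> r) s = d \<otimes>\<^bsub>D\<^esub> e \<otimes>\<^bsub>D\<^esub> e' \<otimes>\<^bsub>D\<^esub> (f q r \<otimes>\<^bsub>D\<^esub> f (q \<otimes>\<^bsub>Q\<^esub> r) s)"
    using c c' by (simp add: D.m_ac)
  also have "f q r \<otimes>\<^bsub>D\<^esub> f (q \<otimes>\<^bsub>Q\<^esub> r) s = f r s \<otimes>\<^bsub>D\<^esub> f q (r \<otimes>\<^bsub>Q\<^esub> s)" using c c' by (intro cocycle)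
  also have "d \<otimes>\<^bsub>D\<^esub> e \<otimes>\<^bsub>D\<^esub> e' \<otimes>\<^bsub>D\<^esub> (f r s \<otimes>\<^bsub>D\<^esub> f q (r \<otimes>\<^bsub>Q\<^esub> s)) = d \<otimes>\<^bsub>D\<^esub> (e \<otimes>\<^bsub>D\<^esub> e' \<otimes>\<^bsub>D\<^esub> f r s) \<otimes>\<^bsub>D\<^esub> f q (r \<otimes>\<^bsub>Q\<^esub> s)"
    using c c' by (simp add: D.m_ac)
  finally show "x \<otimes>\<^bsub>CE\<^esub> y \<otimes>\<^bsub>CE\<^esub> z = x \<otimes>\<^bsub>CE\<^esub> (y \<otimes>\<^bsub>CE\<^esub> z)"
    using c c' by (simp add: xy z' CE_mult Q.m_assoc)
next
  show "\<one>\<^bsub>CE\<^esub> \<in> carrier CE" by (simp add: CE_one CE_carrier)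
  fix x assume x: "x \<in> carrier CE"
  obtain d q where x': "x = (d, q)" by (cases x)
  have c: "d \<in> carrier D" "q \<in> carrier Q" using x by (simp_all add: x' CE_carrier)
  have "inv\<^bsub>D\<^esub> f1 \<otimes>\<^bsub>D\<^esub> d \<otimes>\<^bsub>D\<^esub> f1 = d"
    using c D.m_comm[of "inv\<^bsub>D\<^esub> f1" d] by (simp add: D.m_assoc)
  then show "\<one>\<^bsub>CE\<^esub> \<otimes>\<^bsub>CE\<^esub> x = x"
    using c by (simp add: x' CE_one CE_mult f_one_left[OF c(2)])
  let ?i = "inv\<^bsub>Q\<^esub> q" let ?k = "f ?i q"
  have "d' \<otimes>\<^bsub>D\<^esub> k' \<otimes>\<^bsub>D\<^esub> e \<otimes>\<^bsub>D\<^esub> d \<otimes>\<^bsub>D\<^esub> k = e \<otimes>\<^bsub>D\<^esub> (d' \<otimes>\<^bsub>D\<^esub> d) \<otimes>\<^bsub>D\<^esub> (k' \<otimes>\<^bsub>D\<^esub> k)"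
    if "d' \<in> carrier D" "k' \<in> carrier D" "e \<in> carrier D" "k \<in> carrier D" for d' k' e k
    using that c by (simp add: D.m_ac)
  from this[of "inv\<^bsub>D\<^esub> d" "inv\<^bsub>D\<^esub> ?k" "inv\<^bsub>D\<^esub> f1" ?k]
  have "(inv\<^bsub>D\<^esub> d \<otimes>\<^bsub>D\<^esub> inv\<^bsub>D\<^esub> ?k \<otimes>\<^bsub>D\<^esub> inv\<^bsub>D\<^esub> f1, ?i) \<otimes>\<^bsub>CE\<^esub> x = \<one>\<^bsub>CE\<^esub>"
    using c by (simp add: x' CE_mult CE_one)
  moreover have "(inv\<^bsub>D\<^esub> d \<otimes>\<^bsub>D\<^esub> inv\<^bsub>D\<^esub> ?k \<otimes>\<^bsub>D\<^esub> inv\<^bsub>D\<^esub> f1, ?i) \<in> carrier CE"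
    using c by (simp add: CE_carrier)
  ultimately show "\<exists>y\<in>carrier CE. y \<otimes>\<^bsub>CE\<^esub> x = \<one>\<^bsub>CE\<^esub>" by blast
qed

sublocale CE: group CE by (rule group_CE)

text \<open>The shift by the inverse of \<open>f1\<close> sends the unit of D to the unit of the
  extension.\<close>

definition "incl d = (d \<otimes>\<^bsub>D\<^esub> inv\<^bsub>D\<^esub> f1, \<one>\<^bsub>Q\<^esub>)"

lemma incl_hom: "incl \<in> hom D CE"
proof (rule homI)
  fix d e assume d: "d \<in> carrier D"
  show "incl d \<in> carrier CE" using d by (simp add: incl_def CE_carrier)
  assume e: "e \<in> carrier D"
  have "d \<otimes>\<^bsub>D\<^esub> inv\<^bsub>D\<^esub> f1 \<otimes>\<^bsub>D\<^esub> (e \<otimes>\<^bsub>D\<^esub> inv\<^bsub>D\<^esub> f1) \<otimes>\<^bsub>D\<^esub> f1 = d \<otimes>\<^bsub>D\<^esub> e \<otimes>\<^bsub>D\<^esub> inv\<^bsub>D\<^esub> f1"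
    using d e D.m_comm[of "inv\<^bsub>D\<^esub> f1" e] by (simp add: D.m_assoc)
  then show "incl (d \<otimes>\<^bsub>D\<^esub> e) = incl d \<otimes>\<^bsub>CE\<^esub> incl e"
    using d e by (simp add: incl_def CE_mult)
qed

lemma incl_eq_one: "d \<in> carrier D \<Longrightarrow> incl d = \<one>\<^bsub>CE\<^esub> \<Longrightarrow> d = \<one>\<^bsub>D\<^esub>"
  using D.r_cancel_one[of "inv\<^bsub>D\<^esub> f1" d] by (simp add: incl_def CE_one)

lemma snd_hom: "snd \<in> hom CE Q"
  by (rule homI) (auto simp: CE_mult cocycle_extension_def)

text \<open>The kernel of the projection is central because D is abelian and f(1, q) = f(q,
  1).\<close>

lemma central_map_CE:
  assumes G: "group G" and p: "p \<in> hom G Q"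
  shows "central_map G CE (kernel CE Q snd) (\<lambda>g. (\<one>\<^bsub>D\<^esub>, p g))"
proof -
  interpret G: group G by fact
  interpret s: group_hom CE Q snd by (intro group_homI group_CE snd_hom Q.is_group)
  have pc: "p g \<in> carrier Q" if "g \<in> carrier G" for g using hom_in_carrier[OF p that] .
  have \<sigma>: "(\<one>\<^bsub>D\<^esub>, p g) \<in> carrier CE" if "g \<in> carrier G" for g using pc[OF that] by (simp add: CE_carrier)
  show ?thesis
  proof (intro central_map.intro central_map_axioms.intro G group_CE s.subgroup_kernel \<sigma>)
    fix d x assume d: "d \<in> kernel CE Q snd" and x: "x \<in> carrier CE"
    obtain e where e: "d = (e, \<one>\<^bsub>Q\<^esub>)" "e \<in> carrier D"
      using d by (cases d) (auto simp: kernel_def CE_carrier)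
    obtain e' q where x': "x = (e', q)" by (cases x)
    have q: "q \<in> carrier Q" "e' \<in> carrier D" using x by (simp_all add: x' CE_carrier)
    show "x \<otimes>\<^bsub>CE\<^esub> d = d \<otimes>\<^bsub>CE\<^esub> x"
      using e q D.m_comm[OF e(2) q(2)] by (simp add: x' CE_mult f_one_left[OF q(1)] f_one_right[OF q(1)])
  next
    fix g h assume gh: "g \<in> carrier G" "h \<in> carrier G"
    have gh': "g \<otimes>\<^bsub>G\<^esub> h \<in> carrier G" using gh by simp
    show "(\<one>\<^bsub>D\<^esub>, p g) \<otimes>\<^bsub>CE\<^esub> (\<one>\<^bsub>D\<^esub>, p h) \<otimes>\<^bsub>CE\<^esub> inv\<^bsub>CE\<^esub> (\<one>\<^bsub>D\<^esub>, p (g \<otimes>\<^bsub>G\<^esub> h)) \<in> kernel CE Q snd"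
      unfolding kernel_def using gh pc hom_mult[OF p gh] s.hom_mult s.hom_inv \<sigma>[OF gh(1)] \<sigma>[OF gh(2)] \<sigma>[OF gh']
      by (simp only: mem_Collect_eq CE.m_closed CE.inv_closed s.hom_mult s.hom_inv snd_conv Q.r_inv Q.m_closed simp_thms)
  qed
qed

text \<open>The section has (1, q)(1, r) = (f q r, qr), so its factor set is f itself, up to the
  embedding of D.\<close>

lemma defect_CE:
  assumes G: "group G" and p: "p \<in> hom G Q" and g: "g \<in> carrier G" "h \<in> carrier G"
  shows "central_map.defect G CE (\<lambda>g. (\<one>\<^bsub>D\<^esub>, p g)) g h = incl (f (p g) (p h))"
proof -
  interpret c: central_map G CE "kernel CE Q snd" "\<lambda>g. (\<one>\<^bsub>D\<^esub>, p g)" by (rule central_map_CE[OF G p])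
  have pc: "p g \<in> carrier Q" "p h \<in> carrier Q" using hom_in_carrier[OF p] g by auto
  have gh: "(\<one>\<^bsub>D\<^esub>, p (g \<otimes>\<^bsub>G\<^esub> h)) \<in> carrier CE" using c.\<sigma>[OF c.m_closed[OF g]] .
  have j: "incl (f (p g) (p h)) \<in> carrier CE" using hom_in_carrier[OF incl_hom f[OF pc]] .
  have "(\<one>\<^bsub>D\<^esub>, p g) \<otimes>\<^bsub>CE\<^esub> (\<one>\<^bsub>D\<^esub>, p h) = incl (f (p g) (p h)) \<otimes>\<^bsub>CE\<^esub> (\<one>\<^bsub>D\<^esub>, p (g \<otimes>\<^bsub>G\<^esub> h))"
    using pc by (simp add: incl_def CE_mult hom_mult[OF p g] f_one_left[OF Q.m_closed[OF pc]] D.m_assoc)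
  then show ?thesis
    unfolding c.defect_def using gh j by (simp add: CE.m_assoc)
qed

end

lemma integer_group_hom_eq:
  assumes "group E" "h \<in> hom integer_group E"
  shows "h k = h 1 [^]\<^bsub>E\<^esub> (k :: int)"
  using group_hom.hom_int_pow[OF group_homI[OF group_integer_group assms], of 1 k] by simp

text \<open>The tautological cocycle sends (q, r) to the class of the chain at [q | r] modulo
  boundaries. Its value on the image of z is the class of that image, which is nontrivial by
  assumption.\<close>

lemma (in group) finite_central_map:
  fixes Q :: "('q, 'z) monoid_scheme" and M :: "('m, 'y) monoid_scheme"
  assumes Q: "group Q" "finite (carrier Q)" and M: "comm_group M" "finite (carrier M)"
    and p: "p \<in> hom G Q" and \<theta>: "\<theta> \<in> hom integer_group M"
    and z: "z \<in> carrier (fin_chains integer_group (tuples G 2))"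
    and nb: "chain_push integer_group M (map p) (\<lambda>_. \<theta>) z \<notin> boundaries2 Q M"
  obtains E :: "(('q list \<Rightarrow> 'm) set \<times> 'q) monoid" and D \<sigma>
  where "central_map G E D \<sigma>" "finite (carrier E)" "central_map.ev G E D \<sigma> z \<noteq> \<one>\<^bsub>E\<^esub>"
proof -
  let ?C = "fin_chains M (tuples Q 2)" and ?B = "boundaries2 Q M"
  interpret Q: group Q by fact
  interpret M: comm_group M by fact
  interpret C: comm_group ?C by (rule comm_group_fin_chains[OF M(1)])
  note B = boundaries2_subgroup[OF Q(1) M(1)]
  have nor: "?B \<lhd> ?C" by (rule C.subgroup_imp_normal[OF B])
  \<comment> \<open>All 2-chains modulo boundaries, not only cycles, since the cocycle takes values
    at single pairs.\<close>
  define D where "D = ?C Mod ?B"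
  have D: "comm_group D" unfolding D_def by (rule C.abelian_FactGroup[OF B])
  define co where "co c = ?B #>\<^bsub>?C\<^esub> c" for c
  have co: "co \<in> hom ?C D" unfolding co_def D_def by (rule normal.r_coset_hom_Mod[OF nor])
  interpret D: comm_group D by (rule D)
  interpret co: group_hom ?C D co by (intro group_homI C.is_group D.is_group co)
  \<comment> \<open>A homomorphism on the integers is determined by its value at 1.\<close>
  define \<mu> where "\<mu> = \<theta> 1"
  have \<mu>: "\<mu> \<in> carrier M" unfolding \<mu>_def by (rule hom_in_carrier[OF \<theta>]) simp
  let ?s = "\<lambda>q r. single M [q, r] \<mu>"
  have s: "?s q r \<in> carrier ?C" if "q \<in> carrier Q" "r \<in> carrier Q" for q r
    by (rule single_closed[OF M(1) _ \<mu>]) (use that in \<open>simp add: tuples_def\<close>)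
  define f where "f q r = co (?s q r)" for q r
  have fc: "f q r \<in> carrier D" if "q \<in> carrier Q" "r \<in> carrier Q" for q r
    unfolding f_def by (rule co.hom_closed[OF s[OF that]])
  interpret cc: cocycle D Q f
  proof (intro cocycle.intro cocycle_axioms.intro D Q(1) fc)
    fix q r t assume q: "q \<in> carrier Q" "r \<in> carrier Q" "t \<in> carrier Q"
    have "single M [q, r, t] \<mu> \<in> carrier (fin_chains M (tuples Q 3))"
      by (rule single_closed[OF M(1) _ \<mu>]) (use q in \<open>simp add: tuples_def\<close>)
    then have b: "bdry Q M 3 (single M [q, r, t] \<mu>) \<in> ?B" unfolding boundaries2_def by (rule imageI)
    have b3: "bdry Q M 3 (single M [q, r, t] \<mu>) = ?s r t \<otimes>\<^bsub>?C\<^esub> inv\<^bsub>?C\<^esub> (?s (q \<otimes>\<^bsub>Q\<^esub> r) t) \<otimes>\<^bsub>?C\<^esub>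
      ?s q (r \<otimes>\<^bsub>Q\<^esub> t) \<otimes>\<^bsub>?C\<^esub> inv\<^bsub>?C\<^esub> (?s q r)"
      using s q by (simp add: fun_eq_iff bdry_single3[OF Q(1) M(1) _ _ _ \<mu>] fin_chains_inv[OF M(1)])
    have bc: "bdry Q M 3 (single M [q, r, t] \<mu>) \<in> carrier ?C" using b subgroup.subset[OF B] by blast
    have "\<one>\<^bsub>D\<^esub> = co (bdry Q M 3 (single M [q, r, t] \<mu>))"
      using C.coset_join2[OF bc B b] by (simp add: co_def D_def)
    also have "\<dots> = f r t \<otimes>\<^bsub>D\<^esub> inv\<^bsub>D\<^esub> f (q \<otimes>\<^bsub>Q\<^esub> r) t \<otimes>\<^bsub>D\<^esub> f q (r \<otimes>\<^bsub>Q\<^esub> t) \<otimes>\<^bsub>D\<^esub> inv\<^bsub>D\<^esub> f q r"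
      unfolding b3 f_def by (rule co.hom_alternating) (intro s q Q.m_closed)+
    also have "\<dots> = (f r t \<otimes>\<^bsub>D\<^esub> f q (r \<otimes>\<^bsub>Q\<^esub> t)) \<otimes>\<^bsub>D\<^esub> inv\<^bsub>D\<^esub> (f q r \<otimes>\<^bsub>D\<^esub> f (q \<otimes>\<^bsub>Q\<^esub> r) t)"
      by (rule D.alternating_eq) (intro fc q Q.m_closed)+
    finally have one: "(f r t \<otimes>\<^bsub>D\<^esub> f q (r \<otimes>\<^bsub>Q\<^esub> t)) \<otimes>\<^bsub>D\<^esub> inv\<^bsub>D\<^esub> (f q r \<otimes>\<^bsub>D\<^esub> f (q \<otimes>\<^bsub>Q\<^esub> r) t) = \<one>\<^bsub>D\<^esub>" by (rule HOL.sym)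
    have cl: "f r t \<otimes>\<^bsub>D\<^esub> f q (r \<otimes>\<^bsub>Q\<^esub> t) \<in> carrier D" "f q r \<otimes>\<^bsub>D\<^esub> f (q \<otimes>\<^bsub>Q\<^esub> r) t \<in> carrier D"
      by (intro D.m_closed fc q Q.m_closed)+
    have "inv\<^bsub>D\<^esub> (inv\<^bsub>D\<^esub> (f q r \<otimes>\<^bsub>D\<^esub> f (q \<otimes>\<^bsub>Q\<^esub> r) t)) = f r t \<otimes>\<^bsub>D\<^esub> f q (r \<otimes>\<^bsub>Q\<^esub> t)"
      by (rule D.inv_equality[OF one D.inv_closed[OF cl(2)] cl(1)])
    then show "f q r \<otimes>\<^bsub>D\<^esub> f (q \<otimes>\<^bsub>Q\<^esub> r) t = f r t \<otimes>\<^bsub>D\<^esub> f q (r \<otimes>\<^bsub>Q\<^esub> t)"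
      unfolding D.inv_inv[OF cl(2)] .
  qed
  let ?E = "cocycle_extension D Q f" and ?K = "kernel (cocycle_extension D Q f) Q snd" and ?\<sigma> = "\<lambda>g. (\<one>\<^bsub>D\<^esub>, p g)"
  have cm: "central_map G ?E ?K ?\<sigma>" by (rule cc.central_map_CE[OF is_group p])
  interpret cm: central_map G ?E ?K ?\<sigma> by (rule cm)
  have finD: "finite (carrier D)"
    unfolding D_def using finite_fin_chains[OF M(2) finite_tuples[OF Q(2)]] by (simp add: carrier_FactGroup)
  have finE: "finite (carrier ?E)" using finD Q(2) by (simp add: cocycle_extension_def)
  let ?push = "chain_push integer_group M (map p) (\<lambda>_. \<theta>)"
  have p': "p \<in> carrier G \<rightarrow> carrier Q" using p by (auto simp: hom_def)
  have push: "?push \<in> hom (fin_chains integer_group (tuples G 2)) ?C"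
    by (rule tuple_push_hom[OF abelian_integer_group M(1) \<theta> p'])
  have incl_push: "(\<lambda>c. cc.incl (co (?push c))) \<in> hom (fin_chains integer_group (tuples G 2)) ?E"
    by (rule hom_comp[OF push hom_comp[OF co cc.incl_hom]])
  have ev': "cm.ev \<in> hom (fin_chains integer_group (tuples G 2)) ?E"
    using cm.ev_hom cm.D_carrier by (auto simp: hom_def Pi_iff)
  have "cm.ev z = cc.incl (co (?push z))"
  \<comment> \<open>Evaluation and the passage to the class of the pushed chain are both
    homomorphisms, so a single pair suffices.\<close>
  proof (rule fin_chains_hom_eqI[OF abelian_integer_group cc.group_CE ev' incl_push _ z])
    fix xs and k :: int assume mem: "xs \<in> tuples G 2"
    from mem obtain g h where xs: "xs = [g, h]" and g: "g \<in> carrier G" "h \<in> carrier G" by (rule tuples2E)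
    have pg: "p g \<in> carrier Q" "p h \<in> carrier Q" using p' g by auto
    have t2: "[p g, p h] \<in> tuples Q 2" using pg by (simp add: tuples_def)
    have sh: "(\<lambda>m. single M [p g, p h] m) \<in> hom M ?C"
      by (rule homI) (simp_all add: single_closed[OF M(1) t2] single_mult[OF M(1)])
    have h: "(\<lambda>k. cc.incl (co (single M [p g, p h] (\<theta> k)))) \<in> hom integer_group ?E"
      by (rule hom_comp[OF \<theta> hom_comp[OF sh hom_comp[OF co cc.incl_hom]]])
    have "cm.ev (single integer_group xs k) = cc.incl (f (p g) (p h)) [^]\<^bsub>cm.DG\<^esub> k"
      unfolding xs cm.ev_single[OF g] cc.defect_CE[OF is_group p g] ..
    also have "\<dots> = cc.incl (f (p g) (p h)) [^]\<^bsub>?E\<^esub> k"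
      using cc.CE.int_pow_consistent[OF cm.D, of "cc.incl (f (p g) (p h))" k] cm.defect_closed[OF g]
      unfolding cc.defect_CE[OF is_group p g] by simp
    also have "\<dots> = cc.incl (co (single M [p g, p h] (\<theta> k)))"
      using integer_group_hom_eq[OF cc.group_CE h, of k] by (simp add: f_def \<mu>_def)
    also have "single M [p g, p h] (\<theta> k) = ?push (single integer_group xs k)"
      using \<theta> by (simp add: xs chain_push_single[OF abelian_integer_group M(1)])
    finally show "cm.ev (single integer_group xs k) = cc.incl (co (?push (single integer_group xs k)))" .
  qed
  moreover have "cc.incl (co (?push z)) \<noteq> \<one>\<^bsub>?E\<^esub>"
  proof
    have pz: "?push z \<in> carrier ?C" by (rule hom_in_carrier[OF push z])
    assume "cc.incl (co (?push z)) = \<one>\<^bsub>?E\<^esub>"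
    then have "co (?push z) = \<one>\<^bsub>D\<^esub>" by (rule cc.incl_eq_one[OF co.hom_closed[OF pz]])
    then have "?B #>\<^bsub>?C\<^esub> ?push z = ?B" by (simp add: co_def D_def)
    then show False using C.coset_join1[OF _ pz B] nb by blast
  qed
  ultimately show thesis using that[OF cm finE] by simp
qed

section \<open>Homomorphisms from \<open>\<nu>(G)\<close> induced by central maps\<close>

lemma (in group) comm_elt_self [simp]: "a \<in> carrier G \<Longrightarrow> comm_elt G a a = \<one>"
  by (simp add: comm_elt_def)

text \<open>
  In \<open>E \<times> E \<times> E\<close> modulo \<open>{(b c, b, c) | b c \<in> D}\<close>, the maps \<open>g \<mapsto> (\<sigma> g, \<sigma> g, 1)\<close> and
  \<open>g \<mapsto> (\<sigma> g, 1, \<sigma> g)\<close> are homomorphisms although \<open>\<sigma>\<close> is not, and their commutators lie in the first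
  factor, which embeds.
\<close>

lemma (in central_map) nu_hom_of_central_map:
  assumes fin: "finite (carrier E)"
  obtains Y :: "('e \<times> 'e \<times> 'e) set monoid" and \<Phi> \<psi>
  where "group Y" "finite (carrier Y)" "\<Phi> \<in> hom (nu G) Y" "\<psi> \<in> hom E Y"
    "\<forall>e\<in>carrier E. \<psi> e = \<one>\<^bsub>Y\<^esub> \<longrightarrow> e = \<one>\<^bsub>E\<^esub>"
    "\<forall>a\<in>carrier G. \<forall>b\<in>carrier G. \<Phi> (tensor_elt G a b) = \<psi> (comm_elt E (\<sigma> a) (\<sigma> b))"
proof -
  interpret nu_group G by unfold_locales
  let ?K = "E \<times>\<times> (E \<times>\<times> E)" and ?o = "\<one>\<^bsub>E\<^esub>"
  interpret K: group ?K by (intro DirProd_group E.is_group)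
  define C where "C = {(b \<otimes>\<^bsub>E\<^esub> c, (b, c)) | b c. b \<in> D \<and> c \<in> D}"
  have Km: "(x, (y, z)) \<otimes>\<^bsub>?K\<^esub> (x', (y', z')) = (x \<otimes>\<^bsub>E\<^esub> x', (y \<otimes>\<^bsub>E\<^esub> y', z \<otimes>\<^bsub>E\<^esub> z'))" for x y z x' y' z'
    by simp
  have Kc: "(x, (y, z)) \<in> carrier ?K \<longleftrightarrow> x \<in> carrier E \<and> y \<in> carrier E \<and> z \<in> carrier E" for x y z
    by simp
  have Ki: "inv\<^bsub>?K\<^esub> (x, (y, z)) = (inv\<^bsub>E\<^esub> x, (inv\<^bsub>E\<^esub> y, inv\<^bsub>E\<^esub> z))"
    if "x \<in> carrier E" "y \<in> carrier E" "z \<in> carrier E" for x y z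
    using that by (simp add: inv_DirProd DirProd_group)
  have K1: "\<one>\<^bsub>?K\<^esub> = (?o, (?o, ?o))" by simp
  have Ck: "c \<in> carrier ?K" if "c \<in> C" for c using that by (auto simp: C_def D_carrier)
  have CI: "(b \<otimes>\<^bsub>E\<^esub> c, (b, c)) \<in> C" if "b \<in> D" "c \<in> D" for b c using that by (auto simp: C_def)
  have D1: "?o \<in> D" by (rule subgroup.one_closed[OF D])
  have Ccen: "x \<otimes>\<^bsub>?K\<^esub> c = c \<otimes>\<^bsub>?K\<^esub> x" if cC: "c \<in> C" and x: "x \<in> carrier ?K" for c x
  proof -
    obtain a b where c: "c = (a \<otimes>\<^bsub>E\<^esub> b, (a, b))" "a \<in> D" "b \<in> D" using cC by (auto simp: C_def)
    obtain x1 x2 x3 where x': "x = (x1, (x2, x3))" by (cases x)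
    show ?thesis
      using x c central[of a x2] central[of b x3] central[OF D_mult[OF c(2,3)], of x1] by (simp add: x')
  qed
  have CG: "subgroup C ?K"
  proof (rule K.subgroupI)
    show "C \<subseteq> carrier ?K" using Ck by blast
    show "C \<noteq> {}" using CI[OF D1 D1] by blast
    fix x assume "x \<in> C"
    then obtain a b where x: "x = (a \<otimes>\<^bsub>E\<^esub> b, (a, b))" "a \<in> D" "b \<in> D" by (auto simp: C_def)
    have "inv\<^bsub>?K\<^esub> x = (inv\<^bsub>E\<^esub> (a \<otimes>\<^bsub>E\<^esub> b), (inv\<^bsub>E\<^esub> a, inv\<^bsub>E\<^esub> b))"
      unfolding x(1) using x D_carrier by (intro Ki) simp_all
    also have "inv\<^bsub>E\<^esub> (a \<otimes>\<^bsub>E\<^esub> b) = inv\<^bsub>E\<^esub> a \<otimes>\<^bsub>E\<^esub> inv\<^bsub>E\<^esub> b"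
      using x D_carrier central[OF D_inv[OF x(2)], of "inv\<^bsub>E\<^esub> b"] by (simp add: E.inv_mult_group)
    finally show "inv\<^bsub>?K\<^esub> x \<in> C" using CI[OF D_inv[OF x(2)] D_inv[OF x(3)]] by simp
    fix y assume "y \<in> C"
    then obtain c d where y: "y = (c \<otimes>\<^bsub>E\<^esub> d, (c, d))" "c \<in> D" "d \<in> D" by (auto simp: C_def)
    have "a \<otimes>\<^bsub>E\<^esub> b \<otimes>\<^bsub>E\<^esub> (c \<otimes>\<^bsub>E\<^esub> d) = a \<otimes>\<^bsub>E\<^esub> c \<otimes>\<^bsub>E\<^esub> (b \<otimes>\<^bsub>E\<^esub> d)"
      using x y D_carrier central_left[OF y(2), of b d] by (simp add: E.m_assoc)
    then have "x \<otimes>\<^bsub>?K\<^esub> y = (a \<otimes>\<^bsub>E\<^esub> c \<otimes>\<^bsub>E\<^esub> (b \<otimes>\<^bsub>E\<^esub> d), (a \<otimes>\<^bsub>E\<^esub> c, b \<otimes>\<^bsub>E\<^esub> d))"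
      unfolding x(1) y(1) Km by simp
    then show "x \<otimes>\<^bsub>?K\<^esub> y \<in> C" using CI[OF D_mult[OF x(2) y(2)] D_mult[OF x(3) y(3)]] by simp
  qed
  have nor: "C \<lhd> ?K"
    unfolding K.normal_inv_iff
  proof (intro conjI CG ballI)
    fix x c assume x: "x \<in> carrier ?K" and c: "c \<in> C"
    have "x \<otimes>\<^bsub>?K\<^esub> c \<otimes>\<^bsub>?K\<^esub> inv\<^bsub>?K\<^esub> x = c"
      unfolding Ccen[OF c x] using x Ck[OF c] by (simp only: K.m_assoc K.inv_closed K.r_inv K.r_one)
    then show "x \<otimes>\<^bsub>?K\<^esub> c \<otimes>\<^bsub>?K\<^esub> inv\<^bsub>?K\<^esub> x \<in> C" using c by simp
  qed
  define Y where "Y = ?K Mod C"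
  define co where "co k = C #>\<^bsub>?K\<^esub> k" for k
  have Y: "group Y" unfolding Y_def by (rule normal.factorgroup_is_group[OF nor])
  have finY: "finite (carrier Y)" unfolding Y_def using fin by (simp add: carrier_FactGroup)
  have co: "co \<in> hom ?K Y" unfolding co_def Y_def by (rule normal.r_coset_hom_Mod[OF nor])
  interpret co: group_hom ?K Y co by (intro group_homI K.is_group Y co)
  have coC: "co (c \<otimes>\<^bsub>?K\<^esub> k) = co k" if "c \<in> C" "k \<in> carrier ?K" for c k
    unfolding co_def using K.coset_mult_assoc[OF subgroup.subset[OF CG] Ck[OF that(1)] that(2)]
      K.coset_join2[OF Ck[OF that(1)] CG that(1)] by simp
  define u where "u g = (\<sigma> g, (\<sigma> g, ?o))" for g
  define v where "v g = (\<sigma> g, (?o, \<sigma> g))" for g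
  have uc: "u g \<in> carrier ?K" and vc: "v g \<in> carrier ?K" if "g \<in> carrier G" for g
    using that by (simp_all add: u_def v_def)
  have l: "(\<lambda>g. co (u g)) \<in> hom G Y"
  proof (rule homI)
    fix g h assume g: "g \<in> carrier G"
    show "co (u g) \<in> carrier Y" by (rule co.hom_closed[OF uc[OF g]])
    assume h: "h \<in> carrier G"
    let ?d = "defect g h"
    have d: "?d \<in> D" using g h by simp
    \<comment> \<open>The defect occurs in the first two factors at once and is therefore an element
      of \<open>C\<close>.\<close>
    have "u g \<otimes>\<^bsub>?K\<^esub> u h = (?d \<otimes>\<^bsub>E\<^esub> ?o, (?d, ?o)) \<otimes>\<^bsub>?K\<^esub> u (g \<otimes> h)"
      using g h D_carrier[OF d] by (simp add: u_def \<sigma>_mult)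
    then show "co (u (g \<otimes> h)) = co (u g) \<otimes>\<^bsub>Y\<^esub> co (u h)"
      using coC[OF CI[OF d D1] uc[of "g \<otimes> h"]] co.hom_mult[OF uc[OF g] uc[OF h]] g h by simp
  qed
  have r: "(\<lambda>g. co (v g)) \<in> hom G Y"
  proof (rule homI)
    fix g h assume g: "g \<in> carrier G"
    show "co (v g) \<in> carrier Y" by (rule co.hom_closed[OF vc[OF g]])
    assume h: "h \<in> carrier G"
    let ?d = "defect g h"
    have d: "?d \<in> D" using g h by simp
    have "v g \<otimes>\<^bsub>?K\<^esub> v h = (?o \<otimes>\<^bsub>E\<^esub> ?d, (?o, ?d)) \<otimes>\<^bsub>?K\<^esub> v (g \<otimes> h)"
      using g h D_carrier[OF d] by (simp add: v_def \<sigma>_mult)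
    then show "co (v (g \<otimes> h)) = co (v g) \<otimes>\<^bsub>Y\<^esub> co (v h)"
      using coC[OF CI[OF D1 d] vc[of "g \<otimes> h"]] co.hom_mult[OF vc[OF g] vc[OF h]] g h by simp
  qed
  define \<psi> where "\<psi> e = co (e, (?o, ?o))" for e
  have \<psi>: "\<psi> \<in> hom E Y"
    unfolding \<psi>_def by (rule hom_comp[OF _ co]) (rule homI, simp_all)
  \<comment> \<open>An element of \<open>C\<close> is determined by its last two entries, so
    \<open>C\<close> meets the first factor trivially.\<close>
  have \<psi>_inj: "e = ?o" if e: "e \<in> carrier E" "\<psi> e = \<one>\<^bsub>Y\<^esub>" for e
  proof -
    have "C #>\<^bsub>?K\<^esub> (e, (?o, ?o)) = C" using e(2) by (simp add: \<psi>_def co_def Y_def)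
    then have "(e, (?o, ?o)) \<in> C" by (rule K.coset_join1[OF _ _ CG]) (use e in simp)
    then show ?thesis by (auto simp: C_def)
  qed
  have Ycomm: "comm_elt Y (co x) (co y) = co (comm_elt ?K x y)" if "x \<in> carrier ?K" "y \<in> carrier ?K" for x y
    by (rule co.hom_comm_elt[symmetric, OF that])
  have Yconj: "conj_elt Y (co x) (co y) = co (conj_elt ?K x y)" if "x \<in> carrier ?K" "y \<in> carrier ?K" for x y
    by (rule co.hom_conj_elt[symmetric, OF that])
  have uv: "comm_elt ?K (u a) (v b) = (comm_elt E (\<sigma> a) (\<sigma> b), (?o, ?o))" if "a \<in> carrier G" "b \<in> carrier G" for a b
    using that by (simp add: comm_elt_def u_def v_def Ki)
  have lr: "comm_elt Y (co (u a)) (co (v b)) = \<psi> (comm_elt E (\<sigma> a) (\<sigma> b))" if "a \<in> carrier G" "b \<in> carrier G" for a b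
    unfolding Ycomm[OF uc[OF that(1)] vc[OF that(2)]] uv[OF that] \<psi>_def ..
  \<comment> \<open>On the first factor both copies of c act by conjugation with \<sigma> c; hence
    the first relation of \<nu>(G).\<close>
  have \<psi>u: "conj_elt Y (\<psi> e) (co (u c)) = \<psi> (conj_elt E e (\<sigma> c))" if "e \<in> carrier E" "c \<in> carrier G" for e c
    unfolding \<psi>_def using that uc by (subst Yconj) (simp_all add: conj_elt_def u_def Ki)
  have \<psi>v: "conj_elt Y (\<psi> e) (co (v c)) = \<psi> (conj_elt E e (\<sigma> c))" if "e \<in> carrier E" "c \<in> carrier G" for e c
    unfolding \<psi>_def using that vc by (subst Yconj) (simp_all add: conj_elt_def v_def Ki)
  \<comment> \<open>Conjugation is respected by \<sigma> up to D, from the two ways of writing the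
    image of ac = c a^c.\<close>
  have \<sigma>conj: "\<exists>d\<in>D. \<sigma> (conj_elt G a c) = d \<otimes>\<^bsub>E\<^esub> conj_elt E (\<sigma> a) (\<sigma> c)" if a: "a \<in> carrier G" and c: "c \<in> carrier G" for a c
  proof -
    let ?x = "conj_elt G a c"
    have x: "?x \<in> carrier G" using a c by simp
    have cx: "c \<otimes> ?x = a \<otimes> c" using a c by (simp add: conj_elt_def m_assoc)
    let ?p = "defect c ?x" and ?q = "defect a c"
    have D: "?p \<in> D" "?q \<in> D" "inv\<^bsub>E\<^esub> ?q \<in> D" using a c x by (simp_all add: D_inv)
    note E = D[THEN D_carrier]
    have e1: "\<sigma> c \<otimes>\<^bsub>E\<^esub> \<sigma> ?x = ?p \<otimes>\<^bsub>E\<^esub> \<sigma> (a \<otimes> c)" using \<sigma>_mult[OF c x] cx by simp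
    have e2: "\<sigma> (a \<otimes> c) = inv\<^bsub>E\<^esub> ?q \<otimes>\<^bsub>E\<^esub> (\<sigma> a \<otimes>\<^bsub>E\<^esub> \<sigma> c)"
      unfolding \<sigma>_mult[OF a c] using E a c by simp
    have "\<sigma> ?x = inv\<^bsub>E\<^esub> \<sigma> c \<otimes>\<^bsub>E\<^esub> (\<sigma> c \<otimes>\<^bsub>E\<^esub> \<sigma> ?x)" using c x by simp
    also have "\<dots> = inv\<^bsub>E\<^esub> \<sigma> c \<otimes>\<^bsub>E\<^esub> ((?p \<otimes>\<^bsub>E\<^esub> inv\<^bsub>E\<^esub> ?q) \<otimes>\<^bsub>E\<^esub> (\<sigma> a \<otimes>\<^bsub>E\<^esub> \<sigma> c))"
      unfolding e1 e2 using E a c by (simp add: E.m_assoc)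
    also have "\<dots> = (?p \<otimes>\<^bsub>E\<^esub> inv\<^bsub>E\<^esub> ?q) \<otimes>\<^bsub>E\<^esub> (inv\<^bsub>E\<^esub> \<sigma> c \<otimes>\<^bsub>E\<^esub> (\<sigma> a \<otimes>\<^bsub>E\<^esub> \<sigma> c))"
      by (rule central_left[OF D_mult[OF D(1,3)]]) (use a c in simp_all)
    also have "inv\<^bsub>E\<^esub> \<sigma> c \<otimes>\<^bsub>E\<^esub> (\<sigma> a \<otimes>\<^bsub>E\<^esub> \<sigma> c) = conj_elt E (\<sigma> a) (\<sigma> c)"
      using a c by (simp add: conj_elt_def E.m_assoc)
    finally show ?thesis using D_mult[OF D(1,3)] by (rule bexI)
  qed
  \<comment> \<open>Central factors drop out of commutators, so the failure of \<sigma> to respect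
    conjugation does not affect the second relation.\<close>
  have comm_central: "comm_elt E (d \<otimes>\<^bsub>E\<^esub> x) (e \<otimes>\<^bsub>E\<^esub> y) = comm_elt E x y"
    if d: "d \<in> D" and e: "e \<in> D" and x: "x \<in> carrier E" and y: "y \<in> carrier E" for d e x y
  proof -
    have dc: "d \<in> carrier E" "e \<in> carrier E" using d e D_carrier by auto
    have xy: "x \<otimes>\<^bsub>E\<^esub> y = y \<otimes>\<^bsub>E\<^esub> x \<otimes>\<^bsub>E\<^esub> comm_elt E x y"
      using x y E.comm_elt_eq_iff[of x y "comm_elt E x y"] by simp
    have "d \<otimes>\<^bsub>E\<^esub> x \<otimes>\<^bsub>E\<^esub> (e \<otimes>\<^bsub>E\<^esub> y) = d \<otimes>\<^bsub>E\<^esub> (e \<otimes>\<^bsub>E\<^esub> (x \<otimes>\<^bsub>E\<^esub> y))"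
      using dc x y central_left[OF e x y] by (simp add: E.m_assoc)
    also have "\<dots> = e \<otimes>\<^bsub>E\<^esub> (d \<otimes>\<^bsub>E\<^esub> (y \<otimes>\<^bsub>E\<^esub> (x \<otimes>\<^bsub>E\<^esub> comm_elt E x y)))"
      using dc x y xy central_left[OF e, of d "x \<otimes>\<^bsub>E\<^esub> y"] by (simp add: E.m_assoc)
    also have "\<dots> = e \<otimes>\<^bsub>E\<^esub> (y \<otimes>\<^bsub>E\<^esub> (d \<otimes>\<^bsub>E\<^esub> (x \<otimes>\<^bsub>E\<^esub> comm_elt E x y)))"
      using x y central_left[OF d, of y "x \<otimes>\<^bsub>E\<^esub> comm_elt E x y"] by simp
    finally have "d \<otimes>\<^bsub>E\<^esub> x \<otimes>\<^bsub>E\<^esub> (e \<otimes>\<^bsub>E\<^esub> y) = (e \<otimes>\<^bsub>E\<^esub> y) \<otimes>\<^bsub>E\<^esub> (d \<otimes>\<^bsub>E\<^esub> x) \<otimes>\<^bsub>E\<^esub> comm_elt E x y"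
      using dc x y by (simp add: E.m_assoc)
    then show ?thesis using E.comm_elt_eq_iff[of "d \<otimes>\<^bsub>E\<^esub> x" "e \<otimes>\<^bsub>E\<^esub> y" "comm_elt E x y"] dc x y by simp
  qed
  have conj_comm: "conj_elt E (comm_elt E (\<sigma> a) (\<sigma> b)) (\<sigma> c) = comm_elt E (\<sigma> (conj_elt G a c)) (\<sigma> (conj_elt G b c))"
    if abc: "a \<in> carrier G" "b \<in> carrier G" "c \<in> carrier G" for a b c
  proof -
    obtain d e where "d \<in> D" "\<sigma> (conj_elt G a c) = d \<otimes>\<^bsub>E\<^esub> conj_elt E (\<sigma> a) (\<sigma> c)"
      "e \<in> D" "\<sigma> (conj_elt G b c) = e \<otimes>\<^bsub>E\<^esub> conj_elt E (\<sigma> b) (\<sigma> c)"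
      using \<sigma>conj[OF abc(1,3)] \<sigma>conj[OF abc(2,3)] by blast
    then show ?thesis using abc by (simp add: comm_central E.conj_comm_elt)
  qed
  obtain \<Phi> where \<Phi>: "\<Phi> \<in> hom (nu G) Y" "\<And>g. g \<in> carrier G \<Longrightarrow> \<Phi> (lft g) = co (u g)"
    "\<And>g. g \<in> carrier G \<Longrightarrow> \<Phi> (rgt g) = co (v g)"
  proof (rule nu_universal[OF Y l r])
    fix a b c assume a: "a \<in> carrier G" "b \<in> carrier G" "c \<in> carrier G"
    show "conj_elt Y (comm_elt Y (co (u a)) (co (v b))) (co (u c)) = conj_elt Y (comm_elt Y (co (u a)) (co (v b))) (co (v c))"
      unfolding lr[OF a(1,2)] using a by (simp add: \<psi>u \<psi>v)
    show "conj_elt Y (comm_elt Y (co (u a)) (co (v b))) (co (v c)) = comm_elt Y (co (u (conj_elt G a c))) (co (v (conj_elt G b c)))"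
      unfolding lr[OF a(1,2)] lr[OF conj_elt_closed[OF a(1,3)] conj_elt_closed[OF a(2,3)]] using a by (simp add: \<psi>v conj_comm)
  qed blast
  interpret \<Phi>: group_hom "nu G" Y \<Phi> by (intro group_homI group_nu Y \<Phi>(1))
  have "\<Phi> (tensor_elt G a b) = \<psi> (comm_elt E (\<sigma> a) (\<sigma> b))" if "a \<in> carrier G" "b \<in> carrier G" for a b
  proof -
    have "\<Phi> (tensor_elt G a b) = comm_elt Y (\<Phi> (lft a)) (\<Phi> (rgt b))"
      unfolding tensor_elt_eq[OF that]
      by (rule \<Phi>.hom_comm_elt[OF hom_in_carrier[OF lft_hom that(1)] hom_in_carrier[OF rgt_hom that(2)]])
    then show ?thesis unfolding \<Phi>(2)[OF that(1)] \<Phi>(3)[OF that(2)] lr[OF that] .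
  qed
  then have t: "\<forall>a\<in>carrier G. \<forall>b\<in>carrier G. \<Phi> (tensor_elt G a b) = \<psi> (comm_elt E (\<sigma> a) (\<sigma> b))"
    by simp
  have "\<forall>e\<in>carrier E. \<psi> e = \<one>\<^bsub>Y\<^esub> \<longrightarrow> e = \<one>\<^bsub>E\<^esub>" using \<psi>_inj by simp
  from that[OF Y finY \<Phi>(1) \<psi> this t] show thesis .
qed

section \<open>Residual finiteness of the exterior square\<close>

context group begin

lemma comm_elt_consistent:
  "subgroup H G \<Longrightarrow> a \<in> H \<Longrightarrow> b \<in> H \<Longrightarrow> comm_elt (G\<lparr>carrier := H\<rparr>) a b = comm_elt G a b"
  by (simp add: comm_elt_def m_inv_consistent)

lemma comm_prod_consistent:
  "subgroup H G \<Longrightarrow> set ps \<subseteq> H \<times> H \<Longrightarrow> comm_prod (G\<lparr>carrier := H\<rparr>) ps = comm_prod G ps"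
  by (induction ps) (auto simp: comm_elt_consistent)

lemma comm_chain_consistent:
  "subgroup H G \<Longrightarrow> set ps \<subseteq> H \<times> H \<Longrightarrow> comm_chain (G\<lparr>carrier := H\<rparr>) ps = comm_chain G ps"
  by (induction ps) (auto simp: comm_elt_consistent comm_prod_consistent)

end

text \<open>Without an action, only the multiplication enters the boundary, and a subgroup shares
  it.\<close>

lemma bdry_consistent: "bdry (G\<lparr>carrier := H\<rparr>) M n = bdry G M n"
proof -
  have face: "bar_face (G\<lparr>carrier := H\<rparr>) = bar_face G" by (simp add: fun_eq_iff bar_face_def)
  show ?thesis by (intro ext) (simp only: bdry_apply face)
qed

context nu_quotient begin

abbreviation "w_prod ps \<equiv> foldr (\<lambda>(a, b) x. w a b \<otimes>\<^bsub>N\<^esub> x) ps \<one>\<^bsub>N\<^esub>"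

lemma w_prod_T: "set ps \<subseteq> carrier G \<times> carrier G \<Longrightarrow> w_prod ps \<in> T"
proof (induction ps)
  case Nil
  then show ?case using subgroup.one_closed[OF T_subgroup] by simp
next
  case (Cons p ps)
  obtain a b where p: "p = (a, b)" by (cases p)
  have "w a b \<in> T" "w_prod ps \<in> T" using Cons w_T by (simp_all add: p)
  then show ?case using subgroup.m_closed[OF T_subgroup, of "w a b" "w_prod ps"] by (simp add: p)
qed

lemma \<kappa>_w_prod: "set ps \<subseteq> carrier G \<times> carrier G \<Longrightarrow> \<kappa> (w_prod ps) = comm_prod G ps"
proof (induction ps)
  case (Cons p ps)
  obtain a b where p: "p = (a, b)" by (cases p)
  have "a \<in> carrier G" "b \<in> carrier G" "w_prod ps \<in> carrier N" "\<kappa> (w_prod ps) = comm_prod G ps"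
    using Cons T_carrier[OF w_prod_T[of ps]] by (simp_all add: p)
  then show ?case by (simp add: p)
qed simp

text \<open>One product of commutators in the lift E is evaluated twice: by symbols it is the copy
  of \<open>w_prod ps\<close>, by the factor set it is the value on a boundary.\<close>

lemma w_prod_eq_one:
  assumes ps: "set ps \<subseteq> carrier G \<times> carrier G" and one: "comm_prod G ps = \<one>"
    and b: "comm_cycle G ps \<in> boundaries2 G integer_group"
  shows "w_prod ps = \<one>\<^bsub>N\<^esub>"
proof -
  obtain c where c: "c \<in> carrier (fin_chains integer_group (tuples G 3))"
    and cb: "comm_cycle G ps = bdry G integer_group 3 c"
    using b unfolding boundaries2_def by blast
  \<comment> \<open>The entries of \<open>ps\<close> and of the tuples in c: once E covers them, the
    cycle is already filled over the image H of E.\<close>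
  let ?S = "fst ` set ps \<union> snd ` set ps \<union> (\<Union>xs\<in>chain_support integer_group c. set xs)"
  have finS: "finite ?S" using fin_chains_support(1)[OF c] by simp
  have "?S \<subseteq> carrier G"
    using ps fin_chains_support(2)[OF c] by (auto simp: tuples_def)
  from exterior_lift_over[OF finS this] obtain E :: "('n \<times> int list) monoid" and \<pi> \<iota>
    where lift: "exterior_lift E \<pi> \<iota>" and S: "?S \<subseteq> \<pi> ` carrier E"
    by (elim exE conjE) (rule that)
  interpret E: group E using lift by (simp add: exterior_lift_def)
  have \<pi>: "\<pi> \<in> hom E G" and \<iota>: "\<iota> \<in> hom (N\<lparr>carrier := T\<rparr>) E" and \<iota>_inj: "inj_on \<iota> T"
    and comm: "\<And>u v. u \<in> carrier E \<Longrightarrow> v \<in> carrier E \<Longrightarrow> comm_elt E u v = \<iota> (w (\<pi> u) (\<pi> v))"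
    using lift by (simp_all add: exterior_lift_def)
  interpret p: group_hom E G \<pi> by (intro group_homI E.is_group is_group \<pi>)
  have \<iota>1: "\<iota> \<one>\<^bsub>N\<^esub> = \<one>\<^bsub>E\<^esub>" using hom_one[OF \<iota> T_group E.is_group] by simp
  let ?H = "\<pi> ` carrier E"
  let ?GH = "G\<lparr>carrier := ?H\<rparr>"
  have H: "subgroup ?H G" by (rule p.img_is_subgroup)
  define \<sigma> where "\<sigma> = inv_into (carrier E) \<pi>"
  have \<sigma>: "\<sigma> g \<in> carrier E" "\<pi> (\<sigma> g) = g" if "g \<in> ?H" for g
    using that by (simp_all add: \<sigma>_def inv_into_into f_inv_into_f)
  have psH: "set ps \<subseteq> ?H \<times> ?H" using S by force
  interpret cm: central_map ?GH E "kernel E G \<pi>" \<sigma>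
  proof (intro central_map.intro central_map_axioms.intro subgroup_imp_group[OF H] E.is_group p.subgroup_kernel)
    fix d x assume d: "d \<in> kernel E G \<pi>" and x: "x \<in> carrier E"
    have d': "d \<in> carrier E" "\<pi> d = \<one>" using d by (simp_all add: kernel_def)
    \<comment> \<open>A symbol with an entry 1 is trivial, so elements over 1 are central.\<close>
    have "comm_elt E x d = \<one>\<^bsub>E\<^esub>" using comm[OF x d'(1)] x d' \<iota>1 by simp
    then show "x \<otimes>\<^bsub>E\<^esub> d = d \<otimes>\<^bsub>E\<^esub> x" using E.comm_elt_eq_iff[OF x d'(1), of "\<one>\<^bsub>E\<^esub>"] x d' by simp
  next
    show "\<sigma> g \<in> carrier E" if "g \<in> carrier ?GH" for g using \<sigma>(1) that by simp
    fix g h assume "g \<in> carrier ?GH" "h \<in> carrier ?GH"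
    then have g: "g \<in> ?H" "h \<in> ?H" "g \<otimes> h \<in> ?H" using subgroup.m_closed[OF H] by simp_all
    have gc: "g \<in> carrier G" "h \<in> carrier G" using g subgroup.subset[OF H] by blast+
    have "\<pi> (\<sigma> g \<otimes>\<^bsub>E\<^esub> \<sigma> h \<otimes>\<^bsub>E\<^esub> inv\<^bsub>E\<^esub> \<sigma> (g \<otimes> h)) = g \<otimes> h \<otimes> inv (g \<otimes> h)"
      using \<sigma>(1)[OF g(1)] \<sigma>(1)[OF g(2)] \<sigma>(1)[OF g(3)] by (simp add: \<sigma>(2)[OF g(1)] \<sigma>(2)[OF g(2)] \<sigma>(2)[OF g(3)])
    also have "\<dots> = \<one>" by (rule r_inv) (simp add: gc)
    finally show "\<sigma> g \<otimes>\<^bsub>E\<^esub> \<sigma> h \<otimes>\<^bsub>E\<^esub> inv\<^bsub>E\<^esub> \<sigma> (g \<otimes>\<^bsub>?GH\<^esub> h) \<in> kernel E G \<pi>"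
      using \<sigma>(1)[OF g(1)] \<sigma>(1)[OF g(2)] \<sigma>(1)[OF g(3)] by (simp add: kernel_def)
  qed
  have prod: "comm_prod E (map (map_prod \<sigma> \<sigma>) qs) = \<iota> (w_prod qs)" if "set qs \<subseteq> ?H \<times> ?H" for qs
    using that
  proof (induction qs)
    case Nil
    then show ?case by (simp add: \<iota>1)
  next
    case (Cons q qs)
    obtain a b where q: "q = (a, b)" by (cases q)
    have ab: "a \<in> ?H" "b \<in> ?H" and qs: "set qs \<subseteq> ?H \<times> ?H" using Cons.prems q by auto
    have sub: "?H \<subseteq> carrier G" by (rule subgroup.subset[OF H])
    have abc: "a \<in> carrier G" "b \<in> carrier G" and qsc: "set qs \<subseteq> carrier G \<times> carrier G"
      using ab qs sub by blast+
    have "\<iota> (w a b \<otimes>\<^bsub>N\<^esub> w_prod qs) = \<iota> (w a b) \<otimes>\<^bsub>E\<^esub> \<iota> (w_prod qs)"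
      using hom_mult[OF \<iota>, of "w a b" "w_prod qs"] w_T[OF abc] w_prod_T[OF qsc] by simp
    then show ?case
      using Cons.IH[OF qs] comm[OF \<sigma>(1)[OF ab(1)] \<sigma>(1)[OF ab(2)]]
      by (simp add: q \<sigma>(2)[OF ab(1)] \<sigma>(2)[OF ab(2)])
  qed
  have cH: "c \<in> carrier (fin_chains integer_group (tuples ?GH 3))"
    using c S fin_chains_support(2)[OF c] unfolding fin_chains_def tuples_def by auto
  have "\<iota> (w_prod ps) = cm.ev (comm_cycle ?GH ps)"
    unfolding prod[OF psH, symmetric]
    by (rule cm.comm_prod_\<sigma>) (use psH one in \<open>simp_all add: comm_prod_consistent[OF H]\<close>)
  also have "comm_cycle ?GH ps = bdry ?GH integer_group 3 c"
    unfolding bdry_consistent cb[symmetric] comm_cycle_def comm_chain_consistent[OF H psH] by simp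
  also have "cm.ev \<dots> = \<one>\<^bsub>E\<^esub>" by (rule cm.ev_bdry[OF cH])
  finally have "\<iota> (w_prod ps) = \<iota> \<one>\<^bsub>N\<^esub>" by (simp add: \<iota>1)
  then show ?thesis
    by (rule inj_onD[OF \<iota>_inj _ w_prod_T[OF ps] subgroup.one_closed[OF T_subgroup]])
qed

end

section \<open>The quotient of \<nu>(G) by \<Delta>(G) and the exterior square inside it\<close>

context nu_group begin

text \<open>By the relations, conjugation by either copy of c sends the diagonal generator of g to
  that of g^c; so conjugation preserves the generating set.\<close>

lemma Delta_normal: "Delta G \<lhd> nu G"
proof -
  interpret N: group "nu G" by (rule group_nu)
  note lc = hom_in_carrier[OF lft_hom] and rc = hom_in_carrier[OF rgt_hom]
  let ?D = "{tensor_elt G g g | g. g \<in> carrier G}"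
  have D: "?D \<subseteq> carrier (nu G)" using lc rc by (auto simp: tensor_elt_eq)
  have gen: "conj_elt (nu G) s (lft c) \<in> ?D" "conj_elt (nu G) s (rgt c) \<in> ?D"
    if s: "s \<in> ?D" and c: "c \<in> carrier G" for s c
  proof -
    obtain g where g: "g \<in> carrier G" "s = tensor_elt G g g" using s by blast
    have "conj_elt (nu G) s (rgt c) = tensor_elt G (conj_elt G g c) (conj_elt G g c)"
      using nu_relation_conj[OF g(1) g(1) c] g c by (simp add: tensor_elt_eq)
    then show "conj_elt (nu G) s (rgt c) \<in> ?D" using g c by auto
    then show "conj_elt (nu G) s (lft c) \<in> ?D"
      using nu_relation_lft_rgt[OF g(1) g(1) c] g by (simp add: tensor_elt_eq)
  qed
  have conj: "conj_elt (nu G) s n \<in> ?D" if "n \<in> carrier (nu G)" "s \<in> ?D" for n s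
    using that(1)[unfolded nu_generate] that(2)
  proof (induction arbitrary: s rule: generate.induct)
    case one
    then have "s \<in> carrier (nu G)" using D by blast
    then show ?case using one by simp
  next
    case (incl h)
    then show ?case using gen[OF incl.prems] by blast
  next
    case (inv h)
    then obtain g where g: "g \<in> carrier G" "h = lft g \<or> h = rgt g" by blast
    have "inv\<^bsub>nu G\<^esub> lft g = lft (inv g)" "inv\<^bsub>nu G\<^esub> rgt g = rgt (inv g)"
      using g group_hom.hom_inv[OF group_homI[OF is_group group_nu lft_hom]]
        group_hom.hom_inv[OF group_homI[OF is_group group_nu rgt_hom]] by simp_all
    then show ?case using gen[OF inv.prems inv_closed[OF g(1)]] g(2) by auto
  next
    case (eng x y)
    have xy: "x \<in> carrier (nu G)" "y \<in> carrier (nu G)" using eng.hyps nu_generate by auto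
    have s: "s \<in> carrier (nu G)" using eng.prems D by blast
    show ?case unfolding N.conj_elt_mult[OF s xy] by (rule eng.IH(2)[OF eng.IH(1)[OF eng.prems]])
  qed
  show ?thesis
    unfolding Delta_def
  proof (rule N.normal_generateI[OF D])
    fix h n assume h: "h \<in> ?D" and n: "n \<in> carrier (nu G)"
    have "conj_elt (nu G) h (inv\<^bsub>nu G\<^esub> n) \<in> ?D" by (rule conj[OF N.inv_closed[OF n] h])
    then show "n \<otimes>\<^bsub>nu G\<^esub> h \<otimes>\<^bsub>nu G\<^esub> inv\<^bsub>nu G\<^esub> n \<in> ?D" using n by (simp add: conj_elt_def)
  qed
qed

abbreviation "\<nu>\<Delta> \<equiv> nu G Mod Delta G"
abbreviation "dl g \<equiv> Delta G #>\<^bsub>nu G\<^esub> lft g"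
abbreviation "dr g \<equiv> Delta G #>\<^bsub>nu G\<^esub> rgt g"

lemma Delta_coset_group_hom: "group_hom (nu G) \<nu>\<Delta> (\<lambda>n. Delta G #>\<^bsub>nu G\<^esub> n)"
  by (intro group_homI group_nu normal.factorgroup_is_group normal.r_coset_hom_Mod Delta_normal)

lemma dl_dr_comm_elt:
  assumes "a \<in> carrier G" "b \<in> carrier G"
  shows "comm_elt \<nu>\<Delta> (dl a) (dr b) = Delta G #>\<^bsub>nu G\<^esub> tensor_elt G a b"
  unfolding tensor_elt_eq[OF assms]
  by (rule group_hom.hom_comm_elt[OF Delta_coset_group_hom, symmetric])
     (use assms hom_in_carrier[OF lft_hom] hom_in_carrier[OF rgt_hom] in auto)

lemma kills_Delta:
  assumes h: "group_hom (nu G) H h" and "\<And>g. g \<in> carrier G \<Longrightarrow> h (tensor_elt G g g) = \<one>\<^bsub>H\<^esub>"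
  obtains h' where "h' \<in> hom \<nu>\<Delta> H" "\<And>n. n \<in> carrier (nu G) \<Longrightarrow> h' (Delta G #>\<^bsub>nu G\<^esub> n) = h n"
proof -
  interpret group_hom "nu G" H h by (rule h)
  have "tensor_elt G g g \<in> carrier (nu G)" if "g \<in> carrier G" for g
    using that hom_in_carrier[OF lft_hom that] hom_in_carrier[OF rgt_hom that] by (simp add: tensor_elt_eq)
  then have "{tensor_elt G g g | g. g \<in> carrier G} \<subseteq> kernel (nu G) H h"
    using assms(2) by (auto simp: kernel_def)
  then have "Delta G \<subseteq> kernel (nu G) H h"
    unfolding Delta_def by (rule G.generate_subgroup_incl[OF _ subgroup_kernel])
  from FactGroup_universal_kernel[OF Delta_normal this] that show thesis by blast
qed

text \<open>The identity of G on both copies satisfies the relations; the map it induces sends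
  diagonal elements to [g, g] = 1 and thus gives \<kappa>.\<close>

lemma exterior_nu_quotient: obtains \<kappa> where "nu_quotient G \<nu>\<Delta> dl dr \<kappa>"
proof -
  interpret q: group_hom "nu G" \<nu>\<Delta> "\<lambda>n. Delta G #>\<^bsub>nu G\<^esub> n" by (rule Delta_coset_group_hom)
  note lc = hom_in_carrier[OF lft_hom] and rc = hom_in_carrier[OF rgt_hom]
  obtain k where k: "k \<in> hom (nu G) G" "\<And>g. g \<in> carrier G \<Longrightarrow> k (lft g) = g" "\<And>g. g \<in> carrier G \<Longrightarrow> k (rgt g) = g"
    using nu_universal[OF is_group hom_id hom_id] conj_comm_elt by blast
  have kh: "group_hom (nu G) G k" by (intro group_homI group_nu is_group k(1))
  have "k (tensor_elt G g g) = \<one>" if "g \<in> carrier G" for g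
    using group_hom.hom_comm_elt[OF kh lc[OF that] rc[OF that]] that by (simp add: tensor_elt_eq k)
  from kills_Delta[OF kh this] obtain \<kappa> where
    \<kappa>: "\<kappa> \<in> hom \<nu>\<Delta> G" "\<And>n. n \<in> carrier (nu G) \<Longrightarrow> \<kappa> (Delta G #>\<^bsub>nu G\<^esub> n) = k n" by blast
  have "nu_quotient G \<nu>\<Delta> dl dr \<kappa>"
  proof (intro nu_quotient.intro nu_quotient_axioms.intro is_group q.H.is_group)
    show "dl \<in> hom G \<nu>\<Delta>" by (rule hom_comp[OF lft_hom q.homh])
    show "dr \<in> hom G \<nu>\<Delta>" by (rule hom_comp[OF rgt_hom q.homh])
    show "\<kappa> \<in> hom \<nu>\<Delta> G" by (rule \<kappa>(1))
    show "\<kappa> (dl g) = g" "\<kappa> (dr g) = g" if "g \<in> carrier G" for g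
      using that \<kappa>(2)[OF lc[OF that]] \<kappa>(2)[OF rc[OF that]] k by simp_all
    fix a b c assume a: "a \<in> carrier G" "b \<in> carrier G" "c \<in> carrier G"
    have t: "comm_elt (nu G) (lft a) (rgt b) \<in> carrier (nu G)" using lc[OF a(1)] rc[OF a(2)] by simp
    have ab: "comm_elt \<nu>\<Delta> (dl a) (dr b) = Delta G #>\<^bsub>nu G\<^esub> comm_elt (nu G) (lft a) (rgt b)"
      by (rule q.hom_comm_elt[symmetric, OF lc[OF a(1)] rc[OF a(2)]])
    show "conj_elt \<nu>\<Delta> (comm_elt \<nu>\<Delta> (dl a) (dr b)) (dl c) = conj_elt \<nu>\<Delta> (comm_elt \<nu>\<Delta> (dl a) (dr b)) (dr c)"
      unfolding ab q.hom_conj_elt[OF t lc[OF a(3)], symmetric] q.hom_conj_elt[OF t rc[OF a(3)], symmetric]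
        nu_relation_lft_rgt[OF a] ..
    show "conj_elt \<nu>\<Delta> (comm_elt \<nu>\<Delta> (dl a) (dr b)) (dr c) = comm_elt \<nu>\<Delta> (dl (conj_elt G a c)) (dr (conj_elt G b c))"
      unfolding ab q.hom_conj_elt[OF t rc[OF a(3)], symmetric] nu_relation_conj[OF a]
      by (rule q.hom_comm_elt[OF lc[OF conj_elt_closed[OF a(1,3)]] rc[OF conj_elt_closed[OF a(2,3)]]])
  next
    fix g assume g: "g \<in> carrier G"
    have D: "subgroup (Delta G) (nu G)" by (rule normal_imp_subgroup[OF Delta_normal])
    have "tensor_elt G g g \<in> Delta G" unfolding Delta_def using g by (intro generate.incl) blast
    then show "comm_elt \<nu>\<Delta> (dl g) (dr g) = \<one>\<^bsub>\<nu>\<Delta>\<^esub>"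
      unfolding dl_dr_comm_elt[OF g g] using q.G.coset_join2[OF subgroup.mem_carrier[OF D] D] by simp
  next
    have sub: "lft ` carrier G \<union> rgt ` carrier G \<subseteq> carrier (nu G)" using lc rc by blast
    have "carrier \<nu>\<Delta> = (\<lambda>n. Delta G #>\<^bsub>nu G\<^esub> n) ` generate (nu G) (lft ` carrier G \<union> rgt ` carrier G)"
      unfolding carrier_FactGroup nu_generate[symmetric] ..
    also have "\<dots> = generate \<nu>\<Delta> (dl ` carrier G \<union> dr ` carrier G)"
      unfolding q.generate_img[OF sub, symmetric] image_Un image_image ..
    finally show "carrier \<nu>\<Delta> = generate \<nu>\<Delta> (dl ` carrier G \<union> dr ` carrier G)" .
  qed
  then show thesis by (rule that)
qed

text \<open>The cosets of \<Delta>(G) in the tensor square are also cosets in \<nu>(G), as the same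
  sets with the same product. Hence an equality of groups, not merely an isomorphism.\<close>

lemma exterior_square_eq:
  assumes "nu_quotient G \<nu>\<Delta> dl dr \<kappa>"
  shows "exterior_square G = \<nu>\<Delta>\<lparr>carrier := nu_quotient.T G \<nu>\<Delta> dl dr\<rparr>"
proof -
  interpret q: nu_quotient G \<nu>\<Delta> dl dr \<kappa> by fact
  interpret h: group_hom "nu G" \<nu>\<Delta> "\<lambda>n. Delta G #>\<^bsub>nu G\<^esub> n" by (rule Delta_coset_group_hom)
  let ?t = "{tensor_elt G g h | g h. g \<in> carrier G \<and> h \<in> carrier G}"
  have sub: "?t \<subseteq> carrier (nu G)"
    using hom_in_carrier[OF lft_hom] hom_in_carrier[OF rgt_hom] by (auto simp: tensor_elt_eq)
  have "{q.w a b | a b. a \<in> carrier G \<and> b \<in> carrier G} = (\<lambda>n. Delta G #>\<^bsub>nu G\<^esub> n) ` ?t"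
    by (auto simp: q.w_def dl_dr_comm_elt image_iff) (metis dl_dr_comm_elt)+
  then have T: "q.T = (\<lambda>n. Delta G #>\<^bsub>nu G\<^esub> n) ` generate (nu G) ?t"
    unfolding q.T_def by (simp add: h.generate_img[OF sub])
  have "carrier (exterior_square G) = q.T"
    unfolding exterior_square_def carrier_FactGroup T by (simp add: tensor_square_def r_coset_def)
  moreover have "monoid.mult (exterior_square G) = monoid.mult \<nu>\<Delta>"
    by (simp add: exterior_square_def tensor_square_def set_mult_def fun_eq_iff)
  moreover have "\<one>\<^bsub>exterior_square G\<^esub> = \<one>\<^bsub>\<nu>\<Delta>\<^esub>"
    by (simp add: exterior_square_def)
  ultimately show ?thesis by (intro monoid.equality) simp_all
qed

end

lemma exterior_square_residually_finite:
  fixes G :: "('a, 'b) monoid_scheme"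
  assumes G: "group G" and A2: "in_A_hom 2 G" and rf: "residually_finite G"
    and fg: "finitely_generated_group (integral_homology G 2)"
  shows "residually_finite (exterior_square G)"
proof -
  interpret nu_group G using G by (simp add: nu_group_def)
  interpret profinite G using G by (simp add: profinite_def)
  obtain \<kappa> where quot: "nu_quotient G \<nu>\<Delta> dl dr \<kappa>" by (rule exterior_nu_quotient)
  interpret q: nu_quotient G \<nu>\<Delta> dl dr \<kappa> by (rule quot)
  let ?T = "\<nu>\<Delta>\<lparr>carrier := q.T\<rparr>"
  have hom_T: "h \<in> hom ?T H" if "h \<in> hom \<nu>\<Delta> H" for h and H :: "('y, 'z) monoid_scheme"
    using that q.T_carrier by (auto simp: hom_def Pi_iff)
  have "\<exists>N\<in>finite_index_normals ?T. x \<notin> N" if x: "x \<in> q.T" "x \<noteq> \<one>\<^bsub>\<nu>\<Delta>\<^esub>" for x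
  proof (cases "\<kappa> x = \<one>\<^bsub>G\<^esub>")
    case False
    have "\<kappa> x \<in> carrier G" by (rule q.K.hom_closed[OF q.T_carrier[OF x(1)]])
    with False rf obtain N where N: "N \<in> finite_index_normals G" "\<kappa> x \<notin> N"
      by (auto simp: residually_finite_def)
    \<comment> \<open>A finite quotient of G that detects the image of x is pulled back along
      \<kappa>.\<close>
    have "{y \<in> carrier ?T. \<kappa> y \<in> N} \<in> finite_index_normals ?T"
      by (rule kernel_finite_index_Mod[OF q.T_group G hom_T[OF q.\<kappa>_hom] N(1)])
    then show ?thesis by (rule bexI[rotated]) (simp add: N(2))
  next
    case True
    obtain ps where ps: "set ps \<subseteq> carrier G \<times> carrier G" and xps: "x = q.w_prod ps"
      by (rule q.T_products[OF x(1)])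
    have one: "comm_prod G ps = \<one>\<^bsub>G\<^esub>" using True q.\<kappa>_w_prod[OF ps] xps by simp
    let ?z = "comm_cycle G ps"
    have z: "?z \<in> cycles2 G integer_group" by (rule comm_cycle_cycle[OF ps one])
    have zc: "?z \<in> carrier (fin_chains integer_group (tuples G 2))" by (rule comm_cycle_closed[OF ps])
    have nbz: "?z \<notin> boundaries2 G integer_group"
    proof
      assume "?z \<in> boundaries2 G integer_group"
      then have "x = \<one>\<^bsub>\<nu>\<Delta>\<^esub>" unfolding xps by (rule q.w_prod_eq_one[OF ps one])
      with x(2) show False by (rule notE)
    qed
    have "\<exists>m U N. m \<ge> 1 \<and> (U, N) \<in> levels \<Gamma> (zmod m) (trivial_action \<Gamma> (zmod m)) \<and>
      level_push m U N ?z \<notin> boundaries2 (\<Gamma> Mod U) (zmod m Mod N)"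
    proof (rule ccontr)
      assume "\<not> ?thesis"
      then have "?z \<in> boundaries2 G integer_group"
        by (intro integral_cycle_boundary[OF A2 fg z]) blast
      with nbz show False by (rule notE)
    qed
    then obtain m U N where m: "m \<ge> 1" and l: "(U, N) \<in> levels \<Gamma> (zmod m) (trivial_action \<Gamma> (zmod m))"
      and nb: "level_push m U N ?z \<notin> boundaries2 (\<Gamma> Mod U) (zmod m Mod N)"
      by (elim exE conjE)
    interpret t: trivial_coeffs G "zmod m" "trivial_action \<Gamma> (zmod m)"
      by (rule trivial_coeffs_trivial_action[OF comm_group_zmod[OF m]])
    note d = t.levelD[OF l]
    have finM: "finite (carrier (zmod m Mod N))" by (simp add: carrier_FactGroup)
    have p: "(\<lambda>g. U #>\<^bsub>\<Gamma>\<^esub> \<eta>0 g) \<in> hom G (\<Gamma> Mod U)"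
      by (rule hom_comp[OF completion_map_hom normal.r_coset_hom_Mod[OF d(1)]])
    have \<theta>: "(\<lambda>k. N #>\<^bsub>zmod m\<^esub> red m k) \<in> hom integer_group (zmod m Mod N)"
      by (rule hom_comp[OF red_hom[OF m] normal.r_coset_hom_Mod[OF d(4)]])
    obtain E :: "((('a set \<Rightarrow> 'a set) set list \<Rightarrow> nat set) set \<times> ('a set \<Rightarrow> 'a set) set) monoid" and D \<sigma>
      where cm: "central_map G E D \<sigma>" and finE: "finite (carrier E)" and ev: "central_map.ev G E D \<sigma> ?z \<noteq> \<one>\<^bsub>E\<^esub>"
      by (rule finite_central_map[OF d(6,8,7) finM p \<theta> zc nb[unfolded level_push_def]])
    interpret cm: central_map G E D \<sigma> by (rule cm)
    obtain Y :: "(((('a set \<Rightarrow> 'a set) set list \<Rightarrow> nat set) set \<times> ('a set \<Rightarrow> 'a set) set) \<times> ((('a set \<Rightarrow> 'a set) set list \<Rightarrow> nat set) set \<times> ('a set \<Rightarrow> 'a set) set) \<times> ((('a set \<Rightarrow> 'a set) set list \<Rightarrow> nat set) set \<times> ('a set \<Rightarrow> 'a set) set)) set monoid"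
      and \<Phi> \<psi> where Y: "group Y" "finite (carrier Y)" and \<Phi>: "\<Phi> \<in> hom (nu G) Y"
      and \<psi>: "\<psi> \<in> hom E Y" and \<psi>_inj: "\<forall>e\<in>carrier E. \<psi> e = \<one>\<^bsub>Y\<^esub> \<longrightarrow> e = \<one>\<^bsub>E\<^esub>"
      and \<Phi>t': "\<forall>a\<in>carrier G. \<forall>b\<in>carrier G. \<Phi> (tensor_elt G a b) = \<psi> (comm_elt E (\<sigma> a) (\<sigma> b))"
      by (rule cm.nu_hom_of_central_map[OF finE])
    have \<Phi>t: "\<Phi> (tensor_elt G a b) = \<psi> (comm_elt E (\<sigma> a) (\<sigma> b))" if "a \<in> carrier G" "b \<in> carrier G" for a b
      using \<Phi>t' that by simp
    interpret ph: group_hom E Y \<psi> by (intro group_homI cm.E.is_group Y \<psi>)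
    have Ph: "group_hom (nu G) Y \<Phi>" by (intro group_homI group_nu Y \<Phi>)
    \<comment> \<open>The value is the image of the commutator of \<sigma> g with itself, so the map
      passes to the quotient by \<Delta>(G).\<close>
    have "\<Phi> (tensor_elt G g g) = \<one>\<^bsub>Y\<^esub>" if "g \<in> carrier G" for g
      using that by (simp add: \<Phi>t)
    from kills_Delta[OF Ph this] obtain \<Phi>' where \<Phi>': "\<Phi>' \<in> hom \<nu>\<Delta> Y"
      "\<And>n. n \<in> carrier (nu G) \<Longrightarrow> \<Phi>' (Delta G #>\<^bsub>nu G\<^esub> n) = \<Phi> n" by blast
    interpret Ph': group_hom \<nu>\<Delta> Y \<Phi>' by (intro group_homI q.N.is_group Y \<Phi>'(1))
    have w: "\<Phi>' (q.w a b) = \<psi> (comm_elt E (\<sigma> a) (\<sigma> b))" if "a \<in> carrier G" "b \<in> carrier G" for a b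
    proof -
      have "tensor_elt G a b \<in> carrier (nu G)"
        using that group_nu hom_in_carrier[OF lft_hom] hom_in_carrier[OF rgt_hom]
        by (simp add: tensor_elt_eq group.comm_elt_closed)
      then show ?thesis using \<Phi>'(2) \<Phi>t[OF that] by (simp add: q.w_def dl_dr_comm_elt[OF that])
    qed
    have prod: "\<Phi>' (q.w_prod qs) = \<psi> (comm_prod E (map (map_prod \<sigma> \<sigma>) qs))" if "set qs \<subseteq> carrier G \<times> carrier G" for qs
      using that
    proof (induction qs)
      case Nil
      show ?case using Ph'.hom_one by simp
    next
      case (Cons r qs)
      obtain a b where r: "r = (a, b)" by (cases r)
      have ab: "a \<in> carrier G" "b \<in> carrier G" and qs: "set qs \<subseteq> carrier G \<times> carrier G" using Cons.prems r by auto
      have c: "q.w_prod qs \<in> carrier \<nu>\<Delta>" by (rule q.T_carrier[OF q.w_prod_T[OF qs]])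
      have c': "comm_prod E (map (map_prod \<sigma> \<sigma>) qs) \<in> carrier E"
        by (rule cm.E.comm_prod_closed) (use qs in auto)
      show ?case
        using Ph'.hom_mult[OF q.w_closed[OF ab] c] Cons.IH[OF qs] w[OF ab]
          ph.hom_mult[OF cm.E.comm_elt_closed[OF cm.\<sigma>[OF ab(1)] cm.\<sigma>[OF ab(2)]] c'] by (simp add: r)
    qed
    \<comment> \<open>The value at x comes from a product of commutators in E, which equals the
      factor set on the cycle of \<open>ps\<close>; E was chosen so that this is nontrivial, and
      \<psi> is injective.\<close>
    have "\<Phi>' x = \<psi> (cm.ev ?z)"
      unfolding xps prod[OF ps] cm.comm_prod_\<sigma>[OF ps one] ..
    moreover have "\<psi> (cm.ev ?z) \<noteq> \<one>\<^bsub>Y\<^esub>"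
    proof
      assume "\<psi> (cm.ev ?z) = \<one>\<^bsub>Y\<^esub>"
      from mp[OF bspec[OF \<psi>_inj cm.D_carrier[OF cm.ev_closed[OF zc]]] this] ev show False by (rule notE[rotated])
    qed
    ultimately have nk: "x \<notin> kernel ?T Y \<Phi>'" by (simp add: kernel_def)
    have "kernel ?T Y \<Phi>' \<in> finite_index_normals ?T"
      by (rule kernel_finite_index[OF q.T_group Y(1) hom_T[OF \<Phi>'(1)] Y(2)])
    with nk show ?thesis by (rule bexI)
  qed
  then show ?thesis
    unfolding exterior_square_eq[OF quot] residually_finite_def by simp
qed

theorem corollaryB:
  fixes G :: "('a, 'b) monoid_scheme"
  assumes "group G"
    and "in_A_hom 2 G"
    and "residually_finite G"
    and "finitely_generated_group (integral_homology G 2)"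
  shows "inj_on (integral_comparison_map G 2) (carrier (integral_homology G 2)) \<and>
         residually_finite (exterior_square G)"
proof
  interpret profinite G using assms(1) by (simp add: profinite_def)
  show "inj_on (integral_comparison_map G 2) (carrier (integral_homology G 2))"
    by (rule integral_comparison_inj[OF assms(2,4)])
  show "residually_finite (exterior_square G)"
    by (rule exterior_square_residually_finite[OF assms])
qed

end
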